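(* Let $(\mathcal X,d,\mu)$ be a doubling metric measure space with doubling exponent $n>0$ (see context). Let $s\in(0,\infty)$, $p,q\in(0,\infty]$ and $r=\min\{p,q\}$; $\sigma$ is always a finite positive number. Then, with equality of spaces meaning two-sided inclusion with comparable (quasi-semi)norms: (i) If $\sigma\in(0,r)$, then $\dot M^s_{p,q}(\mathcal X)=\vec C^{s,\sigma}\dot F_{p,q}(\mathcal X)$. (ii) If $\sigma\in(0,r_\ast(s))$, then $\dot M^s_{p,q}(\mathcal X)=\vec I^{s,\sigma}\dot F_{p,q}(\mathcal X)$. (iii) If $\epsilon\in[0,s)$ and $\sigma\in(0,r_\ast(s))$, then $\dot M^s_{p,q}(\mathcal X)=\vec S^{s,\epsilon,\sigma}\dot F_{p,q}(\mathcal X)$. (iv) If $r\in(n/(n+s),\infty]$ and $\sigma\in(0,r_\ast(s))$, then $\dot M^s_{p,q}(\mathcal X)=\vec A^{s,\sigma}\dot F_{p,q}(\mathcal X)$.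
   Context: Setting: $(\mathcal X,d)$ is a metric space and $\mu$ a regular Borel measure on $\mathcal X$ such that all balls have finite and positive measure, and $\mu$ is doubling: there exist constants $C_1>1$ and $n>0$ (fixed; $n$ is called the doubling exponent here) such that $\mu(B(x,\lambda r))\le C_1\lambda^n\mu(B(x,r))$ for all $x\in\mathcal X$, $r\in(0,\infty)$, $\lambda\in(1,\infty)$. Functions are real-valued; $⨍_E f\,d\mu=\frac1{\mu(E)}\int_E f\,d\mu$, $u_B=⨍_Bu\,d\mu$; $u\in L^\sigma_{\rm loc}(\mathcal X)$ means $u\in L^\sigma(B)$ for each ball $B$. For $s\in(0,\infty)$, $r\in(0,\infty]$: $r_\ast(s)=nr/(n-rs)$ if $r<n/s$, and $r_\ast(s)=\infty$ if $r\ge n/s$. Fractional $s$-Hajłasz gradient: for a measurable function $u$, a sequence $\vec g=\{g_k\}_{k\in\mathbb Z}$ of nonnegative measurable functions belongs to $\mathbb D^s(u)$ if there is $E\subset\mathcal X$ with $\mu(E)=0$ such that for all $k\in\mathbb Z$ and all $x,y\in\mathcal X\setminus E$ with $2^{-k-1}\le d(x,y)<2^{-k}$, $|u(x)-u(y)|\le[d(x,y)]^s[g_k(x)+g_k(y)]$. Hajłasz-Triebel-Lizorkin space: $\dot M^s_{p,q}(\mathcal X)$ is the space of all measurable $u$ with $\|u\|_{\dot M^s_{p,q}(\mathcal X)}<\infty$, where, when $p\in(0,\infty)$ or $p=q=\infty$, $\|u\|_{\dot M^s_{p,q}(\mathcal X)}=\inf_{\vec g\in\mathbb D^s(u)}\big\|\,\|\{g_k\}_{k\in\mathbb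 Z}\|_{\ell^q}\big\|_{L^p(\mathcal X)}$, and when $p=\infty$, $q\in(0,\infty)$, $$\|u\|_{\dot M^s_{\infty,q}(\mathcal X)}=\inf_{\vec g\in\mathbb D^s(u)}\sup_{k\in\mathbb Z}\sup_{x\in\mathcal X}\Big\{\sum_{j\ge k}⨍_{B(x,2^{-k})}[g_j(y)]^q\,d\mu(y)\Big\}^{1/q}.$$ For $s,\sigma\in(0,\infty)$, $\epsilon\in[0,s]$, $x\in\mathcal X$, $t\in(0,\infty)$ set $\vec C^{s,\sigma}(u)(x,t)=t^{-s}\big(⨍_{B(x,t)}|u(x)-u(y)|^\sigma d\mu(y)\big)^{1/\sigma}$, $\vec A^{s,\sigma}(u)(x,t)=t^{-s}\big(⨍_{B(x,t)}|u(y)-u_{B(x,t)}|^\sigma d\mu(y)\big)^{1/\sigma}$, $\vec I^{s,\sigma}(u)(x,t)=t^{-s}\big(\inf_{c\in\mathbb R}⨍_{B(x,t)}|u(y)-c|^\sigma d\mu(y)\big)^{1/\sigma}$, $\vec S^{s,\epsilon,\sigma}(u)(x,t)=t^{\epsilon-s}\sup_{\rho\in(0,t]}\rho^{-\epsilon}\big(\inf_{c\in\mathbb R}⨍_{B(x,\rho)}|u(y)-c|^\sigma d\mu(y)\big)^{1/\sigma}$. For $\vec E$ one of these, $\vec E\dot F_{p,q}(\mathcal X)$ is the collection of all $u\in L^\sigma_{\rm loc}(\mathcal X)$ with $\|u\|_{\vec E\dot F_{p,q}(\mathcal X)}<\infty$, where: when $p\in(0,\infty)$, $\|u\|_{\vec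 E\dot F_{p,q}(\mathcal X)}=\big\|\big(\int_0^\infty[\vec E(u)(\cdot,t)]^q\frac{dt}{t}\big)^{1/q}\big\|_{L^p(\mathcal X)}$ (supremum over $t$ if $q=\infty$); when $p=\infty$, $q\in(0,\infty)$, $\|u\|_{\vec E\dot F_{\infty,q}(\mathcal X)}=\sup_{x\in\mathcal X}\sup_{\rho>0}\big(\int_0^\rho⨍_{B(x,\rho)}[\vec E(u)(y,t)]^q\,d\mu(y)\frac{dt}{t}\big)^{1/q}$; when $p=q=\infty$, $\|u\|_{\vec E\dot F_{\infty,\infty}(\mathcal X)}=\sup_{t>0}\|\vec E(u)(\cdot,t)\|_{L^\infty(\mathcal X)}$. (For $\vec E=\vec A^{s,\sigma}$ with $\sigma<1$, $u$ is also required to be integrable on balls, so that $u_{B(x,t)}$ is defined.) For (quasi-semi)normed spaces, $X\subset Y$ means $u\in X$ implies $u\in Y$ and $\|u\|_Y\le C\|u\|_X$ with $C$ independent of $u$; $X=Y$ means $X\subset Y$ and $Y\subset X$. *)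

theory Defs
  imports "HOL-Probability.Essential_Supremum"
begin

section \<open>Doubling metric measure spaces\<close>

text \<open>
  The underlying metric space is the whole type. A regular Borel measure is rendered as a
  measure on some sigma-algebra containing the Borel sets (so both the Borel sigma-algebra and
  its completion are covered) for which every measurable set has a Borel hull of the same measure.
\<close>

locale doubling_metric_measure_space =
  fixes \<mu> :: "'a::metric_space measure" and C1 n :: real
  assumes borel_sets: "sets borel \<subseteq> sets \<mu>"
    and borel_regular:
      "\<And>E. E \<in> sets \<mu> \<Longrightarrow> \<exists>B\<in>sets borel. E \<subseteq> B \<and> emeasure \<mu> B = emeasure \<mu> E"
    and ball_pos: "\<And>x r. 0 < r \<Longrightarrow> 0 < emeasure \<mu> (ball x r)"
    and ball_finite: "\<And>x r. 0 < r \<Longrightarrow> emeasure \<mu> (ball x r) < \<infinity>"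
    and C1_gt_1: "1 < C1"
    and n_pos: "0 < n"
    and doubling: "\<And>x r l. 0 < r \<Longrightarrow> 1 < l \<Longrightarrow>
      emeasure \<mu> (ball x (l * r)) \<le> ennreal (C1 * l powr n) * emeasure \<mu> (ball x r)"

section \<open>Powers, averages, and norms\<close>

text \<open>Only used for exponents \<open>a > 0\<close>.\<close>

definition epowr :: "ennreal \<Rightarrow> real \<Rightarrow> ennreal" where
  "epowr x a = (if x = \<infinity> then \<infinity> else ennreal (enn2real x powr a))"

definition nn_avg :: "'a measure \<Rightarrow> 'a set \<Rightarrow> ('a \<Rightarrow> ennreal) \<Rightarrow> ennreal" where
  "nn_avg \<mu> E f = (\<integral>\<^sup>+ y\<in>E. f y \<partial>\<mu>) / emeasure \<mu> E"

definition avg :: "'a measure \<Rightarrow> 'a set \<Rightarrow> ('a \<Rightarrow> real) \<Rightarrow> real" where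
  "avg \<mu> E f = (LINT y:E|\<mu>. f y) / measure \<mu> E"

definition Lp_norm :: "'a measure \<Rightarrow> ennreal \<Rightarrow> ('a \<Rightarrow> ennreal) \<Rightarrow> ennreal" where
  "Lp_norm \<mu> p f =
    (if p = \<infinity> then esssup \<mu> f
     else epowr (\<integral>\<^sup>+ x. epowr (f x) (enn2real p) \<partial>\<mu>) (1 / enn2real p))"

definition lq_norm :: "ennreal \<Rightarrow> (int \<Rightarrow> ennreal) \<Rightarrow> ennreal" where
  "lq_norm q a =
    (if q = \<infinity> then (SUP k. a k)
     else epowr (\<integral>\<^sup>+ k. epowr (a k) (enn2real q) \<partial>count_space UNIV) (1 / enn2real q))"

definition L_loc :: "'a::metric_space measure \<Rightarrow> real \<Rightarrow> ('a \<Rightarrow> real) set" where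
  "L_loc \<mu> \<sigma> = {u \<in> borel_measurable \<mu>.
    \<forall>x r. 0 < r \<longrightarrow> (\<integral>\<^sup>+ y\<in>ball x r. ennreal (\<bar>u y\<bar> powr \<sigma>) \<partial>\<mu>) < \<infinity>}"

definition r_star :: "real \<Rightarrow> ennreal \<Rightarrow> real \<Rightarrow> ennreal" where
  "r_star n r s =
    (if r < ennreal (n / s) then ennreal (n * enn2real r / (n - enn2real r * s)) else \<infinity>)"

section \<open>Inclusion and equality of spaces\<close>

text \<open>A space is given by its underlying set of functions together with its quasi-seminorm.\<close>

type_synonym 'a fspace = "('a \<Rightarrow> real) set \<times> (('a \<Rightarrow> real) \<Rightarrow> ennreal)"

definition fspace_le :: "'a fspace \<Rightarrow> 'a fspace \<Rightarrow> bool" where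
  "fspace_le X Y \<longleftrightarrow>
    fst X \<subseteq> fst Y \<and> (\<exists>C::real. 0 < C \<and> (\<forall>u\<in>fst X. snd Y u \<le> ennreal C * snd X u))"

definition fspace_eq :: "'a fspace \<Rightarrow> 'a fspace \<Rightarrow> bool" where
  "fspace_eq X Y \<longleftrightarrow> fspace_le X Y \<and> fspace_le Y X"

section \<open>Hajlasz-Triebel-Lizorkin spaces\<close>

definition hajlasz_gradients ::
  "'a::metric_space measure \<Rightarrow> real \<Rightarrow> ('a \<Rightarrow> real) \<Rightarrow> (int \<Rightarrow> 'a \<Rightarrow> real) set" where
  "hajlasz_gradients \<mu> s u = {g.
    (\<forall>k. g k \<in> borel_measurable \<mu> \<and> (\<forall>x. 0 \<le> g k x)) \<and>
    (\<exists>E\<in>null_sets \<mu>. \<forall>k. \<forall>x\<in>-E. \<forall>y\<in>-E.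
      2 powi (-k - 1) \<le> dist x y \<and> dist x y < 2 powi (-k) \<longrightarrow>
      \<bar>u x - u y\<bar> \<le> dist x y powr s * (g k x + g k y))}"

definition M_norm ::
  "'a::metric_space measure \<Rightarrow> real \<Rightarrow> ennreal \<Rightarrow> ennreal \<Rightarrow> ('a \<Rightarrow> real) \<Rightarrow> ennreal" where
  "M_norm \<mu> s p q u =
    (if p = \<infinity> \<and> q \<noteq> \<infinity> then
       (INF g\<in>hajlasz_gradients \<mu> s u. SUP k. SUP x.
          epowr (\<integral>\<^sup>+ j. nn_avg \<mu> (ball x (2 powi (-k))) (\<lambda>y. ennreal (g j y powr enn2real q))
                   \<partial>count_space {k..})
            (1 / enn2real q))
     else
       (INF g\<in>hajlasz_gradients \<mu> s u. Lp_norm \<mu> p (\<lambda>x. lq_norm q (\<lambda>k. ennreal (g k x)))))"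

definition M_space :: "'a::metric_space measure \<Rightarrow> real \<Rightarrow> ennreal \<Rightarrow> ennreal \<Rightarrow> 'a fspace" where
  "M_space \<mu> s p q = ({u \<in> borel_measurable \<mu>. M_norm \<mu> s p q u < \<infinity>}, M_norm \<mu> s p q)"

section \<open>Spaces defined by local oscillations\<close>

definition C_osc ::
  "'a::metric_space measure \<Rightarrow> real \<Rightarrow> real \<Rightarrow> ('a \<Rightarrow> real) \<Rightarrow> 'a \<Rightarrow> real \<Rightarrow> ennreal" where
  "C_osc \<mu> s \<sigma> u x t = ennreal (t powr (-s)) *
    epowr (nn_avg \<mu> (ball x t) (\<lambda>y. ennreal (\<bar>u x - u y\<bar> powr \<sigma>))) (1 / \<sigma>)"

definition A_osc ::
  "'a::metric_space measure \<Rightarrow> real \<Rightarrow> real \<Rightarrow> ('a \<Rightarrow> real) \<Rightarrow> 'a \<Rightarrow> real \<Rightarrow> ennreal" where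
  "A_osc \<mu> s \<sigma> u x t = ennreal (t powr (-s)) *
    epowr (nn_avg \<mu> (ball x t) (\<lambda>y. ennreal (\<bar>u y - avg \<mu> (ball x t) u\<bar> powr \<sigma>))) (1 / \<sigma>)"

definition I_osc ::
  "'a::metric_space measure \<Rightarrow> real \<Rightarrow> real \<Rightarrow> ('a \<Rightarrow> real) \<Rightarrow> 'a \<Rightarrow> real \<Rightarrow> ennreal" where
  "I_osc \<mu> s \<sigma> u x t = ennreal (t powr (-s)) *
    epowr (INF c. nn_avg \<mu> (ball x t) (\<lambda>y. ennreal (\<bar>u y - c\<bar> powr \<sigma>))) (1 / \<sigma>)"

definition S_osc ::
  "'a::metric_space measure \<Rightarrow> real \<Rightarrow> real \<Rightarrow> real \<Rightarrow> ('a \<Rightarrow> real) \<Rightarrow> 'a \<Rightarrow> real \<Rightarrow> ennreal" where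
  "S_osc \<mu> s \<epsilon> \<sigma> u x t = ennreal (t powr (\<epsilon> - s)) *
    (SUP \<rho>\<in>{0<..t}. ennreal (\<rho> powr (-\<epsilon>)) *
      epowr (INF c. nn_avg \<mu> (ball x \<rho>) (\<lambda>y. ennreal (\<bar>u y - c\<bar> powr \<sigma>))) (1 / \<sigma>))"

definition F_norm ::
  "'a::metric_space measure \<Rightarrow> ennreal \<Rightarrow> ennreal \<Rightarrow> ('a \<Rightarrow> real \<Rightarrow> ennreal) \<Rightarrow> ennreal" where
  "F_norm \<mu> p q f =
    (if p \<noteq> \<infinity> then
       Lp_norm \<mu> p (\<lambda>x.
         if q = \<infinity> then (SUP t\<in>{0<..}. f x t)
         else epowr (\<integral>\<^sup>+ t\<in>{0<..}. (epowr (f x t) (enn2real q) / ennreal t) \<partial>lborel)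
                (1 / enn2real q))
     else if q \<noteq> \<infinity> then
       (SUP x. SUP \<rho>\<in>{0<..}.
         epowr (\<integral>\<^sup>+ t\<in>{0<..<\<rho>}.
                  (nn_avg \<mu> (ball x \<rho>) (\<lambda>y. epowr (f y t) (enn2real q)) / ennreal t) \<partial>lborel)
           (1 / enn2real q))
     else (SUP t\<in>{0<..}. Lp_norm \<mu> \<infinity> (\<lambda>x. f x t)))"

definition F_space ::
  "'a::metric_space measure \<Rightarrow> real \<Rightarrow> ennreal \<Rightarrow> ennreal \<Rightarrow>
   (('a \<Rightarrow> real) \<Rightarrow> 'a \<Rightarrow> real \<Rightarrow> ennreal) \<Rightarrow> 'a fspace" where
  "F_space \<mu> \<sigma> p q E = ({u \<in> L_loc \<mu> \<sigma>. F_norm \<mu> p q (E u) < \<infinity>}, \<lambda>u. F_norm \<mu> p q (E u))"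

definition CF_space ::
  "'a::metric_space measure \<Rightarrow> real \<Rightarrow> real \<Rightarrow> ennreal \<Rightarrow> ennreal \<Rightarrow> 'a fspace" where
  "CF_space \<mu> s \<sigma> p q = F_space \<mu> \<sigma> p q (C_osc \<mu> s \<sigma>)"

definition IF_space ::
  "'a::metric_space measure \<Rightarrow> real \<Rightarrow> real \<Rightarrow> ennreal \<Rightarrow> ennreal \<Rightarrow> 'a fspace" where
  "IF_space \<mu> s \<sigma> p q = F_space \<mu> \<sigma> p q (I_osc \<mu> s \<sigma>)"

definition SF_space ::
  "'a::metric_space measure \<Rightarrow> real \<Rightarrow> real \<Rightarrow> real \<Rightarrow> ennreal \<Rightarrow> ennreal \<Rightarrow> 'a fspace" where
  "SF_space \<mu> s \<epsilon> \<sigma> p q = F_space \<mu> \<sigma> p q (S_osc \<mu> s \<epsilon> \<sigma>)"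

text \<open>For \<open>\<sigma> < 1\<close>, integrability on balls is imposed so that the averages of \<open>u\<close> make sense.\<close>

definition AF_space ::
  "'a::metric_space measure \<Rightarrow> real \<Rightarrow> real \<Rightarrow> ennreal \<Rightarrow> ennreal \<Rightarrow> 'a fspace" where
  "AF_space \<mu> s \<sigma> p q =
    ({u \<in> fst (F_space \<mu> \<sigma> p q (A_osc \<mu> s \<sigma>)).
        \<sigma> < 1 \<longrightarrow> (\<forall>x t. 0 < t \<longrightarrow> set_integrable \<mu> (ball x t) u)},
     snd (F_space \<mu> \<sigma> p q (A_osc \<mu> s \<sigma>)))"

end

theory Submission
  imports Defs
begin

text \<open>
  Discretize scales as \<open>2\<^sup>-\<^sup>k\<close>; all norms become mixed norms of sequences of functions. Given a
  fractional gradient \<open>g\<close> of \<open>u\<close>, a chain argument through the level sets of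
  \<open>sup\<^sub>j 2\<^sup>-\<^sup>j\<^sup>(\<^sup>s\<^sup>-\<^sup>\<epsilon>\<^sup>) g\<^sub>j\<close> gives a Sobolev-Poincare inequality: the oscillation of \<open>u\<close> at scale \<open>2\<^sup>-\<^sup>k\<close>
  is dominated by \<open>(\<Sum>\<^sub>j 2\<^sup>(\<^sup>k\<^sup>-\<^sup>j\<^sup>)\<^sup>\<delta> A\<^sub>k(g\<^sub>j\<^sup>\<tau>))\<^sup>1\<^sup>/\<^sup>\<tau>\<close> with \<open>1/\<tau> = 1/\<sigma> + \<epsilon>/n\<close>, where \<open>A\<^sub>k\<close> averages over balls of
  radius comparable to \<open>2\<^sup>-\<^sup>k\<close>; the condition \<open>\<sigma> < r\<^sub>*(s)\<close> says exactly that some \<open>\<epsilon> < s\<close> makes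
  \<open>\<tau> < min p q\<close>. The operator on the right is bounded in the mixed norm by a
  Fefferman-Stein type inequality. Conversely, telescoping near-optimal constants over shrinking
  balls bounds \<open>\<bar>u x - u y\<bar>\<close> at almost all points by sums of oscillations at smaller scales, which
  yields a fractional gradient. Since all four oscillations dominate \<open>I\<close>, the case of \<open>I\<close>
  suffices here.
\<close>

section \<open>Powers of extended nonnegative reals\<close>

text \<open>Two features shape the argument. All exponents may be small: for p, q or \<sigma> below
  1 there is no triangle inequality and no duality, and u need not be locally integrable. Hence
  estimates are made after raising to a power \<tau> below min p q, so that p/\<tau> and q/\<tau>
  exceed 1, and near-optimal constants of two balls are compared through a common good point
  (Chebyshev and approximate continuity) instead of through mean values and Lebesgue points.
  Secondly, functions of a fine scale j are averaged over balls of a coarser scale k with geometric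
  weights. The adjoint averages are all below one maximal function, after which k occurs in the
  weights alone and can be summed out; the vector-valued bound therefore needs only the scalar
  maximal theorem. For p = \<infinity> > q the norm is of Carleson type, and symmetry of the
  averaging kernel takes over. Finally, I and S are infima or suprema over uncountable families, so
  their measurability in the centre is a genuine step; it rests on semicontinuity. Measurability of
  the ball averages in turn rests on separability, which doubling provides.\<close>

lemma epowr_top [simp]: "epowr top a = top"
  by (simp add: epowr_def infinity_ennreal_def)

lemma epowr_0 [simp]: "epowr 0 a = 0"
  by (simp add: epowr_def infinity_ennreal_def)

lemma epowr_1 [simp]: "epowr x 1 = x"
  by (cases x) (auto simp: epowr_def infinity_ennreal_def)

lemma epowr_one_left [simp]: "epowr 1 a = 1"
  by (simp add: epowr_def infinity_ennreal_def)

lemma epowr_ennreal: "0 \<le> x \<Longrightarrow> epowr (ennreal x) a = ennreal (x powr a)"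
  by (simp add: epowr_def infinity_ennreal_def)

lemma epowr_epowr: "epowr (epowr x a) b = epowr x (a * b)"
  by (cases x) (auto simp: epowr_ennreal powr_powr)

lemma epowr_mono: "0 \<le> a \<Longrightarrow> x \<le> y \<Longrightarrow> epowr x a \<le> epowr y a"
  by (cases x; cases y) (auto simp: epowr_ennreal powr_mono2 ennreal_leI top_unique)

lemma epowr_inverse:
  assumes "0 < a"
  shows "epowr (epowr x a) (1 / a) = x" "epowr (epowr x (1 / a)) a = x"
  using assms by (auto simp: epowr_epowr)

lemma epowr_le_iff: "0 < a \<Longrightarrow> epowr x a \<le> epowr y a \<longleftrightarrow> x \<le> y"
  by (metis epowr_inverse(1) epowr_mono less_imp_le divide_nonneg_nonneg zero_le_one)

lemma epowr_less_iff: "0 < a \<Longrightarrow> epowr x a < epowr y a \<longleftrightarrow> x < y"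
  using epowr_le_iff[of a y x] by (simp add: not_le[symmetric])

lemma epowr_le_swap: "0 < a \<Longrightarrow> epowr x (1 / a) \<le> y \<longleftrightarrow> x \<le> epowr y a"
  by (metis epowr_inverse(2) epowr_le_iff)

lemma le_epowr_swap: "0 < a \<Longrightarrow> x \<le> epowr y (1 / a) \<longleftrightarrow> epowr x a \<le> y"
  by (metis epowr_inverse(2) epowr_le_iff)

lemma epowr_eq_0_iff [simp]: "epowr x a = 0 \<longleftrightarrow> x = 0"
  by (cases x) (auto simp: epowr_ennreal)

lemma epowr_eq_top_iff [simp]: "epowr x a = top \<longleftrightarrow> x = top"
  by (cases x) (auto simp: epowr_ennreal)

lemma epowr_less_top_iff [simp]: "epowr x a < top \<longleftrightarrow> x < top"
  by (simp add: less_top[symmetric])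

lemma epowr_mult: "epowr (x * y) a = epowr x a * epowr y a"
proof (cases "x = 0 \<or> y = 0 \<or> x = top \<or> y = top")
  case True
  then show ?thesis by (auto simp: ennreal_mult_top ennreal_top_mult)
next
  case False
  then obtain a b where "x = ennreal a" "0 < a" "y = ennreal b" "0 < b"
    by (cases x; cases y) (auto simp: less_le)
  then show ?thesis
    by (simp add: epowr_ennreal ennreal_mult[symmetric] powr_mult)
qed

lemma epowr_add: "0 < a \<Longrightarrow> 0 < b \<Longrightarrow> epowr x (a + b) = epowr x a * epowr x b"
  by (cases x) (auto simp: epowr_ennreal ennreal_mult[symmetric] powr_add ennreal_mult_top)

lemma epowr_measurable [measurable]:
  assumes [measurable]: "f \<in> borel_measurable M"
  shows "(\<lambda>x. epowr (f x) a) \<in> borel_measurable M"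
proof -
  have [measurable]: "(\<lambda>x. epowr x a) \<in> borel_measurable borel"
    unfolding epowr_def by measurable
  show ?thesis by measurable
qed

lemma epowr_SUP:
  assumes a: "0 < a"
  shows "epowr (SUP i\<in>I. f i) a = (SUP i\<in>I. epowr (f i) a)"
proof (rule antisym)
  have "(SUP i\<in>I. f i) \<le> epowr (SUP i\<in>I. epowr (f i) a) (1 / a)"
    by (intro SUP_least) (auto simp: le_epowr_swap a intro: SUP_upper)
  then show "epowr (SUP i\<in>I. f i) a \<le> (SUP i\<in>I. epowr (f i) a)"
    by (simp add: le_epowr_swap a)
qed (use a in \<open>auto intro!: SUP_least epowr_mono SUP_upper\<close>)

lemma epowr_max: "0 \<le> a \<Longrightarrow> epowr (max x y) a = max (epowr x a) (epowr y a)"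
  by (metis epowr_mono max_def max_def_raw order_antisym_conv nle_le)

text \<open>Bounding the sum by twice the maximum gives one constant for all a > 0, so concave and
  convex powers need no separate treatment.\<close>

lemma epowr_add_le:
  assumes a: "0 < a"
  shows "epowr (x + y) a \<le> ennreal (2 powr a) * (epowr x a + epowr y a)"
proof -
  have "x + y \<le> 2 * max x y"
    by (metis add_mono max.cobounded1 max.cobounded2 mult_2)
  then have "epowr (x + y) a \<le> epowr 2 a * epowr (max x y) a"
    using a by (metis epowr_mono epowr_mult less_imp_le)
  also have "epowr (max x y) a \<le> epowr x a + epowr y a"
    using a by (simp add: epowr_max)
  also have "epowr 2 a = ennreal (2 powr a)"
    using epowr_ennreal[of 2 a] by simp
  finally show ?thesis by (simp add: mult_left_mono)
qed

text \<open>Each \<open>f\<^sup>a\<close> is dominated by the total sum \<open>S\<close>, so \<open>f = f\<^sup>a f\<^sup>1\<^sup>-\<^sup>a \<le> f\<^sup>a S\<^sup>1\<^sup>/\<^sup>a\<^sup>-\<^sup>1\<close> can be summed.\<close>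

lemma nn_integral_count_space_le_epowr:
  fixes f :: "'i \<Rightarrow> ennreal"
  assumes a: "0 < a" "a \<le> 1"
  shows "(\<integral>\<^sup>+ i. f i \<partial>count_space I) \<le> epowr (\<integral>\<^sup>+ i. epowr (f i) a \<partial>count_space I) (1 / a)"
proof (cases "a = 1")
  case False
  with a have a1: "a < 1" by simp
  define S where "S = (\<integral>\<^sup>+ i. epowr (f i) a \<partial>count_space I)"
  have *: "f i \<le> epowr (f i) a * epowr S (1 / a - 1)" if "i \<in> I" for i
  proof -
    have "epowr (f i) a \<le> S"
      unfolding S_def using that by (intro nn_integral_ge_point)
    then have "epowr (epowr (f i) a) (1 / a - 1) \<le> epowr S (1 / a - 1)"
      using a by (intro epowr_mono) auto
    then have "epowr (f i) (1 - a) \<le> epowr S (1 / a - 1)"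
      using a by (simp add: epowr_epowr algebra_simps)
    then have "epowr (f i) a * epowr (f i) (1 - a) \<le> epowr (f i) a * epowr S (1 / a - 1)"
      by (rule mult_left_mono) simp
    then show ?thesis
      using a a1 by (simp add: epowr_add[symmetric])
  qed
  have "(\<integral>\<^sup>+ i. f i \<partial>count_space I) \<le> (\<integral>\<^sup>+ i. epowr (f i) a * epowr S (1 / a - 1) \<partial>count_space I)"
    using * by (intro nn_integral_mono) auto
  also have "\<dots> = S * epowr S (1 / a - 1)"
    by (simp add: nn_integral_multc S_def)
  also have "\<dots> = epowr S 1 * epowr S (1 / a - 1)" by simp
  also have "\<dots> = epowr S (1 / a)"
    using a a1 by (subst epowr_add[symmetric]) auto
  finally show ?thesis by (simp add: S_def)
qed simp

section \<open>Hoelder's and Jensen's inequalities\<close>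

lemma ennreal_Young:
  fixes a b :: ennreal
  assumes p: "1 < p" and pq: "1 / p + 1 / q = 1"
  shows "a * b \<le> ennreal (1 / p) * epowr a p + ennreal (1 / q) * epowr b q"
proof -
  have q: "1 < q"
  proof -
    have "1 / q = 1 - 1 / p" using pq by simp
    then have "0 < 1 / q" "1 / q < 1" using p by auto
    then show ?thesis by (auto simp: field_simps split: if_splits)
  qed
  show ?thesis
  proof (cases "a = top \<or> b = top")
    case True
    then show ?thesis
      using p q by (auto simp: ennreal_mult_top)
  next
    case False
    then obtain x y where xy: "a = ennreal x" "0 \<le> x" "b = ennreal y" "0 \<le> y"
      by (cases a; cases b) auto
    have "x * y \<le> x powr p / p + y powr q / q"
      using Youngs_inequality[of p q x y] p q pq xy by simp
    then show ?thesis
      using p q xy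
      by (simp add: epowr_ennreal ennreal_mult[symmetric] ennreal_plus[symmetric] del: ennreal_plus)
  qed
qed

text \<open>The extended values leave several degenerate cases: a factor with vanishing power
  integral is 0 almost everywhere, and if one power integral is infinite and the other is not 0, the
  right-hand side is infinite. What remains is Young's inequality after normalisation.\<close>

lemma nn_integral_Holder:
  assumes p: "1 < p" and pq: "1 / p + 1 / q = 1"
    and [measurable]: "f \<in> borel_measurable M" "g \<in> borel_measurable M"
  shows "(\<integral>\<^sup>+ x. f x * g x \<partial>M) \<le>
    epowr (\<integral>\<^sup>+ x. epowr (f x) p \<partial>M) (1 / p) * epowr (\<integral>\<^sup>+ x. epowr (g x) q \<partial>M) (1 / q)"
proof -
  have q: "1 < q"
  proof -
    have "1 / q = 1 - 1 / p" using pq by simp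
    then have "0 < 1 / q" "1 / q < 1" using p by auto
    then show ?thesis by (auto simp: field_simps split: if_splits)
  qed
  define F where "F = (\<integral>\<^sup>+ x. epowr (f x) p \<partial>M)"
  define G where "G = (\<integral>\<^sup>+ x. epowr (g x) q \<partial>M)"
  consider "F = 0" | "G = 0" | "F \<noteq> 0" "G = top" | "F = top" "G \<noteq> 0"
    | "F \<noteq> 0" "G \<noteq> 0" "F < top" "G < top"
    by (metis less_top)
  then show ?thesis
  proof cases
    case 1
    then have "AE x in M. f x = 0"
      unfolding F_def by (subst (asm) nn_integral_0_iff_AE) auto
    then have "(\<integral>\<^sup>+ x. f x * g x \<partial>M) = 0"
      by (subst nn_integral_0_iff_AE) auto
    then show ?thesis by simp
  next
    case 2
    then have "AE x in M. g x = 0"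
      unfolding G_def by (subst (asm) nn_integral_0_iff_AE) auto
    then have "(\<integral>\<^sup>+ x. f x * g x \<partial>M) = 0"
      by (subst nn_integral_0_iff_AE) auto
    then show ?thesis by simp
  next
    case 3
    then show ?thesis unfolding F_def[symmetric] G_def[symmetric]
      by (simp add: ennreal_mult_top)
  next
    case 4
    then show ?thesis unfolding F_def[symmetric] G_def[symmetric]
      by (simp add: ennreal_top_mult)
  next
    case 5
    then obtain x y where x: "F = ennreal x" "0 < x" and y: "G = ennreal y" "0 < y"
      by (cases F; cases G) (auto simp: less_le)
    \<comment> \<open>The multiples of f and g by \<alpha> and \<beta> have power integral 1, so
      that Young's inequality integrates to 1/p + 1/q = 1.\<close>
    define \<alpha> where "\<alpha> = ennreal (x powr (- (1 / p)))"
    define \<beta> where "\<beta> = ennreal (y powr (- (1 / q)))"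
    have \<alpha>: "epowr \<alpha> p * F = 1" "\<alpha> * epowr F (1 / p) = 1"
      using p x by (simp_all add: \<alpha>_def epowr_ennreal powr_powr ennreal_mult[symmetric]
        powr_minus field_simps powr_add[symmetric] powr_divide)
    have \<beta>: "epowr \<beta> q * G = 1" "\<beta> * epowr G (1 / q) = 1"
      using q y by (simp_all add: \<beta>_def epowr_ennreal powr_powr ennreal_mult[symmetric]
        powr_minus field_simps powr_add[symmetric] powr_divide)
    have "(\<alpha> * \<beta>) * (\<integral>\<^sup>+ x. f x * g x \<partial>M) = (\<integral>\<^sup>+ x. (\<alpha> * f x) * (\<beta> * g x) \<partial>M)"
      by (subst nn_integral_cmult[symmetric]) (auto simp: ac_simps)
    also have "\<dots> \<le> (\<integral>\<^sup>+ x. ennreal (1 / p) * epowr (\<alpha> * f x) p + ennreal (1 / q) * epowr (\<beta> * g x) q \<partial>M)"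
      by (intro nn_integral_mono ennreal_Young p pq)
    also have "\<dots> = ennreal (1 / p) * (epowr \<alpha> p * F) + ennreal (1 / q) * (epowr \<beta> q * G)"
      by (simp add: epowr_mult nn_integral_add nn_integral_cmult F_def G_def)
    also have "\<dots> = 1"
      using p q pq by (simp add: \<alpha> \<beta> ennreal_plus[symmetric] del: ennreal_plus)
    finally have "(epowr F (1 / p) * epowr G (1 / q)) * ((\<alpha> * \<beta>) * (\<integral>\<^sup>+ x. f x * g x \<partial>M))
        \<le> (epowr F (1 / p) * epowr G (1 / q)) * 1"
      by (rule mult_left_mono) simp
    also have "(epowr F (1 / p) * epowr G (1 / q)) * ((\<alpha> * \<beta>) * (\<integral>\<^sup>+ x. f x * g x \<partial>M))
        = (\<alpha> * epowr F (1 / p)) * (\<beta> * epowr G (1 / q)) * (\<integral>\<^sup>+ x. f x * g x \<partial>M)"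
      by (simp add: ac_simps)
    finally show ?thesis unfolding \<alpha>(2) \<beta>(2) by (simp add: F_def G_def)
  qed
qed

text \<open>Hoelder's inequality against the constant 1. The total mass enters through any upper
  bound W, and the case Q = 1, where the conjugate exponent is infinite, is split off with factor
  1.\<close>

lemma nn_integral_Jensen:
  assumes Q: "1 \<le> Q" and [measurable]: "f \<in> borel_measurable M" and W: "emeasure M (space M) \<le> W"
  shows "epowr (\<integral>\<^sup>+ x. f x \<partial>M) Q \<le> (if Q = 1 then 1 else epowr W (Q - 1)) * (\<integral>\<^sup>+ x. epowr (f x) Q \<partial>M)"
proof (cases "Q = 1")
  case False
  with Q have Q: "1 < Q" by simp
  have "(\<integral>\<^sup>+ x. f x * 1 \<partial>M) \<le>
    epowr (\<integral>\<^sup>+ x. epowr (f x) Q \<partial>M) (1 / Q) * epowr (\<integral>\<^sup>+ x. epowr 1 (Q / (Q - 1)) \<partial>M) (1 / (Q / (Q - 1)))"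
    using Q by (intro nn_integral_Holder) (auto simp: field_simps)
  also have "\<dots> \<le> epowr (\<integral>\<^sup>+ x. epowr (f x) Q \<partial>M) (1 / Q) * epowr W ((Q - 1) / Q)"
    using Q W by (auto intro!: mult_left_mono epowr_mono)
  finally have "epowr (\<integral>\<^sup>+ x. f x \<partial>M) Q \<le>
      epowr (epowr (\<integral>\<^sup>+ x. epowr (f x) Q \<partial>M) (1 / Q) * epowr W ((Q - 1) / Q)) Q"
    using Q by (intro epowr_mono) auto
  also have "\<dots> = epowr W (Q - 1) * (\<integral>\<^sup>+ x. epowr (f x) Q \<partial>M)"
    using Q by (simp add: epowr_mult epowr_epowr mult.commute)
  finally show ?thesis using Q by simp
qed simp

section \<open>Geometric sums over the integers\<close>

text \<open>The sum of the geometric series 2^(-\<delta> i) over i >= 0.\<close>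

definition geom :: "real \<Rightarrow> real" where
  "geom \<delta> = 1 / (1 - 2 powr (- \<delta>))"

lemma geom_pos: "0 < \<delta> \<Longrightarrow> 0 < geom \<delta>"
  by (simp add: geom_def powr_less_one)

lemma nn_integral_int_geom:
  fixes k :: int
  assumes \<delta>: "0 < \<delta>"
  shows "(\<integral>\<^sup>+ j. (if k \<le> j then ennreal (2 powr (of_int (k - j) * \<delta>)) else 0) \<partial>count_space UNIV) = ennreal (geom \<delta>)"
    and "(\<integral>\<^sup>+ j. (if j \<le> k then ennreal (2 powr (of_int (j - k) * \<delta>)) else 0) \<partial>count_space UNIV) = ennreal (geom \<delta>)"
proof -
  have *: "(\<integral>\<^sup>+ i. ennreal (2 powr (- of_nat i * \<delta>)) \<partial>count_space UNIV) = ennreal (geom \<delta>)"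
  proof -
    have eq: "2 powr (- of_nat i * \<delta>) = (2 powr (- \<delta>)) ^ i" for i :: nat
      by (simp add: powr_realpow[symmetric] powr_powr mult.commute)
    have "(\<integral>\<^sup>+ i. ennreal (2 powr (- of_nat i * \<delta>)) \<partial>count_space UNIV) = (\<Sum>i. ennreal ((2 powr (- \<delta>)) ^ i))"
      unfolding nn_integral_count_space_nat eq ..
    also have "\<dots> = ennreal (geom \<delta>)"
      using \<delta> unfolding geom_def by (intro suminf_ennreal_eq geometric_sums) (auto simp: powr_less_one)
    finally show ?thesis .
  qed
  have b1: "bij_betw (\<lambda>i::nat. k + int i) UNIV {k..}"
    by (rule bij_betwI[where g = "\<lambda>j. nat (j - k)"]) auto
  have b2: "bij_betw (\<lambda>i::nat. k - int i) UNIV {..k}"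
    by (rule bij_betwI[where g = "\<lambda>j. nat (k - j)"]) auto
  have "(\<integral>\<^sup>+ j. (if k \<le> j then ennreal (2 powr (of_int (k - j) * \<delta>)) else 0) \<partial>count_space UNIV)
      = (\<integral>\<^sup>+ j. ennreal (2 powr (of_int (k - j) * \<delta>)) \<partial>count_space {k..})"
    by (subst nn_integral_count_space_indicator) (auto intro!: nn_integral_cong split: split_indicator)
  also have "\<dots> = (\<integral>\<^sup>+ i. ennreal (2 powr (- of_nat i * \<delta>)) \<partial>count_space UNIV)"
    by (subst nn_integral_bij_count_space[OF b1, symmetric]) simp
  finally show "(\<integral>\<^sup>+ j. (if k \<le> j then ennreal (2 powr (of_int (k - j) * \<delta>)) else 0) \<partial>count_space UNIV) = ennreal (geom \<delta>)"
    using * by simp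
  have "(\<integral>\<^sup>+ j. (if j \<le> k then ennreal (2 powr (of_int (j - k) * \<delta>)) else 0) \<partial>count_space UNIV)
      = (\<integral>\<^sup>+ j. ennreal (2 powr (of_int (j - k) * \<delta>)) \<partial>count_space {..k})"
    by (subst nn_integral_count_space_indicator) (auto intro!: nn_integral_cong split: split_indicator)
  also have "\<dots> = (\<integral>\<^sup>+ i. ennreal (2 powr (- of_nat i * \<delta>)) \<partial>count_space UNIV)"
    by (subst nn_integral_bij_count_space[OF b2, symmetric]) simp
  finally show "(\<integral>\<^sup>+ j. (if j \<le> k then ennreal (2 powr (of_int (j - k) * \<delta>)) else 0) \<partial>count_space UNIV) = ennreal (geom \<delta>)"
    using * by simp
qed

section \<open>Doubling measures\<close>

text \<open>Written with \<open>powr\<close>, so that real powers of radii reduce to linear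
  arithmetic in the exponent. A larger index means a smaller ball.\<close>

definition rad :: "int \<Rightarrow> real" where
  "rad k = 2 powr (- of_int k)"

lemma rad_pos [simp]: "0 < rad k" "0 \<le> rad k"
  by (auto simp: rad_def)

lemma rad_powi: "2 powi (- k) = rad k"
  using powr_real_of_int'[of 2 "- k"] by (simp add: rad_def)

lemma rad_1: "rad (k + 1) = rad k / 2" "rad (k - 1) = 2 * rad k"
  by (simp_all add: rad_def powr_minus powr_add powr_diff field_simps)

lemma rad_mono: "j \<le> k \<Longrightarrow> rad k \<le> rad j"
  by (simp add: rad_def)

lemma rad_powr: "rad k powr a = 2 powr (- of_int k * a)"
  by (simp add: rad_def powr_powr)

lemma ennreal_divide_mult_cancel:
  fixes b c :: ennreal
  assumes "0 < c" "c < top"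
  shows "b / c * c = b"
  using assms by (cases b; cases c)
    (auto simp: divide_ennreal ennreal_mult[symmetric] ennreal_top_divide ennreal_top_mult)

lemma ennreal_le_divide_iff:
  fixes a b c :: ennreal
  assumes "0 < c" "c < top"
  shows "a \<le> b / c \<longleftrightarrow> a * c \<le> b"
  using ennreal_divide_mult_cancel[OF assms, of b] ennreal_mult_le_mult_iff[of c a "b / c"] assms
  by (simp add: mult.commute)

lemma ennreal_divide_le_iff:
  fixes a b c :: ennreal
  assumes "0 < c" "c < top"
  shows "b / c \<le> a \<longleftrightarrow> b \<le> a * c"
  using ennreal_divide_mult_cancel[OF assms, of b] ennreal_mult_le_mult_iff[of c "b / c" a] assms
  by (simp add: mult.commute)

context doubling_metric_measure_space
begin

abbreviation V :: "'a \<Rightarrow> real \<Rightarrow> ennreal" where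
  "V x r \<equiv> emeasure \<mu> (ball x r)"

definition Dbl :: real where
  "Dbl = C1 * 2 powr n"

lemma Dbl_ge_1: "1 \<le> Dbl"
proof -
  have "1 * 1 \<le> C1 * 2 powr n"
    using C1_gt_1 n_pos by (intro mult_mono) (auto simp: ge_one_powr_ge_zero)
  then show ?thesis by (simp add: Dbl_def)
qed

lemma Dbl_pos: "0 < Dbl" using Dbl_ge_1 by simp

lemma space_mu [simp]: "space \<mu> = UNIV"
proof -
  have "UNIV \<in> sets \<mu>" using subsetD[OF borel_sets, of UNIV] by simp
  then show ?thesis by (metis sets.sets_into_space top.extremum_uniqueI)
qed

lemma borel_in_sets: "A \<in> sets borel \<Longrightarrow> A \<in> sets \<mu>"
  using borel_sets by auto

lemma open_in_sets [simp]: "open U \<Longrightarrow> U \<in> sets \<mu>"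
  by (rule borel_in_sets) simp

lemma ball_in_sets [measurable, simp]: "ball x r \<in> sets \<mu>"
  by simp

lemma V_pos [simp]: "0 < r \<Longrightarrow> 0 < V x r" "0 < r \<Longrightarrow> V x r \<noteq> 0"
  using ball_pos[of r x] by auto

lemma V_finite [simp]: "V x r < top" "V x r \<noteq> top"
proof -
  show "V x r < top"
    using ball_finite[of r x] by (cases "0 < r") (auto simp: infinity_ennreal_def ball_empty)
  then show "V x r \<noteq> top" by simp
qed

lemma V_mono: "ball x r \<subseteq> ball y t \<Longrightarrow> V x r \<le> V y t"
  by (rule emeasure_mono) auto

lemma ball_subset_dist: "dist x y + r \<le> t \<Longrightarrow> ball x r \<subseteq> ball y t"
proof
  fix z assume "dist x y + r \<le> t" "z \<in> ball x r"
  then show "z \<in> ball y t"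
    using dist_triangle[of y z x] by (auto simp: dist_commute)
qed

lemma V_double: "0 < r \<Longrightarrow> V x (2 * r) \<le> ennreal Dbl * V x r"
  using doubling[of r 2 x] by (simp add: Dbl_def)

lemma V_double_near:
  assumes "0 < r" "dist x y \<le> r"
  shows "V x r \<le> ennreal Dbl * V y r"
proof -
  have "V x r \<le> V y (2 * r)"
    using assms by (intro V_mono ball_subset_dist) auto
  then show ?thesis using V_double[of r y] assms by simp
qed

lemma sigma_finite_mu: "sigma_finite_measure \<mu>"
proof
  \<comment> \<open>Here and below \<open>undefined\<close> serves as a base point of the
    space.\<close>
  let ?A = "range (\<lambda>i::nat. ball (undefined::'a) (real i))"
  have "\<exists>i::nat. dist (undefined::'a) x < real i" for x :: 'a
    by (rule reals_Archimedean2)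
  then have "\<Union> ?A = space \<mu>" by auto
  then show "\<exists>A. countable A \<and> A \<subseteq> sets \<mu> \<and> \<Union> A = space \<mu> \<and> (\<forall>a\<in>A. emeasure \<mu> a \<noteq> \<infinity>)"
    by (intro exI[of _ ?A]) (auto simp: infinity_ennreal_def)
qed

sublocale sigma_finite_measure \<mu>
  by (rule sigma_finite_mu)

lemma pair_sigma_finite_mu: "pair_sigma_finite \<mu> \<mu>"
  by (simp add: pair_sigma_finite.intro sigma_finite_mu)

section \<open>Separated sets and the packing bound\<close>

definition separated :: "real \<Rightarrow> 'a set \<Rightarrow> bool" where
  "separated r S \<longleftrightarrow> (\<forall>x\<in>S. \<forall>y\<in>S. x \<noteq> y \<longrightarrow> r \<le> dist x y)"

lemma separated_disjoint:
  assumes "separated (2 * r) S" "0 < r"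
  shows "disjoint_family_on (\<lambda>x. ball x r) S"
  unfolding disjoint_family_on_def
proof (intro ballI impI)
  fix x y assume "x \<in> S" "y \<in> S" "x \<noteq> y"
  then have *: "2 * r \<le> dist x y" using assms by (auto simp: separated_def)
  show "ball x r \<inter> ball y r = {}"
  proof (rule ccontr)
    assume "ball x r \<inter> ball y r \<noteq> {}"
    then obtain z where "dist x z < r" "dist y z < r" by auto
    then show False using * dist_triangle[of x y z] by (simp add: dist_commute)
  qed
qed

text \<open>Packing: the balls of radius r around the points of S are disjoint, lie in the ball of
  radius 2m, and each of them has at least a fixed fraction of the measure of the ball of radius m.
  Doubling then bounds their number.\<close>

lemma finite_separated:
  assumes S: "separated (2 * r) S" "S \<subseteq> ball x0 m" and r: "0 < r" "r < m"
  shows "finite S"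
proof (rule ccontr)
  assume "infinite S"
  \<comment> \<open>L * r = 2 * m is the radius at which a ball centred in S is sure to contain the
    ball of radius m around \<open>x0\<close>.\<close>
  define L where "L = 2 * m / r"
  have L: "1 < L" using r by (simp add: L_def)
  define c where "c = C1 * L powr n"
  have c: "0 < c" using C1_gt_1 L by (simp add: c_def)
  \<comment> \<open>One more point than the packing bound c * Dbl allows.\<close>
  define N where "N = nat \<lceil>c * Dbl\<rceil> + 1"
  obtain T where T: "T \<subseteq> S" "finite T" "card T = N"
    using \<open>infinite S\<close> infinite_arbitrarily_large by metis
  have low: "V x0 m \<le> ennreal c * V x r" if "x \<in> T" for x
  proof -
    have "dist x x0 < m" using that T S by (auto simp: dist_commute)
    then have "V x0 m \<le> V x (L * r)"
      using r by (intro V_mono ball_subset_dist) (auto simp: L_def dist_commute)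
    then show ?thesis using doubling[OF r(1) L, of x] by (simp add: c_def)
  qed
  have "of_nat N * V x0 m = (\<Sum>x\<in>T. V x0 m)" using T by simp
  also have "\<dots> \<le> (\<Sum>x\<in>T. ennreal c * V x r)" by (intro sum_mono low)
  also have "\<dots> = ennreal c * emeasure \<mu> (\<Union>x\<in>T. ball x r)"
    using separated_disjoint[OF S(1) r(1)] T
    by (subst sum_emeasure[symmetric]) (auto simp: sum_distrib_left disjoint_family_on_def)
  also have "emeasure \<mu> (\<Union>x\<in>T. ball x r) \<le> V x0 (2 * m)"
  proof (intro emeasure_mono UN_least ball_subset_dist)
    fix x assume "x \<in> T"
    then have "dist x x0 < m" using T S by (auto simp: dist_commute)
    then show "dist x x0 + r \<le> 2 * m" using r by simp
  qed simp
  also have "\<dots> \<le> ennreal Dbl * V x0 m" using r by (intro V_double) auto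
  finally have "of_nat N * V x0 m \<le> ennreal (c * Dbl) * V x0 m"
    using c Dbl_pos by (simp add: ennreal_mult mult_left_mono mult.assoc)
  moreover have "0 < V x0 m" "V x0 m < top" using r by auto
  ultimately have "of_nat N \<le> ennreal (c * Dbl)"
    using ennreal_mult_le_mult_iff[of "V x0 m" "of_nat N" "ennreal (c * Dbl)"] by (simp add: mult.commute)
  then have "real N \<le> c * Dbl"
    using c Dbl_pos by (simp add: ennreal_of_nat_eq_real_of_nat)
  moreover have "c * Dbl < real N" unfolding N_def by linarith
  ultimately show False by simp
qed

lemma countable_separated:
  assumes S: "separated r S" and r: "0 < r"
  shows "countable S"
proof -
  have "finite (S \<inter> ball undefined (r + real m))" for m :: nat
    using S r by (intro finite_separated[where r = "r / 2" and m = "r + real m"]) (auto simp: separated_def)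
  then have "countable (\<Union>m::nat. S \<inter> ball undefined (r + real m))"
    by (intro countable_UN) (auto intro: countable_finite)
  moreover have "S \<subseteq> (\<Union>m::nat. S \<inter> ball undefined (r + real m))"
  proof
    fix x assume "x \<in> S"
    obtain m :: nat where "dist undefined x < real m" using reals_Archimedean2 by blast
    then show "x \<in> (\<Union>m::nat. S \<inter> ball undefined (r + real m))"
      using \<open>x \<in> S\<close> r by (auto intro!: exI[of _ m])
  qed
  ultimately show ?thesis using countable_subset by blast
qed

text \<open>A maximal separated subset, which exists by Zorn's lemma, is automatically a net: a
  point of E at distance at least r from all of its points could be added to it. Countability is the
  packing bound.\<close>

lemma maximal_separated:
  assumes r: "0 < r"
  shows "\<exists>S\<subseteq>E. separated r S \<and> countable S \<and> (\<forall>x\<in>E. \<exists>y\<in>S. dist x y < r)"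
proof -
  let ?F = "{S. S \<subseteq> E \<and> separated r S}"
  have "\<exists>M\<in>?F. \<forall>X\<in>?F. M \<subseteq> X \<longrightarrow> X = M"
  proof (rule subset_Zorn')
    fix C assume "subset.chain ?F C"
    then have C: "C \<subseteq> ?F" "\<And>X Y. X \<in> C \<Longrightarrow> Y \<in> C \<Longrightarrow> X \<subseteq> Y \<or> Y \<subseteq> X"
      by (auto simp: subset_chain_def)
    show "\<Union> C \<in> ?F"
    proof (clarsimp, intro conjI)
      show "\<Union> C \<subseteq> E" using C(1) by auto
      show "separated r (\<Union> C)"
        unfolding separated_def
      proof (intro ballI impI)
        fix x y assume "x \<in> \<Union> C" "y \<in> \<Union> C" "x \<noteq> y"
        then obtain X Y where XY: "X \<in> C" "x \<in> X" "Y \<in> C" "y \<in> Y" by auto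
        then obtain Z where "Z \<in> C" "x \<in> Z" "y \<in> Z" using C(2)[of X Y] by auto
        then show "r \<le> dist x y" using C(1) \<open>x \<noteq> y\<close> by (auto simp: separated_def)
      qed
    qed
  qed
  then obtain M where M0: "M \<in> ?F" "\<forall>X\<in>?F. M \<subseteq> X \<longrightarrow> X = M" by (rule bexE)
  have M: "M \<subseteq> E" "separated r M" using M0(1) by auto
  have max: "X = M" if "X \<subseteq> E" "separated r X" "M \<subseteq> X" for X using M0(2) that by auto
  have "\<exists>y\<in>M. dist x y < r" if "x \<in> E" for x
  proof (rule ccontr)
    assume *: "\<not> (\<exists>y\<in>M. dist x y < r)"
    then have "separated r (insert x M)"
      using M(2) by (auto simp: separated_def not_less dist_commute)
    then have "insert x M = M" using M that by (intro max) auto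
    then show False using * r by force
  qed
  then show ?thesis using M countable_separated[OF M(2) r] by blast
qed

section \<open>Separability, and measurability in the centre of a ball\<close>

lemma countable_dense:
  obtains Q :: "'a set" where "countable Q" "\<And>x e. 0 < e \<Longrightarrow> \<exists>q\<in>Q. dist x q < e"
proof -
  have "\<exists>S. countable S \<and> (\<forall>x::'a. \<exists>y\<in>S. dist x y < 1 / real (Suc m))" for m :: nat
    using maximal_separated[of "1 / real (Suc m)" UNIV] by auto
  then have "\<exists>S. \<forall>m. countable (S m) \<and> (\<forall>x::'a. \<exists>y\<in>S m. dist x y < 1 / real (Suc m))"
    by (intro choice) blast
  then obtain S :: "nat \<Rightarrow> 'a set"
    where S0: "\<forall>m. countable (S m) \<and> (\<forall>x. \<exists>y\<in>S m. dist x y < 1 / real (Suc m))" by (rule exE)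
  have S1: "countable (S m)" for m using S0 by simp
  have S2: "\<exists>y\<in>S m. dist x y < 1 / real (Suc m)" for m x using S0 by simp
  have "\<exists>q\<in>(\<Union>m. S m). dist x q < e" if "0 < e" for x e
  proof -
    from that obtain m where "1 / real (Suc m) < e" by (rule nat_approx_posE)
    moreover from S2[of m x] obtain y where "y \<in> S m" "dist x y < 1 / real (Suc m)" by (rule bexE)
    ultimately show ?thesis by (intro bexI[of _ y]) auto
  qed
  moreover have "countable (\<Union>m. S m)" using S1 by simp
  ultimately show ?thesis by (intro that[of "\<Union>m. S m"])
qed

text \<open>Openness alone does not place this set in the product sigma-algebra; separability does,
  by writing it as a countable union of rectangles. All measurability of averages as functions of
  the centre goes back to this.\<close>

lemma dist_less_measurable [measurable]:
  "{z. dist (fst z) (snd z) < t} \<in> sets (\<mu> \<Otimes>\<^sub>M \<mu>)"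
proof -
  obtain Q :: "'a set" where Q: "countable Q" "\<And>x e. 0 < e \<Longrightarrow> \<exists>q\<in>Q. dist x q < e"
    using countable_dense by metis
  \<comment> \<open>If q is closer to x than 1/(m+1), which is less than half of the slack t -
    d(x,y), then y lies within t - 1/(m+1) of q.\<close>
  have "{z :: 'a \<times> 'a. dist (fst z) (snd z) < t} =
      (\<Union>q\<in>Q. \<Union>m::nat. ball q (1 / real (Suc m)) \<times> ball q (t - 1 / real (Suc m)))" (is "?L = ?R")
  proof (intro set_eqI iffI; clarsimp simp: split_paired_all)
    fix x y :: 'a assume xy: "dist x y < t"
    then obtain m where m: "1 / real (Suc m) < (t - dist x y) / 2"
      by (metis diff_gt_0_iff_gt half_gt_zero nat_approx_posE)
    obtain q where q: "q \<in> Q" "dist x q < 1 / real (Suc m)" using Q(2)[of "1 / real (Suc m)" x] by auto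
    have "dist q y \<le> dist x q + dist x y" by (metis dist_triangle dist_commute)
    then have "dist q y < t - 1 / real (Suc m)" using q(2) m by argo
    then show "\<exists>q\<in>Q. \<exists>m. dist q x < 1 / (1 + real m) \<and> dist q y < t - 1 / (1 + real m)"
      using q by (intro bexI[of _ q] exI[of _ m]) (auto simp: dist_commute)
  next
    fix x y q :: 'a and m assume "dist q x < 1 / (1 + real m)" "dist q y < t - 1 / (1 + real m)"
    then show "dist x y < t"
      using dist_triangle[of x y q] by (simp add: dist_commute)
  qed
  also have "?R \<in> sets (\<mu> \<Otimes>\<^sub>M \<mu>)"
    using Q(1) by (intro sets.countable_UN' sets.countable_UN) auto
  finally show ?thesis .
qed

lemma indicator_ball_measurable [measurable]:
  "(\<lambda>(x, y). indicator (ball x t) y :: ennreal) \<in> borel_measurable (\<mu> \<Otimes>\<^sub>M \<mu>)"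
proof -
  have "(\<lambda>(x :: 'a, y). indicator (ball x t) y :: ennreal) = indicator {z. dist (fst z) (snd z) < t}"
    by (auto simp: fun_eq_iff split: split_indicator)
  then show ?thesis by simp
qed

lemma ball_integral_measurable':
  assumes [measurable]: "(\<lambda>(x, y). H x y) \<in> borel_measurable (\<mu> \<Otimes>\<^sub>M \<mu>)"
  shows "(\<lambda>x. \<integral>\<^sup>+ y\<in>ball x t. H x y \<partial>\<mu>) \<in> borel_measurable \<mu>"
  by (rule borel_measurable_nn_integral) measurable

lemma ball_integral_measurable [measurable]:
  assumes [measurable]: "f \<in> borel_measurable \<mu>"
  shows "(\<lambda>x. \<integral>\<^sup>+ y\<in>ball x t. f y \<partial>\<mu>) \<in> borel_measurable \<mu>"
  by (rule ball_integral_measurable') measurable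

lemma V_measurable [measurable]: "(\<lambda>x. V x t) \<in> borel_measurable \<mu>"
  using ball_integral_measurable[of "\<lambda>_. 1" t] by simp

lemma nn_avg_measurable' :
  assumes [measurable]: "(\<lambda>(x, y). H x y) \<in> borel_measurable (\<mu> \<Otimes>\<^sub>M \<mu>)"
  shows "(\<lambda>x. nn_avg \<mu> (ball x t) (H x)) \<in> borel_measurable \<mu>"
  unfolding nn_avg_def using ball_integral_measurable'[OF assms] by measurable

lemma nn_avg_measurable [measurable]:
  assumes [measurable]: "f \<in> borel_measurable \<mu>"
  shows "(\<lambda>x. nn_avg \<mu> (ball x t) f) \<in> borel_measurable \<mu>"
  unfolding nn_avg_def by measurable

section \<open>Calculus of averages over balls\<close>

lemma nn_avg_mono_AE: "AE x in \<mu>. f x \<le> g x \<Longrightarrow> nn_avg \<mu> E f \<le> nn_avg \<mu> E g"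
  unfolding nn_avg_def by (intro divide_right_mono_ennreal nn_integral_mono_AE) (auto split: split_indicator)

lemma nn_avg_mono: "(\<And>x. x \<in> E \<Longrightarrow> f x \<le> g x) \<Longrightarrow> nn_avg \<mu> E f \<le> nn_avg \<mu> E g"
  unfolding nn_avg_def by (intro divide_right_mono_ennreal nn_integral_mono) (auto split: split_indicator)

lemma nn_avg_cmult:
  "f \<in> borel_measurable \<mu> \<Longrightarrow> E \<in> sets \<mu> \<Longrightarrow> nn_avg \<mu> E (\<lambda>x. c * f x) = c * nn_avg \<mu> E f"
  unfolding nn_avg_def by (simp add: mult.assoc nn_integral_cmult ennreal_times_divide)

lemma nn_avg_add:
  "f \<in> borel_measurable \<mu> \<Longrightarrow> g \<in> borel_measurable \<mu> \<Longrightarrow> E \<in> sets \<mu> \<Longrightarrow>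
    nn_avg \<mu> E (\<lambda>x. f x + g x) = nn_avg \<mu> E f + nn_avg \<mu> E g"
  unfolding nn_avg_def by (simp add: distrib_right nn_integral_add add_divide_distrib_ennreal)

lemma nn_avg_const: "0 < r \<Longrightarrow> nn_avg \<mu> (ball x r) (\<lambda>_. c) = c"
  unfolding nn_avg_def by (simp add: nn_integral_cmult_indicator ennreal_times_divide[symmetric])

lemma nn_avg_sum:
  assumes [measurable]: "\<And>j. f j \<in> borel_measurable \<mu>" and "E \<in> sets \<mu>"
  shows "nn_avg \<mu> E (\<lambda>x. \<integral>\<^sup>+ j. f j x \<partial>count_space (UNIV :: int set)) =
    (\<integral>\<^sup>+ j. nn_avg \<mu> E (f j) \<partial>count_space UNIV)"
proof -
  have [measurable]: "E \<in> sets \<mu>" by fact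
  have "(\<integral>\<^sup>+ x\<in>E. (\<integral>\<^sup>+ j. f j x \<partial>count_space (UNIV :: int set)) \<partial>\<mu>)
     = (\<integral>\<^sup>+ x. (\<integral>\<^sup>+ j. f j x * indicator E x \<partial>count_space (UNIV :: int set)) \<partial>\<mu>)"
    by (simp add: nn_integral_multc)
  also have "\<dots> = (\<integral>\<^sup>+ j. (\<integral>\<^sup>+ x\<in>E. f j x \<partial>\<mu>) \<partial>count_space UNIV)"
    by (rule nn_integral_count_space_nn_integral) auto
  finally show ?thesis
    unfolding nn_avg_def divide_ennreal_def by (simp add: nn_integral_multc)
qed

lemma nn_avg_le_subset:
  assumes "0 < r" "ball x r \<subseteq> ball y t" "V y t \<le> ennreal c * V x r" "0 \<le> c"
  shows "nn_avg \<mu> (ball x r) f \<le> ennreal c * nn_avg \<mu> (ball y t) f"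
proof -
  have t: "0 < t"
    using assms(1,2) by (metis ball_eq_empty not_le subset_empty)
  have "(\<integral>\<^sup>+ y\<in>ball x r. f y \<partial>\<mu>) \<le> (\<integral>\<^sup>+ y\<in>ball y t. f y \<partial>\<mu>)"
    using assms(2) by (intro nn_integral_mono) (auto split: split_indicator)
  also have "\<dots> = nn_avg \<mu> (ball y t) f * V y t"
    unfolding nn_avg_def using t by (simp add: ennreal_divide_mult_cancel)
  also have "\<dots> \<le> nn_avg \<mu> (ball y t) f * (ennreal c * V x r)"
    by (intro mult_left_mono assms) simp
  finally show ?thesis
    unfolding nn_avg_def[of _ "ball x r"] using assms(1)
    by (subst ennreal_divide_le_iff) (auto simp: ac_simps)
qed

lemma nn_avg_Jensen:
  assumes Q: "1 \<le> Q" and [measurable]: "f \<in> borel_measurable \<mu>" and r: "0 < r"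
  shows "epowr (nn_avg \<mu> (ball x r) f) Q \<le> nn_avg \<mu> (ball x r) (\<lambda>y. epowr (f y) Q)"
proof -
  \<comment> \<open>The average over the ball is integration against this probability density, which
    reduces the claim to Jensen's inequality with mass 1.\<close>
  let ?N = "density \<mu> (\<lambda>y. indicator (ball x r) y / V x r)"
  have eq: "nn_avg \<mu> (ball x r) g = (\<integral>\<^sup>+ y. g y \<partial>?N)" if [measurable]: "g \<in> borel_measurable \<mu>" for g
  proof -
    have "(\<integral>\<^sup>+ y. g y \<partial>?N) = (\<integral>\<^sup>+ y. g y * indicator (ball x r) y * inverse (V x r) \<partial>\<mu>)"
      by (subst nn_integral_density) (auto simp: divide_ennreal_def ac_simps)
    then show ?thesis by (simp add: nn_avg_def nn_integral_multc divide_ennreal_def)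
  qed
  have "emeasure ?N (space ?N) = (\<integral>\<^sup>+ y. 1 \<partial>?N)" by simp
  also have "\<dots> = 1" using nn_avg_const[OF r, of x 1] by (subst eq[symmetric]) auto
  finally have "emeasure ?N (space ?N) \<le> 1" by simp
  from nn_integral_Jensen[OF Q _ this, of f] show ?thesis
    by (simp add: eq split: if_splits)
qed

section \<open>Averaging operators at dyadic scales\<close>

definition Av :: "int \<Rightarrow> ('a \<Rightarrow> ennreal) \<Rightarrow> 'a \<Rightarrow> ennreal" where
  "Av k f x = nn_avg \<mu> (ball x (rad k)) f"

lemma Av_measurable [measurable]: "f \<in> borel_measurable \<mu> \<Longrightarrow> Av k f \<in> borel_measurable \<mu>"
  unfolding Av_def by measurable

text \<open>The kernel of \<open>Av k\<close> is the indicator of d(x,y) < 2^-k divided by the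
  measure of the ball around x. Where it does not vanish, the balls around x and y have comparable
  measure, so exchanging x and y costs one doubling constant.\<close>

lemma Av_symmetric:
  assumes [measurable]: "f \<in> borel_measurable \<mu>" "\<phi> \<in> borel_measurable \<mu>"
  shows "(\<integral>\<^sup>+ x. Av k f x * \<phi> x \<partial>\<mu>) \<le> ennreal Dbl * (\<integral>\<^sup>+ x. f x * Av k \<phi> x \<partial>\<mu>)"
proof -
  interpret P: pair_sigma_finite \<mu> \<mu> by (rule pair_sigma_finite_mu)
  let ?r = "rad k"
  have "(\<integral>\<^sup>+ x. Av k f x * \<phi> x \<partial>\<mu>)
      = (\<integral>\<^sup>+ x. \<integral>\<^sup>+ y. f y * indicator (ball x ?r) y * (inverse (V x ?r) * \<phi> x) \<partial>\<mu> \<partial>\<mu>)"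
    by (intro nn_integral_cong, subst nn_integral_multc)
      (auto simp: Av_def nn_avg_def divide_ennreal_def ac_simps)
  also have "\<dots> = (\<integral>\<^sup>+ y. \<integral>\<^sup>+ x. f y * indicator (ball x ?r) y * (inverse (V x ?r) * \<phi> x) \<partial>\<mu> \<partial>\<mu>)"
    by (rule P.Fubini'[symmetric]) measurable
  also have "\<dots> \<le> (\<integral>\<^sup>+ y. \<integral>\<^sup>+ x. ennreal Dbl * f y * inverse (V y ?r) * (\<phi> x * indicator (ball y ?r) x) \<partial>\<mu> \<partial>\<mu>)"
  proof (intro nn_integral_mono)
    fix y x
    show "f y * indicator (ball x ?r) y * (inverse (V x ?r) * \<phi> x)
      \<le> ennreal Dbl * f y * inverse (V y ?r) * (\<phi> x * indicator (ball y ?r) x)"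
    proof (cases "dist x y < ?r")
      case True
      have "V y ?r \<le> ennreal Dbl * V x ?r"
        using True by (intro V_double_near) (auto simp: dist_commute)
      then have "1 / V x ?r \<le> ennreal Dbl * (1 / V y ?r)"
        by (subst ennreal_divide_le_iff)
          (auto simp: ennreal_times_divide mult.commute divide_ennreal_def[symmetric]
            ennreal_le_divide_iff ac_simps)
      then have "inverse (V x ?r) \<le> ennreal Dbl * inverse (V y ?r)"
        by (simp add: divide_ennreal_def)
      then have "inverse (V x ?r) * (f y * \<phi> x) \<le> ennreal Dbl * inverse (V y ?r) * (f y * \<phi> x)"
        by (rule mult_right_mono) simp
      with True show ?thesis by (simp add: dist_commute ac_simps)
    qed (auto simp: dist_commute)
  qed
  also have "\<dots> = (\<integral>\<^sup>+ y. ennreal Dbl * (f y * Av k \<phi> y) \<partial>\<mu>)"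
    by (intro nn_integral_cong, subst nn_integral_cmult)
      (auto simp: Av_def nn_avg_def divide_ennreal_def ac_simps)
  also have "\<dots> = ennreal Dbl * (\<integral>\<^sup>+ x. f x * Av k \<phi> x \<partial>\<mu>)"
    by (rule nn_integral_cmult) measurable
  finally show ?thesis .
qed

end

section \<open>The dyadic maximal function\<close>

context doubling_metric_measure_space
begin

text \<open>A covering argument by induction over the scales, the largest radius first: points whose balls
  meet the selected balls are absorbed by doubling, and for the remaining points \<open>f\<close> may be replaced
  by its restriction to the complement of the selected balls.\<close>

lemma weak_type_finite:
  assumes "sorted ks" and "f \<in> borel_measurable \<mu>"
  shows "ennreal l * emeasure \<mu> {x. \<exists>k\<in>set ks. ennreal l < Av k f x} \<le> ennreal Dbl * (\<integral>\<^sup>+ x. f x \<partial>\<mu>)"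
  using assms
proof (induction ks arbitrary: f)
  case (Cons k ks)
  note [measurable] = Cons.prems(2)
  let ?r = "rad k"
  define E where "E = {x. \<exists>k\<in>set (k # ks). ennreal l < Av k f x}"
  \<comment> \<open>Separation by twice the radius makes the balls of radius 2^-k disjoint, while
    maximality puts each bad point of this scale into one of the doubled balls.\<close>
  obtain S where S: "S \<subseteq> {x. ennreal l < Av k f x}" "separated (2 * ?r) S" "countable S"
    "\<And>x. ennreal l < Av k f x \<Longrightarrow> \<exists>y\<in>S. dist x y < 2 * ?r"
    using maximal_separated[of "2 * ?r" "{x. ennreal l < Av k f x}"] by auto
  define W where "W = (\<Union>s\<in>S. ball s ?r)"
  have [measurable]: "W \<in> sets \<mu>" unfolding W_def by (intro open_in_sets) auto
  define f' where "f' x = f x * indicator (- W) x" for x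
  have [measurable]: "f' \<in> borel_measurable \<mu>" unfolding f'_def by measurable
  define E' where "E' = {x. \<exists>k\<in>set ks. ennreal l < Av k f' x}"
  have E'_eq: "E' = (\<Union>k\<in>set ks. {x \<in> space \<mu>. ennreal l < Av k f' x})" by (auto simp: E'_def)
  have [measurable]: "E' \<in> sets \<mu>" unfolding E'_eq by measurable
  have sub: "E \<subseteq> (\<Union>s\<in>S. ball s (2 * ?r)) \<union> E'"
  proof
    fix x assume "x \<in> E"
    then consider "ennreal l < Av k f x" | k' where "k' \<in> set ks" "ennreal l < Av k' f x"
      by (auto simp: E_def)
    then show "x \<in> (\<Union>s\<in>S. ball s (2 * ?r)) \<union> E'"
    proof cases
      case 1
      then show ?thesis using S(4)[of x] by (auto simp: dist_commute)
    next
      case 2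
      \<comment> \<open>The list is sorted, so \<open>k'\<close> is at least k and its radius at
        most that of the balls selected for k.\<close>
      have r': "rad k' \<le> ?r" using Cons.prems(1) 2 by (intro rad_mono) auto
      show ?thesis
      proof (cases "ball x (rad k') \<inter> W = {}")
        case True
        then have "Av k' f' x = Av k' f x"
          unfolding Av_def nn_avg_def f'_def
          by (intro arg_cong2[where f = "(/)"] nn_integral_cong refl) (auto split: split_indicator)
        then have "\<exists>k\<in>set ks. ennreal l < Av k f' x" using 2 by (intro bexI[of _ k']) simp_all
        then show ?thesis by (simp add: E'_def)
      next
        case False
        then obtain s z where "s \<in> S" "dist x z < rad k'" "dist s z < ?r" by (auto simp: W_def)
        then have "dist s x < 2 * ?r"
          using r' dist_triangle[of s x z] by (simp add: dist_commute)
        then show ?thesis using \<open>s \<in> S\<close> by auto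
      qed
    qed
  qed
  have Um [measurable]: "(\<Union>s\<in>S. ball s (2 * ?r)) \<in> sets \<mu>" by (intro open_in_sets) auto
  have sum_le: "emeasure \<mu> (\<Union>s\<in>S. ball s (2 * ?r)) \<le> (\<integral>\<^sup>+ s. V s (2 * ?r) \<partial>count_space S)"
  proof -
    have "emeasure \<mu> (\<Union>s\<in>S. ball s (2 * ?r)) = (\<integral>\<^sup>+ x. indicator (\<Union>s\<in>S. ball s (2 * ?r)) x \<partial>\<mu>)"
      by (intro nn_integral_indicator[symmetric] open_in_sets) auto
    also have "\<dots> \<le> (\<integral>\<^sup>+ x. \<integral>\<^sup>+ s. indicator (ball s (2 * ?r)) x \<partial>count_space S \<partial>\<mu>)"
    proof (intro nn_integral_mono)
      fix x
      show "indicator (\<Union>s\<in>S. ball s (2 * ?r)) x \<le>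
        (\<integral>\<^sup>+ s. indicator (ball s (2 * ?r)) x \<partial>count_space S)"
      proof (cases "x \<in> (\<Union>s\<in>S. ball s (2 * ?r))")
        case True
        then obtain s where "s \<in> S" "x \<in> ball s (2 * ?r)" by auto
        then show ?thesis
          using nn_integral_ge_point[of s S "\<lambda>s. indicator (ball s (2 * ?r)) x"] True by simp
      qed simp
    qed
    also have "\<dots> = (\<integral>\<^sup>+ s. V s (2 * ?r) \<partial>count_space S)"
      using S(3) by (subst nn_integral_count_space_nn_integral) auto
    finally show ?thesis .
  qed
  have sel: "ennreal l * V s (2 * ?r) \<le> ennreal Dbl * (\<integral>\<^sup>+ y\<in>ball s ?r. f y \<partial>\<mu>)" if "s \<in> S" for s
  proof -
    have "ennreal l \<le> Av k f s" using S(1) that by (auto simp: less_imp_le)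
    then have "ennreal l * V s ?r \<le> (\<integral>\<^sup>+ y\<in>ball s ?r. f y \<partial>\<mu>)"
      unfolding Av_def nn_avg_def by (subst (asm) ennreal_le_divide_iff) auto
    then have "ennreal Dbl * (ennreal l * V s ?r) \<le> ennreal Dbl * (\<integral>\<^sup>+ y\<in>ball s ?r. f y \<partial>\<mu>)"
      by (rule mult_left_mono) simp
    moreover have "ennreal l * V s (2 * ?r) \<le> ennreal l * (ennreal Dbl * V s ?r)"
      by (intro mult_left_mono V_double) auto
    ultimately show ?thesis by (simp add: ac_simps)
  qed
  have "ennreal l * emeasure \<mu> E \<le> ennreal l * ((\<integral>\<^sup>+ s. V s (2 * ?r) \<partial>count_space S) + emeasure \<mu> E')"
  proof (rule mult_left_mono)
    have "emeasure \<mu> E \<le> emeasure \<mu> ((\<Union>s\<in>S. ball s (2 * ?r)) \<union> E')"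
      using sub by (rule emeasure_mono) measurable
    also have "\<dots> \<le> emeasure \<mu> (\<Union>s\<in>S. ball s (2 * ?r)) + emeasure \<mu> E'"
      by (rule emeasure_subadditive) measurable
    finally show "emeasure \<mu> E \<le> (\<integral>\<^sup>+ s. V s (2 * ?r) \<partial>count_space S) + emeasure \<mu> E'"
      using sum_le by (meson add_right_mono order_trans)
  qed simp
  also have "\<dots> = (\<integral>\<^sup>+ s. ennreal l * V s (2 * ?r) \<partial>count_space S) + ennreal l * emeasure \<mu> E'"
    by (simp add: distrib_left nn_integral_cmult)
  also have "\<dots> \<le> (\<integral>\<^sup>+ s. ennreal Dbl * (\<integral>\<^sup>+ y\<in>ball s ?r. f y \<partial>\<mu>) \<partial>count_space S) + ennreal Dbl * (\<integral>\<^sup>+ x. f' x \<partial>\<mu>)"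
  proof (rule add_mono)
    show "(\<integral>\<^sup>+ s. ennreal l * V s (2 * ?r) \<partial>count_space S) \<le>
      (\<integral>\<^sup>+ s. ennreal Dbl * (\<integral>\<^sup>+ y\<in>ball s ?r. f y \<partial>\<mu>) \<partial>count_space S)"
      using sel by (intro nn_integral_mono) auto
    show "ennreal l * emeasure \<mu> E' \<le> ennreal Dbl * (\<integral>\<^sup>+ x. f' x \<partial>\<mu>)"
      unfolding E'_def using Cons.prems(1) by (intro Cons.IH) auto
  qed
  also have "\<dots> = ennreal Dbl * ((\<integral>\<^sup>+ s. (\<integral>\<^sup>+ y\<in>ball s ?r. f y \<partial>\<mu>) \<partial>count_space S) + (\<integral>\<^sup>+ x. f' x \<partial>\<mu>))"
    by (simp add: distrib_left nn_integral_cmult)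
  also have "(\<integral>\<^sup>+ s. (\<integral>\<^sup>+ y\<in>ball s ?r. f y \<partial>\<mu>) \<partial>count_space S) = (\<integral>\<^sup>+ x. f x * indicator W x \<partial>\<mu>)"
  proof -
    \<comment> \<open>Countable additivity of the measure with density f over the disjoint selected
      balls. Together with the part of f outside \<open>W\<close> this gives back the full integral,
      with no loss in the induction.\<close>
    have "emeasure (density \<mu> f) (\<Union>s\<in>S. ball s ?r) = (\<integral>\<^sup>+ s. emeasure (density \<mu> f) (ball s ?r) \<partial>count_space S)"
      using S(3) separated_disjoint[OF S(2)] by (intro emeasure_UN_countable) auto
    moreover have "emeasure (density \<mu> f) (\<Union>s\<in>S. ball s ?r) = (\<integral>\<^sup>+ x. f x * indicator W x \<partial>\<mu>)"
      by (subst emeasure_density) (auto simp: W_def[symmetric])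
    ultimately show ?thesis by (simp add: emeasure_density)
  qed
  also have "(\<integral>\<^sup>+ x. f x * indicator W x \<partial>\<mu>) + (\<integral>\<^sup>+ x. f' x \<partial>\<mu>) = (\<integral>\<^sup>+ x. f x \<partial>\<mu>)"
    by (subst nn_integral_add[symmetric]) (auto simp: f'_def intro!: nn_integral_cong split: split_indicator)
  finally show ?case by (simp add: E_def)
qed simp

section \<open>The maximal operator: weak type and strong type\<close>

definition Mx :: "('a \<Rightarrow> ennreal) \<Rightarrow> 'a \<Rightarrow> ennreal" where
  "Mx f x = (SUP k. Av k f x)"

lemma Mx_measurable [measurable]: "f \<in> borel_measurable \<mu> \<Longrightarrow> Mx f \<in> borel_measurable \<mu>"
  unfolding Mx_def by measurable

lemma Av_le_Mx: "Av k f x \<le> Mx f x"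
  unfolding Mx_def by (rule SUP_upper) simp

lemma Av_mono: "(\<And>x. f x \<le> g x) \<Longrightarrow> Av k f x \<le> Av k g x"
  unfolding Av_def by (rule nn_avg_mono) simp

lemma Av_add: "f \<in> borel_measurable \<mu> \<Longrightarrow> g \<in> borel_measurable \<mu> \<Longrightarrow> Av k (\<lambda>x. f x + g x) x = Av k f x + Av k g x"
  unfolding Av_def by (rule nn_avg_add) auto

lemma Av_const: "Av k (\<lambda>_. c) x = c"
  unfolding Av_def by (rule nn_avg_const) simp

text \<open>The bound for finitely many scales does not depend on their number, so the scales from
  -N to N exhaust the supremum by continuity from below.\<close>

lemma weak_type:
  assumes l: "0 < l" and [measurable]: "f \<in> borel_measurable \<mu>"
  shows "emeasure \<mu> {x. ennreal l < Mx f x} \<le> ennreal (Dbl / l) * (\<integral>\<^sup>+ x. f x \<partial>\<mu>)"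
proof -
  define E where "E N = {x. \<exists>k\<in>set [- int N..int N]. ennreal l < Av k f x}" for N
  have E_eq: "E N = (\<Union>k\<in>set [- int N..int N]. {x \<in> space \<mu>. ennreal l < Av k f x})" for N
    by (auto simp: E_def)
  have [measurable]: "E N \<in> sets \<mu>" for N unfolding E_eq by measurable
  have "{x. ennreal l < Mx f x} = (\<Union>N. E N)"
  proof (intro set_eqI iffI)
    fix x assume "x \<in> {x. ennreal l < Mx f x}"
    then obtain k where "ennreal l < Av k f x" by (auto simp: Mx_def less_SUP_iff)
    then show "x \<in> (\<Union>N. E N)" by (auto simp: E_def intro!: exI[of _ "nat \<bar>k\<bar>"] bexI[of _ k])
  next
    fix x assume "x \<in> (\<Union>N. E N)"
    then show "x \<in> {x. ennreal l < Mx f x}" by (auto simp: E_def Mx_def less_SUP_iff)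
  qed
  moreover have "incseq E" by (auto simp: E_def incseq_def)
  ultimately have eq: "emeasure \<mu> {x. ennreal l < Mx f x} = (SUP N. emeasure \<mu> (E N))"
    by (simp add: SUP_emeasure_incseq image_subset_iff)
  have "emeasure \<mu> (E N) \<le> ennreal (Dbl / l) * (\<integral>\<^sup>+ x. f x \<partial>\<mu>)" for N
  proof -
    have "sorted [- int N..int N]" by (rule sorted_upto)
    then have "ennreal l * emeasure \<mu> (E N) \<le> ennreal Dbl * (\<integral>\<^sup>+ x. f x \<partial>\<mu>)"
      unfolding E_def by (rule weak_type_finite) measurable
    then have "ennreal (1 / l) * (ennreal l * emeasure \<mu> (E N)) \<le> ennreal (1 / l) * (ennreal Dbl * (\<integral>\<^sup>+ x. f x \<partial>\<mu>))"
      by (rule mult_left_mono) simp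
    then show ?thesis
      using l Dbl_pos by (simp add: mult.assoc[symmetric] ennreal_mult[symmetric])
  qed
  then show ?thesis unfolding eq by (rule SUP_least)
qed

text \<open>Discrete layer cake. For finite positive z the single index with 2^i < z <= 2^(i+1)
  already gives the bound; for z infinite every index counts and the terms are unbounded.\<close>

lemma epowr_le_dyadic_sum:
  assumes a: "0 < a"
  shows "epowr z a \<le> (\<integral>\<^sup>+ i. ennreal (2 powr ((of_int i + 1) * a)) * indicator {i. ennreal (2 powr of_int i) < z} i
    \<partial>count_space (UNIV :: int set))" (is "_ \<le> ?S")
proof (cases z)
  case top
  have "ennreal x \<le> ?S" if "0 < x" for x
  proof -
    define i where "i = \<lceil>log 2 x / a\<rceil>"
    have "log 2 x \<le> (of_int i + 1) * a"
      using a by (simp add: i_def pos_divide_le_eq[symmetric]) linarith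
    then have "x \<le> 2 powr ((of_int i + 1) * a)"
      using that by (simp add: le_powr_iff)
    then have "ennreal x \<le> ennreal (2 powr ((of_int i + 1) * a)) * indicator {i. ennreal (2 powr of_int i) < z} i"
      using top by (simp add: ennreal_leI)
    also have "\<dots> \<le> ?S" by (rule nn_integral_ge_point) simp
    finally show ?thesis .
  qed
  then have "?S = top"
  proof (cases ?S)
    case (real r)
    then show ?thesis using \<open>\<And>x. 0 < x \<Longrightarrow> ennreal x \<le> ?S\<close>[of "r + 1"] by (simp del: ennreal_plus)
  qed simp
  then show ?thesis by simp
next
  case (real x)
  show ?thesis
  proof (cases "x = 0")
    case False
    with real have x: "0 < x" by simp
    define i where "i = \<lceil>log 2 x\<rceil> - 1"
    have "of_int i < log 2 x" "log 2 x \<le> of_int i + 1" unfolding i_def by linarith+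
    then have i: "2 powr of_int i < x" "x \<le> 2 powr (of_int i + 1)"
      using x by (simp_all add: less_log_iff log_le_iff)
    have "epowr z a = ennreal (x powr a)" using real by (simp add: epowr_ennreal)
    also have "x powr a \<le> (2 powr (of_int i + 1)) powr a"
      using i x a by (intro powr_mono2) auto
    finally have "epowr z a \<le> ennreal (2 powr ((of_int i + 1) * a)) * indicator {i. ennreal (2 powr of_int i) < z} i"
      using real i by (simp add: powr_powr ennreal_less_iff ennreal_leI)
    also have "\<dots> \<le> ?S" by (rule nn_integral_ge_point) simp
    finally show ?thesis .
  qed (use real in simp)
qed

text \<open>The admissible indices are bounded above by about log z, and the terms below the last
  one form a geometric series, so the sum is comparable to its last term.\<close>

lemma dyadic_sum_le_epowr:
  assumes a: "0 < a"
  shows "(\<integral>\<^sup>+ i. ennreal (2 powr (of_int i * a)) * indicator {i. ennreal (2 powr (of_int i - 1)) < z} i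
    \<partial>count_space (UNIV :: int set)) \<le> ennreal (geom a * 2 powr a) * epowr z a" (is "?S \<le> _")
proof (cases z)
  case top
  then show ?thesis using geom_pos[OF a] by (simp add: ennreal_mult_top)
next
  case (real x)
  show ?thesis
  proof (cases "x = 0")
    case False
    with real have x: "0 < x" by simp
    define m where "m = \<lfloor>log 2 x\<rfloor> + 1"
    have "of_int m \<le> log 2 x + 1" unfolding m_def by linarith
    then have m: "2 powr (of_int m * a) \<le> (2 * x) powr a"
    proof -
      assume "of_int m \<le> log 2 x + 1"
      then have "of_int m \<le> log 2 (2 * x)" using x by (simp add: log_mult)
      then have "2 powr of_int m \<le> 2 * x" using x by (simp add: le_log_iff)
      then have "(2 powr of_int m) powr a \<le> (2 * x) powr a" using a by (intro powr_mono2) auto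
      then show ?thesis by (simp add: powr_powr)
    qed
    have "?S \<le> (\<integral>\<^sup>+ i. ennreal (2 powr (of_int m * a)) * (if i \<le> m then ennreal (2 powr (of_int (i - m) * a)) else 0)
      \<partial>count_space (UNIV :: int set))"
    proof (intro nn_integral_mono)
      fix i :: int
      have "i \<le> m" if "2 powr (of_int i - 1) < x"
      proof -
        have "of_int i - 1 < log 2 x" using that x by (simp add: less_log_iff)
        then show ?thesis unfolding m_def by linarith
      qed
      then show "ennreal (2 powr (of_int i * a)) * indicator {i. ennreal (2 powr (of_int i - 1)) < z} i
        \<le> ennreal (2 powr (of_int m * a)) * (if i \<le> m then ennreal (2 powr (of_int (i - m) * a)) else 0)"
        using real by (auto simp: ennreal_less_iff ennreal_mult[symmetric] powr_add[symmetric]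
          algebra_simps split: split_indicator)
    qed
    also have "\<dots> = ennreal (2 powr (of_int m * a)) * ennreal (geom a)"
      by (simp add: nn_integral_cmult nn_integral_int_geom(2)[OF a, of m])
    also have "\<dots> \<le> ennreal (geom a * 2 powr a) * epowr z a"
      using real m geom_pos[OF a] by (simp add: epowr_ennreal ennreal_mult[symmetric] powr_mult
        mult_left_mono ennreal_leI mult.commute[of _ "geom a"] mult.assoc)
    finally show ?thesis .
  qed (use real in simp)
qed

text \<open>Marcinkiewicz interpolation between the weak type bound and the trivial bound by the
  supremum: at level 2^i only the part of f above 2^(i-1) matters, because the rest adds at most
  2^(i-1) to the maximal function.\<close>

lemma maximal_theorem:
  assumes a: "1 < a"
  shows "\<exists>C>0. \<forall>f\<in>borel_measurable \<mu>. (\<integral>\<^sup>+ x. epowr (Mx f x) a \<partial>\<mu>) \<le> ennreal C * (\<integral>\<^sup>+ x. epowr (f x) a \<partial>\<mu>)"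
proof (intro exI conjI ballI)
  \<comment> \<open>The factor 2 * Dbl comes from the weak type bound at level 2^(i-1), 2^a from the
    layer cake sum with i + 1 in place of i, and the last factor from summing the levels below f;
    the exponent a - 1 > 0 makes that sum converge.\<close>
  let ?C = "2 * Dbl * 2 powr a * (geom (a - 1) * 2 powr (a - 1))"
  show "0 < ?C" using geom_pos[of "a - 1"] a Dbl_pos by simp
  fix f :: "'a \<Rightarrow> ennreal" assume [measurable]: "f \<in> borel_measurable \<mu>"
  define g where "g i x = f x * indicator {x. ennreal (2 powr (of_int i - 1)) < f x} x" for i :: int and x
  have [measurable]: "g i \<in> borel_measurable \<mu>" for i
  proof -
    have "{x \<in> space \<mu>. ennreal (2 powr (of_int i - 1)) < f x} \<in> sets \<mu>" by measurable
    then have [measurable]: "{x. ennreal (2 powr (of_int i - 1)) < f x} \<in> sets \<mu>" by simp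
    show ?thesis unfolding g_def by measurable
  qed
  have lev: "emeasure \<mu> {x. ennreal (2 powr of_int i) < Mx f x} \<le> ennreal (Dbl / 2 powr (of_int i - 1)) * (\<integral>\<^sup>+ x. g i x \<partial>\<mu>)" for i :: int
  proof -
    let ?t = "2 powr (of_int i - 1) :: real"
    have "Mx f x \<le> Mx (g i) x + ennreal ?t" for x
      unfolding Mx_def
    proof (rule SUP_least)
      fix k
      have "Av k f x \<le> Av k (\<lambda>x. g i x + ennreal ?t) x"
        by (rule Av_mono) (auto simp: g_def split: split_indicator)
      also have "\<dots> = Av k (g i) x + ennreal ?t" by (simp add: Av_add Av_const)
      also have "\<dots> \<le> (SUP k. Av k (g i) x) + ennreal ?t" by (intro add_mono SUP_upper) auto
      finally show "Av k f x \<le> (SUP k. Av k (g i) x) + ennreal ?t" .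
    qed
    then have le: "Mx f x \<le> Mx (g i) x + ennreal ?t" for x .
    have tt: "ennreal (2 powr of_int i) = ennreal ?t + ennreal ?t"
      by (subst ennreal_plus[symmetric]) (auto simp: powr_diff)
    have "{x. ennreal (2 powr of_int i) < Mx f x} \<subseteq> {x. ennreal ?t < Mx (g i) x}"
    proof
      fix x assume "x \<in> {x. ennreal (2 powr of_int i) < Mx f x}"
      then have "ennreal ?t + ennreal ?t < Mx (g i) x + ennreal ?t"
        using le[of x] unfolding tt by (simp add: order_less_le_trans)
      then have "\<not> Mx (g i) x \<le> ennreal ?t" by (meson add_right_mono not_less)
      then show "x \<in> {x. ennreal ?t < Mx (g i) x}" by simp
    qed
    moreover have "{x \<in> space \<mu>. ennreal ?t < Mx (g i) x} \<in> sets \<mu>" by measurable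
    ultimately have "emeasure \<mu> {x. ennreal (2 powr of_int i) < Mx f x} \<le> emeasure \<mu> {x. ennreal ?t < Mx (g i) x}"
      by (intro emeasure_mono) auto
    also have "\<dots> \<le> ennreal (Dbl / ?t) * (\<integral>\<^sup>+ x. g i x \<partial>\<mu>)"
      by (rule weak_type) auto
    finally show ?thesis .
  qed
  have [measurable]: "{x. ennreal (2 powr of_int i) < Mx f x} \<in> sets \<mu>" for i :: int
  proof -
    have "{x \<in> space \<mu>. ennreal (2 powr of_int i) < Mx f x} \<in> sets \<mu>" by measurable
    then show ?thesis by simp
  qed
  have "(\<integral>\<^sup>+ x. epowr (Mx f x) a \<partial>\<mu>) \<le>
    (\<integral>\<^sup>+ x. \<integral>\<^sup>+ i. ennreal (2 powr ((of_int i + 1) * a)) * indicator {x. ennreal (2 powr of_int i) < Mx f x} x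
      \<partial>count_space (UNIV :: int set) \<partial>\<mu>)"
    using a by (intro nn_integral_mono order_trans[OF epowr_le_dyadic_sum[of a]])
      (auto intro!: nn_integral_mono split: split_indicator)
  also have "\<dots> = (\<integral>\<^sup>+ i. ennreal (2 powr ((of_int i + 1) * a)) * emeasure \<mu> {x. ennreal (2 powr of_int i) < Mx f x} \<partial>count_space (UNIV :: int set))"
    by (subst nn_integral_count_space_nn_integral) (auto simp: nn_integral_cmult_indicator)
  also have "\<dots> \<le> (\<integral>\<^sup>+ i. ennreal (2 * Dbl * 2 powr a) * (ennreal (2 powr (of_int i * (a - 1))) * (\<integral>\<^sup>+ x. g i x \<partial>\<mu>)) \<partial>count_space (UNIV :: int set))"
  proof (intro nn_integral_mono)
    fix i :: int
    have "ennreal (2 powr ((of_int i + 1) * a)) * emeasure \<mu> {x. ennreal (2 powr of_int i) < Mx f x}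
      \<le> ennreal (2 powr ((of_int i + 1) * a)) * (ennreal (Dbl / 2 powr (of_int i - 1)) * (\<integral>\<^sup>+ x. g i x \<partial>\<mu>))"
      by (intro mult_left_mono lev) simp
    also have "\<dots> = ennreal (2 * Dbl * 2 powr a) * (ennreal (2 powr (of_int i * (a - 1))) * (\<integral>\<^sup>+ x. g i x \<partial>\<mu>))"
    proof -
      have "2 powr ((of_int i + 1) * a) * (Dbl / 2 powr (of_int i - 1)) = 2 * Dbl * 2 powr a * 2 powr (of_int i * (a - 1))"
        by (simp add: powr_add powr_diff algebra_simps)
      then show ?thesis
        using Dbl_pos by (simp add: mult.assoc[symmetric] ennreal_mult[symmetric])
    qed
    finally show "ennreal (2 powr ((of_int i + 1) * a)) * emeasure \<mu> {x. ennreal (2 powr of_int i) < Mx f x} \<le> \<dots>" .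
  qed
  also have "\<dots> = ennreal (2 * Dbl * 2 powr a) *
      (\<integral>\<^sup>+ x. \<integral>\<^sup>+ i. ennreal (2 powr (of_int i * (a - 1))) * g i x \<partial>count_space (UNIV :: int set) \<partial>\<mu>)"
    by (subst nn_integral_count_space_nn_integral) (auto simp: nn_integral_cmult)
  also have "\<dots> \<le> ennreal (2 * Dbl * 2 powr a) *
      (\<integral>\<^sup>+ x. ennreal (geom (a - 1) * 2 powr (a - 1)) * epowr (f x) a \<partial>\<mu>)"
  proof (intro mult_left_mono nn_integral_mono)
    fix x
    have "(\<integral>\<^sup>+ i. ennreal (2 powr (of_int i * (a - 1))) * g i x \<partial>count_space (UNIV :: int set))
      = (\<integral>\<^sup>+ i. f x * (ennreal (2 powr (of_int i * (a - 1))) * indicator {i. ennreal (2 powr (of_int i - 1)) < f x} i)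
         \<partial>count_space (UNIV :: int set))"
      by (intro nn_integral_cong) (auto simp: g_def mult.commute split: split_indicator)
    also have "\<dots> = f x * (\<integral>\<^sup>+ i. ennreal (2 powr (of_int i * (a - 1))) * indicator {i. ennreal (2 powr (of_int i - 1)) < f x} i
         \<partial>count_space (UNIV :: int set))"
      by (rule nn_integral_cmult) simp
    also have "\<dots> \<le> f x * (ennreal (geom (a - 1) * 2 powr (a - 1)) * epowr (f x) (a - 1))"
      using a by (intro mult_left_mono dyadic_sum_le_epowr) auto
    also have "\<dots> = ennreal (geom (a - 1) * 2 powr (a - 1)) * (epowr (f x) 1 * epowr (f x) (a - 1))"
      by (simp add: ac_simps)
    also have "\<dots> = ennreal (geom (a - 1) * 2 powr (a - 1)) * epowr (f x) a"
      using a by (subst epowr_add[symmetric]) auto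
    finally show "(\<integral>\<^sup>+ i. ennreal (2 powr (of_int i * (a - 1))) * g i x \<partial>count_space (UNIV :: int set)) \<le> \<dots>" .
  qed simp
  also have "\<dots> = ennreal ?C * (\<integral>\<^sup>+ x. epowr (f x) a \<partial>\<mu>)"
    using geom_pos[of "a - 1"] a Dbl_pos
    by (subst nn_integral_cmult) (auto simp: mult.assoc[symmetric] ennreal_mult[symmetric])
  finally show "(\<integral>\<^sup>+ x. epowr (Mx f x) a \<partial>\<mu>) \<le> ennreal ?C * (\<integral>\<^sup>+ x. epowr (f x) a \<partial>\<mu>)" .
qed

end

section \<open>Points of approximate continuity\<close>

context doubling_metric_measure_space
begin

lemma emeasure_decseq_less:
  assumes A: "\<And>i. A i \<in> sets \<mu>" "decseq A" "\<And>i. A i \<subseteq> ball x0 R"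
    and e: "emeasure \<mu> (\<Inter>i. A i) < e"
  shows "\<exists>i. emeasure \<mu> (A i) < e"
proof -
  have "emeasure \<mu> (A i) \<noteq> \<infinity>" for i
    using emeasure_mono[OF A(3)[of i] ball_in_sets] V_finite(1)[of x0 R]
    by (metis infinity_ennreal_def not_less_iff_gr_or_eq order_le_less_trans)
  then have "(\<lambda>i. emeasure \<mu> (A i)) \<longlonglongrightarrow> emeasure \<mu> (\<Inter>i. A i)"
    using A by (intro Lim_emeasure_decseq) auto
  then have "\<forall>\<^sub>F i in sequentially. emeasure \<mu> (A i) < e" using e by (rule order_tendstoD)
  then show ?thesis by (auto simp: eventually_sequentially)
qed

text \<open>Induction over the generation of the Borel sets from the open ones. The error is
  measured inside a fixed ball, where the measure is finite and continuity from above is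
  available.\<close>

lemma borel_approx:
  assumes "B \<in> sets borel" "0 < e"
  shows "\<exists>U F. open U \<and> closed F \<and> F \<subseteq> B \<and> B \<subseteq> U \<and> emeasure \<mu> ((U - F) \<inter> ball x0 R) < ennreal e"
proof -
  have "B \<in> sigma_sets UNIV {S :: 'a set. open S}"
    using assms(1) by (simp add: borel_def)
  then show ?thesis using \<open>0 < e\<close>
  proof (induction arbitrary: e rule: sigma_sets.induct)
    case (Basic S)
    then have "open S" by simp
    show ?case
    \<comment> \<open>The distance to the empty complement is 0 by convention, so the whole space is
      treated apart.\<close>
    proof (cases "S = UNIV")
      case True
      then show ?thesis using Basic by (intro exI[of _ UNIV]) auto
    next
      case False
      define F where "F m = {x. 1 / real (Suc m) \<le> infdist x (- S)}" for m
      have cl: "closed (F m)" for m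
        unfolding F_def by (intro closed_Collect_le continuous_intros)
      have sub: "F m \<subseteq> S" for m
      proof
        fix x assume "x \<in> F m"
        then have "0 < infdist x (- S)"
          unfolding F_def by (auto intro: less_le_trans[of 0 "1 / real (Suc m)"] simp del: of_nat_Suc)
        then show "x \<in> S" by (metis ComplI infdist_zero less_irrefl)
      qed
      have ex: "\<exists>m. x \<in> F m" if "x \<in> S" for x
      proof -
        have "0 < infdist x (- S)"
          using that False \<open>open S\<close> infdist_pos_not_in_closed[of "- S" x] by (auto simp: closed_def)
        then obtain m where "1 / real (Suc m) < infdist x (- S)" by (rule nat_approx_posE)
        then show ?thesis by (auto simp: F_def intro!: exI[of _ m])
      qed
      have F_mono: "F m \<subseteq> F l" if "m \<le> l" for m l
      proof
        fix x assume "x \<in> F m"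
        moreover have "1 / real (Suc l) \<le> 1 / real (Suc m)" using that by (simp add: frac_le)
        ultimately show "x \<in> F l" unfolding F_def by (simp del: of_nat_Suc)
      qed
      have "\<exists>m. emeasure \<mu> ((S - F m) \<inter> ball x0 R) < ennreal e"
      proof (rule emeasure_decseq_less)
        show "(S - F m) \<inter> ball x0 R \<in> sets \<mu>" for m
          using cl \<open>open S\<close> by (intro open_in_sets) (auto intro!: open_Diff)
        show "decseq (\<lambda>m. (S - F m) \<inter> ball x0 R)"
          using F_mono by (auto simp: decseq_def)
        have "(\<Inter>m. (S - F m) \<inter> ball x0 R) = {}" using ex by auto
        then show "emeasure \<mu> (\<Inter>m. (S - F m) \<inter> ball x0 R) < ennreal e"
          using Basic by simp
      qed auto
      then show ?thesis using cl sub \<open>open S\<close> by blast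
    qed
  next
    case Empty
    then show ?case by (intro exI[of _ "{}"]) auto
  next
    case (Compl B)
    then obtain U F where "open U" "closed F" "F \<subseteq> B" "B \<subseteq> U" "emeasure \<mu> ((U - F) \<inter> ball x0 R) < ennreal e"
      by meson
    moreover have "- F - - U = U - F" by auto
    ultimately show ?case
      by (intro exI[of _ "- F"] exI[of _ "- U"]) (auto simp: Compl_eq_Diff_UNIV[symmetric])
  next
    case (Union B)
    \<comment> \<open>The errors sum to e/2, which leaves room for a strict inequality after the
      closed sets are cut down to a finite union.\<close>
    have "\<exists>U F. open U \<and> closed F \<and> F \<subseteq> B i \<and> B i \<subseteq> U \<and>
        emeasure \<mu> ((U - F) \<inter> ball x0 R) < ennreal (e / 2 * (1 / 2) ^ Suc i)" for i
      using Union.IH[of "e / 2 * (1 / 2) ^ Suc i" i] Union.prems by simp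
    then obtain U F where UF: "\<And>i. open (U i)" "\<And>i. closed (F i)" "\<And>i. F i \<subseteq> B i" "\<And>i. B i \<subseteq> U i"
      "\<And>i. emeasure \<mu> ((U i - F i) \<inter> ball x0 R) < ennreal (e / 2 * (1 / 2) ^ Suc i)"
      by metis
    have ms: "(U i - F i) \<inter> ball x0 R \<in> sets \<mu>" for i
      using UF by (intro open_in_sets) (auto intro!: open_Diff)
    have "\<exists>N. emeasure \<mu> (((\<Union>i. U i) - (\<Union>i\<le>N. F i)) \<inter> ball x0 R) < ennreal e"
    proof (rule emeasure_decseq_less)
      show "((\<Union>i. U i) - (\<Union>i\<le>N. F i)) \<inter> ball x0 R \<in> sets \<mu>" for N
        using UF by (intro open_in_sets) (auto intro!: open_Diff)
      show "decseq (\<lambda>N. ((\<Union>i. U i) - (\<Union>i\<le>N. F i)) \<inter> ball x0 R)"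
        by (force simp: decseq_def)
      have "emeasure \<mu> (\<Inter>N. ((\<Union>i. U i) - (\<Union>i\<le>N. F i)) \<inter> ball x0 R)
          \<le> emeasure \<mu> (\<Union>i. (U i - F i) \<inter> ball x0 R)"
      proof (rule emeasure_mono)
        show "(\<Union>i. (U i - F i) \<inter> ball x0 R) \<in> sets \<mu>"
          by (rule sets.countable_UN) (use ms in blast)
      qed auto
      also have "\<dots> \<le> (\<Sum>i. emeasure \<mu> ((U i - F i) \<inter> ball x0 R))"
        using ms by (intro emeasure_subadditive_countably) auto
      also have "\<dots> \<le> (\<Sum>i. ennreal (e / 2 * (1 / 2) ^ Suc i))"
        using UF(5) by (intro suminf_le) (auto simp: less_imp_le)
      also have "\<dots> = ennreal (e / 2 * 1)"
        using Union.prems by (intro suminf_ennreal_eq sums_mult power_half_series) auto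
      also have "\<dots> < ennreal e" using Union.prems by (simp add: ennreal_less_iff)
      finally show "emeasure \<mu> (\<Inter>N. ((\<Union>i. U i) - (\<Union>i\<le>N. F i)) \<inter> ball x0 R) < ennreal e" .
    qed auto
    then obtain N where "emeasure \<mu> (((\<Union>i. U i) - (\<Union>i\<le>N. F i)) \<inter> ball x0 R) < ennreal e" ..
    moreover have "open (\<Union>i. U i)" using UF(1) by (intro open_UN) simp
    moreover have "closed (\<Union>i\<le>N. F i)" using UF(2) by (intro closed_UN) simp_all
    moreover have "(\<Union>i\<le>N. F i) \<subseteq> (\<Union>i. B i)" using UF(3) by (intro UN_mono) simp_all
    moreover have "(\<Union>i. B i) \<subseteq> (\<Union>i. U i)" using UF(4) by (intro UN_mono) simp_all
    ultimately show ?case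
      by - (rule exI[of _ "\<Union>i. U i"], rule exI[of _ "\<Union>i\<le>N. F i"], intro conjI)
  qed
qed

text \<open>E is first enlarged to a Borel hull. The hull exceeds E by a null set because the
  measures agree and are finite; an open approximation of the hull then serves for E.\<close>

lemma outer_regular_bounded:
  assumes E: "E \<in> sets \<mu>" "E \<subseteq> ball x0 R" and e: "0 < e"
  shows "\<exists>U. open U \<and> E \<subseteq> U \<and> emeasure \<mu> (U - E) < ennreal e"
proof -
  obtain B where B: "B \<in> sets borel" "E \<subseteq> B" "emeasure \<mu> B = emeasure \<mu> E"
    using borel_regular[OF E(1)] by auto
  have Bm: "B \<in> sets \<mu>" by (rule borel_in_sets[OF B(1)])
  have "emeasure \<mu> E < top"
    using emeasure_mono[OF E(2) ball_in_sets] V_finite(1)[of x0 R] by (rule order_le_less_trans)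
  then have null: "emeasure \<mu> (B - E) = 0"
    using B E Bm by (subst emeasure_Diff) auto
  obtain U F where UF: "open U" "closed F" "F \<subseteq> B" "B \<subseteq> U" "emeasure \<mu> ((U - F) \<inter> ball x0 R) < ennreal e"
    using borel_approx[OF B(1) e, of x0 R] by auto
  have [measurable]: "U \<in> sets \<mu>" "F \<in> sets \<mu>" "B \<in> sets \<mu>" "E \<in> sets \<mu>"
    using UF Bm E(1) by (auto intro: borel_in_sets)
  have "emeasure \<mu> (U \<inter> ball x0 R - E) \<le> emeasure \<mu> ((U - F) \<inter> ball x0 R \<union> (B - E))"
    using UF by (intro emeasure_mono) auto
  also have "\<dots> \<le> emeasure \<mu> ((U - F) \<inter> ball x0 R) + emeasure \<mu> (B - E)"
    by (intro emeasure_subadditive) measurable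
  finally have "emeasure \<mu> (U \<inter> ball x0 R - E) < ennreal e" using UF null by simp
  then show ?thesis using UF E B by (intro exI[of _ "U \<inter> ball x0 R"]) auto
qed

lemma rad_tendsto: "0 < e \<Longrightarrow> \<forall>\<^sub>F n in sequentially. rad (int n) < e"
proof -
  assume e: "0 < e"
  have "(\<lambda>n. (1 / 2 :: real) ^ n) \<longlonglongrightarrow> 0" by (rule LIMSEQ_power_zero) simp
  then have "\<forall>\<^sub>F n in sequentially. (1 / 2 :: real) ^ n < e" using e by (rule order_tendstoD)
  moreover have "rad (int n) = (1 / 2) ^ n" for n
    by (simp add: rad_def powr_minus powr_realpow power_one_over inverse_eq_divide)
  ultimately show ?thesis by simp
qed

text \<open>At a point of E that is not a density point, and for an open U containing E, the
  complement of E looks like U - E in all small balls. The maximal function of the indicator of U -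
  E is then at least 1/2 there, and the weak type bound controls such points by the measure of U -
  E, which can be made arbitrarily small.\<close>

lemma density_bounded:
  assumes E: "E \<in> sets \<mu>" "E \<subseteq> ball x0 R"
  shows "AE x in \<mu>. x \<in> E \<longrightarrow> (\<forall>\<^sub>F m in sequentially. Av (int m) (indicator (- E)) x < 1 / 2)"
proof -
  have [measurable]: "E \<in> sets \<mu>" by fact
  have Ec [measurable]: "- E \<in> sets \<mu>" using sets.compl_sets[OF E(1)] by (simp add: Compl_eq_Diff_UNIV)
  define N where "N = {x \<in> space \<mu>. x \<in> E \<and> \<not> (\<forall>\<^sub>F m in sequentially. Av (int m) (indicator (- E)) x < 1 / 2)}"
  have [measurable]: "N \<in> sets \<mu>" unfolding N_def eventually_sequentially by measurable
  have "emeasure \<mu> N \<le> 0 + ennreal e" if e: "0 < e" for e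
  proof -
    \<comment> \<open>Compensates the constant 3 * Dbl of the weak type bound at level 1/3. The
      level is below 1/2 because that bound is about a strict inequality.\<close>
    define d where "d = e / (3 * Dbl)"
    have d: "0 < d" using e Dbl_pos by (simp add: d_def)
    obtain U where U: "open U" "E \<subseteq> U" "emeasure \<mu> (U - E) < ennreal d"
      using outer_regular_bounded[OF E d] by auto
    have [measurable]: "U - E \<in> sets \<mu>" using U by (intro sets.Diff) auto
    have "N \<subseteq> {x. ennreal (1 / 3) < Mx (indicator (U - E)) x}"
    proof
      fix x assume x: "x \<in> N"
      then have "x \<in> U" using U by (auto simp: N_def)
      then obtain r where r: "0 < r" "ball x r \<subseteq> U" using U(1) open_contains_ball by blast
      from x have "\<exists>\<^sub>F m in sequentially. \<not> Av (int m) (indicator (- E)) x < 1 / 2"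
        by (simp add: N_def frequently_def)
      then obtain m where m: "\<not> Av (int m) (indicator (- E)) x < 1 / 2" "rad (int m) < r"
        using frequently_eventually_conj[OF _ rad_tendsto[OF r(1)]] frequently_ex by blast
      have "ball x (rad (int m)) \<subseteq> U" using m r subset_ball[of "rad (int m)" r x] by auto
      then have "Av (int m) (indicator (- E)) x = Av (int m) (indicator (U - E)) x"
        unfolding Av_def nn_avg_def
        by (intro arg_cong2[where f = "(/)"] nn_integral_cong refl) (auto split: split_indicator)
      then have "1 / 2 \<le> Mx (indicator (U - E)) x"
        using m Av_le_Mx[of "int m" "indicator (U - E)" x] by (simp add: not_less)
      moreover have "ennreal (1 / 3) < 1 / 2"
        using ennreal_less_iff[of "1 / 3" "1 / 2"] divide_ennreal[of 1 2] by simp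
      ultimately show "x \<in> {x. ennreal (1 / 3) < Mx (indicator (U - E)) x}" by simp
    qed
    moreover have "{x \<in> space \<mu>. ennreal (1 / 3) < Mx (indicator (U - E)) x} \<in> sets \<mu>" by measurable
    ultimately have "emeasure \<mu> N \<le> emeasure \<mu> {x. ennreal (1 / 3) < Mx (indicator (U - E)) x}"
      by (intro emeasure_mono) auto
    also have "\<dots> \<le> ennreal (Dbl / (1 / 3)) * (\<integral>\<^sup>+ x. indicator (U - E) x \<partial>\<mu>)"
      by (rule weak_type) auto
    also have "\<dots> \<le> ennreal (3 * Dbl) * ennreal d"
      using U by (intro mult_mono) (auto simp: mult.commute less_imp_le)
    also have "\<dots> = ennreal e" using Dbl_pos d by (simp add: ennreal_mult[symmetric] d_def)
    finally show ?thesis by simp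
  qed
  then have "emeasure \<mu> N \<le> 0" by (rule ennreal_le_epsilon)
  then have "N \<in> null_sets \<mu>" by auto
  then show ?thesis by (rule AE_I') (auto simp: N_def)
qed

lemma density:
  assumes E: "E \<in> sets \<mu>"
  shows "AE x in \<mu>. x \<in> E \<longrightarrow> (\<forall>\<^sub>F m in sequentially. Av (int m) (indicator (- E)) x < 1 / 2)"
proof -
  have "AE x in \<mu>. \<forall>N. x \<in> E \<inter> ball undefined (real N) \<longrightarrow>
      (\<forall>\<^sub>F m in sequentially. Av (int m) (indicator (- (E \<inter> ball undefined (real N)))) x < 1 / 2)"
    unfolding AE_all_countable using E by (intro allI density_bounded[of _ undefined]) auto
  then show ?thesis
  proof (rule AE_mp, intro AE_I2 impI)
    fix x assume *: "\<forall>N. x \<in> E \<inter> ball undefined (real N) \<longrightarrow>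
      (\<forall>\<^sub>F m in sequentially. Av (int m) (indicator (- (E \<inter> ball undefined (real N)))) x < 1 / 2)"
      and "x \<in> E"
    obtain N :: nat where "dist undefined x < real N" using reals_Archimedean2 by blast
    with * \<open>x \<in> E\<close> have "\<forall>\<^sub>F m in sequentially. Av (int m) (indicator (- (E \<inter> ball undefined (real N)))) x < 1 / 2"
      by auto
    then show "\<forall>\<^sub>F m in sequentially. Av (int m) (indicator (- E)) x < 1 / 2"
    proof (rule eventually_mono)
      fix m
      have "Av (int m) (indicator (- E)) x \<le> Av (int m) (indicator (- (E \<inter> ball undefined (real N)))) x"
        by (rule Av_mono) (auto split: split_indicator)
      then show "Av (int m) (indicator (- (E \<inter> ball undefined (real N)))) x < 1 / 2 \<Longrightarrow>
        Av (int m) (indicator (- E)) x < 1 / 2" by simp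
    qed
  qed
qed

text \<open>Apply the density theorem to the countably many preimages of intervals with rational
  endpoints; one of them contains u x and lies within \<epsilon> of it. Since u is merely
  measurable, this takes the place of Lebesgue points.\<close>

lemma approximate_continuity:
  fixes u :: "'a \<Rightarrow> real"
  assumes [measurable]: "u \<in> borel_measurable \<mu>"
  shows "AE x in \<mu>. \<forall>\<epsilon>>0. \<forall>\<^sub>F m in sequentially. Av (int m) (indicator {y. \<epsilon> \<le> \<bar>u y - u x\<bar>}) x < 1 / 2"
proof -
  define E where "E a b = {y. of_rat a < u y \<and> u y < of_rat b}" for a b :: rat
  have "{y \<in> space \<mu>. of_rat a < u y \<and> u y < of_rat b} \<in> sets \<mu>" for a b :: rat by measurable
  then have [measurable]: "E a b \<in> sets \<mu>" for a b by (simp add: E_def)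
  have "AE x in \<mu>. \<forall>a b. x \<in> E a b \<longrightarrow> (\<forall>\<^sub>F m in sequentially. Av (int m) (indicator (- E a b)) x < 1 / 2)"
    unfolding AE_all_countable by (intro allI density) measurable
  then show ?thesis
  proof (rule AE_mp, intro AE_I2 impI allI)
    fix x and \<epsilon> :: real assume *: "\<forall>a b. x \<in> E a b \<longrightarrow> (\<forall>\<^sub>F m in sequentially. Av (int m) (indicator (- E a b)) x < 1 / 2)"
      and \<epsilon>: "0 < \<epsilon>"
    obtain a where a: "u x - \<epsilon> < of_rat a" "of_rat a < u x" using of_rat_dense[of "u x - \<epsilon>" "u x"] \<epsilon> by auto
    obtain b where b: "u x < of_rat b" "of_rat b < u x + \<epsilon>" using of_rat_dense[of "u x" "u x + \<epsilon>"] \<epsilon> by auto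
    have "\<forall>\<^sub>F m in sequentially. Av (int m) (indicator (- E a b)) x < 1 / 2"
      using * a b by (auto simp: E_def)
    then show "\<forall>\<^sub>F m in sequentially. Av (int m) (indicator {y. \<epsilon> \<le> \<bar>u y - u x\<bar>}) x < 1 / 2"
    proof (rule eventually_mono)
      fix m
      have "Av (int m) (indicator {y. \<epsilon> \<le> \<bar>u y - u x\<bar>}) x \<le> Av (int m) (indicator (- E a b)) x"
        using a b by (intro Av_mono) (auto simp: E_def split: split_indicator)
      then show "Av (int m) (indicator (- E a b)) x < 1 / 2 \<Longrightarrow>
        Av (int m) (indicator {y. \<epsilon> \<le> \<bar>u y - u x\<bar>}) x < 1 / 2" by simp
    qed
  qed
qed

end

section \<open>A vector-valued maximal inequality\<close>

text \<open>The one-sided kernel 2^(-(j-k)\<delta>) for j >= k: finer scales j contribute to the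
  coarser scale k with geometric decay. Its row sums and its column sums are equally
  bounded.\<close>

definition wgt :: "real \<Rightarrow> int \<Rightarrow> int \<Rightarrow> ennreal" where
  "wgt \<delta> k j = (if k \<le> j then ennreal (2 powr (of_int (k - j) * \<delta>)) else 0)"

lemma sum_wgt:
  assumes "0 < \<delta>"
  shows "(\<integral>\<^sup>+ j. wgt \<delta> k j \<partial>count_space UNIV) = ennreal (geom \<delta>)"
    and "(\<integral>\<^sup>+ k. wgt \<delta> k j \<partial>count_space UNIV) = ennreal (geom \<delta>)"
  using nn_integral_int_geom[OF assms] by (simp_all add: wgt_def)

lemma measurable_int_sum [measurable]:
  assumes "\<And>j::int. f j \<in> borel_measurable M"
  shows "(\<lambda>x. \<integral>\<^sup>+ j. f j x \<partial>count_space UNIV) \<in> borel_measurable M"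
proof -
  have "sigma_finite_measure (count_space (UNIV :: int set))"
    by (rule sigma_finite_measure_count_space)
  moreover have "(\<lambda>(x, j). f j x) \<in> borel_measurable (M \<Otimes>\<^sub>M count_space UNIV)"
    unfolding case_prod_beta
    by (rule measurable_compose_countable'[where f = "\<lambda>j p. f j (fst p)" and g = snd and I = UNIV])
      (use assms in auto)
  ultimately show ?thesis by (rule sigma_finite_measure.borel_measurable_nn_integral)
qed

lemma int_sum_swap:
  fixes f :: "int \<Rightarrow> int \<Rightarrow> ennreal"
  shows "(\<integral>\<^sup>+ k. \<integral>\<^sup>+ j. f k j \<partial>count_space UNIV \<partial>count_space UNIV) =
    (\<integral>\<^sup>+ j. \<integral>\<^sup>+ k. f k j \<partial>count_space UNIV \<partial>count_space UNIV)"
  by (rule nn_integral_count_space_nn_integral) auto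

text \<open>Jensen's inequality for the measure on the integers with density
  \<open>wgt \<delta> k\<close>, whose mass \<open>geom \<delta>\<close> is the same for every
  k.\<close>

lemma epowr_sum_wgt_le:
  assumes "0 < \<delta>" "1 \<le> Q"
  shows "epowr (\<integral>\<^sup>+ j. wgt \<delta> k j * f j \<partial>count_space UNIV) Q \<le>
    ennreal (geom \<delta> powr (Q - 1)) * (\<integral>\<^sup>+ j. wgt \<delta> k j * epowr (f j) Q \<partial>count_space UNIV)"
proof -
  let ?N = "density (count_space UNIV) (wgt \<delta> k)"
  have "emeasure ?N (space ?N) = (\<integral>\<^sup>+ j. 1 \<partial>?N)" by simp
  also have "\<dots> = ennreal (geom \<delta>)"
    by (subst nn_integral_density) (auto simp: sum_wgt assms)
  finally have "emeasure ?N (space ?N) \<le> ennreal (geom \<delta>)" by simp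
  from nn_integral_Jensen[OF assms(2) _ this, of f] show ?thesis
    using geom_pos[OF assms(1)]
    by (auto simp: nn_integral_density epowr_ennreal split: if_splits)
qed

context doubling_metric_measure_space
begin

text \<open>The summand \<open>f x\<close> makes sums without averaging (Hardy's inequality) a special case of
  the estimates for \<open>T\<close> below.\<close>

definition Aop :: "int \<Rightarrow> ('a \<Rightarrow> ennreal) \<Rightarrow> 'a \<Rightarrow> ennreal" where
  "Aop k f x = f x + Av k f x"

lemma Aop_measurable [measurable]:
  assumes [measurable]: "f \<in> borel_measurable \<mu>"
  shows "Aop k f \<in> borel_measurable \<mu>"
  unfolding Aop_def[abs_def] by measurable

lemma epowr_Aop_le:
  assumes "1 \<le> Q" and [measurable]: "f \<in> borel_measurable \<mu>"
  shows "epowr (Aop k f x) Q \<le> ennreal (2 powr Q) * Aop k (\<lambda>y. epowr (f y) Q) x"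
proof -
  have "epowr (Aop k f x) Q \<le> ennreal (2 powr Q) * (epowr (f x) Q + epowr (Av k f x) Q)"
    unfolding Aop_def using assms by (intro epowr_add_le) auto
  also have "epowr (Av k f x) Q \<le> Av k (\<lambda>y. epowr (f y) Q) x"
    unfolding Av_def using assms by (intro nn_avg_Jensen) auto
  finally show ?thesis unfolding Aop_def by (simp add: add_left_mono mult_left_mono)
qed

text \<open>The form in which the Sobolev-Poincare inequality delivers its bound: the function of
  scale j is averaged over balls of the coarser radius 2^-k, not over balls of its own
  scale.\<close>

definition T :: "real \<Rightarrow> (int \<Rightarrow> 'a \<Rightarrow> ennreal) \<Rightarrow> int \<Rightarrow> 'a \<Rightarrow> ennreal" where
  "T \<delta> h k x = (\<integral>\<^sup>+ j. wgt \<delta> k j * Aop k (h j) x \<partial>count_space UNIV)"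

lemma T_measurable [measurable]:
  assumes [measurable]: "\<And>j. h j \<in> borel_measurable \<mu>"
  shows "T \<delta> h k \<in> borel_measurable \<mu>"
  unfolding T_def[abs_def] by measurable

lemma epowr_T_le:
  assumes "0 < \<delta>" "1 \<le> Q" and [measurable]: "\<And>j. h j \<in> borel_measurable \<mu>"
  shows "epowr (T \<delta> h k x) Q \<le>
    ennreal (geom \<delta> powr (Q - 1) * 2 powr Q) * T \<delta> (\<lambda>j y. epowr (h j y) Q) k x"
proof -
  have "epowr (T \<delta> h k x) Q \<le>
      ennreal (geom \<delta> powr (Q - 1)) * (\<integral>\<^sup>+ j. wgt \<delta> k j * epowr (Aop k (h j) x) Q \<partial>count_space UNIV)"
    unfolding T_def by (rule epowr_sum_wgt_le[OF assms(1,2)])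
  also have "\<dots> \<le> ennreal (geom \<delta> powr (Q - 1)) *
      (\<integral>\<^sup>+ j. ennreal (2 powr Q) * (wgt \<delta> k j * Aop k (\<lambda>y. epowr (h j y) Q) x) \<partial>count_space UNIV)"
    using epowr_Aop_le[OF assms(2,3)]
    by (intro mult_left_mono nn_integral_mono) (auto simp: mult.left_commute intro!: mult_left_mono)
  also have "\<dots> = ennreal (geom \<delta> powr (Q - 1) * 2 powr Q) * T \<delta> (\<lambda>j y. epowr (h j y) Q) k x"
    by (simp add: nn_integral_cmult T_def ennreal_mult mult.assoc)
  finally show ?thesis .
qed

text \<open>On the dual side every average is below the maximal function of \<phi>, whatever k is.
  This independence of k is what makes the sum over k harmless later.\<close>

lemma Aop_dual:
  assumes [measurable]: "f \<in> borel_measurable \<mu>" "\<phi> \<in> borel_measurable \<mu>"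
  shows "(\<integral>\<^sup>+ x. Aop k f x * \<phi> x \<partial>\<mu>) \<le> ennreal Dbl * (\<integral>\<^sup>+ x. f x * (\<phi> x + Mx \<phi> x) \<partial>\<mu>)"
proof -
  have "(\<integral>\<^sup>+ x. Aop k f x * \<phi> x \<partial>\<mu>) = (\<integral>\<^sup>+ x. f x * \<phi> x \<partial>\<mu>) + (\<integral>\<^sup>+ x. Av k f x * \<phi> x \<partial>\<mu>)"
    by (simp add: Aop_def distrib_right nn_integral_add)
  also have "\<dots> \<le> ennreal Dbl * (\<integral>\<^sup>+ x. f x * \<phi> x \<partial>\<mu>) + ennreal Dbl * (\<integral>\<^sup>+ x. f x * Mx \<phi> x \<partial>\<mu>)"
  proof (rule add_mono)
    have "1 * (\<integral>\<^sup>+ x. f x * \<phi> x \<partial>\<mu>) \<le> ennreal Dbl * (\<integral>\<^sup>+ x. f x * \<phi> x \<partial>\<mu>)"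
      using Dbl_ge_1 by (intro mult_right_mono) (auto simp: ennreal_ge_1)
    then show "(\<integral>\<^sup>+ x. f x * \<phi> x \<partial>\<mu>) \<le> ennreal Dbl * (\<integral>\<^sup>+ x. f x * \<phi> x \<partial>\<mu>)" by simp
    have "(\<integral>\<^sup>+ x. f x * Av k \<phi> x \<partial>\<mu>) \<le> (\<integral>\<^sup>+ x. f x * Mx \<phi> x \<partial>\<mu>)"
      by (intro nn_integral_mono mult_left_mono Av_le_Mx) auto
    then show "(\<integral>\<^sup>+ x. Av k f x * \<phi> x \<partial>\<mu>) \<le> ennreal Dbl * (\<integral>\<^sup>+ x. f x * Mx \<phi> x \<partial>\<mu>)"
      using Av_symmetric[OF assms, of k] by (meson mult_left_mono order_trans zero_le)
  qed
  also have "\<dots> = ennreal Dbl * (\<integral>\<^sup>+ x. f x * (\<phi> x + Mx \<phi> x) \<partial>\<mu>)"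
    by (simp add: distrib_left nn_integral_add)
  finally show ?thesis .
qed

text \<open>After dualizing each average, k remains only in the weights, whose sum over k is
  \<open>geom \<delta>\<close>; the sum over j is left to f.\<close>

lemma T_dual:
  assumes \<delta>: "0 < \<delta>" and [measurable]: "\<And>j. f j \<in> borel_measurable \<mu>" "\<phi> \<in> borel_measurable \<mu>"
  shows "(\<integral>\<^sup>+ x. (\<integral>\<^sup>+ k. T \<delta> f k x \<partial>count_space UNIV) * \<phi> x \<partial>\<mu>) \<le>
    ennreal (geom \<delta> * Dbl) * (\<integral>\<^sup>+ x. (\<integral>\<^sup>+ j. f j x \<partial>count_space UNIV) * (\<phi> x + Mx \<phi> x) \<partial>\<mu>)"
proof -
  have "(\<integral>\<^sup>+ x. (\<integral>\<^sup>+ k. T \<delta> f k x \<partial>count_space UNIV) * \<phi> x \<partial>\<mu>)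
      = (\<integral>\<^sup>+ x. \<integral>\<^sup>+ k. \<integral>\<^sup>+ j. wgt \<delta> k j * (Aop k (f j) x * \<phi> x) \<partial>count_space UNIV \<partial>count_space UNIV \<partial>\<mu>)"
  proof (intro nn_integral_cong)
    fix x
    have "T \<delta> f k x * \<phi> x = (\<integral>\<^sup>+ j. wgt \<delta> k j * (Aop k (f j) x * \<phi> x) \<partial>count_space UNIV)" for k
      unfolding T_def by (subst nn_integral_multc[symmetric]) (auto simp: mult.assoc)
    then show "(\<integral>\<^sup>+ k. T \<delta> f k x \<partial>count_space UNIV) * \<phi> x =
      (\<integral>\<^sup>+ k. \<integral>\<^sup>+ j. wgt \<delta> k j * (Aop k (f j) x * \<phi> x) \<partial>count_space UNIV \<partial>count_space UNIV)"
      by (subst nn_integral_multc[symmetric]) auto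
  qed
  also have "\<dots> = (\<integral>\<^sup>+ k. \<integral>\<^sup>+ x. \<integral>\<^sup>+ j. wgt \<delta> k j * (Aop k (f j) x * \<phi> x) \<partial>count_space UNIV \<partial>\<mu> \<partial>count_space UNIV)"
    by (rule nn_integral_count_space_nn_integral) (auto intro!: measurable_int_sum)
  also have "\<dots> = (\<integral>\<^sup>+ k. \<integral>\<^sup>+ j. wgt \<delta> k j * (\<integral>\<^sup>+ x. Aop k (f j) x * \<phi> x \<partial>\<mu>) \<partial>count_space UNIV \<partial>count_space UNIV)"
    by (intro nn_integral_cong, subst nn_integral_count_space_nn_integral) (auto simp: nn_integral_cmult)
  also have "\<dots> \<le> (\<integral>\<^sup>+ k. \<integral>\<^sup>+ j. wgt \<delta> k j * (ennreal Dbl * (\<integral>\<^sup>+ x. f j x * (\<phi> x + Mx \<phi> x) \<partial>\<mu>)) \<partial>count_space UNIV \<partial>count_space UNIV)"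
    by (intro nn_integral_mono mult_left_mono Aop_dual) auto
  also have "\<dots> = (\<integral>\<^sup>+ j. \<integral>\<^sup>+ k. wgt \<delta> k j * (ennreal Dbl * (\<integral>\<^sup>+ x. f j x * (\<phi> x + Mx \<phi> x) \<partial>\<mu>)) \<partial>count_space UNIV \<partial>count_space UNIV)"
    by (rule int_sum_swap)
  also have "\<dots> = (\<integral>\<^sup>+ j. ennreal (geom \<delta> * Dbl) * (\<integral>\<^sup>+ x. f j x * (\<phi> x + Mx \<phi> x) \<partial>\<mu>) \<partial>count_space UNIV)"
    using geom_pos[OF \<delta>] Dbl_pos
    by (intro nn_integral_cong) (simp add: nn_integral_multc sum_wgt[OF \<delta>] ennreal_mult mult.assoc)
  also have "\<dots> = ennreal (geom \<delta> * Dbl) * (\<integral>\<^sup>+ x. \<integral>\<^sup>+ j. f j x * (\<phi> x + Mx \<phi> x) \<partial>count_space UNIV \<partial>\<mu>)"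
    by (subst nn_integral_count_space_nn_integral) (auto simp: nn_integral_cmult)
  also have "\<dots> = ennreal (geom \<delta> * Dbl) * (\<integral>\<^sup>+ x. (\<integral>\<^sup>+ j. f j x \<partial>count_space UNIV) * (\<phi> x + Mx \<phi> x) \<partial>\<mu>)"
    by (simp add: nn_integral_multc)
  finally show ?thesis .
qed

lemma add_Mx_strong_type:
  assumes a: "1 < a"
  shows "\<exists>C>0. \<forall>f\<in>borel_measurable \<mu>.
    (\<integral>\<^sup>+ x. epowr (f x + Mx f x) a \<partial>\<mu>) \<le> ennreal C * (\<integral>\<^sup>+ x. epowr (f x) a \<partial>\<mu>)"
proof -
  obtain C where C: "0 < C" "\<And>f. f \<in> borel_measurable \<mu> \<Longrightarrow>
      (\<integral>\<^sup>+ x. epowr (Mx f x) a \<partial>\<mu>) \<le> ennreal C * (\<integral>\<^sup>+ x. epowr (f x) a \<partial>\<mu>)"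
    using maximal_theorem[OF a] by auto
  show ?thesis
  proof (intro exI[of _ "2 powr a * (1 + C)"] conjI ballI)
    show "0 < 2 powr a * (1 + C)" using C by simp
    fix f :: "'a \<Rightarrow> ennreal" assume [measurable]: "f \<in> borel_measurable \<mu>"
    have "(\<integral>\<^sup>+ x. epowr (f x + Mx f x) a \<partial>\<mu>) \<le>
        (\<integral>\<^sup>+ x. ennreal (2 powr a) * (epowr (f x) a + epowr (Mx f x) a) \<partial>\<mu>)"
      using a by (intro nn_integral_mono epowr_add_le) auto
    also have "\<dots> = ennreal (2 powr a) * ((\<integral>\<^sup>+ x. epowr (f x) a \<partial>\<mu>) + (\<integral>\<^sup>+ x. epowr (Mx f x) a \<partial>\<mu>))"
      by (simp add: nn_integral_cmult nn_integral_add)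
    also have "\<dots> \<le> ennreal (2 powr a) * ((\<integral>\<^sup>+ x. epowr (f x) a \<partial>\<mu>) + ennreal C * (\<integral>\<^sup>+ x. epowr (f x) a \<partial>\<mu>))"
      by (intro mult_left_mono add_left_mono C) auto
    also have "\<dots> = ennreal (2 powr a) * (ennreal (1 + C) * (\<integral>\<^sup>+ x. epowr (f x) a \<partial>\<mu>))"
      using C by (simp add: distrib_right)
    also have "\<dots> = ennreal (2 powr a * (1 + C)) * (\<integral>\<^sup>+ x. epowr (f x) a \<partial>\<mu>)"
      using C by (simp add: ennreal_mult mult.assoc del: ennreal_plus)
    finally show "(\<integral>\<^sup>+ x. epowr (f x + Mx f x) a \<partial>\<mu>) \<le> \<dots>" .
  qed
qed

lemma Mx_one: "Mx (\<lambda>_. 1) x = 1"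
  unfolding Mx_def by (simp add: Av_const)

text \<open>Exponent 1 is duality against the constant 1, which equals its own maximal function, so
  the maximal theorem, false for this exponent, does not enter.\<close>

lemma T_sum_strong_type_1:
  assumes \<delta>: "0 < \<delta>" and [measurable]: "\<And>j. f j \<in> borel_measurable \<mu>"
  shows "(\<integral>\<^sup>+ x. (\<integral>\<^sup>+ k. T \<delta> f k x \<partial>count_space UNIV) \<partial>\<mu>) \<le>
    ennreal (2 * (geom \<delta> * Dbl)) * (\<integral>\<^sup>+ x. (\<integral>\<^sup>+ j. f j x \<partial>count_space UNIV) \<partial>\<mu>)"
proof -
  have "(\<integral>\<^sup>+ x. (\<integral>\<^sup>+ k. T \<delta> f k x \<partial>count_space UNIV) \<partial>\<mu>) \<le>
      ennreal (geom \<delta> * Dbl) * (\<integral>\<^sup>+ x. (\<integral>\<^sup>+ j. f j x \<partial>count_space UNIV) * (1 + Mx (\<lambda>_. 1) x) \<partial>\<mu>)"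
    using T_dual[OF \<delta>, of f "\<lambda>_. 1"] by simp
  also have "\<dots> = ennreal (geom \<delta> * Dbl) * (ennreal 2 * (\<integral>\<^sup>+ x. (\<integral>\<^sup>+ j. f j x \<partial>count_space UNIV) \<partial>\<mu>))"
    by (simp add: Mx_one nn_integral_cmult mult.commute[of _ 2])
  also have "\<dots> = ennreal (2 * (geom \<delta> * Dbl)) * (\<integral>\<^sup>+ x. (\<integral>\<^sup>+ j. f j x \<partial>count_space UNIV) \<partial>\<mu>)"
    using geom_pos[OF \<delta>] Dbl_pos by (subst ennreal_mult) (auto simp: ac_simps)
  finally show ?thesis .
qed

text \<open>Duality against a power of a truncation of the left-hand side; the truncation makes the
  quantity that is to be absorbed finite.\<close>

lemma T_sum_strong_type:
  assumes \<delta>: "0 < \<delta>" and a: "1 < a"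
  shows "\<exists>C>0. \<forall>f. (\<forall>j. f j \<in> borel_measurable \<mu>) \<longrightarrow>
    (\<integral>\<^sup>+ x. epowr (\<integral>\<^sup>+ k. T \<delta> f k x \<partial>count_space UNIV) a \<partial>\<mu>) \<le>
    ennreal C * (\<integral>\<^sup>+ x. epowr (\<integral>\<^sup>+ j. f j x \<partial>count_space UNIV) a \<partial>\<mu>)"
proof -
  \<comment> \<open>The conjugate exponent. Because of (a - 1) b = a, the b-th power of the test
    function \<phi> is the a-th power of the truncation.\<close>
  define b where "b = a / (a - 1)"
  have b: "1 < b" "1 / a + 1 / b = 1" "(a - 1) * b = a" using a by (auto simp: b_def field_simps)
  obtain C where C: "0 < C" "\<And>f. f \<in> borel_measurable \<mu> \<Longrightarrow>
      (\<integral>\<^sup>+ x. epowr (f x + Mx f x) b \<partial>\<mu>) \<le> ennreal C * (\<integral>\<^sup>+ x. epowr (f x) b \<partial>\<mu>)"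
    using add_Mx_strong_type[OF b(1)] by auto
  define K where "K = geom \<delta> * Dbl * C powr (1 / b)"
  have K: "0 < K" using geom_pos[OF \<delta>] Dbl_pos C by (simp add: K_def)
  show ?thesis
  proof (intro exI[of _ "K powr a"] conjI allI impI)
    show "0 < K powr a" using K by simp
    fix f :: "int \<Rightarrow> 'a \<Rightarrow> ennreal" assume "\<forall>j. f j \<in> borel_measurable \<mu>"
    then have [measurable]: "\<And>j. f j \<in> borel_measurable \<mu>" by simp
    define S where "S x = (\<integral>\<^sup>+ k. T \<delta> f k x \<partial>count_space UNIV)" for x
    define F where "F x = (\<integral>\<^sup>+ j. f j x \<partial>count_space UNIV)" for x
    have [measurable]: "S \<in> borel_measurable \<mu>" "F \<in> borel_measurable \<mu>"
      unfolding S_def F_def by measurable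
    define X where "X = (\<integral>\<^sup>+ x. epowr (F x) a \<partial>\<mu>)"
    define SN where "SN N x = min (S x) (of_nat N) * indicator (ball undefined (real N)) x" for N :: nat and x
    have [measurable]: "SN N \<in> borel_measurable \<mu>" for N unfolding SN_def by measurable
    have bound: "(\<integral>\<^sup>+ x. epowr (SN N x) a \<partial>\<mu>) \<le> ennreal (K powr a) * X" for N
    proof -
      define I where "I = (\<integral>\<^sup>+ x. epowr (SN N x) a \<partial>\<mu>)"
      have "I \<le> (\<integral>\<^sup>+ x. epowr (of_nat N) a * indicator (ball undefined (real N)) x \<partial>\<mu>)"
        unfolding I_def SN_def using a
        by (intro nn_integral_mono) (auto split: split_indicator intro!: epowr_mono)
      also have "\<dots> = epowr (of_nat N) a * V undefined (real N)"
        by (simp add: nn_integral_cmult_indicator)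
      also have "\<dots> < top" by (intro ennreal_mult_less_top[THEN iffD2]) (auto simp: less_top[symmetric])
      finally have fin: "I < top" .
      define \<phi> where "\<phi> x = epowr (SN N x) (a - 1)" for x
      have [measurable]: "\<phi> \<in> borel_measurable \<mu>" unfolding \<phi>_def by measurable
      have "I = (\<integral>\<^sup>+ x. SN N x * \<phi> x \<partial>\<mu>)"
        unfolding I_def
      proof (intro nn_integral_cong)
        fix x
        have "epowr (SN N x) a = epowr (SN N x) (1 + (a - 1))" by simp
        also have "\<dots> = SN N x * \<phi> x" unfolding \<phi>_def using a by (subst epowr_add) auto
        finally show "epowr (SN N x) a = SN N x * \<phi> x" .
      qed
      also have "\<dots> \<le> (\<integral>\<^sup>+ x. S x * \<phi> x \<partial>\<mu>)"
        by (intro nn_integral_mono mult_right_mono) (auto simp: SN_def split: split_indicator)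
      also have "\<dots> \<le> ennreal (geom \<delta> * Dbl) * (\<integral>\<^sup>+ x. F x * (\<phi> x + Mx \<phi> x) \<partial>\<mu>)"
        unfolding S_def F_def by (rule T_dual[OF \<delta>]) measurable
      also have "\<dots> \<le> ennreal (geom \<delta> * Dbl) *
          (epowr X (1 / a) * epowr (\<integral>\<^sup>+ x. epowr (\<phi> x + Mx \<phi> x) b \<partial>\<mu>) (1 / b))"
        unfolding X_def by (intro mult_left_mono nn_integral_Holder[OF a b(2)]) auto
      also have "\<dots> \<le> ennreal (geom \<delta> * Dbl) * (epowr X (1 / a) * epowr (ennreal C * I) (1 / b))"
      proof -
        have "(\<integral>\<^sup>+ x. epowr (\<phi> x) b \<partial>\<mu>) = I"
          unfolding I_def \<phi>_def using b by (simp add: epowr_epowr)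
        then show ?thesis using C(2)[of \<phi>] b by (intro mult_left_mono epowr_mono) auto
      qed
      also have "\<dots> = ennreal K * epowr X (1 / a) * epowr I (1 / b)"
        using geom_pos[OF \<delta>] Dbl_pos C
        by (simp add: epowr_mult epowr_ennreal K_def ennreal_mult ac_simps)
      finally have le: "I \<le> ennreal K * epowr X (1 / a) * epowr I (1 / b)" .
      \<comment> \<open>Division by the power 1/b of I, which is legitimate as the truncation has
        made I finite and the case I = 0 is trivial.\<close>
      have "epowr I (1 / a) \<le> ennreal K * epowr X (1 / a)"
      proof (cases "I = 0")
        case False
        have "epowr I (1 / a) * epowr I (1 / b) = epowr I 1"
          using a b by (subst epowr_add[symmetric]) auto
        then have "epowr I (1 / b) * epowr I (1 / a) \<le> epowr I (1 / b) * (ennreal K * epowr X (1 / a))"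
          using le by (simp add: ac_simps)
        then show ?thesis using False fin
          by (subst (asm) ennreal_mult_le_mult_iff) auto
      qed simp
      then have "I \<le> epowr (ennreal K * epowr X (1 / a)) a"
        using a by (simp add: epowr_le_swap)
      also have "\<dots> = ennreal (K powr a) * X"
        using a K by (simp add: epowr_mult epowr_ennreal epowr_epowr)
      finally show ?thesis by (simp add: I_def)
    qed
    have "(\<integral>\<^sup>+ x. epowr (S x) a \<partial>\<mu>) = (\<integral>\<^sup>+ x. (SUP N. epowr (SN N x) a) \<partial>\<mu>)"
    proof (intro nn_integral_cong)
      fix x
      have "(SUP N. SN N x) = S x"
      proof (rule antisym)
        show "(SUP N. SN N x) \<le> S x" by (intro SUP_least) (auto simp: SN_def split: split_indicator)
        obtain N0 :: nat where N0: "dist undefined x < real N0" using reals_Archimedean2 by blast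
        have "min (S x) (of_nat N) \<le> (SUP N. SN N x)" for N :: nat
        proof -
          have "min (S x) (of_nat N) \<le> SN (max N N0) x"
            using N0 by (auto simp: SN_def min_le_iff_disj intro: of_nat_mono)
          also have "\<dots> \<le> (SUP N. SN N x)" by (rule SUP_upper) simp
          finally show ?thesis .
        qed
        then have "(SUP N. min (S x) (of_nat N)) \<le> (SUP N. SN N x)" by (rule SUP_least)
        moreover have "(SUP N. min (S x) (of_nat N)) = S x"
          by (simp add: inf_min[symmetric] inf_SUP[symmetric] ennreal_SUP_of_nat_eq_top)
        ultimately show "S x \<le> (SUP N. SN N x)" by simp
      qed
      then show "epowr (S x) a = (SUP N. epowr (SN N x) a)"
        using a by (simp add: epowr_SUP[symmetric])
    qed
    also have "\<dots> = (SUP N. \<integral>\<^sup>+ x. epowr (SN N x) a \<partial>\<mu>)"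
    proof (rule nn_integral_monotone_convergence_SUP)
      show "incseq (\<lambda>N x. epowr (SN N x) a)"
      proof (intro incseq_SucI le_funI epowr_mono)
        fix N x
        show "SN N x \<le> SN (Suc N) x"
          unfolding SN_def by (auto split: split_indicator simp: min_le_iff_disj intro: of_nat_mono)
      qed (use a in auto)
    qed measurable
    also have "\<dots> \<le> ennreal (K powr a) * X" by (rule SUP_least) (rule bound)
    finally show "(\<integral>\<^sup>+ x. epowr (\<integral>\<^sup>+ k. T \<delta> f k x \<partial>count_space UNIV) a \<partial>\<mu>) \<le>
        ennreal (K powr a) * (\<integral>\<^sup>+ x. epowr (\<integral>\<^sup>+ j. f j x \<partial>count_space UNIV) a \<partial>\<mu>)"
      by (simp add: S_def F_def X_def)
  qed
qed

section \<open>Mixed norms with finite exponents\<close>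

lemma Av_Holder:
  assumes Q: "1 < Q" and [measurable]: "v \<in> borel_measurable \<mu>" "G \<in> borel_measurable \<mu>"
  shows "Av k (\<lambda>y. epowr (v y) (1 / Q) * epowr (G y) ((Q - 1) / Q)) x \<le>
    epowr (Av k v x) (1 / Q) * epowr (Av k G x) ((Q - 1) / Q)"
proof -
  let ?N = "density \<mu> (\<lambda>y. indicator (ball x (rad k)) y / V x (rad k))"
  have eq: "Av k g x = (\<integral>\<^sup>+ y. g y \<partial>?N)" if [measurable]: "g \<in> borel_measurable \<mu>" for g
  proof -
    have "(\<integral>\<^sup>+ y. g y \<partial>?N) = (\<integral>\<^sup>+ y. g y * indicator (ball x (rad k)) y * inverse (V x (rad k)) \<partial>\<mu>)"
      by (subst nn_integral_density) (auto simp: divide_ennreal_def ac_simps)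
    then show ?thesis by (simp add: Av_def nn_avg_def nn_integral_multc divide_ennreal_def)
  qed
  have "(\<integral>\<^sup>+ y. epowr (v y) (1 / Q) * epowr (G y) ((Q - 1) / Q) \<partial>?N) \<le>
    epowr (\<integral>\<^sup>+ y. epowr (epowr (v y) (1 / Q)) Q \<partial>?N) (1 / Q) *
    epowr (\<integral>\<^sup>+ y. epowr (epowr (G y) ((Q - 1) / Q)) (Q / (Q - 1)) \<partial>?N) (1 / (Q / (Q - 1)))"
    using Q by (intro nn_integral_Holder) (auto simp: field_simps)
  then show ?thesis using Q by (simp add: eq epowr_epowr)
qed

text \<open>Jensen's inequality moves the power Q inside \<open>T\<close>; what remains is a scalar
  estimate for the sum over all scales with exponent P/Q >= 1.\<close>

lemma vector_maximal_ge:
  assumes \<delta>: "0 < \<delta>" and PQ: "1 < Q" "Q \<le> P"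
  shows "\<exists>C>0. \<forall>h. (\<forall>j. h j \<in> borel_measurable \<mu>) \<longrightarrow>
    (\<integral>\<^sup>+ x. epowr (\<integral>\<^sup>+ k. epowr (T \<delta> h k x) Q \<partial>count_space UNIV) (P / Q) \<partial>\<mu>) \<le>
    ennreal C * (\<integral>\<^sup>+ x. epowr (\<integral>\<^sup>+ j. epowr (h j x) Q \<partial>count_space UNIV) (P / Q) \<partial>\<mu>)"
proof -
  have *: "\<exists>C>0. \<forall>f. (\<forall>j. f j \<in> borel_measurable \<mu>) \<longrightarrow>
    (\<integral>\<^sup>+ x. epowr (\<integral>\<^sup>+ k. T \<delta> f k x \<partial>count_space UNIV) (P / Q) \<partial>\<mu>) \<le>
    ennreal C * (\<integral>\<^sup>+ x. epowr (\<integral>\<^sup>+ j. f j x \<partial>count_space UNIV) (P / Q) \<partial>\<mu>)"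
  proof (cases "P = Q")
    case True
    then show ?thesis using PQ T_sum_strong_type_1[OF \<delta>] geom_pos[OF \<delta>] Dbl_pos
      by (intro exI[of _ "2 * (geom \<delta> * Dbl)"]) auto
  next
    case False
    then show ?thesis using PQ by (intro T_sum_strong_type \<delta>) auto
  qed
  then obtain C where C: "0 < C" "\<And>f. (\<And>j. f j \<in> borel_measurable \<mu>) \<Longrightarrow>
    (\<integral>\<^sup>+ x. epowr (\<integral>\<^sup>+ k. T \<delta> f k x \<partial>count_space UNIV) (P / Q) \<partial>\<mu>) \<le>
    ennreal C * (\<integral>\<^sup>+ x. epowr (\<integral>\<^sup>+ j. f j x \<partial>count_space UNIV) (P / Q) \<partial>\<mu>)" by blast
  define J where "J = geom \<delta> powr (Q - 1) * 2 powr Q"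
  have J: "0 < J" using geom_pos[OF \<delta>] by (simp add: J_def)
  show ?thesis
  proof (intro exI[of _ "J powr (P / Q) * C"] conjI allI impI)
    show "0 < J powr (P / Q) * C" using J C by simp
    fix h :: "int \<Rightarrow> 'a \<Rightarrow> ennreal" assume "\<forall>j. h j \<in> borel_measurable \<mu>"
    then have [measurable]: "\<And>j. h j \<in> borel_measurable \<mu>" by simp
    let ?f = "\<lambda>j y. epowr (h j y) Q"
    have "(\<integral>\<^sup>+ x. epowr (\<integral>\<^sup>+ k. epowr (T \<delta> h k x) Q \<partial>count_space UNIV) (P / Q) \<partial>\<mu>) \<le>
      (\<integral>\<^sup>+ x. epowr (\<integral>\<^sup>+ k. ennreal J * T \<delta> ?f k x \<partial>count_space UNIV) (P / Q) \<partial>\<mu>)"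
      unfolding J_def using PQ by (intro nn_integral_mono epowr_mono epowr_T_le \<delta>) auto
    also have "\<dots> = (\<integral>\<^sup>+ x. ennreal (J powr (P / Q)) * epowr (\<integral>\<^sup>+ k. T \<delta> ?f k x \<partial>count_space UNIV) (P / Q) \<partial>\<mu>)"
      using J by (simp add: nn_integral_cmult epowr_mult epowr_ennreal)
    also have "\<dots> = ennreal (J powr (P / Q)) * (\<integral>\<^sup>+ x. epowr (\<integral>\<^sup>+ k. T \<delta> ?f k x \<partial>count_space UNIV) (P / Q) \<partial>\<mu>)"
      by (rule nn_integral_cmult) measurable
    also have "\<dots> \<le> ennreal (J powr (P / Q)) * (ennreal C * (\<integral>\<^sup>+ x. epowr (\<integral>\<^sup>+ j. ?f j x \<partial>count_space UNIV) (P / Q) \<partial>\<mu>))"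
      by (intro mult_left_mono C) auto
    finally show "(\<integral>\<^sup>+ x. epowr (\<integral>\<^sup>+ k. epowr (T \<delta> h k x) Q \<partial>count_space UNIV) (P / Q) \<partial>\<mu>) \<le>
      ennreal (J powr (P / Q) * C) * (\<integral>\<^sup>+ x. epowr (\<integral>\<^sup>+ j. epowr (h j x) Q \<partial>count_space UNIV) (P / Q) \<partial>\<mu>)"
      using C by (simp add: ennreal_mult mult.assoc)
  qed
qed

text \<open>For \<open>P < Q\<close>, Hoelder's inequality against the weight \<open>F\<^sup>Q\<^sup>-\<^sup>P\<close>, where \<open>F\<close> is the
  \<open>\<ell>\<^sup>Q\<close>-norm of \<open>h\<close>, reduces the claim to the scalar maximal theorem.\<close>

lemma vector_maximal_less:
  assumes \<delta>: "0 < \<delta>" and PQ: "1 < P" "P < Q"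
  shows "\<exists>C>0. \<forall>h. (\<forall>j. h j \<in> borel_measurable \<mu>) \<longrightarrow>
    (\<integral>\<^sup>+ x. epowr (\<integral>\<^sup>+ k. epowr (T \<delta> h k x) Q \<partial>count_space UNIV) (P / Q) \<partial>\<mu>) \<le>
    ennreal C * (\<integral>\<^sup>+ x. epowr (\<integral>\<^sup>+ j. epowr (h j x) Q \<partial>count_space UNIV) (P / Q) \<partial>\<mu>)"
proof -
  \<comment> \<open>The exponent of the scalar maximal theorem that Hoelder's inequality with Q/P
    and Q/(Q-P) will produce for \<open>G\<close>. It exceeds 1 exactly because P > 1, and it turns
    G^\<kappa> into F^P.\<close>
  define \<kappa> where "\<kappa> = (Q - 1) * (P / (Q - P))"
  have "0 < Q * (P - 1)" using PQ by simp
  then have "Q - P < (Q - 1) * P" by (simp add: algebra_simps)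
  then have \<kappa>1: "1 < \<kappa>" using PQ by (simp add: \<kappa>_def field_simps)
  have "(Q - P) / (Q - 1) * \<kappa> = P" using PQ by (simp add: \<kappa>_def)
  note \<kappa> = \<kappa>1 this
  obtain C2 where C2: "0 < C2" "\<And>f. f \<in> borel_measurable \<mu> \<Longrightarrow>
      (\<integral>\<^sup>+ x. epowr (f x + Mx f x) \<kappa> \<partial>\<mu>) \<le> ennreal C2 * (\<integral>\<^sup>+ x. epowr (f x) \<kappa> \<partial>\<mu>)"
    using add_Mx_strong_type[OF \<kappa>(1)] by auto
  define C1' where "C1' = 2 * (geom \<delta> * Dbl)"
  have C1': "0 < C1'" using geom_pos[OF \<delta>] Dbl_pos by (simp add: C1'_def)
  define K where "K = geom \<delta> powr (Q - 1) * 2 powr Q"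
  have K: "0 < K" using geom_pos[OF \<delta>] by (simp add: K_def)
  define C where "C = K powr (P / Q) * (C1' powr (P / Q) * C2 powr ((Q - P) / Q))"
  have C: "0 < C" using K C1' C2 by (simp add: C_def)
  show ?thesis
  proof (intro exI[of _ C] conjI allI impI C)
    fix h :: "int \<Rightarrow> 'a \<Rightarrow> ennreal" assume "\<forall>j. h j \<in> borel_measurable \<mu>"
    then have [measurable]: "\<And>j. h j \<in> borel_measurable \<mu>" by simp
    define F where "F x = epowr (\<integral>\<^sup>+ j. epowr (h j x) Q \<partial>count_space UNIV) (1 / Q)" for x
    \<comment> \<open>Chosen so that h = v^(1/Q) * G^((Q-1)/Q) wherever F is finite, while the sum
      of v over j is at most F^P: the summation over scales falls on v alone, and G does not depend
      on j.\<close>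
    define v where "v j x = epowr (h j x) Q / epowr (F x) (Q - P)" for j x
    define G where "G x = epowr (F x) ((Q - P) / (Q - 1))" for x
    have [measurable]: "F \<in> borel_measurable \<mu>" unfolding F_def[abs_def] by measurable
    have [measurable]: "G \<in> borel_measurable \<mu>" "\<And>j. v j \<in> borel_measurable \<mu>"
      unfolding G_def[abs_def] v_def[abs_def] by measurable
    define X where "X = (\<integral>\<^sup>+ x. epowr (F x) P \<partial>\<mu>)"
    have FQ: "epowr (F x) Q = (\<integral>\<^sup>+ j. epowr (h j x) Q \<partial>count_space UNIV)" for x
      using PQ by (simp add: F_def epowr_epowr)
    have X_eq: "X = (\<integral>\<^sup>+ x. epowr (\<integral>\<^sup>+ j. epowr (h j x) Q \<partial>count_space UNIV) (P / Q) \<partial>\<mu>)"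
      by (simp add: X_def F_def epowr_epowr)
    \<comment> \<open>For X infinite the claim is trivial. For X finite, F is finite almost
      everywhere, which the factorization of h requires.\<close>
    have main: "(\<integral>\<^sup>+ x. epowr (\<integral>\<^sup>+ k. epowr (T \<delta> h k x) Q \<partial>count_space UNIV) (P / Q) \<partial>\<mu>) \<le> ennreal C * X"
      if "X < top"
    proof -
      have "AE x in \<mu>. epowr (F x) P \<noteq> top"
        using nn_integral_PInf_AE[of "\<lambda>x. epowr (F x) P" \<mu>] that by (simp add: X_def infinity_ennreal_def)
      then have Ffin: "AE x in \<mu>. F x < top" by (simp add: less_top)
      have h_eq: "h j x = epowr (v j x) (1 / Q) * epowr (G x) ((Q - 1) / Q)" if "F x < top" for j x
      proof (cases "F x = 0")
        case True
        have "epowr (h j x) Q \<le> epowr (F x) Q"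
          unfolding FQ by (rule nn_integral_ge_point) simp
        then show ?thesis using True by (simp add: G_def)
      next
        case False
        have "v j x * epowr (F x) (Q - P) = epowr (h j x) Q"
          unfolding v_def using False that by (intro ennreal_divide_mult_cancel) (auto simp: zero_less_iff_neq_zero)
        then have "epowr (v j x * epowr (F x) (Q - P)) (1 / Q) = h j x"
          using PQ by (simp add: epowr_epowr)
        then show ?thesis using PQ by (simp add: epowr_mult epowr_epowr G_def)
      qed
      define \<Psi> where "\<Psi> x = (\<integral>\<^sup>+ k. T \<delta> v k x \<partial>count_space UNIV)" for x
      define \<Phi> where "\<Phi> x = epowr (G x + Mx G x) (Q - 1)" for x
      have [measurable]: "\<Psi> \<in> borel_measurable \<mu>" "\<Phi> \<in> borel_measurable \<mu>"
        unfolding \<Psi>_def[abs_def] \<Phi>_def[abs_def] by measurable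
      have step: "(\<integral>\<^sup>+ k. epowr (T \<delta> h k x) Q \<partial>count_space UNIV) \<le> ennreal K * (\<Phi> x * \<Psi> x)"
        if x: "F x < top" for x
      proof -
        have A1: "epowr (Aop k (h j) x) Q \<le> ennreal (2 powr Q) * \<Phi> x * Aop k (v j) x" for k j
        proof -
          let ?R = "epowr (Aop k (v j) x) (1 / Q) * epowr (G x + Mx G x) ((Q - 1) / Q)"
          have "h j x \<le> ?R"
            unfolding h_eq[OF x] using PQ
            by (intro mult_mono epowr_mono) (auto simp: Aop_def)
          moreover have "Av k (h j) x \<le> ?R"
          proof -
            have "Av k (h j) x \<le> Av k (\<lambda>y. epowr (v j y) (1 / Q) * epowr (G y) ((Q - 1) / Q)) x"
              unfolding Av_def using Ffin by (intro nn_avg_mono_AE) (auto simp: h_eq)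
            also have "\<dots> \<le> epowr (Av k (v j) x) (1 / Q) * epowr (Av k G x) ((Q - 1) / Q)"
              using PQ by (intro Av_Holder) auto
            also have "\<dots> \<le> ?R"
              using PQ by (intro mult_mono epowr_mono) (auto simp: Aop_def intro: add_increasing Av_le_Mx)
            finally show ?thesis .
          qed
          ultimately have "Aop k (h j) x \<le> 2 * ?R"
            unfolding Aop_def[of k "h j"] by (metis add_mono mult_2)
          then have "epowr (Aop k (h j) x) Q \<le> epowr (2 * ?R) Q" using PQ by (intro epowr_mono) auto
          also have "epowr (2 * ?R) Q = ennreal (2 powr Q) * \<Phi> x * Aop k (v j) x"
            using PQ epowr_ennreal[of 2 Q] by (simp add: epowr_mult epowr_epowr \<Phi>_def ac_simps)
          finally show ?thesis .
        qed
        have "epowr (T \<delta> h k x) Q \<le> ennreal K * \<Phi> x * T \<delta> v k x" for k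
        proof -
          have "epowr (T \<delta> h k x) Q \<le> ennreal (geom \<delta> powr (Q - 1)) *
              (\<integral>\<^sup>+ j. wgt \<delta> k j * epowr (Aop k (h j) x) Q \<partial>count_space UNIV)"
            unfolding T_def using PQ by (intro epowr_sum_wgt_le \<delta>) auto
          also have "\<dots> \<le> ennreal (geom \<delta> powr (Q - 1)) *
              (\<integral>\<^sup>+ j. (ennreal (2 powr Q) * \<Phi> x) * (wgt \<delta> k j * Aop k (v j) x) \<partial>count_space UNIV)"
            using A1 by (intro mult_left_mono nn_integral_mono)
              (auto simp: mult.left_commute[of "_ * \<Phi> x"] intro!: mult_left_mono)
          also have "\<dots> = ennreal K * \<Phi> x * T \<delta> v k x"
            by (subst nn_integral_cmult) (auto simp: T_def K_def ennreal_mult mult.assoc)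
          finally show ?thesis .
        qed
        then have "(\<integral>\<^sup>+ k. epowr (T \<delta> h k x) Q \<partial>count_space UNIV) \<le>
            (\<integral>\<^sup>+ k. ennreal K * \<Phi> x * T \<delta> v k x \<partial>count_space UNIV)"
          by (intro nn_integral_mono) auto
        also have "\<dots> = ennreal K * (\<Phi> x * \<Psi> x)"
          by (simp add: nn_integral_cmult \<Psi>_def mult.assoc)
        finally show ?thesis .
      qed
      \<comment> \<open>Only an inequality, since the quotients 0/0 and top/top are 0.\<close>
      have v_sum: "(\<integral>\<^sup>+ j. v j x \<partial>count_space UNIV) \<le> epowr (F x) P" for x
      proof -
        have "(\<integral>\<^sup>+ j. v j x \<partial>count_space UNIV) = epowr (F x) Q / epowr (F x) (Q - P)"
          unfolding v_def divide_ennreal_def FQ by (simp add: nn_integral_multc)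
        also have "epowr (F x) Q = epowr (F x) P * epowr (F x) (Q - P)"
          using PQ by (subst epowr_add[symmetric]) auto
        also have "epowr (F x) P * epowr (F x) (Q - P) / epowr (F x) (Q - P) \<le> epowr (F x) P"
        proof (cases "F x = 0 \<or> F x = top")
          case False
          then show ?thesis
            by (subst ennreal_divide_le_iff) (auto simp: zero_less_iff_neq_zero less_top)
        qed auto
        finally show ?thesis .
      qed
      have \<Psi>_int: "(\<integral>\<^sup>+ x. \<Psi> x \<partial>\<mu>) \<le> ennreal C1' * X"
      proof -
        have "(\<integral>\<^sup>+ x. \<Psi> x \<partial>\<mu>) \<le> ennreal C1' * (\<integral>\<^sup>+ x. (\<integral>\<^sup>+ j. v j x \<partial>count_space UNIV) \<partial>\<mu>)"
          unfolding \<Psi>_def C1'_def by (rule T_sum_strong_type_1[OF \<delta>]) measurable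
        also have "\<dots> \<le> ennreal C1' * X"
          unfolding X_def by (intro mult_left_mono nn_integral_mono v_sum) simp
        finally show ?thesis .
      qed
      have \<Phi>_int: "(\<integral>\<^sup>+ x. epowr (epowr (\<Phi> x) (P / Q)) (Q / (Q - P)) \<partial>\<mu>) \<le> ennreal C2 * X"
      proof -
        have "(\<integral>\<^sup>+ x. epowr (epowr (\<Phi> x) (P / Q)) (Q / (Q - P)) \<partial>\<mu>) = (\<integral>\<^sup>+ x. epowr (G x + Mx G x) \<kappa> \<partial>\<mu>)"
          using PQ by (simp add: \<Phi>_def epowr_epowr \<kappa>_def)
        also have "\<dots> \<le> ennreal C2 * (\<integral>\<^sup>+ x. epowr (G x) \<kappa> \<partial>\<mu>)" by (rule C2) measurable
        also have "(\<integral>\<^sup>+ x. epowr (G x) \<kappa> \<partial>\<mu>) = X"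
          unfolding X_def G_def epowr_epowr \<kappa>(2) ..
        finally show ?thesis .
      qed
      have "(\<integral>\<^sup>+ x. epowr (\<integral>\<^sup>+ k. epowr (T \<delta> h k x) Q \<partial>count_space UNIV) (P / Q) \<partial>\<mu>) \<le>
          (\<integral>\<^sup>+ x. epowr (ennreal K * (\<Phi> x * \<Psi> x)) (P / Q) \<partial>\<mu>)"
        using Ffin PQ by (intro nn_integral_mono_AE) (auto intro!: epowr_mono step)
      also have "\<dots> = (\<integral>\<^sup>+ x. ennreal (K powr (P / Q)) * (epowr (\<Psi> x) (P / Q) * epowr (\<Phi> x) (P / Q)) \<partial>\<mu>)"
        using K by (simp add: epowr_mult epowr_ennreal ac_simps)
      also have "\<dots> = ennreal (K powr (P / Q)) * (\<integral>\<^sup>+ x. epowr (\<Psi> x) (P / Q) * epowr (\<Phi> x) (P / Q) \<partial>\<mu>)"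
        by (rule nn_integral_cmult) measurable
      also have "\<dots> \<le> ennreal (K powr (P / Q)) *
          (epowr (\<integral>\<^sup>+ x. epowr (epowr (\<Psi> x) (P / Q)) (Q / P) \<partial>\<mu>) (1 / (Q / P)) *
           epowr (\<integral>\<^sup>+ x. epowr (epowr (\<Phi> x) (P / Q)) (Q / (Q - P)) \<partial>\<mu>) (1 / (Q / (Q - P))))"
        using PQ by (intro mult_left_mono nn_integral_Holder) (auto simp: field_simps)
      also have "\<dots> \<le> ennreal (K powr (P / Q)) *
          (epowr (ennreal C1' * X) (P / Q) * epowr (ennreal C2 * X) ((Q - P) / Q))"
        using PQ \<Psi>_int \<Phi>_int by (intro mult_left_mono mult_mono) (auto simp: epowr_epowr[of _ "P / Q" "Q / P"] intro!: epowr_mono)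
      also have "\<dots> = ennreal C * (epowr X (P / Q) * epowr X ((Q - P) / Q))"
        using C1' C2 K by (simp add: epowr_mult epowr_ennreal C_def ennreal_mult ac_simps)
      also have "epowr X (P / Q) * epowr X ((Q - P) / Q) = X"
        using PQ by (subst epowr_add[symmetric]) (auto simp: field_simps)
      finally show ?thesis .
    qed
    then show "(\<integral>\<^sup>+ x. epowr (\<integral>\<^sup>+ k. epowr (T \<delta> h k x) Q \<partial>count_space UNIV) (P / Q) \<partial>\<mu>) \<le>
      ennreal C * (\<integral>\<^sup>+ x. epowr (\<integral>\<^sup>+ j. epowr (h j x) Q \<partial>count_space UNIV) (P / Q) \<partial>\<mu>)"
      unfolding X_eq[symmetric] using C by (cases "X = top") (auto simp: ennreal_mult_top less_top)
  qed
qed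

lemma vector_maximal:
  assumes "0 < \<delta>" "1 < P" "1 < Q"
  shows "\<exists>C>0. \<forall>h. (\<forall>j. h j \<in> borel_measurable \<mu>) \<longrightarrow>
    (\<integral>\<^sup>+ x. epowr (\<integral>\<^sup>+ k. epowr (T \<delta> h k x) Q \<partial>count_space UNIV) (P / Q) \<partial>\<mu>) \<le>
    ennreal C * (\<integral>\<^sup>+ x. epowr (\<integral>\<^sup>+ j. epowr (h j x) Q \<partial>count_space UNIV) (P / Q) \<partial>\<mu>)"
  using vector_maximal_ge[of \<delta> Q P] vector_maximal_less[of \<delta> P Q] assms by (cases "Q \<le> P") auto

end

section \<open>The mixed norms of sequences of functions\<close>

text \<open>The functional that \<open>M_norm\<close> minimises, freed from gradients, so that
  sequences of oscillations are measured by the same norm. For p infinite and q finite it is of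
  Carleson type: a ball of radius 2^-k sees only the scales j >= k.\<close>

definition D_norm ::
  "'a::metric_space measure \<Rightarrow> ennreal \<Rightarrow> ennreal \<Rightarrow> (int \<Rightarrow> 'a \<Rightarrow> ennreal) \<Rightarrow> ennreal" where
  "D_norm \<mu> p q a =
    (if p = \<infinity> \<and> q \<noteq> \<infinity> then
       (SUP k. SUP x.
          epowr (\<integral>\<^sup>+ j. nn_avg \<mu> (ball x (rad k)) (\<lambda>y. epowr (a j y) (enn2real q)) \<partial>count_space {k..})
            (1 / enn2real q))
     else Lp_norm \<mu> p (\<lambda>x. lq_norm q (\<lambda>k. a k x)))"

lemma M_norm_eq:
  "M_norm \<mu> s p q u = (INF g\<in>hajlasz_gradients \<mu> s u. D_norm \<mu> p q (\<lambda>k x. ennreal (g k x)))"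
proof -
  have "\<And>g k x. g \<in> hajlasz_gradients \<mu> s u \<Longrightarrow> 0 \<le> g k x"
    by (simp add: hajlasz_gradients_def)
  then show ?thesis
    unfolding M_norm_def D_norm_def
    by (auto simp: rad_powi epowr_ennreal intro!: INF_cong SUP_cong arg_cong2[where f = epowr]
      nn_integral_cong arg_cong2[where f = "nn_avg \<mu>"])
qed

lemma enn2real_pos: "0 < p \<Longrightarrow> p \<noteq> top \<Longrightarrow> 0 < enn2real p"
  by (simp add: enn2real_positive_iff less_top)

lemma int_sum_atLeast:
  "(\<integral>\<^sup>+ j. f j \<partial>count_space {k..}) = (\<integral>\<^sup>+ j. (if k \<le> j then f j else 0) \<partial>count_space (UNIV :: int set))"
  by (subst nn_integral_count_space_indicator) (auto intro!: nn_integral_cong split: split_indicator)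

lemma lq_norm_mono:
  assumes "0 < q" "\<And>k. a k \<le> b k"
  shows "lq_norm q a \<le> lq_norm q b"
  unfolding lq_norm_def using assms
  by (auto intro!: SUP_mono epowr_mono nn_integral_mono)

lemma lq_norm_cmult:
  assumes "0 < q"
  shows "lq_norm q (\<lambda>k. c * a k) = c * lq_norm q a"
proof (cases "q = top")
  case True
  then show ?thesis by (simp add: lq_norm_def SUP_mult_left_ennreal)
next
  case False
  then have "0 < enn2real q" using assms by (simp add: enn2real_pos)
  then show ?thesis using False
    by (simp add: lq_norm_def epowr_mult nn_integral_cmult epowr_epowr)
qed

lemma le_lq_norm:
  assumes "0 < q"
  shows "a k \<le> lq_norm q a"
proof (cases "q = top")
  case True
  then show ?thesis by (auto simp: lq_norm_def intro: SUP_upper)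
next
  case False
  then have "0 < enn2real q" using assms by (simp add: enn2real_pos)
  moreover have "epowr (a k) (enn2real q) \<le> (\<integral>\<^sup>+ k. epowr (a k) (enn2real q) \<partial>count_space UNIV)"
    by (rule nn_integral_ge_point) simp
  ultimately show ?thesis using False by (simp add: lq_norm_def le_epowr_swap)
qed

lemma lq_norm_measurable [measurable]:
  assumes [measurable]: "\<And>k. a k \<in> borel_measurable M"
  shows "(\<lambda>x. lq_norm q (\<lambda>k. a k x)) \<in> borel_measurable M"
  unfolding lq_norm_def by (cases "q = top") (auto intro!: borel_measurable_SUP)

lemma Lp_norm_mono_AE:
  assumes "0 < p" "p = top \<Longrightarrow> f \<in> borel_measurable M" "AE x in M. f x \<le> g x"
  shows "Lp_norm M p f \<le> Lp_norm M p g"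
proof (cases "p = top")
  case True
  then show ?thesis using assms by (simp add: Lp_norm_def esssup_AE_mono)
next
  case False
  then have p: "0 < enn2real p" using assms by (simp add: enn2real_pos)
  have "(\<integral>\<^sup>+ x. epowr (f x) (enn2real p) \<partial>M) \<le> (\<integral>\<^sup>+ x. epowr (g x) (enn2real p) \<partial>M)"
    using p by (intro nn_integral_mono_AE eventually_mono[OF assms(3)] epowr_mono) auto
  then show ?thesis using False p by (simp add: Lp_norm_def epowr_mono)
qed

lemma Lp_norm_cmult_le:
  assumes "0 < p" and [measurable]: "f \<in> borel_measurable M"
  shows "Lp_norm M p (\<lambda>x. c * f x) \<le> c * Lp_norm M p f"
proof (cases "p = top")
  case True
  have "esssup M (\<lambda>x. c * f x) \<le> c * esssup M f"
    by (intro esssup_I eventually_mono[OF esssup_AE[of f M]] mult_left_mono) auto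
  then show ?thesis using True by (simp add: Lp_norm_def)
next
  case False
  then have p: "0 < enn2real p" using assms by (simp add: enn2real_pos)
  then show ?thesis using False
    by (simp add: Lp_norm_def epowr_mult nn_integral_cmult epowr_epowr)
qed

context doubling_metric_measure_space
begin

lemma D_norm_mono_AE:
  assumes pq: "0 < p" "0 < q"
    and [measurable]: "\<And>k. a k \<in> borel_measurable \<mu>"
    and le: "\<And>k. AE x in \<mu>. a k x \<le> b k x"
  shows "D_norm \<mu> p q a \<le> D_norm \<mu> p q b"
proof (cases "p = top \<and> q \<noteq> top")
  case True
  then have q: "0 < enn2real q" using pq by (simp add: enn2real_pos)
  have "nn_avg \<mu> B (\<lambda>y. epowr (a j y) (enn2real q)) \<le> nn_avg \<mu> B (\<lambda>y. epowr (b j y) (enn2real q))" for B j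
    using q by (intro nn_avg_mono_AE eventually_mono[OF le[of j]] epowr_mono) auto
  then show ?thesis
    unfolding D_norm_def using True q
    by (auto intro!: SUP_mono' epowr_mono nn_integral_mono)
next
  case False
  have "AE x in \<mu>. \<forall>k. a k x \<le> b k x" using le by (simp add: AE_all_countable)
  then have "AE x in \<mu>. lq_norm q (\<lambda>k. a k x) \<le> lq_norm q (\<lambda>k. b k x)"
    using pq by (auto intro!: lq_norm_mono)
  then have "Lp_norm \<mu> p (\<lambda>x. lq_norm q (\<lambda>k. a k x)) \<le> Lp_norm \<mu> p (\<lambda>x. lq_norm q (\<lambda>k. b k x))"
    using pq by (intro Lp_norm_mono_AE) auto
  then show ?thesis unfolding D_norm_def using False by auto
qed

lemma D_norm_cmult_le:
  assumes pq: "0 < p" "0 < q"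
    and [measurable]: "\<And>k. a k \<in> borel_measurable \<mu>"
  shows "D_norm \<mu> p q (\<lambda>k x. c * a k x) \<le> c * D_norm \<mu> p q a"
proof (cases "p = top \<and> q \<noteq> top")
  case True
  then have q: "0 < enn2real q" using pq by (simp add: enn2real_pos)
  have "epowr (\<integral>\<^sup>+ j. nn_avg \<mu> (ball x (rad k)) (\<lambda>y. epowr (c * a j y) (enn2real q)) \<partial>count_space {k..}) (1 / enn2real q)
     = c * epowr (\<integral>\<^sup>+ j. nn_avg \<mu> (ball x (rad k)) (\<lambda>y. epowr (a j y) (enn2real q)) \<partial>count_space {k..}) (1 / enn2real q)" for x k
    using q by (simp add: epowr_mult nn_avg_cmult nn_integral_cmult epowr_epowr)
  then show ?thesis
    unfolding D_norm_def using True by (simp add: SUP_mult_left_ennreal)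
next
  case False
  then show ?thesis
    unfolding D_norm_def using Lp_norm_cmult_le[of p "\<lambda>x. lq_norm q (\<lambda>k. a k x)" \<mu> c] pq
    by (auto simp: lq_norm_cmult)
qed

lemma D_norm_le_cmult:
  assumes pq: "0 < p" "0 < q"
    and [measurable]: "\<And>k. a k \<in> borel_measurable \<mu>" "\<And>k. b k \<in> borel_measurable \<mu>"
    and le: "\<And>k. AE x in \<mu>. a k x \<le> c * b k x"
  shows "D_norm \<mu> p q a \<le> c * D_norm \<mu> p q b"
proof -
  have "D_norm \<mu> p q a \<le> D_norm \<mu> p q (\<lambda>k x. c * b k x)"
    by (intro D_norm_mono_AE pq le) auto
  also have "\<dots> \<le> c * D_norm \<mu> p q b" by (intro D_norm_cmult_le pq) auto
  finally show ?thesis .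
qed

lemma nn_avg_rad_le: "nn_avg \<mu> (ball x (rad k)) f \<le> ennreal Dbl * nn_avg \<mu> (ball x (rad (k - 1))) f"
  using Dbl_pos V_double[of "rad k" x] by (intro nn_avg_le_subset) (auto simp: rad_1 intro!: subset_ball)

text \<open>The norm of the whole sequence is invariant under shifts except in the Carleson case,
  where the shift lets the scale k - 1 into a ball of radius 2^-k; passing to the doubled ball
  repairs this at the cost of a doubling constant.\<close>

lemma D_norm_shift:
  assumes pq: "0 < p" "0 < q"
  shows "\<exists>C>0. \<forall>a. D_norm \<mu> p q (\<lambda>k. a (k - 1)) \<le> ennreal C * D_norm \<mu> p q a"
proof (cases "p = top \<and> q \<noteq> top")
  case True
  define q' where "q' = enn2real q"
  have q: "0 < q'" using pq True by (simp add: q'_def enn2real_pos)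
  show ?thesis
  proof (intro exI[of _ "Dbl powr (1 / q')"] conjI allI)
    show "0 < Dbl powr (1 / q')" using Dbl_pos by simp
    fix a :: "int \<Rightarrow> 'a \<Rightarrow> ennreal"
    let ?N = "D_norm \<mu> p q a"
    let ?S = "\<lambda>x k. (\<integral>\<^sup>+ j. nn_avg \<mu> (ball x (rad k)) (\<lambda>y. epowr (a j y) q') \<partial>count_space {k..})"
    have N: "?N = (SUP k. SUP x. epowr (?S x k) (1 / q'))"
      unfolding D_norm_def q'_def using True by simp
    have "epowr (\<integral>\<^sup>+ j. nn_avg \<mu> (ball x (rad k)) (\<lambda>y. epowr (a (j - 1) y) q') \<partial>count_space {k..}) (1 / q')
      \<le> ennreal (Dbl powr (1 / q')) * ?N" for x k
    proof -
      have "bij_betw (\<lambda>j::int. j - 1) {k..} {k - 1..}"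
        by (rule bij_betwI[where g = "\<lambda>j. j + 1"]) auto
      then have "(\<integral>\<^sup>+ j. nn_avg \<mu> (ball x (rad k)) (\<lambda>y. epowr (a (j - 1) y) q') \<partial>count_space {k..})
        = (\<integral>\<^sup>+ j. nn_avg \<mu> (ball x (rad k)) (\<lambda>y. epowr (a j y) q') \<partial>count_space {k - 1..})"
        by (rule nn_integral_bij_count_space)
      also have "\<dots> \<le> (\<integral>\<^sup>+ j. ennreal Dbl * nn_avg \<mu> (ball x (rad (k - 1))) (\<lambda>y. epowr (a j y) q') \<partial>count_space {k - 1..})"
        by (intro nn_integral_mono nn_avg_rad_le)
      also have "\<dots> = ennreal Dbl * ?S x (k - 1)" by (rule nn_integral_cmult) simp
      finally have "epowr (\<integral>\<^sup>+ j. nn_avg \<mu> (ball x (rad k)) (\<lambda>y. epowr (a (j - 1) y) q') \<partial>count_space {k..}) (1 / q')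
        \<le> epowr (ennreal Dbl * ?S x (k - 1)) (1 / q')"
        using q by (intro epowr_mono) auto
      also have "\<dots> = ennreal (Dbl powr (1 / q')) * epowr (?S x (k - 1)) (1 / q')"
        using Dbl_pos by (simp add: epowr_mult epowr_ennreal)
      also have "epowr (?S x (k - 1)) (1 / q') \<le> ?N"
        unfolding N by (rule SUP_upper2[of "k - 1"], simp, rule SUP_upper, simp)
      finally show ?thesis by (simp add: mult_left_mono)
    qed
    then show "D_norm \<mu> p q (\<lambda>k. a (k - 1)) \<le> ennreal (Dbl powr (1 / q')) * ?N"
      using True by (subst D_norm_def) (auto simp: q'_def intro!: SUP_least)
  qed
next
  case False
  have bij: "bij_betw (\<lambda>k::int. k - 1) UNIV UNIV"
    by (rule bij_betwI[where g = "\<lambda>k. k + 1"]) auto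
  have "lq_norm q (\<lambda>k. f (k - 1)) = lq_norm q f" for f
  proof -
    have "(SUP k. f (k - 1)) = (SUP k. f k)"
      using bij_betw_imp_surj_on[OF bij] by (metis (no_types) image_image)
    moreover have "(\<integral>\<^sup>+ k. epowr (f (k - 1)) (enn2real q) \<partial>count_space UNIV) = (\<integral>\<^sup>+ k. epowr (f k) (enn2real q) \<partial>count_space UNIV)"
      using nn_integral_bij_count_space[OF bij, of "\<lambda>k. epowr (f k) (enn2real q)"] by simp
    ultimately show ?thesis by (simp add: lq_norm_def)
  qed
  then have "lq_norm q (\<lambda>k. a (k - 1) x) = lq_norm q (\<lambda>k. a k x)" for a :: "int \<Rightarrow> 'a \<Rightarrow> ennreal" and x
    by this
  then show ?thesis using False
    by (intro exI[of _ 1]) (auto simp: D_norm_def)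
qed

lemma AE_ball_finite:
  assumes [measurable]: "f \<in> borel_measurable \<mu>"
    and "\<And>N::nat. \<exists>x r. ball undefined (real N) \<subseteq> ball x r \<and> (\<integral>\<^sup>+ y\<in>ball x r. f y \<partial>\<mu>) < top"
  shows "AE y in \<mu>. f y < top"
proof -
  have "AE y in \<mu>. \<forall>N::nat. y \<in> ball undefined (real N) \<longrightarrow> f y < top"
    unfolding AE_all_countable
  proof
    fix N :: nat
    obtain x r where xr: "ball undefined (real N) \<subseteq> ball x r" "(\<integral>\<^sup>+ y\<in>ball x r. f y \<partial>\<mu>) < top"
      using assms(2) by blast
    have "AE y in \<mu>. f y * indicator (ball x r) y \<noteq> \<infinity>"
      using xr(2) by (intro nn_integral_PInf_AE) auto
    then show "AE y in \<mu>. y \<in> ball undefined (real N) \<longrightarrow> f y < top"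
      using xr(1) by (auto elim!: eventually_mono simp: less_top infinity_ennreal_def
        split: split_indicator_asm dest: subsetD)
  qed
  then show ?thesis
  proof (rule AE_mp, intro AE_I2 impI)
    fix y assume *: "\<forall>N::nat. y \<in> ball undefined (real N) \<longrightarrow> f y < top"
    obtain N :: nat where "dist undefined y < real N" using reals_Archimedean2 by blast
    then show "f y < top" using * by auto
  qed
qed

lemma rad_unbounded: "\<exists>K\<le>(k::int). r < rad K"
proof -
  obtain N :: nat where N: "r < 2 ^ N" using real_arch_pow[of 2 r] by auto
  have "rad (- int N) = 2 ^ N" by (simp add: rad_def powr_realpow)
  moreover have "rad (- int N) \<le> rad (min k (- int N))" by (rule rad_mono) simp
  ultimately show ?thesis using N by (intro exI[of _ "min k (- int N)"]) auto
qed

text \<open>Needed to turn an extended-valued candidate for a gradient into a real-valued one. In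
  the Carleson case a given scale is seen by all large balls, and these exhaust the space.\<close>

lemma D_norm_finite_AE:
  assumes pq: "0 < p" "0 < q" and [measurable]: "\<And>k. a k \<in> borel_measurable \<mu>"
    and fin: "D_norm \<mu> p q a < top"
  shows "AE x in \<mu>. \<forall>k. a k x < top"
proof (cases "p = top \<and> q \<noteq> top")
  case True
  then have q: "0 < enn2real q" using pq by (simp add: enn2real_pos)
  have "AE x in \<mu>. a k x < top" for k
  proof -
    have "AE x in \<mu>. epowr (a k x) (enn2real q) < top"
    proof (rule AE_ball_finite)
      fix N :: nat
      obtain K where K: "K \<le> k" "real N < rad K" using rad_unbounded by blast
      have "nn_avg \<mu> (ball undefined (rad K)) (\<lambda>y. epowr (a k y) (enn2real q)) \<le>
        (\<integral>\<^sup>+ j. nn_avg \<mu> (ball undefined (rad K)) (\<lambda>y. epowr (a j y) (enn2real q)) \<partial>count_space {K..})"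
        using K by (intro nn_integral_ge_point) auto
      also have "\<dots> \<le> epowr (D_norm \<mu> p q a) (enn2real q)"
      proof -
        have "epowr (\<integral>\<^sup>+ j. nn_avg \<mu> (ball undefined (rad K)) (\<lambda>y. epowr (a j y) (enn2real q)) \<partial>count_space {K..}) (1 / enn2real q)
          \<le> D_norm \<mu> p q a"
          using True by (simp add: D_norm_def) (rule SUP_upper2[of K], simp, rule SUP_upper, simp)
        then show ?thesis using q by (simp add: epowr_le_swap)
      qed
      also have "\<dots> < top" using fin by simp
      finally have "(\<integral>\<^sup>+ y\<in>ball undefined (rad K). epowr (a k y) (enn2real q) \<partial>\<mu>) / V undefined (rad K) < top"
        by (simp add: nn_avg_def)
      then have "(\<integral>\<^sup>+ y\<in>ball undefined (rad K). epowr (a k y) (enn2real q) \<partial>\<mu>) < top"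
        by (metis V_finite(2) divide_ennreal_def ennreal_inverse_eq_0_iff ennreal_top_mult less_top top.not_eq_extremum)
      then show "\<exists>x r. ball undefined (real N) \<subseteq> ball x r \<and> (\<integral>\<^sup>+ y\<in>ball x r. epowr (a k y) (enn2real q) \<partial>\<mu>) < top"
        using K by (intro exI[of _ undefined] exI[of _ "rad K"]) auto
    qed measurable
    then show ?thesis by simp
  qed
  then show ?thesis by (simp add: AE_all_countable)
next
  case False
  have *: "AE x in \<mu>. lq_norm q (\<lambda>k. a k x) < top"
  proof (cases "p = top")
    case True
    then have "esssup \<mu> (\<lambda>x. lq_norm q (\<lambda>k. a k x)) < top"
      using fin False by (auto simp: D_norm_def Lp_norm_def)
    then show ?thesis
      using esssup_AE[of "\<lambda>x. lq_norm q (\<lambda>k. a k x)" \<mu>] by (auto elim!: eventually_mono)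
  next
    case False
    then have p: "0 < enn2real p" using pq by (simp add: enn2real_pos)
    have "(\<integral>\<^sup>+ x. epowr (lq_norm q (\<lambda>k. a k x)) (enn2real p) \<partial>\<mu>) < top"
      using fin False by (auto simp: D_norm_def Lp_norm_def)
    then have "AE x in \<mu>. epowr (lq_norm q (\<lambda>k. a k x)) (enn2real p) \<noteq> \<infinity>"
      by (intro nn_integral_PInf_AE) auto
    then show ?thesis by (simp add: less_top infinity_ennreal_def)
  qed
  then show ?thesis
    using pq by (auto elim!: eventually_mono intro: le_less_trans[OF le_lq_norm])
qed

section \<open>Boundedness of \<open>T\<close> in the mixed norms\<close>

lemma T_le_const:
  assumes "0 < \<delta>" "\<And>j. AE x in \<mu>. h j x \<le> c"
  shows "AE x in \<mu>. \<forall>k. T \<delta> h k x \<le> ennreal (geom \<delta>) * (2 * c)"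
proof -
  have "AE x in \<mu>. \<forall>j. h j x \<le> c" using assms by (simp add: AE_all_countable)
  then show ?thesis
  proof (rule eventually_mono, intro allI)
    fix x k assume x: "\<forall>j. h j x \<le> c"
    have "Aop k (h j) x \<le> 2 * c" for j
    proof -
      have "Av k (h j) x \<le> Av k (\<lambda>_. c) x" unfolding Av_def by (intro nn_avg_mono_AE assms)
      then show ?thesis using x by (simp add: Aop_def Av_const mult_2 add_mono)
    qed
    then have "T \<delta> h k x \<le> (\<integral>\<^sup>+ j. wgt \<delta> k j * (2 * c) \<partial>count_space UNIV)"
      unfolding T_def by (intro nn_integral_mono mult_left_mono) auto
    then show "T \<delta> h k x \<le> ennreal (geom \<delta>) * (2 * c)"
      by (simp add: nn_integral_multc sum_wgt assms)
  qed
qed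

lemma T_le_Mx:
  assumes "0 < \<delta>" "\<And>j y. h j y \<le> H y"
  shows "T \<delta> h k x \<le> ennreal (geom \<delta>) * (H x + Mx H x)"
proof -
  have "Aop k (h j) x \<le> H x + Mx H x" for j
    unfolding Aop_def using assms(2) Av_mono[of "h j" H k x] Av_le_Mx[of k H x]
    by (intro add_mono) auto
  then have "T \<delta> h k x \<le> (\<integral>\<^sup>+ j. wgt \<delta> k j * (H x + Mx H x) \<partial>count_space UNIV)"
    unfolding T_def by (intro nn_integral_mono mult_left_mono) auto
  then show ?thesis by (simp add: nn_integral_multc sum_wgt assms)
qed

text \<open>By symmetry the averaging operator moves onto the indicator of the ball. Its average at
  a scale k >= K is at most 1 and vanishes outside the doubled ball.\<close>

lemma nn_avg_Aop_le:
  assumes [measurable]: "f \<in> borel_measurable \<mu>" and k: "K \<le> k"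
  shows "nn_avg \<mu> (ball x (rad K)) (Aop k f) \<le> ennreal (2 * Dbl * Dbl) * nn_avg \<mu> (ball x (rad (K - 1))) f"
proof -
  let ?B = "ball x (rad K)" and ?B2 = "ball x (rad (K - 1))"
  have sub: "?B \<subseteq> ?B2" by (rule subset_ball) (simp add: rad_1)
  have "(\<integral>\<^sup>+ y\<in>?B. Av k f y \<partial>\<mu>) \<le> ennreal Dbl * (\<integral>\<^sup>+ y. f y * Av k (indicator ?B) y \<partial>\<mu>)"
    by (rule Av_symmetric) auto
  also have "\<dots> \<le> ennreal Dbl * (\<integral>\<^sup>+ y\<in>?B2. f y \<partial>\<mu>)"
  proof (intro mult_left_mono nn_integral_mono)
    fix y
    show "Av k (indicator ?B) y \<le> indicator ?B2 y"
    proof (cases "y \<in> ?B2")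
      case True
      have "Av k (indicator ?B) y \<le> Av k (\<lambda>_. 1) y" by (rule Av_mono) (auto split: split_indicator)
      then show ?thesis using True by (simp add: Av_const)
    next
      case False
      have "z \<notin> ?B" if "z \<in> ball y (rad k)" for z
      proof
        assume "z \<in> ?B"
        then have "dist x y < rad K + rad k"
          using that dist_triangle[of x y z] by (auto simp: dist_commute)
        also have "\<dots> \<le> rad (K - 1)" using rad_mono[OF k] by (simp add: rad_1)
        finally show False using False by simp
      qed
      then have "(\<integral>\<^sup>+ z\<in>ball y (rad k). indicator ?B z \<partial>\<mu>) = 0"
        by (subst nn_integral_0_iff_AE) (auto split: split_indicator)
      then show ?thesis by (simp add: Av_def nn_avg_def)
    qed
  qed auto
  finally have 1: "(\<integral>\<^sup>+ y\<in>?B. Av k f y \<partial>\<mu>) \<le> ennreal Dbl * (\<integral>\<^sup>+ y\<in>?B2. f y \<partial>\<mu>)" .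
  have "(\<integral>\<^sup>+ y\<in>?B. f y \<partial>\<mu>) \<le> 1 * (\<integral>\<^sup>+ y\<in>?B2. f y \<partial>\<mu>)"
    using sub by (auto intro!: nn_integral_mono split: split_indicator)
  also have "\<dots> \<le> ennreal Dbl * (\<integral>\<^sup>+ y\<in>?B2. f y \<partial>\<mu>)"
    using Dbl_ge_1 by (intro mult_right_mono) (auto simp: ennreal_ge_1)
  finally have "(\<integral>\<^sup>+ y\<in>?B. Aop k f y \<partial>\<mu>) \<le> ennreal Dbl * (\<integral>\<^sup>+ y\<in>?B2. f y \<partial>\<mu>) + ennreal Dbl * (\<integral>\<^sup>+ y\<in>?B2. f y \<partial>\<mu>)"
    unfolding Aop_def using 1 by (simp add: distrib_right nn_integral_add add_mono)
  also have "\<dots> = ennreal (2 * Dbl) * (\<integral>\<^sup>+ y\<in>?B2. f y \<partial>\<mu>)"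
  proof -
    have "ennreal Dbl + ennreal Dbl = ennreal (2 * Dbl)"
      using Dbl_pos by (subst ennreal_plus[symmetric]) auto
    then show ?thesis by (simp only: distrib_right[symmetric])
  qed
  also have "\<dots> = ennreal (2 * Dbl) * (nn_avg \<mu> ?B2 f * V x (rad (K - 1)))"
    by (simp add: nn_avg_def ennreal_divide_mult_cancel)
  also have "\<dots> \<le> ennreal (2 * Dbl) * (nn_avg \<mu> ?B2 f * (ennreal Dbl * V x (rad K)))"
    using V_double[of "rad K" x] by (intro mult_left_mono) (auto simp: rad_1)
  also have "\<dots> = ennreal (2 * Dbl * Dbl) * nn_avg \<mu> ?B2 f * V x (rad K)"
    using Dbl_pos by (simp add: ennreal_mult ac_simps)
  finally show ?thesis
    unfolding nn_avg_def[of _ ?B] by (subst ennreal_divide_le_iff) auto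
qed

text \<open>Jensen's inequality with exponent q/\<tau> brings the q-th power inside, and the
  averaging is then moved from the function to the ball, which doubles. Since the weight is
  one-sided, only scales j >= k >= K occur, and the Carleson condition on the doubled ball counts
  all of them.\<close>

lemma T_norm_bound_Carleson:
  assumes \<delta>: "0 < \<delta>" and \<tau>: "0 < \<tau>" and q: "\<tau> < q"
  shows "\<exists>C>0. \<forall>g. (\<forall>k. g k \<in> borel_measurable \<mu>) \<longrightarrow>
    D_norm \<mu> \<infinity> (ennreal q) (\<lambda>k x. epowr (T \<delta> (\<lambda>j y. epowr (g j y) \<tau>) k x) (1 / \<tau>)) \<le> ennreal C * D_norm \<mu> \<infinity> (ennreal q) g"
proof -
  have q0: "0 < q" using \<tau> q by simp
  define J where "J = geom \<delta> powr (q / \<tau> - 1) * 2 powr (q / \<tau>)"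
  define C where "C = (J * (2 * Dbl * Dbl)) * geom \<delta>"
  have J: "0 < J" using geom_pos[OF \<delta>] by (simp add: J_def)
  have C: "0 < C" using geom_pos[OF \<delta>] J Dbl_pos by (simp add: C_def)
  show ?thesis
  proof (intro exI[of _ "C powr (1 / q)"] conjI allI impI)
    show "0 < C powr (1 / q)" using C by simp
    fix g :: "int \<Rightarrow> 'a \<Rightarrow> ennreal" assume "\<forall>k. g k \<in> borel_measurable \<mu>"
    then have [measurable]: "\<And>k. g k \<in> borel_measurable \<mu>" by simp
    define f where "f j y = epowr (g j y) q" for j y
    have [measurable]: "f j \<in> borel_measurable \<mu>" for j unfolding f_def[abs_def] by measurable
    let ?h = "\<lambda>j y. epowr (g j y) \<tau>"
    let ?N = "D_norm \<mu> \<infinity> (ennreal q) g"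
    have N: "(\<integral>\<^sup>+ j. nn_avg \<mu> (ball x (rad K)) (f j) \<partial>count_space {K..}) \<le> epowr ?N q" for x K
    proof -
      have "epowr (\<integral>\<^sup>+ j. nn_avg \<mu> (ball x (rad K)) (f j) \<partial>count_space {K..}) (1 / q) \<le> ?N"
        unfolding D_norm_def f_def[abs_def] using q0
        by simp (rule SUP_upper2[of K], simp, rule SUP_upper, simp)
      then show ?thesis using q0 by (simp add: epowr_le_swap)
    qed
    have "(\<integral>\<^sup>+ k. nn_avg \<mu> (ball x (rad K)) (\<lambda>y. epowr (epowr (T \<delta> ?h k y) (1 / \<tau>)) q) \<partial>count_space {K..}) \<le>
        ennreal C * epowr ?N q" for x K
    proof -
      let ?B = "ball x (rad K)" and ?B2 = "ball x (rad (K - 1))"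
      \<comment> \<open>The cut-off \<open>K - 1 \<le> j\<close> loses nothing, as the weight forces
        j >= k >= K; it is the range of summation that belongs to a ball of radius 2^-(K-1).\<close>
      have 1: "nn_avg \<mu> ?B (\<lambda>y. epowr (epowr (T \<delta> ?h k y) (1 / \<tau>)) q) \<le>
          (\<integral>\<^sup>+ j. ennreal (J * (2 * Dbl * Dbl)) * (wgt \<delta> k j * (if K - 1 \<le> j then nn_avg \<mu> ?B2 (f j) else 0)) \<partial>count_space UNIV)"
        if k: "K \<le> k" for k
      proof -
        have "nn_avg \<mu> ?B (\<lambda>y. epowr (epowr (T \<delta> ?h k y) (1 / \<tau>)) q) \<le> nn_avg \<mu> ?B (\<lambda>y. ennreal J * T \<delta> f k y)"
        proof (rule nn_avg_mono)
          fix y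
          have "epowr (T \<delta> ?h k y) (q / \<tau>) \<le> ennreal J * T \<delta> (\<lambda>j y. epowr (?h j y) (q / \<tau>)) k y"
            unfolding J_def using \<tau> q by (intro epowr_T_le \<delta>) auto
          then show "epowr (epowr (T \<delta> ?h k y) (1 / \<tau>)) q \<le> ennreal J * T \<delta> f k y"
            using \<tau> by (simp add: epowr_epowr f_def[abs_def])
        qed
        also have "\<dots> = ennreal J * nn_avg \<mu> ?B (T \<delta> f k)"
          by (rule nn_avg_cmult) measurable
        also have "nn_avg \<mu> ?B (T \<delta> f k) = (\<integral>\<^sup>+ j. wgt \<delta> k j * nn_avg \<mu> ?B (Aop k (f j)) \<partial>count_space UNIV)"
          unfolding T_def[abs_def] by (subst nn_avg_sum) (auto simp: nn_avg_cmult)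
        also have "\<dots> \<le> (\<integral>\<^sup>+ j. ennreal (2 * Dbl * Dbl) * (wgt \<delta> k j * (if K - 1 \<le> j then nn_avg \<mu> ?B2 (f j) else 0)) \<partial>count_space UNIV)"
        proof (intro nn_integral_mono)
          fix j
          show "wgt \<delta> k j * nn_avg \<mu> ?B (Aop k (f j)) \<le>
              ennreal (2 * Dbl * Dbl) * (wgt \<delta> k j * (if K - 1 \<le> j then nn_avg \<mu> ?B2 (f j) else 0))"
            using nn_avg_Aop_le[OF _ k, of "f j" x] k
            by (cases "k \<le> j") (auto simp: wgt_def mult.left_commute[of "ennreal (2 * Dbl * Dbl)"] intro!: mult_left_mono)
        qed
        also have "ennreal J * \<dots> = (\<integral>\<^sup>+ j. ennreal (J * (2 * Dbl * Dbl)) * (wgt \<delta> k j * (if K - 1 \<le> j then nn_avg \<mu> ?B2 (f j) else 0)) \<partial>count_space UNIV)"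
          using J Dbl_pos by (simp add: nn_integral_cmult ennreal_mult mult.assoc)
        finally show ?thesis by (simp add: mult_left_mono)
      qed
      have "(\<integral>\<^sup>+ k. nn_avg \<mu> ?B (\<lambda>y. epowr (epowr (T \<delta> ?h k y) (1 / \<tau>)) q) \<partial>count_space {K..}) \<le>
          (\<integral>\<^sup>+ k. \<integral>\<^sup>+ j. ennreal (J * (2 * Dbl * Dbl)) * (wgt \<delta> k j * (if K - 1 \<le> j then nn_avg \<mu> ?B2 (f j) else 0)) \<partial>count_space UNIV \<partial>count_space UNIV)"
        unfolding int_sum_atLeast by (intro nn_integral_mono) (auto intro: 1)
      also have "\<dots> = (\<integral>\<^sup>+ j. \<integral>\<^sup>+ k. ennreal (J * (2 * Dbl * Dbl)) * (wgt \<delta> k j * (if K - 1 \<le> j then nn_avg \<mu> ?B2 (f j) else 0)) \<partial>count_space UNIV \<partial>count_space UNIV)"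
        by (rule int_sum_swap)
      also have "\<dots> = (\<integral>\<^sup>+ j. ennreal C * (if K - 1 \<le> j then nn_avg \<mu> ?B2 (f j) else 0) \<partial>count_space UNIV)"
        using J Dbl_pos geom_pos[OF \<delta>]
        by (intro nn_integral_cong)
          (simp add: nn_integral_cmult nn_integral_multc sum_wgt[OF \<delta>] C_def ennreal_mult mult.assoc)
      also have "\<dots> = ennreal C * (\<integral>\<^sup>+ j. nn_avg \<mu> ?B2 (f j) \<partial>count_space {K - 1..})"
        unfolding int_sum_atLeast by (rule nn_integral_cmult) simp
      also have "\<dots> \<le> ennreal C * epowr ?N q"
        by (intro mult_left_mono N) simp
      finally show ?thesis .
    qed
    then have "epowr (\<integral>\<^sup>+ k. nn_avg \<mu> (ball x (rad K)) (\<lambda>y. epowr (epowr (T \<delta> ?h k y) (1 / \<tau>)) q) \<partial>count_space {K..}) (1 / q) \<le>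
        epowr (ennreal C * epowr ?N q) (1 / q)" for x K
      using q0 by (intro epowr_mono) auto
    also have "epowr (ennreal C * epowr ?N q) (1 / q) = ennreal (C powr (1 / q)) * ?N"
      using C q0 by (simp add: epowr_mult epowr_ennreal epowr_epowr)
    finally show "D_norm \<mu> \<infinity> (ennreal q) (\<lambda>k x. epowr (T \<delta> ?h k x) (1 / \<tau>)) \<le> ennreal (C powr (1 / q)) * ?N"
      using q0 by (subst D_norm_def) (auto intro!: SUP_least)
  qed
qed

text \<open>Raising to the power \<tau> replaces p and q by p/\<tau> and q/\<tau>, and the strict
  inequalities make both larger than 1, where the maximal inequalities hold even if p and q are
  small.\<close>

lemma T_norm_bound:
  assumes \<delta>: "0 < \<delta>" and \<tau>: "0 < \<tau>" and pq: "ennreal \<tau> < p" "ennreal \<tau> < q"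
  shows "\<exists>C>0. \<forall>g. (\<forall>k. g k \<in> borel_measurable \<mu>) \<longrightarrow>
    D_norm \<mu> p q (\<lambda>k x. epowr (T \<delta> (\<lambda>j y. epowr (g j y) \<tau>) k x) (1 / \<tau>)) \<le> ennreal C * D_norm \<mu> p q g"
proof -
  consider (ii) "p = top" "q = top" | (ir) q' where "p = top" "q = ennreal q'" "\<tau> < q'"
    | (ri) p' where "p = ennreal p'" "\<tau> < p'" "q = top"
    | (rr) p' q' where "p = ennreal p'" "\<tau> < p'" "q = ennreal q'" "\<tau> < q'"
    using pq \<tau> by (cases p; cases q) (auto simp: ennreal_less_iff)
  then show ?thesis
  proof cases
    case ii
    let ?C = "(geom \<delta> * 2) powr (1 / \<tau>)"
    show ?thesis
    proof (intro exI[of _ ?C] conjI allI impI)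
      show "0 < ?C" using geom_pos[OF \<delta>] by simp
      fix g :: "int \<Rightarrow> 'a \<Rightarrow> ennreal" assume "\<forall>k. g k \<in> borel_measurable \<mu>"
      then have [measurable]: "\<And>k. g k \<in> borel_measurable \<mu>" by simp
      let ?h = "\<lambda>j y. epowr (g j y) \<tau>"
      define N where "N = esssup \<mu> (\<lambda>x. lq_norm top (\<lambda>k. g k x))"
      have "AE x in \<mu>. lq_norm top (\<lambda>k. g k x) \<le> N" unfolding N_def by (rule esssup_AE)
      then have "AE x in \<mu>. ?h j x \<le> epowr N \<tau>" for j
      proof (rule eventually_mono)
        fix x assume "lq_norm top (\<lambda>k. g k x) \<le> N"
        then have "g j x \<le> N" using le_lq_norm[of top "\<lambda>k. g k x" j] by simp
        then show "?h j x \<le> epowr N \<tau>" using \<tau> by (intro epowr_mono) auto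
      qed
      then have "AE x in \<mu>. \<forall>k. T \<delta> ?h k x \<le> ennreal (geom \<delta>) * (2 * epowr N \<tau>)"
        by (rule T_le_const[OF \<delta>])
      then have "AE x in \<mu>. lq_norm top (\<lambda>k. epowr (T \<delta> ?h k x) (1 / \<tau>)) \<le> ennreal ?C * N"
      proof (rule eventually_mono)
        fix x assume *: "\<forall>k. T \<delta> ?h k x \<le> ennreal (geom \<delta>) * (2 * epowr N \<tau>)"
        have "epowr (T \<delta> ?h k x) (1 / \<tau>) \<le> epowr (ennreal (geom \<delta> * 2) * epowr N \<tau>) (1 / \<tau>)" for k
          using *[rule_format, of k] \<tau> geom_pos[OF \<delta>]
          by (intro epowr_mono) (auto simp: ennreal_mult mult.assoc)
        also have "epowr (ennreal (geom \<delta> * 2) * epowr N \<tau>) (1 / \<tau>) = ennreal ?C * N"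
          using \<tau> geom_pos[OF \<delta>] by (simp add: epowr_mult epowr_ennreal epowr_epowr)
        finally show "lq_norm top (\<lambda>k. epowr (T \<delta> ?h k x) (1 / \<tau>)) \<le> ennreal ?C * N"
          by (auto simp: lq_norm_def infinity_ennreal_def intro: SUP_least)
      qed
      then have "esssup \<mu> (\<lambda>x. lq_norm top (\<lambda>k. epowr (T \<delta> ?h k x) (1 / \<tau>))) \<le> ennreal ?C * N"
        by (intro esssup_I) auto
      then show "D_norm \<mu> p q (\<lambda>k x. epowr (T \<delta> ?h k x) (1 / \<tau>)) \<le> ennreal ?C * D_norm \<mu> p q g"
        using ii by (simp add: D_norm_def Lp_norm_def N_def infinity_ennreal_def)
    qed
  next
    case ir
    then show ?thesis using T_norm_bound_Carleson[OF \<delta> \<tau>] by (simp add: infinity_ennreal_def)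
  next
    case ri
    then have p: "0 < p'" "1 < p' / \<tau>" using \<tau> by auto
    obtain C where C: "0 < C" "\<And>f. f \<in> borel_measurable \<mu> \<Longrightarrow>
        (\<integral>\<^sup>+ x. epowr (f x + Mx f x) (p' / \<tau>) \<partial>\<mu>) \<le> ennreal C * (\<integral>\<^sup>+ x. epowr (f x) (p' / \<tau>) \<partial>\<mu>)"
      using add_Mx_strong_type[OF p(2)] by auto
    let ?K = "geom \<delta> powr (p' / \<tau>) * C"
    show ?thesis
    proof (intro exI[of _ "?K powr (1 / p')"] conjI allI impI)
      show "0 < ?K powr (1 / p')" using geom_pos[OF \<delta>] C by simp
      fix g :: "int \<Rightarrow> 'a \<Rightarrow> ennreal" assume "\<forall>k. g k \<in> borel_measurable \<mu>"
      then have [measurable]: "\<And>k. g k \<in> borel_measurable \<mu>" by simp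
      let ?h = "\<lambda>j y. epowr (g j y) \<tau>"
      \<comment> \<open>For q infinite the supremum over the scales is taken first: \<open>T\<close>
        is bounded at all scales at once by H and its maximal function, and the scalar theorem with
        exponent p'/\<tau> > 1 finishes.\<close>
      define H where "H y = (SUP j. ?h j y)" for y
      have [measurable]: "H \<in> borel_measurable \<mu>" unfolding H_def[abs_def] by measurable
      have "(\<integral>\<^sup>+ x. epowr (lq_norm top (\<lambda>k. epowr (T \<delta> ?h k x) (1 / \<tau>))) p' \<partial>\<mu>) \<le>
          (\<integral>\<^sup>+ x. ennreal (geom \<delta> powr (p' / \<tau>)) * epowr (H x + Mx H x) (p' / \<tau>) \<partial>\<mu>)"
      proof (intro nn_integral_mono)
        fix x
        have TH: "T \<delta> ?h k x \<le> ennreal (geom \<delta>) * (H x + Mx H x)" for k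
          by (rule T_le_Mx[OF \<delta>]) (auto simp: H_def intro: SUP_upper)
        have "lq_norm top (\<lambda>k. epowr (T \<delta> ?h k x) (1 / \<tau>)) \<le> epowr (ennreal (geom \<delta>) * (H x + Mx H x)) (1 / \<tau>)"
          using \<tau> unfolding lq_norm_def
          by (auto simp: infinity_ennreal_def intro!: SUP_least epowr_mono TH)
        then have "epowr (lq_norm top (\<lambda>k. epowr (T \<delta> ?h k x) (1 / \<tau>))) p' \<le>
          epowr (epowr (ennreal (geom \<delta>) * (H x + Mx H x)) (1 / \<tau>)) p'"
          using p by (intro epowr_mono) auto
        also have "\<dots> = ennreal (geom \<delta> powr (p' / \<tau>)) * epowr (H x + Mx H x) (p' / \<tau>)"
          using geom_pos[OF \<delta>] by (simp add: epowr_epowr epowr_mult epowr_ennreal powr_powr)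
        finally show "epowr (lq_norm top (\<lambda>k. epowr (T \<delta> ?h k x) (1 / \<tau>))) p' \<le> \<dots>" .
      qed
      also have "\<dots> = ennreal (geom \<delta> powr (p' / \<tau>)) * (\<integral>\<^sup>+ x. epowr (H x + Mx H x) (p' / \<tau>) \<partial>\<mu>)"
        by (rule nn_integral_cmult) measurable
      also have "\<dots> \<le> ennreal (geom \<delta> powr (p' / \<tau>)) * (ennreal C * (\<integral>\<^sup>+ x. epowr (H x) (p' / \<tau>) \<partial>\<mu>))"
        by (intro mult_left_mono C) auto
      also have "\<dots> = ennreal ?K * (\<integral>\<^sup>+ x. epowr (lq_norm top (\<lambda>k. g k x)) p' \<partial>\<mu>)"
        using C \<tau> by (simp add: ennreal_mult mult.assoc H_def epowr_SUP[symmetric] epowr_epowr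
          lq_norm_def infinity_ennreal_def)
      finally have "epowr (\<integral>\<^sup>+ x. epowr (lq_norm top (\<lambda>k. epowr (T \<delta> ?h k x) (1 / \<tau>))) p' \<partial>\<mu>) (1 / p') \<le>
          epowr (ennreal ?K * (\<integral>\<^sup>+ x. epowr (lq_norm top (\<lambda>k. g k x)) p' \<partial>\<mu>)) (1 / p')"
        using p by (intro epowr_mono) auto
      also have "\<dots> = ennreal (?K powr (1 / p')) * epowr (\<integral>\<^sup>+ x. epowr (lq_norm top (\<lambda>k. g k x)) p' \<partial>\<mu>) (1 / p')"
        using C by (subst epowr_mult, subst epowr_ennreal) auto
      finally show "D_norm \<mu> p q (\<lambda>k x. epowr (T \<delta> ?h k x) (1 / \<tau>)) \<le> ennreal (?K powr (1 / p')) * D_norm \<mu> p q g"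
        using ri p by (simp add: D_norm_def Lp_norm_def infinity_ennreal_def)
    qed
  next
    case rr
    then have p: "0 < p'" "1 < p' / \<tau>" "0 < q'" "1 < q' / \<tau>" "(p' / \<tau>) / (q' / \<tau>) = p' / q'" using \<tau> by auto
    obtain C where C: "0 < C" "\<And>h. (\<And>j. h j \<in> borel_measurable \<mu>) \<Longrightarrow>
      (\<integral>\<^sup>+ x. epowr (\<integral>\<^sup>+ k. epowr (T \<delta> h k x) (q' / \<tau>) \<partial>count_space UNIV) (p' / q') \<partial>\<mu>) \<le>
      ennreal C * (\<integral>\<^sup>+ x. epowr (\<integral>\<^sup>+ j. epowr (h j x) (q' / \<tau>) \<partial>count_space UNIV) (p' / q') \<partial>\<mu>)"
      using vector_maximal[OF \<delta> p(2,4)] unfolding p(5) by blast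
    show ?thesis
    proof (intro exI[of _ "C powr (1 / p')"] conjI allI impI)
      show "0 < C powr (1 / p')" using C by simp
      fix g :: "int \<Rightarrow> 'a \<Rightarrow> ennreal" assume "\<forall>k. g k \<in> borel_measurable \<mu>"
      then have [measurable]: "\<And>k. g k \<in> borel_measurable \<mu>" by simp
      let ?h = "\<lambda>j y. epowr (g j y) \<tau>"
      have D: "D_norm \<mu> p q a = epowr (\<integral>\<^sup>+ x. epowr (\<integral>\<^sup>+ k. epowr (a k x) q' \<partial>count_space UNIV) (p' / q') \<partial>\<mu>) (1 / p')" for a
        using rr p by (simp add: D_norm_def Lp_norm_def lq_norm_def epowr_epowr)
      have "D_norm \<mu> p q (\<lambda>k x. epowr (T \<delta> ?h k x) (1 / \<tau>)) \<le>
        epowr (ennreal C * (\<integral>\<^sup>+ x. epowr (\<integral>\<^sup>+ j. epowr (?h j x) (q' / \<tau>) \<partial>count_space UNIV) (p' / q') \<partial>\<mu>)) (1 / p')"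
        unfolding D using p \<tau> C(2)[of ?h] by (intro epowr_mono) (auto simp: epowr_epowr)
      also have "\<dots> = ennreal (C powr (1 / p')) * D_norm \<mu> p q g"
        unfolding D using C \<tau> by (simp add: epowr_mult epowr_ennreal epowr_epowr)
      finally show "D_norm \<mu> p q (\<lambda>k x. epowr (T \<delta> ?h k x) (1 / \<tau>)) \<le> ennreal (C powr (1 / p')) * D_norm \<mu> p q g" .
    qed
  qed
qed

text \<open>The index k - 2 is where the pointwise estimates land, because the Poincare inequality
  on a ball of radius 2^-k involves pairs of points up to 4 * 2^-k apart. Two shifts remove
  it.\<close>

lemma D_norm_le_T:
  assumes \<delta>: "0 < \<delta>" and \<tau>: "0 < \<tau>" and pq: "ennreal \<tau> < p" "ennreal \<tau> < q" and K: "0 < K"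
  shows "\<exists>C>0. \<forall>a g. (\<forall>k. a k \<in> borel_measurable \<mu>) \<longrightarrow> (\<forall>k. g k \<in> borel_measurable \<mu>) \<longrightarrow>
    (\<forall>k. AE x in \<mu>. a k x \<le> ennreal K * epowr (T \<delta> (\<lambda>j y. epowr (g j y) \<tau>) (k - 2) x) (1 / \<tau>)) \<longrightarrow>
    D_norm \<mu> p q a \<le> ennreal C * D_norm \<mu> p q g"
proof -
  have pq0: "0 < p" "0 < q" using pq by (auto intro: le_less_trans[OF zero_le])
  obtain C1 where C1: "0 < C1" "\<And>a. D_norm \<mu> p q (\<lambda>k. a (k - 1)) \<le> ennreal C1 * D_norm \<mu> p q a"
    using D_norm_shift[OF pq0] by blast
  obtain C2 where C2: "0 < C2" "\<And>g. (\<And>k. g k \<in> borel_measurable \<mu>) \<Longrightarrow>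
    D_norm \<mu> p q (\<lambda>k x. epowr (T \<delta> (\<lambda>j y. epowr (g j y) \<tau>) k x) (1 / \<tau>)) \<le> ennreal C2 * D_norm \<mu> p q g"
    using T_norm_bound[OF \<delta> \<tau> pq] by blast
  show ?thesis
  proof (intro exI[of _ "K * (C1 * (C1 * C2))"] conjI allI impI)
    show "0 < K * (C1 * (C1 * C2))" using C1 C2 K by simp
    fix a g :: "int \<Rightarrow> 'a \<Rightarrow> ennreal"
    assume "\<forall>k. a k \<in> borel_measurable \<mu>" "\<forall>k. g k \<in> borel_measurable \<mu>"
    then have [measurable]: "\<And>k. a k \<in> borel_measurable \<mu>" "\<And>k. g k \<in> borel_measurable \<mu>" by simp_all
    let ?b = "\<lambda>k x. epowr (T \<delta> (\<lambda>j y. epowr (g j y) \<tau>) k x) (1 / \<tau>)"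
    assume "\<forall>k. AE x in \<mu>. a k x \<le> ennreal K * ?b (k - 2) x"
    then have "D_norm \<mu> p q a \<le> ennreal K * D_norm \<mu> p q (\<lambda>k. ?b (k - 2))"
      by (intro D_norm_le_cmult pq0) auto
    also have "D_norm \<mu> p q (\<lambda>k. ?b (k - 2)) \<le> ennreal C1 * (ennreal C1 * (ennreal C2 * D_norm \<mu> p q g))"
    proof -
      have "D_norm \<mu> p q (\<lambda>k. ?b (k - 2)) \<le> ennreal C1 * D_norm \<mu> p q (\<lambda>k. ?b (k - 1))"
        using C1(2)[of "\<lambda>k. ?b (k - 1)"] by simp
      also have "D_norm \<mu> p q (\<lambda>k. ?b (k - 1)) \<le> ennreal C1 * D_norm \<mu> p q ?b" by (rule C1(2))
      also have "D_norm \<mu> p q ?b \<le> ennreal C2 * D_norm \<mu> p q g" by (rule C2) measurable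
      finally show ?thesis by (simp add: mult_left_mono)
    qed
    finally show "D_norm \<mu> p q a \<le> ennreal (K * (C1 * (C1 * C2))) * D_norm \<mu> p q g"
      using C1 C2 K by (simp add: ennreal_mult mult_left_mono mult.assoc)
  qed
qed

end

section \<open>A Sobolev-Poincare inequality\<close>

context doubling_metric_measure_space
begin

text \<open>\<open>x\<close> in the level set \<open>G \<le> \<lambda> 2\<^sup>i\<^sup>+\<^sup>1\<close> is joined to a point of \<open>G \<le> \<lambda> 2\<^sup>i\<close> at distance less than
  \<open>R \<theta>\<^sup>i (1 - \<theta>)\<close>; such a point exists because the complement of the level set is too small to
  contain the ball of that radius. The radii telescope, so the chain stays inside \<open>B(z, 2R)\<close>.\<close>

lemma Poincare_core:
  fixes u :: "'a \<Rightarrow> real" and G :: "'a \<Rightarrow> ennreal"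
  assumes \<sigma>: "0 < \<sigma>" and \<epsilon>: "0 < \<epsilon>" and p: "p = \<sigma> * n / (n + \<sigma> * \<epsilon>)" and R: "0 < R"
    and \<theta>: "\<theta> = 2 powr (- p / n)" and \<beta>: "\<beta> = 2 powr (p / \<sigma>)"
    and \<kappa>: "\<kappa> = (1 - \<theta>) powr n / (C1 * 4 powr n)"
    and K: "K = 2 * 4 powr \<epsilon> + 3 / (\<beta> - 1)"
    and [measurable]: "G \<in> borel_measurable \<mu>" and E: "E \<in> null_sets \<mu>"
    and hol: "\<And>x y. x \<notin> E \<Longrightarrow> y \<notin> E \<Longrightarrow> dist x y < 4 * R \<Longrightarrow>
      ennreal \<bar>u x - u y\<bar> \<le> ennreal (dist x y powr \<epsilon>) * (G x + G y)"
    and l: "0 < l" and small: "nn_avg \<mu> (ball z (2 * R)) (\<lambda>y. epowr (G y) p) < ennreal (\<kappa> * l powr p)"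
  shows "\<exists>c. \<forall>x\<in>ball z R - E. \<forall>i::nat. G x \<le> ennreal (l * 2 ^ i) \<longrightarrow> \<bar>u x - c\<bar> \<le> K * R powr \<epsilon> * l * \<beta> ^ i"
proof -
  have p0: "0 < p" using \<sigma> \<epsilon> n_pos by (simp add: p add_pos_pos)
  have \<theta>01: "0 < \<theta>" "\<theta> < 1" using p0 n_pos by (auto simp: \<theta> powr_less_one)
  \<comment> \<open>\<theta> solves \<theta>^n = 2^-p. Doubling bounds the measure of a ball of
    radius about R \<theta>^i below by a multiple of 2^(-p i), which is the rate at which
    Chebyshev's inequality makes the sets G > l 2^i shrink.\<close>
  have \<theta>n: "(\<theta> ^ i) powr n = 2 powr (- p * real i)" for i
    using n_pos by (simp add: \<theta> powr_realpow[symmetric] powr_powr)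
  have \<beta>1: "1 < \<beta>" using p0 \<sigma> by (simp add: \<beta>)
  have "p / \<sigma> = n / (n + \<sigma> * \<epsilon>)" using \<sigma> by (simp add: p)
  moreover have "1 - p * \<epsilon> / n = n / (n + \<sigma> * \<epsilon>)"
  proof -
    have "p * \<epsilon> / n = \<sigma> * \<epsilon> / (n + \<sigma> * \<epsilon>)" using n_pos by (simp add: p)
    moreover have "0 < n + \<sigma> * \<epsilon>" using \<sigma> \<epsilon> n_pos by (simp add: add_pos_pos)
    ultimately show ?thesis by (simp add: diff_divide_eq_iff)
  qed
  ultimately have exps: "1 - p * \<epsilon> / n = p / \<sigma>" by simp
  \<comment> \<open>The relation between p and \<sigma> enters here: the gain
    (\<theta>^i)^\<epsilon> from short steps and the growth 2^i of G combine to \<beta>^i with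
    \<beta>^\<sigma> = 2^p, so on the level G ~ l 2^i the power \<sigma> of the bound for u - c
    grows like G^p.\<close>
  have \<theta>\<beta>: "(\<theta> ^ i) powr \<epsilon> * 2 ^ i = \<beta> ^ i" for i
  proof -
    have "(\<theta> ^ i) powr \<epsilon> * 2 ^ i = 2 powr (- p / n * real i * \<epsilon> + real i)"
      by (simp add: \<theta> powr_realpow[symmetric] powr_powr powr_add[symmetric])
    also have "- p / n * real i * \<epsilon> + real i = (1 - p * \<epsilon> / n) * real i" by (simp add: field_simps)
    also have "2 powr \<dots> = \<beta> ^ i" unfolding exps by (simp add: \<beta> powr_realpow[symmetric] powr_powr)
    finally show ?thesis .
  qed
  have \<kappa>0: "0 < \<kappa>" using \<theta>01 C1_gt_1 by (simp add: \<kappa>)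
  \<comment> \<open>The first summand of K pays for the first link of the chain, whose length is
    only known to be below 4R. The second makes K (\<beta> - 1) >= 3, which absorbs each further
    link; 3 = 2 + 1 comes from the levels 2^(i+1) and 2^i at its ends.\<close>
  have "K * (\<beta> - 1) = 2 * 4 powr \<epsilon> * (\<beta> - 1) + 3"
    using \<beta>1 by (simp add: K field_simps)
  then have K0: "2 * 4 powr \<epsilon> \<le> K" "3 \<le> K * (\<beta> - 1)" "0 < K"
    using \<beta>1 by (simp_all add: K add_pos_pos)
  define \<rho> where "\<rho> i = R * \<theta> ^ i * (1 - \<theta>)" for i :: nat
  have \<rho>0: "0 < \<rho> i" for i using R \<theta>01 by (simp add: \<rho>_def)
  have \<rho>R: "\<rho> i \<le> R * \<theta> ^ i" for i using R \<theta>01 by (simp add: \<rho>_def mult_left_le)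
  let ?B2 = "ball z (2 * R)"
  have near: "\<exists>y. dist x y < \<rho> i \<and> y \<notin> E \<and> G y \<le> ennreal (l * 2 ^ i)"
    if sub: "ball x (\<rho> i) \<subseteq> ?B2" for x i
  proof (rule ccontr)
    assume no: "\<not> ?thesis"
    define t where "t = (l * 2 ^ i) powr p"
    have t0: "0 < t" using l by (simp add: t_def)
    have "x \<in> ?B2" by (rule subsetD[OF sub]) (simp add: \<rho>0)
    have "ennreal t * V x (\<rho> i) = (\<integral>\<^sup>+ y\<in>ball x (\<rho> i). ennreal t \<partial>\<mu>)"
      by (simp add: nn_integral_cmult_indicator)
    also have "\<dots> \<le> (\<integral>\<^sup>+ y\<in>?B2. epowr (G y) p \<partial>\<mu>)"
    proof (rule nn_integral_mono_AE, rule eventually_mono[OF AE_not_in[OF E]])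
      fix y assume y: "y \<notin> E"
      show "ennreal t * indicator (ball x (\<rho> i)) y \<le> epowr (G y) p * indicator ?B2 y"
      proof (cases "y \<in> ball x (\<rho> i)")
        case True
        then have "ennreal (l * 2 ^ i) \<le> G y" using no y by (auto simp: not_le less_imp_le)
        then have "epowr (ennreal (l * 2 ^ i)) p \<le> epowr (G y) p" using p0 by (intro epowr_mono) auto
        then show ?thesis using True sub l by (auto simp: epowr_ennreal t_def)
      qed simp
    qed
    also have "\<dots> = nn_avg \<mu> ?B2 (\<lambda>y. epowr (G y) p) * V z (2 * R)"
      using R by (simp add: nn_avg_def ennreal_divide_mult_cancel)
    also have "\<dots> < ennreal (\<kappa> * l powr p) * V z (2 * R)"
      using small R by (intro ennreal_mult_strict_right_mono) auto
    also have "\<dots> \<le> ennreal (\<kappa> * l powr p) * (ennreal (C1 * (4 * R / \<rho> i) powr n) * V x (\<rho> i))"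
    proof (intro mult_left_mono)
      have "V z (2 * R) \<le> V x (4 * R)"
        using \<open>x \<in> ?B2\<close> by (intro V_mono ball_subset_dist) (auto simp: dist_commute)
      moreover have "1 < 4 * R / \<rho> i"
      proof -
        have "R * \<theta> ^ i \<le> R * 1" using R \<theta>01 by (intro mult_left_mono power_le_one) auto
        then have "\<rho> i < 4 * R" using \<rho>R[of i] R by linarith
        then show ?thesis using \<rho>0[of i] by simp
      qed
      ultimately show "V z (2 * R) \<le> ennreal (C1 * (4 * R / \<rho> i) powr n) * V x (\<rho> i)"
        using doubling[of "\<rho> i" "4 * R / \<rho> i" x] \<rho>0[of i] by simp
    qed simp
    also have "\<dots> = ennreal (\<kappa> * l powr p * (C1 * (4 * R / \<rho> i) powr n)) * V x (\<rho> i)"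
      using \<kappa>0 C1_gt_1 by (simp add: ennreal_mult mult.assoc)
    \<comment> \<open>\<kappa> is the constant that makes this an equality, so the strict inequality
      above becomes a contradiction.\<close>
    also have "\<kappa> * l powr p * (C1 * (4 * R / \<rho> i) powr n) = t"
    proof -
      have "4 * R / \<rho> i = 4 / (\<theta> ^ i * (1 - \<theta>))" using R by (simp add: \<rho>_def)
      then have "(4 * R / \<rho> i) powr n = 4 powr n / (2 powr (- p * real i) * (1 - \<theta>) powr n)"
        using \<theta>01 by (simp add: powr_divide powr_mult \<theta>n)
      then have "\<kappa> * l powr p * (C1 * (4 * R / \<rho> i) powr n) = l powr p * 2 powr (p * real i)"
        using \<theta>01 C1_gt_1 by (simp add: \<kappa> powr_minus field_simps)
      also have "\<dots> = t"
        using l by (simp add: t_def powr_mult powr_realpow[symmetric] powr_powr mult.commute)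
      finally show ?thesis .
    qed
    finally show False by simp
  qed
  have "ball z (\<rho> 0) \<subseteq> ?B2" using \<rho>R[of 0] R by (intro subset_ball) auto
  from near[OF this] obtain x0 where x0: "dist z x0 < \<rho> 0" "x0 \<notin> E" "G x0 \<le> ennreal l" by auto
  define c where "c = u x0"
  have diff: "\<bar>u x - u y\<bar> \<le> r powr \<epsilon> * (a + b)"
    if "x \<notin> E" "y \<notin> E" "dist x y \<le> r" "dist x y < 4 * R" "G x \<le> ennreal a" "G y \<le> ennreal b" "0 \<le> a" "0 \<le> b" for x y a b r
  proof -
    have "ennreal \<bar>u x - u y\<bar> \<le> ennreal (dist x y powr \<epsilon>) * (G x + G y)" using that by (intro hol)
    also have "\<dots> \<le> ennreal (r powr \<epsilon>) * (ennreal a + ennreal b)"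
      using that \<epsilon> by (intro mult_mono add_mono ennreal_leI powr_mono2) auto
    also have "\<dots> = ennreal (r powr \<epsilon> * (a + b))" using that by (simp add: ennreal_mult)
    finally show ?thesis using that by (subst (asm) ennreal_le_iff) auto
  qed
  have chain: "\<bar>u x - c\<bar> \<le> K * R powr \<epsilon> * l * \<beta> ^ i"
    if "x \<notin> E" "dist z x < R * (1 + \<theta> ^ i)" "G x \<le> ennreal (l * 2 ^ i)" for x i
    using that
  proof (induction i arbitrary: x)
    case 0
    have "dist x x0 < 4 * R"
      using 0 x0 \<rho>R[of 0] dist_triangle[of x x0 z] R by (simp add: dist_commute)
    then have "\<bar>u x - u x0\<bar> \<le> (4 * R) powr \<epsilon> * (l + l)"
      using 0 x0 l by (intro diff) auto
    also have "\<dots> = 2 * 4 powr \<epsilon> * R powr \<epsilon> * l" using R by (simp add: powr_mult)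
    also have "\<dots> \<le> K * R powr \<epsilon> * l" using K0 l by (intro mult_right_mono) auto
    finally show ?case by (simp add: c_def)
  next
    case (Suc i)
    have "ball x (\<rho> i) \<subseteq> ball z (R * (1 + \<theta> ^ i))"
      using Suc.prems by (intro ball_subset_dist) (auto simp: \<rho>_def dist_commute algebra_simps)
    moreover have "\<theta> ^ i \<le> 1" using \<theta>01 by (intro power_le_one) auto
    then have "ball z (R * (1 + \<theta> ^ i)) \<subseteq> ?B2" using R by (intro subset_ball) auto
    ultimately obtain y where y: "dist x y < \<rho> i" "y \<notin> E" "G y \<le> ennreal (l * 2 ^ i)"
      using near[of x i] by blast
    have "y \<in> ball z (R * (1 + \<theta> ^ i))" using y \<open>ball x (\<rho> i) \<subseteq> ball z (R * (1 + \<theta> ^ i))\<close> by auto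
    then have 1: "\<bar>u y - c\<bar> \<le> K * R powr \<epsilon> * l * \<beta> ^ i" using y by (intro Suc.IH) auto
    have d: "dist x y \<le> R * \<theta> ^ i" using y \<rho>R[of i] by simp
    moreover have "R * \<theta> ^ i < 4 * R" using \<open>\<theta> ^ i \<le> 1\<close> R by (simp add: mult_less_cancel_left1 less_le_trans)
    ultimately have "\<bar>u x - u y\<bar> \<le> (R * \<theta> ^ i) powr \<epsilon> * (l * 2 ^ Suc i + l * 2 ^ i)"
      using Suc.prems y l by (intro diff) auto
    also have "\<dots> = 3 * R powr \<epsilon> * l * ((\<theta> ^ i) powr \<epsilon> * 2 ^ i)"
      using R \<theta>01 by (simp add: powr_mult algebra_simps)
    also have "\<dots> \<le> K * (\<beta> - 1) * R powr \<epsilon> * l * \<beta> ^ i"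
      unfolding \<theta>\<beta> using K0 l \<beta>1 by (intro mult_right_mono) auto
    finally have "\<bar>u x - c\<bar> \<le> K * (\<beta> - 1) * R powr \<epsilon> * l * \<beta> ^ i + K * R powr \<epsilon> * l * \<beta> ^ i"
      using 1 by linarith
    then show ?case by (simp add: algebra_simps)
  qed
  show ?thesis
  proof (intro exI[of _ c] ballI allI impI chain)
    fix x i assume "x \<in> ball z R - E"
    moreover have "R \<le> R * (1 + \<theta> ^ i)" using R \<theta>01 by simp
    ultimately show "dist z x < R * (1 + \<theta> ^ i)" by auto
  qed auto
qed

text \<open>The level bounds add up to a pointwise estimate of |u - c|^\<sigma> by a multiple of 1 +
  l^-p G^p, which is averaged. The parameter l is then taken so that \<kappa> l^p is comparable to
  the average of G^p, which makes both terms of the same size.\<close>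

lemma Poincare:
  assumes \<sigma>: "0 < \<sigma>" and \<epsilon>: "0 < \<epsilon>" and p: "p = \<sigma> * n / (n + \<sigma> * \<epsilon>)"
  shows "\<exists>C>0. \<forall>(u :: 'a \<Rightarrow> real) G E z R. 0 < R \<longrightarrow> G \<in> borel_measurable \<mu> \<longrightarrow> E \<in> null_sets \<mu> \<longrightarrow>
    (\<forall>x y. x \<notin> E \<longrightarrow> y \<notin> E \<longrightarrow> dist x y < 4 * R \<longrightarrow>
      ennreal \<bar>u x - u y\<bar> \<le> ennreal (dist x y powr \<epsilon>) * (G x + G y)) \<longrightarrow>
    (INF c. nn_avg \<mu> (ball z R) (\<lambda>y. ennreal (\<bar>u y - c\<bar> powr \<sigma>))) \<le>
      ennreal (C * R powr (\<epsilon> * \<sigma>)) * epowr (nn_avg \<mu> (ball z (2 * R)) (\<lambda>y. epowr (G y) p)) (\<sigma> / p)"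
proof -
  have p0: "0 < p" using \<sigma> \<epsilon> n_pos by (simp add: p add_pos_pos)
  define \<theta> where "\<theta> = 2 powr (- p / n)"
  define \<beta> where "\<beta> = 2 powr (p / \<sigma>)"
  define \<kappa> where "\<kappa> = (1 - \<theta>) powr n / (C1 * 4 powr n)"
  define K where "K = 2 * 4 powr \<epsilon> + 3 / (\<beta> - 1)"
  have \<theta>01: "0 < \<theta>" "\<theta> < 1" using p0 n_pos by (auto simp: \<theta>_def powr_less_one)
  have \<beta>1: "1 < \<beta>" using p0 \<sigma> by (simp add: \<beta>_def)
  have \<beta>\<sigma>: "\<beta> powr \<sigma> = 2 powr p" using \<sigma> by (simp add: \<beta>_def powr_powr)
  have \<kappa>0: "0 < \<kappa>" using \<theta>01 C1_gt_1 by (simp add: \<kappa>_def)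
  have K0: "0 < K" using \<beta>1 by (simp add: K_def add_pos_pos)
  define C where "C = (K * \<beta>) powr \<sigma> * (1 + Dbl * \<kappa>)"
  have C0: "0 < C" using K0 \<beta>1 Dbl_pos \<kappa>0 by (simp add: C_def add_pos_pos)
  show ?thesis
  proof (intro exI[of _ "C * (2 / \<kappa>) powr (\<sigma> / p)"] conjI allI impI)
    show "0 < C * (2 / \<kappa>) powr (\<sigma> / p)" using C0 \<kappa>0 by simp
    fix u :: "'a \<Rightarrow> real" and G E z R
    assume R: "0 < R" and [measurable]: "G \<in> borel_measurable \<mu>" and E: "E \<in> null_sets \<mu>"
      and hol: "\<forall>x y. x \<notin> E \<longrightarrow> y \<notin> E \<longrightarrow> dist x y < 4 * R \<longrightarrow>
        ennreal \<bar>u x - u y\<bar> \<le> ennreal (dist x y powr \<epsilon>) * (G x + G y)"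
    let ?I = "INF c. nn_avg \<mu> (ball z R) (\<lambda>y. ennreal (\<bar>u y - c\<bar> powr \<sigma>))"
    let ?W = "nn_avg \<mu> (ball z (2 * R)) (\<lambda>y. epowr (G y) p)"
    have bound: "?I \<le> ennreal (C * R powr (\<epsilon> * \<sigma>) * l powr \<sigma>)"
      if l: "0 < l" and small: "?W < ennreal (\<kappa> * l powr p)" for l
    proof -
      have "\<exists>c. \<forall>x\<in>ball z R - E. \<forall>i::nat. G x \<le> ennreal (l * 2 ^ i) \<longrightarrow>
          \<bar>u x - c\<bar> \<le> K * R powr \<epsilon> * l * \<beta> ^ i"
        by (rule Poincare_core[OF \<sigma> \<epsilon> p R \<theta>_def \<beta>_def \<kappa>_def K_def _ E _ l small]) (use hol in simp_all)
      then obtain c where c: "\<And>x i. x \<in> ball z R - E \<Longrightarrow> G x \<le> ennreal (l * 2 ^ i) \<Longrightarrow>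
          \<bar>u x - c\<bar> \<le> K * R powr \<epsilon> * l * \<beta> ^ i" by metis
      define A where "A = (K * R powr \<epsilon> * l * \<beta>) powr \<sigma>"
      have pt: "ennreal (\<bar>u x - c\<bar> powr \<sigma>) \<le> ennreal A * (1 + ennreal (l powr (- p)) * epowr (G x) p)"
        if x: "x \<in> ball z R - E" for x
      proof (cases "G x")
        case top
        have "A \<noteq> 0" using K0 R l \<beta>1 by (simp add: A_def)
        moreover have "0 \<le> A" by (simp add: A_def)
        ultimately show ?thesis using top l by (simp add: ennreal_mult_top)
      next
        case (real g)
        have ex: "\<exists>i. g \<le> l * 2 ^ i"
        proof -
          obtain i where "g / l < 2 ^ i" using real_arch_pow[of 2 "g / l"] by auto
          then show ?thesis using l by (intro exI[of _ i]) (simp add: field_simps)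
        qed
        define i where "i = (LEAST i. g \<le> l * 2 ^ i)"
        have i: "g \<le> l * 2 ^ i" unfolding i_def by (rule LeastI_ex[OF ex])
        have "\<bar>u x - c\<bar> powr \<sigma> \<le> (K * R powr \<epsilon> * l * \<beta> ^ i) powr \<sigma>"
          using c[OF x, of i] i real \<sigma> by (intro powr_mono2) (auto intro: ennreal_leI)
        also have "\<dots> \<le> A * (1 + l powr (- p) * g powr p)"
        proof (cases i)
          case 0
          have "(K * R powr \<epsilon> * l * \<beta> ^ i) powr \<sigma> \<le> A"
            unfolding A_def 0 using K0 R l \<beta>1 \<sigma> by (intro powr_mono2) auto
          also have "\<dots> * 1 \<le> A * (1 + l powr (- p) * g powr p)"
            by (intro mult_left_mono) (auto simp: A_def)
          finally show ?thesis by simp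
        next
          case (Suc m)
          have "\<not> g \<le> l * 2 ^ m" using not_less_Least[of m "\<lambda>i. g \<le> l * 2 ^ i"] Suc by (simp add: i_def)
          then have "2 ^ m \<le> g / l" using l by (simp add: field_simps)
          then have "(2 ^ m) powr p \<le> (g / l) powr p" using p0 by (intro powr_mono2) auto
          also have "\<dots> = l powr (- p) * g powr p"
            using l real by (simp add: powr_divide powr_minus field_simps)
          finally have gm: "(2 ^ m) powr p \<le> l powr (- p) * g powr p" .
          have "(K * R powr \<epsilon> * l * \<beta> ^ i) powr \<sigma> = A * (\<beta> powr \<sigma>) ^ m"
            using K0 R l \<beta>1 by (simp add: A_def Suc powr_mult powr_power mult.assoc powr_realpow[symmetric] powr_powr mult.commute[of _ \<sigma>])
          also have "(\<beta> powr \<sigma>) ^ m = (2 ^ m) powr p"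
            unfolding \<beta>\<sigma> by (simp add: powr_realpow[symmetric] powr_powr mult.commute)
          also have "A * (2 ^ m) powr p \<le> A * (1 + l powr (- p) * g powr p)"
            using gm by (intro mult_left_mono) (auto simp: A_def)
          finally show ?thesis .
        qed
        finally have "ennreal (\<bar>u x - c\<bar> powr \<sigma>) \<le> ennreal (A * (1 + l powr (- p) * g powr p))"
          by (rule ennreal_leI)
        also have "\<dots> = ennreal A * (1 + ennreal (l powr (- p)) * epowr (G x) p)"
          using real by (simp add: epowr_ennreal ennreal_mult A_def)
        finally show ?thesis .
      qed
      have "?I \<le> nn_avg \<mu> (ball z R) (\<lambda>y. ennreal (\<bar>u y - c\<bar> powr \<sigma>))" by (rule INF_lower) simp
      also have "\<dots> \<le> nn_avg \<mu> (ball z R) (\<lambda>x. ennreal A * (1 + ennreal (l powr (- p)) * epowr (G x) p))"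
        unfolding nn_avg_def
        by (intro divide_right_mono_ennreal nn_integral_mono_AE eventually_mono[OF AE_not_in[OF E]])
          (auto split: split_indicator intro!: pt)
      also have "\<dots> = ennreal A * (1 + ennreal (l powr (- p)) * nn_avg \<mu> (ball z R) (\<lambda>x. epowr (G x) p))"
        using R by (simp add: nn_avg_cmult nn_avg_add nn_avg_const)
      also have "\<dots> \<le> ennreal A * (1 + ennreal (l powr (- p)) * (ennreal Dbl * ennreal (\<kappa> * l powr p)))"
      proof -
        have "nn_avg \<mu> (ball z R) (\<lambda>x. epowr (G x) p) \<le> ennreal Dbl * ?W"
          using R V_double[OF R, of z] Dbl_pos by (intro nn_avg_le_subset) (auto intro!: subset_ball)
        also have "\<dots> \<le> ennreal Dbl * ennreal (\<kappa> * l powr p)"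
          using small by (intro mult_left_mono) auto
        finally show ?thesis by (intro mult_left_mono add_left_mono) auto
      qed
      also have "\<dots> = ennreal (A * (1 + l powr (- p) * (Dbl * (\<kappa> * l powr p))))"
        using Dbl_pos \<kappa>0 by (simp add: ennreal_mult A_def)
      also have "A * (1 + l powr (- p) * (Dbl * (\<kappa> * l powr p))) = C * R powr (\<epsilon> * \<sigma>) * l powr \<sigma>"
        using l R K0 \<beta>1 by (simp add: A_def C_def powr_minus powr_mult powr_powr field_simps)
      finally show ?thesis .
    qed
    show "?I \<le> ennreal (C * (2 / \<kappa>) powr (\<sigma> / p) * R powr (\<epsilon> * \<sigma>)) * epowr ?W (\<sigma> / p)"
    proof (cases ?W)
      case top
      have "0 < C * (2 / \<kappa>) powr (\<sigma> / p) * R powr (\<epsilon> * \<sigma>)" using C0 \<kappa>0 R by simp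
      then show ?thesis using top C0 \<kappa>0 R by (simp add: ennreal_mult_top)
    next
      case (real w)
      show ?thesis
      proof (cases "w = 0")
        case True
        \<comment> \<open>If the average of G^p vanishes, every l > 0 is admissible, and l is chosen
          small enough for the bound to equal e.\<close>
        have "?I \<le> 0 + ennreal e" if e: "0 < e" for e
        proof -
          define l where "l = (e / (C * R powr (\<epsilon> * \<sigma>))) powr (1 / \<sigma>)"
          have l: "0 < l" using e C0 R by (simp add: l_def)
          have "?W < ennreal (\<kappa> * l powr p)" using True real l \<kappa>0 by simp
          from bound[OF l this] have "?I \<le> ennreal (C * R powr (\<epsilon> * \<sigma>) * l powr \<sigma>)" .
          also have "C * R powr (\<epsilon> * \<sigma>) * l powr \<sigma> = e"
            using \<sigma> e C0 R by (simp add: l_def powr_powr)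
          finally show ?thesis by simp
        qed
        then have "?I \<le> 0" by (rule ennreal_le_epsilon)
        then show ?thesis by simp
      next
        case False
        then have w: "0 < w" using real by simp
        \<comment> \<open>The factor 2 provides the strict inequality that the bound asks
          for.\<close>
        define l where "l = (2 * w / \<kappa>) powr (1 / p)"
        have l: "0 < l" using w \<kappa>0 by (simp add: l_def)
        have "\<kappa> * l powr p = 2 * w" using p0 w \<kappa>0 by (simp add: l_def powr_powr)
        then have "?W < ennreal (\<kappa> * l powr p)" using real w by (simp add: ennreal_less_iff)
        from bound[OF l this] have "?I \<le> ennreal (C * R powr (\<epsilon> * \<sigma>) * l powr \<sigma>)" .
        also have "l powr \<sigma> = (2 / \<kappa>) powr (\<sigma> / p) * w powr (\<sigma> / p)"
        proof -
          have "l powr \<sigma> = ((2 / \<kappa>) * w) powr (\<sigma> / p)" by (simp add: l_def powr_powr)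
          also have "\<dots> = (2 / \<kappa>) powr (\<sigma> / p) * w powr (\<sigma> / p)" using w \<kappa>0 by (subst powr_mult) auto
          finally show ?thesis .
        qed
        also have "ennreal (C * R powr (\<epsilon> * \<sigma>) * ((2 / \<kappa>) powr (\<sigma> / p) * w powr (\<sigma> / p)))
          = ennreal (C * (2 / \<kappa>) powr (\<sigma> / p) * R powr (\<epsilon> * \<sigma>)) * epowr ?W (\<sigma> / p)"
          using real C0 by (simp add: epowr_ennreal ennreal_mult[symmetric] mult_ac)
        finally show ?thesis .
      qed
    qed
  qed
qed

end

section \<open>Pointwise estimates for oscillations\<close>

lemma rad_nonzero [simp]: "rad k \<noteq> 0"
  by (simp add: rad_def)

lemma dyadic_annulus:
  assumes "0 < d"
  obtains j where "rad (j + 1) \<le> d" "d < rad j"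
proof -
  define j where "j = - \<lfloor>log 2 d\<rfloor> - 1"
  have "- of_int (j + 1) \<le> log 2 d" "log 2 d < - of_int j" unfolding j_def by linarith+
  then show ?thesis
    using assms that[of j] by (simp_all add: rad_def le_log_iff log_less_iff)
qed

lemma rad_le_imp: "rad (j + 1) < rad k \<Longrightarrow> k \<le> j"
  by (rule ccontr) (use rad_mono[of "j + 1" k] in auto)

lemma wgt_shift: "wgt \<delta> k j \<le> ennreal (2 powr \<delta>) * wgt \<delta> (k - 1) j"
proof -
  have "real_of_int (k - j) * \<delta> = \<delta> + real_of_int (k - 1 - j) * \<delta>" by (simp add: algebra_simps)
  then show ?thesis
    by (auto simp: wgt_def ennreal_mult[symmetric] powr_add[symmetric])
qed

lemma epowr_wgt: "epowr (wgt \<delta> k j) \<tau> = wgt (\<delta> * \<tau>) k j"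
  by (auto simp: wgt_def epowr_ennreal powr_powr mult.assoc)

lemma hajlasz_gradients_estimate:
  assumes g: "g \<in> hajlasz_gradients \<mu> s u"
  obtains E where "E \<in> null_sets \<mu>"
    "\<And>x y j. x \<notin> E \<Longrightarrow> y \<notin> E \<Longrightarrow> rad (j + 1) \<le> dist x y \<Longrightarrow> dist x y < rad j \<Longrightarrow>
      \<bar>u x - u y\<bar> \<le> dist x y powr s * (g j x + g j y)"
proof -
  obtain E where E: "E \<in> null_sets \<mu>" "\<forall>k. \<forall>x\<in>-E. \<forall>y\<in>-E.
      2 powi (-k - 1) \<le> dist x y \<and> dist x y < 2 powi (-k) \<longrightarrow>
      \<bar>u x - u y\<bar> \<le> dist x y powr s * (g k x + g k y)"
    using g by (auto simp: hajlasz_gradients_def)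
  have "2 powi (- k - 1) = rad (k + 1)" for k using rad_powi[of "k + 1"] by simp
  then show ?thesis using E by (intro that[of E]) (auto simp: rad_powi)
qed

context doubling_metric_measure_space
begin

lemma Av_shift: "Av k f x \<le> ennreal Dbl * Av (k - 1) f x"
  unfolding Av_def by (rule nn_avg_rad_le)

lemma T_shift: "T \<delta> h k x \<le> ennreal (2 powr \<delta> * Dbl) * T \<delta> h (k - 1) x"
proof -
  have "T \<delta> h k x \<le> (\<integral>\<^sup>+ j. ennreal (2 powr \<delta> * Dbl) * (wgt \<delta> (k - 1) j * Aop (k - 1) (h j) x) \<partial>count_space UNIV)"
    unfolding T_def
  proof (intro nn_integral_mono)
    fix j
    have "1 * h j x \<le> ennreal Dbl * h j x" using Dbl_ge_1 by (intro mult_right_mono) (auto simp: ennreal_ge_1)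
    then have "Aop k (h j) x \<le> ennreal Dbl * Aop (k - 1) (h j) x"
      unfolding Aop_def distrib_left by (intro add_mono Av_shift) simp
    then have "wgt \<delta> k j * Aop k (h j) x \<le> (ennreal (2 powr \<delta>) * wgt \<delta> (k - 1) j) * (ennreal Dbl * Aop (k - 1) (h j) x)"
      by (intro mult_mono wgt_shift) auto
    then show "wgt \<delta> k j * Aop k (h j) x \<le> ennreal (2 powr \<delta> * Dbl) * (wgt \<delta> (k - 1) j * Aop (k - 1) (h j) x)"
      using Dbl_pos by (simp add: ennreal_mult mult_ac)
  qed
  then show ?thesis by (simp add: nn_integral_cmult T_def)
qed

lemma epowr_T_shift:
  assumes \<tau>: "0 < \<tau>"
  shows "epowr (T \<delta> h k x) (1 / \<tau>) \<le> ennreal ((2 powr \<delta> * Dbl) powr (1 / \<tau>)) * epowr (T \<delta> h (k - 1) x) (1 / \<tau>)"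
proof -
  have "epowr (T \<delta> h k x) (1 / \<tau>) \<le> epowr (ennreal (2 powr \<delta> * Dbl) * T \<delta> h (k - 1) x) (1 / \<tau>)"
    using \<tau> by (intro epowr_mono T_shift) auto
  then show ?thesis using Dbl_pos by (simp add: epowr_mult epowr_ennreal)
qed

text \<open>For \<tau> <= 1 the sum is at most its \<tau>-quasi-norm. As \<tau> may be chosen below
  p and q, sums over scales are thereby bounded even for p, q <= 1. The summand f x of
  \<open>Aop\<close> is the one that is used.\<close>

lemma Hardy_le_T:
  assumes \<tau>: "0 < \<tau>" "\<tau> \<le> 1"
  shows "(\<integral>\<^sup>+ j. wgt s k j * a j x \<partial>count_space UNIV) \<le> epowr (T (s * \<tau>) (\<lambda>j y. epowr (a j y) \<tau>) k x) (1 / \<tau>)"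
proof -
  have "(\<integral>\<^sup>+ j. wgt s k j * a j x \<partial>count_space UNIV) \<le>
      epowr (\<integral>\<^sup>+ j. epowr (wgt s k j * a j x) \<tau> \<partial>count_space UNIV) (1 / \<tau>)"
    by (rule nn_integral_count_space_le_epowr[OF \<tau>])
  also have "\<dots> \<le> epowr (T (s * \<tau>) (\<lambda>j y. epowr (a j y) \<tau>) k x) (1 / \<tau>)"
    unfolding T_def using \<tau>
    by (intro epowr_mono nn_integral_mono) (auto simp: epowr_mult epowr_wgt Aop_def intro!: mult_left_mono)
  finally show ?thesis .
qed

text \<open>On the annulus of scale j the factor d^s is at most d^\<epsilon> 2^(-j(s-\<epsilon>)).
  The sacrificed smoothness s - \<epsilon> becomes a decaying weight, and the whole sequence of
  gradients becomes a single function G to which the Poincare inequality of order \<epsilon>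
  applies.\<close>

lemma I_osc_le_T:
  assumes s: "0 < s" and \<sigma>: "0 < \<sigma>" and \<epsilon>: "0 < \<epsilon>" "\<epsilon> < s" and p: "p = \<sigma> * n / (n + \<sigma> * \<epsilon>)"
  shows "\<exists>K>0. \<forall>u. \<forall>g\<in>hajlasz_gradients \<mu> s u. \<forall>k x. I_osc \<mu> s \<sigma> u x (rad k) \<le>
    ennreal K * epowr (T ((s - \<epsilon>) * p) (\<lambda>j y. epowr (ennreal (g j y)) p) (k - 2) x) (1 / p)"
proof -
  have p0: "0 < p" using \<sigma> \<epsilon> n_pos by (simp add: p add_pos_pos)
  define \<delta> where "\<delta> = (s - \<epsilon>) * p"
  obtain C where C: "0 < C" "\<And>(u :: 'a \<Rightarrow> real) G E z R. 0 < R \<Longrightarrow> G \<in> borel_measurable \<mu> \<Longrightarrow> E \<in> null_sets \<mu> \<Longrightarrow>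
    (\<And>x y. x \<notin> E \<Longrightarrow> y \<notin> E \<Longrightarrow> dist x y < 4 * R \<Longrightarrow>
      ennreal \<bar>u x - u y\<bar> \<le> ennreal (dist x y powr \<epsilon>) * (G x + G y)) \<Longrightarrow>
    (INF c. nn_avg \<mu> (ball z R) (\<lambda>y. ennreal (\<bar>u y - c\<bar> powr \<sigma>))) \<le>
      ennreal (C * R powr (\<epsilon> * \<sigma>)) * epowr (nn_avg \<mu> (ball z (2 * R)) (\<lambda>y. epowr (G y) p)) (\<sigma> / p)"
    using Poincare[OF \<sigma> \<epsilon>(1) p] by blast
  define K where "K = C powr (1 / \<sigma>) * (2 powr (2 * \<delta>) * Dbl) powr (1 / p)"
  have K0: "0 < K" using C Dbl_pos by (simp add: K_def)
  show ?thesis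
  proof (intro exI[of _ K] conjI ballI allI)
    show "0 < K" by fact
    fix u g k x assume g: "g \<in> hajlasz_gradients \<mu> s u"
    then have [measurable]: "\<And>k. g k \<in> borel_measurable \<mu>" and g0: "\<And>k x. 0 \<le> g k x"
      by (auto simp: hajlasz_gradients_def)
    obtain E where E: "E \<in> null_sets \<mu>" and grad:
      "\<And>x y j. x \<notin> E \<Longrightarrow> y \<notin> E \<Longrightarrow> rad (j + 1) \<le> dist x y \<Longrightarrow> dist x y < rad j \<Longrightarrow>
        \<bar>u x - u y\<bar> \<le> dist x y powr s * (g j x + g j y)"
      using hajlasz_gradients_estimate[OF g] by blast
    define G where "G y = (SUP j\<in>{k - 2..}. ennreal (rad j powr (s - \<epsilon>) * g j y))" for y
    have [measurable]: "G \<in> borel_measurable \<mu>" unfolding G_def[abs_def] by measurable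
    let ?h = "\<lambda>j y. epowr (ennreal (g j y)) p"
    let ?W = "nn_avg \<mu> (ball x (2 * rad k)) (\<lambda>y. epowr (G y) p)"
    have hol: "ennreal \<bar>u x - u y\<bar> \<le> ennreal (dist x y powr \<epsilon>) * (G x + G y)"
      if xy: "x \<notin> E" "y \<notin> E" "dist x y < 4 * rad k" for x y
    proof (cases "x = y")
      case False
      then obtain j where j: "rad (j + 1) \<le> dist x y" "dist x y < rad j"
        using dyadic_annulus[of "dist x y"] by auto
      \<comment> \<open>Pairs closer than 4 * 2^-k involve no annulus of a scale coarser than k - 2,
        hence the range of the supremum in G.\<close>
      have "rad (k - 2) = 4 * rad k" by (simp add: rad_def powr_diff powr_minus field_simps)
      then have kj: "k - 2 \<le> j" using j xy by (intro rad_le_imp) simp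
      have "\<bar>u x - u y\<bar> \<le> dist x y powr s * (g j x + g j y)" using j xy by (intro grad)
      also have "dist x y powr s = dist x y powr \<epsilon> * dist x y powr (s - \<epsilon>)"
        by (simp add: powr_add[symmetric])
      also have "dist x y powr \<epsilon> * dist x y powr (s - \<epsilon>) * (g j x + g j y) \<le>
          dist x y powr \<epsilon> * rad j powr (s - \<epsilon>) * (g j x + g j y)"
        using j \<epsilon> g0 by (intro mult_right_mono mult_left_mono powr_mono2 add_nonneg_nonneg) auto
      finally have "ennreal \<bar>u x - u y\<bar> \<le> ennreal (dist x y powr \<epsilon> * (rad j powr (s - \<epsilon>) * g j x + rad j powr (s - \<epsilon>) * g j y))"
        by (intro ennreal_leI) (simp add: algebra_simps)
      also have "\<dots> = ennreal (dist x y powr \<epsilon>) * (ennreal (rad j powr (s - \<epsilon>) * g j x) + ennreal (rad j powr (s - \<epsilon>) * g j y))"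
        using g0 by (simp add: ennreal_mult)
      also have "\<dots> \<le> ennreal (dist x y powr \<epsilon>) * (G x + G y)"
        unfolding G_def using kj by (intro mult_left_mono add_mono SUP_upper) auto
      finally show ?thesis .
    qed simp
    have I: "(INF c. nn_avg \<mu> (ball x (rad k)) (\<lambda>y. ennreal (\<bar>u y - c\<bar> powr \<sigma>))) \<le>
      ennreal (C * rad k powr (\<epsilon> * \<sigma>)) * epowr ?W (\<sigma> / p)"
      using E hol by (intro C(2)[where E = E]) auto
    have W: "?W \<le> ennreal (rad k powr \<delta>) * (ennreal (2 powr (2 * \<delta>) * Dbl) * T \<delta> ?h (k - 2) x)"
    proof -
      have "?W \<le> nn_avg \<mu> (ball x (rad (k - 1))) (\<lambda>y. \<integral>\<^sup>+ j. ennreal (rad k powr \<delta> * 2 powr (2 * \<delta>)) * wgt \<delta> (k - 2) j * ?h j y \<partial>count_space UNIV)"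
        unfolding rad_1(2)
      proof (rule nn_avg_mono)
        fix y
        have "epowr (G y) p = (SUP j\<in>{k - 2..}. epowr (ennreal (rad j powr (s - \<epsilon>) * g j y)) p)"
          unfolding G_def by (rule epowr_SUP[OF p0])
        \<comment> \<open>The supremum may be replaced by the sum over j, since the positive
          exponent \<delta> supplies geometric weights.\<close>
        also have "\<dots> \<le> (\<integral>\<^sup>+ j. ennreal (rad k powr \<delta> * 2 powr (2 * \<delta>)) * wgt \<delta> (k - 2) j * ?h j y \<partial>count_space UNIV)"
        proof (rule SUP_least)
          fix j assume j: "j \<in> {k - 2..}"
          have "real_of_int (k - 2 - j) * \<delta> + (2 * \<delta> + - real_of_int k * \<delta>) = - real_of_int j * \<delta>" by (simp add: algebra_simps)
          then have "rad j powr \<delta> = rad k powr \<delta> * 2 powr (2 * \<delta>) * 2 powr (of_int (k - 2 - j) * \<delta>)"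
            by (simp add: rad_powr powr_add[symmetric] add_ac)
          then have "epowr (ennreal (rad j powr (s - \<epsilon>) * g j y)) p = ennreal (rad k powr \<delta> * 2 powr (2 * \<delta>)) * wgt \<delta> (k - 2) j * ?h j y"
            using j g0 by (simp add: epowr_mult ennreal_mult epowr_ennreal powr_powr \<delta>_def[symmetric] wgt_def)
          also have "\<dots> \<le> (\<integral>\<^sup>+ j. ennreal (rad k powr \<delta> * 2 powr (2 * \<delta>)) * wgt \<delta> (k - 2) j * ?h j y \<partial>count_space UNIV)"
            by (rule nn_integral_ge_point) simp
          finally show "epowr (ennreal (rad j powr (s - \<epsilon>) * g j y)) p \<le> \<dots>" .
        qed
        finally show "epowr (G y) p \<le> (\<integral>\<^sup>+ j. ennreal (rad k powr \<delta> * 2 powr (2 * \<delta>)) * wgt \<delta> (k - 2) j * ?h j y \<partial>count_space UNIV)" .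
      qed
      also have "\<dots> = (\<integral>\<^sup>+ j. ennreal (rad k powr \<delta> * 2 powr (2 * \<delta>)) * (wgt \<delta> (k - 2) j * Av (k - 1) (?h j) x) \<partial>count_space UNIV)"
        by (subst nn_avg_sum) (auto simp: nn_avg_cmult Av_def mult.assoc)
      also have "\<dots> \<le> (\<integral>\<^sup>+ j. ennreal (rad k powr \<delta> * 2 powr (2 * \<delta>)) * (wgt \<delta> (k - 2) j * (ennreal Dbl * Aop (k - 2) (?h j) x)) \<partial>count_space UNIV)"
      proof (intro nn_integral_mono mult_left_mono)
        fix j
        have "Av (k - 1) (?h j) x \<le> ennreal Dbl * Av (k - 2) (?h j) x" using Av_shift[of "k - 1"] by simp
        also have "\<dots> \<le> ennreal Dbl * Aop (k - 2) (?h j) x" by (intro mult_left_mono) (auto simp: Aop_def)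
        finally show "Av (k - 1) (?h j) x \<le> \<dots>" .
      qed auto
      also have "\<dots> = (\<integral>\<^sup>+ j. ennreal (rad k powr \<delta>) * ennreal (2 powr (2 * \<delta>) * Dbl) * (wgt \<delta> (k - 2) j * Aop (k - 2) (?h j) x) \<partial>count_space UNIV)"
        using Dbl_pos by (simp add: ennreal_mult mult_ac)
      also have "\<dots> = ennreal (rad k powr \<delta>) * (ennreal (2 powr (2 * \<delta>) * Dbl) * T \<delta> ?h (k - 2) x)"
        by (subst nn_integral_cmult) (auto simp: T_def mult.assoc)
      finally show ?thesis .
    qed
    have "I_osc \<mu> s \<sigma> u x (rad k) \<le> ennreal (rad k powr (- s)) *
        epowr (ennreal (C * rad k powr (\<epsilon> * \<sigma>)) * epowr (ennreal (rad k powr \<delta>) * (ennreal (2 powr (2 * \<delta>) * Dbl) * T \<delta> ?h (k - 2) x)) (\<sigma> / p)) (1 / \<sigma>)"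
      unfolding I_osc_def using \<sigma> p0
      by (intro mult_left_mono epowr_mono order_trans[OF I] epowr_mono W) auto
    also have "\<dots> = ennreal (rad k powr (- s) * (C powr (1 / \<sigma>) * rad k powr \<epsilon>) * (rad k powr (s - \<epsilon>) * (2 powr (2 * \<delta>) * Dbl) powr (1 / p))) *
        epowr (T \<delta> ?h (k - 2) x) (1 / p)"
    proof -
      have "\<delta> / p = s - \<epsilon>" using p0 by (simp add: \<delta>_def)
      then show ?thesis
        using C(1) \<sigma> p0 Dbl_pos
        by (simp add: epowr_mult epowr_epowr epowr_ennreal powr_mult powr_powr ennreal_mult mult.assoc)
    qed
    also have "rad k powr (- s) * (C powr (1 / \<sigma>) * rad k powr \<epsilon>) * (rad k powr (s - \<epsilon>) * (2 powr (2 * \<delta>) * Dbl) powr (1 / p)) = K"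
    proof -
      have "rad k powr (- s) * rad k powr \<epsilon> * rad k powr (s - \<epsilon>) = 1"
        by (simp add: powr_add[symmetric])
      then show ?thesis by (simp add: K_def mult_ac)
    qed
    finally show "I_osc \<mu> s \<sigma> u x (rad k) \<le>
      ennreal K * epowr (T ((s - \<epsilon>) * p) (\<lambda>j y. epowr (ennreal (g j y)) p) (k - 2) x) (1 / p)"
      by (simp add: \<delta>_def)
  qed
qed

text \<open>Since u x itself is subtracted, the gradients appear at the centre x as well as in
  averages, and no Sobolev gain is possible: the exponent stays \<sigma>. The value at x also
  restricts the estimate to points outside the exceptional set.\<close>

lemma C_osc_le_T:
  assumes s: "0 < s" and \<sigma>: "0 < \<sigma>" and g: "g \<in> hajlasz_gradients \<mu> s u"
  shows "AE x in \<mu>. \<forall>k. C_osc \<mu> s \<sigma> u x (rad k) \<le>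
    ennreal 2 * epowr (T (s * \<sigma>) (\<lambda>j y. epowr (ennreal (g j y)) \<sigma>) k x) (1 / \<sigma>)"
proof -
  from g have [measurable]: "\<And>k. g k \<in> borel_measurable \<mu>" and g0: "\<And>k x. 0 \<le> g k x"
    by (auto simp: hajlasz_gradients_def)
  obtain E where E: "E \<in> null_sets \<mu>" and grad:
    "\<And>x y j. x \<notin> E \<Longrightarrow> y \<notin> E \<Longrightarrow> rad (j + 1) \<le> dist x y \<Longrightarrow> dist x y < rad j \<Longrightarrow>
      \<bar>u x - u y\<bar> \<le> dist x y powr s * (g j x + g j y)"
    using hajlasz_gradients_estimate[OF g] by blast
  let ?h = "\<lambda>j y. epowr (ennreal (g j y)) \<sigma>"
  let ?\<delta> = "s * \<sigma>"
  show ?thesis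
  proof (rule eventually_mono[OF AE_not_in[OF E]], intro allI)
    fix x k assume x: "x \<notin> E"
    let ?c = "ennreal (rad k powr ?\<delta> * 2 powr \<sigma>)"
    have pt: "ennreal (\<bar>u x - u y\<bar> powr \<sigma>) \<le> (\<integral>\<^sup>+ j. ?c * wgt ?\<delta> k j * (?h j x + ?h j y) \<partial>count_space UNIV)"
      if y: "y \<notin> E" "dist x y < rad k" for y
    proof (cases "x = y")
      case False
      then obtain j where j: "rad (j + 1) \<le> dist x y" "dist x y < rad j"
        using dyadic_annulus[of "dist x y"] by auto
      have kj: "k \<le> j" using j y by (intro rad_le_imp) simp
      have "\<bar>u x - u y\<bar> \<le> dist x y powr s * (g j x + g j y)" using x y j by (intro grad)
      also have "\<dots> \<le> rad j powr s * (g j x + g j y)"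
        using j s g0 by (intro mult_right_mono powr_mono2 add_nonneg_nonneg) auto
      finally have "\<bar>u x - u y\<bar> powr \<sigma> \<le> (rad j powr s * (g j x + g j y)) powr \<sigma>"
        using \<sigma> by (intro powr_mono2) auto
      then have "ennreal (\<bar>u x - u y\<bar> powr \<sigma>) \<le> ennreal ((rad j powr s * (g j x + g j y)) powr \<sigma>)"
        by (rule ennreal_leI)
      also have "\<dots> = ennreal (rad j powr ?\<delta>) * epowr (ennreal (g j x) + ennreal (g j y)) \<sigma>"
        using g0 by (simp add: powr_mult powr_powr ennreal_mult epowr_ennreal add_nonneg_nonneg flip: ennreal_plus)
      also have "\<dots> \<le> ennreal (rad j powr ?\<delta>) * (ennreal (2 powr \<sigma>) * (?h j x + ?h j y))"
        by (intro mult_left_mono epowr_add_le \<sigma>) auto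
      also have "\<dots> = ?c * wgt ?\<delta> k j * (?h j x + ?h j y)"
      proof -
        have "real_of_int (k - j) * ?\<delta> + - real_of_int k * ?\<delta> = - real_of_int j * ?\<delta>" by (simp add: algebra_simps)
        then have "rad j powr ?\<delta> = rad k powr ?\<delta> * 2 powr (of_int (k - j) * ?\<delta>)"
          by (simp add: rad_powr powr_add[symmetric] add.commute)
        then show ?thesis using kj by (simp add: wgt_def ennreal_mult mult_ac)
      qed
      also have "\<dots> \<le> (\<integral>\<^sup>+ j. ?c * wgt ?\<delta> k j * (?h j x + ?h j y) \<partial>count_space UNIV)"
        by (rule nn_integral_ge_point) simp
      finally show ?thesis .
    qed simp
    have "nn_avg \<mu> (ball x (rad k)) (\<lambda>y. ennreal (\<bar>u x - u y\<bar> powr \<sigma>)) \<le>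
        nn_avg \<mu> (ball x (rad k)) (\<lambda>y. \<integral>\<^sup>+ j. ?c * wgt ?\<delta> k j * (?h j x + ?h j y) \<partial>count_space UNIV)"
      unfolding nn_avg_def
      by (intro divide_right_mono_ennreal nn_integral_mono_AE eventually_mono[OF AE_not_in[OF E]])
        (auto split: split_indicator intro!: pt)
    also have "\<dots> = (\<integral>\<^sup>+ j. ?c * (wgt ?\<delta> k j * Aop k (?h j) x) \<partial>count_space UNIV)"
      by (subst nn_avg_sum) (auto simp: nn_avg_cmult nn_avg_add nn_avg_const Av_def Aop_def mult.assoc)
    also have "\<dots> = ?c * T ?\<delta> ?h k x" by (simp add: nn_integral_cmult T_def)
    finally have "C_osc \<mu> s \<sigma> u x (rad k) \<le> ennreal (rad k powr (- s)) * epowr (?c * T ?\<delta> ?h k x) (1 / \<sigma>)"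
      unfolding C_osc_def using \<sigma> by (intro mult_left_mono epowr_mono) auto
    also have "\<dots> = ennreal (rad k powr (- s) * (rad k powr s * 2)) * epowr (T ?\<delta> ?h k x) (1 / \<sigma>)"
      using \<sigma> by (simp add: epowr_mult epowr_ennreal powr_mult powr_powr ennreal_mult mult.assoc)
    also have "rad k powr (- s) * (rad k powr s * 2) = 2"
      by (simp add: powr_add[symmetric] mult.assoc[symmetric])
    finally show "C_osc \<mu> s \<sigma> u x (rad k) \<le> ennreal 2 * epowr (T ?\<delta> ?h k x) (1 / \<sigma>)" by simp
  qed
qed

end

section \<open>Telescoping along near-optimal constants\<close>

context doubling_metric_measure_space
begin

definition osc :: "real \<Rightarrow> ('a \<Rightarrow> real) \<Rightarrow> 'a \<Rightarrow> real \<Rightarrow> ennreal" where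
  "osc \<sigma> u x t = epowr (INF c. nn_avg \<mu> (ball x t) (\<lambda>y. ennreal (\<bar>u y - c\<bar> powr \<sigma>))) (1 / \<sigma>)"

text \<open>Less than half of every small dyadic ball carries a deviation of at least \<epsilon>.
  Together with a Chebyshev bound of 1/4 this leaves a point good for both purposes, which is all
  that telescoping asks for.\<close>

definition approx_cont :: "('a \<Rightarrow> real) \<Rightarrow> 'a set" where
  "approx_cont u = {x. \<forall>\<epsilon>>0. \<forall>\<^sub>F m in sequentially. Av (int m) (indicator {y. \<epsilon> \<le> \<bar>u y - u x\<bar>}) x < 1 / 2}"

lemma sum_fractions_less_one:
  "ennreal (1 / 4) + ennreal (1 / 4) < 1" "ennreal (1 / 4) + ennreal (1 / 2) < 1"
proof -
  have "ennreal (1 / 4 + 1 / 4) < ennreal 1" "ennreal (1 / 4 + 1 / 2) < ennreal 1"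
    by (subst ennreal_less_iff; simp)+
  then show "ennreal (1 / 4) + ennreal (1 / 4) < 1" "ennreal (1 / 4) + ennreal (1 / 2) < 1"
    by (subst ennreal_plus[symmetric]; simp del: ennreal_plus)+
qed

text \<open>Two sets whose fractions of the ball add up to less than 1 cannot cover it. Evaluating
  at a point left over replaces integration of the triangle inequality, which would need \<sigma> >=
  1.\<close>

lemma exists_good_point:
  assumes [measurable]: "P \<in> sets \<mu>" "Q \<in> sets \<mu>" and r: "0 < r"
    and "nn_avg \<mu> (ball x r) (indicator P) + nn_avg \<mu> (ball x r) (indicator Q) < 1"
  shows "\<exists>y\<in>ball x r. y \<notin> P \<and> y \<notin> Q"
proof (rule ccontr)
  assume no: "\<not> ?thesis"
  have "1 = nn_avg \<mu> (ball x r) (\<lambda>_. 1)" using r by (simp add: nn_avg_const)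
  also have "\<dots> \<le> nn_avg \<mu> (ball x r) (\<lambda>y. indicator P y + indicator Q y)"
    using no by (intro nn_avg_mono) (auto split: split_indicator)
  also have "\<dots> = nn_avg \<mu> (ball x r) (indicator P) + nn_avg \<mu> (ball x r) (indicator Q)"
    by (rule nn_avg_add) auto
  finally show False using assms(4) by simp
qed

lemma level_set_measurable [measurable]:
  fixes u :: "'a \<Rightarrow> real"
  assumes [measurable]: "u \<in> borel_measurable \<mu>"
  shows "{y. t \<le> \<bar>u y - c\<bar>} \<in> sets \<mu>"
proof -
  have "{y \<in> space \<mu>. t \<le> \<bar>u y - c\<bar>} \<in> sets \<mu>" by measurable
  then show ?thesis by simp
qed

lemma Chebyshev_avg:
  fixes u :: "'a \<Rightarrow> real"
  assumes \<sigma>: "0 < \<sigma>" and t: "0 < t" and l: "0 < l" and [measurable]: "u \<in> borel_measurable \<mu>"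
    and le: "nn_avg \<mu> B (\<lambda>y. ennreal (\<bar>u y - c\<bar> powr \<sigma>)) \<le> ennreal (t powr \<sigma>)" and B: "B \<in> sets \<mu>"
  shows "nn_avg \<mu> B (indicator {y. l * t \<le> \<bar>u y - c\<bar>}) \<le> ennreal (l powr (- \<sigma>))"
proof -
  have "nn_avg \<mu> B (indicator {y. l * t \<le> \<bar>u y - c\<bar>}) \<le>
      nn_avg \<mu> B (\<lambda>y. ennreal ((l * t) powr (- \<sigma>)) * ennreal (\<bar>u y - c\<bar> powr \<sigma>))"
  proof (rule nn_avg_mono)
    fix y
    show "indicator {y. l * t \<le> \<bar>u y - c\<bar>} y \<le> ennreal ((l * t) powr (- \<sigma>)) * ennreal (\<bar>u y - c\<bar> powr \<sigma>)"
    proof (cases "l * t \<le> \<bar>u y - c\<bar>")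
      case True
      then have "(l * t) powr \<sigma> \<le> \<bar>u y - c\<bar> powr \<sigma>" using t l \<sigma> by (intro powr_mono2) auto
      then have "1 \<le> (l * t) powr (- \<sigma>) * \<bar>u y - c\<bar> powr \<sigma>"
        using t l by (simp add: powr_minus field_simps)
      then show ?thesis using True by (simp add: ennreal_mult[symmetric])
    qed simp
  qed
  also have "\<dots> = ennreal ((l * t) powr (- \<sigma>)) * nn_avg \<mu> B (\<lambda>y. ennreal (\<bar>u y - c\<bar> powr \<sigma>))"
    using B by (intro nn_avg_cmult) auto
  also have "\<dots> \<le> ennreal ((l * t) powr (- \<sigma>)) * ennreal (t powr \<sigma>)"
    by (intro mult_left_mono le) simp
  also have "\<dots> = ennreal (l powr (- \<sigma>))"
    using t l by (simp add: ennreal_mult[symmetric] powr_mult powr_minus)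
  finally show ?thesis .
qed

text \<open>Constants of consecutive balls are compared at a point good for both, and the constant
  of a very small ball is compared with u x by approximate continuity. The parameter l keeps each
  exceptional set below a quarter of its ball even after a loss of Dbl^2.\<close>

lemma telescoping:
  fixes u :: "'a \<Rightarrow> real" and c \<gamma> :: "int \<Rightarrow> real"
  assumes \<sigma>: "0 < \<sigma>" and l: "0 < l" "l powr (- \<sigma>) * (Dbl * Dbl) \<le> 1 / 4"
    and [measurable]: "u \<in> borel_measurable \<mu>" and x: "x \<in> approx_cont u"
    and \<gamma>: "\<And>j. i \<le> j \<Longrightarrow> 0 < \<gamma> j"
    and c: "\<And>j. i \<le> j \<Longrightarrow> nn_avg \<mu> (ball x (rad j)) (\<lambda>y. ennreal (\<bar>u y - c j\<bar> powr \<sigma>)) \<le> ennreal (\<gamma> j powr \<sigma>)"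
  shows "ennreal \<bar>u x - c i\<bar> \<le> ennreal (2 * l) * (\<integral>\<^sup>+ j. ennreal (\<gamma> j) \<partial>count_space {i..})"
proof -
  let ?S = "\<integral>\<^sup>+ j. ennreal (\<gamma> j) \<partial>count_space {i..}"
  have Dl: "l powr (- \<sigma>) \<le> 1 / 4" "Dbl * l powr (- \<sigma>) \<le> 1 / 4"
  proof -
    have "l powr (- \<sigma>) * 1 \<le> l powr (- \<sigma>) * (Dbl * Dbl)" "l powr (- \<sigma>) * (1 * Dbl) \<le> l powr (- \<sigma>) * (Dbl * Dbl)"
      using Dbl_ge_1 mult_mono[of 1 Dbl 1 Dbl] by (intro mult_left_mono; simp)+
    then show "l powr (- \<sigma>) \<le> 1 / 4" "Dbl * l powr (- \<sigma>) \<le> 1 / 4" using l(2) by (auto simp: mult.commute)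
  qed
  have ch: "nn_avg \<mu> (ball x (rad j)) (indicator {y. l * \<gamma> j \<le> \<bar>u y - c j\<bar>}) \<le> ennreal (1 / 4)" if "i \<le> j" for j
    using Chebyshev_avg[OF \<sigma> \<gamma>[OF that] l(1) _ c[OF that]] Dl by (auto intro: order_trans ennreal_leI)
  have step: "\<bar>c j - c (j + 1)\<bar> \<le> l * \<gamma> j + l * \<gamma> (j + 1)" if j: "i \<le> j" for j
  proof -
    let ?B = "ball x (rad (j + 1))"
    have "nn_avg \<mu> ?B (indicator {y. l * \<gamma> j \<le> \<bar>u y - c j\<bar>}) \<le>
      ennreal Dbl * nn_avg \<mu> (ball x (rad j)) (indicator {y. l * \<gamma> j \<le> \<bar>u y - c j\<bar>})"
      using nn_avg_rad_le[of x "j + 1"] by simp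
    also have "\<dots> \<le> ennreal Dbl * ennreal (l powr (- \<sigma>))"
      using j by (intro mult_left_mono Chebyshev_avg \<sigma> \<gamma> l(1) c) auto
    also have "\<dots> \<le> ennreal (1 / 4)"
      using Dl Dbl_pos by (simp add: ennreal_mult[symmetric] ennreal_leI)
    finally have "nn_avg \<mu> ?B (indicator {y. l * \<gamma> j \<le> \<bar>u y - c j\<bar>}) +
        nn_avg \<mu> ?B (indicator {y. l * \<gamma> (j + 1) \<le> \<bar>u y - c (j + 1)\<bar>}) \<le> ennreal (1 / 4) + ennreal (1 / 4)"
      using j by (intro add_mono ch) auto
    then have "\<exists>y\<in>?B. y \<notin> {y. l * \<gamma> j \<le> \<bar>u y - c j\<bar>} \<and> y \<notin> {y. l * \<gamma> (j + 1) \<le> \<bar>u y - c (j + 1)\<bar>}"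
      using sum_fractions_less_one by (intro exists_good_point) auto
    then show ?thesis by (auto simp: abs_le_iff abs_less_iff not_le)
  qed
  \<comment> \<open>The extra term on the left makes the induction close with every \<gamma> counted
    twice, and it later pays for the step from the last constant to u x.\<close>
  have sum: "\<bar>c i - c (i + int m)\<bar> + l * \<gamma> (i + int m) \<le> 2 * l * (\<Sum>j\<le>m. \<gamma> (i + int j))" for m
  proof (induction m)
    case 0
    then show ?case using \<gamma>[of i] l by simp
  next
    case (Suc m)
    have "i + int (Suc m) = i + int m + 1" by simp
    moreover have "\<bar>c (i + int m) - c (i + int m + 1)\<bar> \<le> l * \<gamma> (i + int m) + l * \<gamma> (i + int m + 1)"
      by (rule step) simp
    ultimately show ?case using Suc by (simp add: algebra_simps)
  qed
  have sumS: "ennreal (\<Sum>j\<le>m. \<gamma> (i + int j)) \<le> ?S" for m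
  proof -
    have bij: "bij_betw (\<lambda>j. i + int j) {..m} {i..i + int m}"
      by (rule bij_betwI[where g = "\<lambda>j. nat (j - i)"]) auto
    have "ennreal (\<Sum>j\<le>m. \<gamma> (i + int j)) = (\<Sum>j\<le>m. ennreal (\<gamma> (i + int j)))"
      using \<gamma> by (intro sum_ennreal[symmetric]) (auto intro: less_imp_le)
    also have "\<dots> = (\<Sum>j\<in>{i..i + int m}. ennreal (\<gamma> j))"
      by (rule sum.reindex_bij_betw[OF bij])
    also have "\<dots> = (\<integral>\<^sup>+ j. ennreal (\<gamma> j) \<partial>count_space {i..i + int m})"
      by (simp add: nn_integral_count_space_finite)
    also have "\<dots> \<le> ?S"
      by (subst (1 2) nn_integral_count_space_indicator)
        (auto intro!: nn_integral_mono split: split_indicator)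
    finally show ?thesis .
  qed
  have "ennreal \<bar>u x - c i\<bar> \<le> ennreal (2 * l) * ?S + ennreal \<epsilon>" if \<epsilon>: "0 < \<epsilon>" for \<epsilon>
  proof -
    have "\<forall>\<^sub>F m in sequentially. Av (int m) (indicator {y. \<epsilon> \<le> \<bar>u y - u x\<bar>}) x < 1 / 2"
      using x \<epsilon> by (auto simp: approx_cont_def)
    then obtain M where M: "\<And>m. M \<le> m \<Longrightarrow> Av (int m) (indicator {y. \<epsilon> \<le> \<bar>u y - u x\<bar>}) x < 1 / 2"
      by (auto simp: eventually_sequentially)
    \<comment> \<open>m >= M for approximate continuity, and m >= i so that the scale belongs to the
      chain.\<close>
    define m where "m = nat (max (int M) i)"
    define m' where "m' = nat (int m - i)"
    have mm: "M \<le> m" "i \<le> int m" "int m = i + int m'" by (auto simp: m_def m'_def)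
    have half: "(1 / 2 :: ennreal) = ennreal (1 / 2)" using divide_ennreal[of 1 2] by simp
    have "nn_avg \<mu> (ball x (rad (int m))) (indicator {y. l * \<gamma> (int m) \<le> \<bar>u y - c (int m)\<bar>}) +
      nn_avg \<mu> (ball x (rad (int m))) (indicator {y. \<epsilon> \<le> \<bar>u y - u x\<bar>}) \<le> ennreal (1 / 4) + ennreal (1 / 2)"
      using M[OF mm(1)] mm ch[of "int m"] unfolding Av_def half by (intro add_mono) auto
    then have "\<exists>y\<in>ball x (rad (int m)). y \<notin> {y. l * \<gamma> (int m) \<le> \<bar>u y - c (int m)\<bar>} \<and> y \<notin> {y. \<epsilon> \<le> \<bar>u y - u x\<bar>}"
      using sum_fractions_less_one by (intro exists_good_point) auto
    then have "\<bar>u x - c (int m)\<bar> \<le> \<epsilon> + l * \<gamma> (int m)"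
      by (auto simp: abs_le_iff abs_less_iff not_le)
    then have "\<bar>u x - c i\<bar> \<le> 2 * l * (\<Sum>j\<le>m'. \<gamma> (i + int j)) + \<epsilon>"
      using sum[of m'] unfolding mm(3) by linarith
    then have "ennreal \<bar>u x - c i\<bar> \<le> ennreal (2 * l * (\<Sum>j\<le>m'. \<gamma> (i + int j)) + \<epsilon>)" by (rule ennreal_leI)
    also have "\<dots> = ennreal (2 * l) * ennreal (\<Sum>j\<le>m'. \<gamma> (i + int j)) + ennreal \<epsilon>"
      using l \<epsilon> \<gamma> by (subst ennreal_plus) (auto simp: ennreal_mult'' sum_nonneg less_imp_le intro!: mult_nonneg_nonneg)
    also have "\<dots> \<le> ennreal (2 * l) * ?S + ennreal \<epsilon>"
      by (intro add_mono mult_left_mono sumS) auto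
    finally show ?thesis .
  qed
  then show ?thesis by (rule ennreal_le_epsilon)
qed

lemma osc_less_obtain:
  assumes \<sigma>: "0 < \<sigma>" and "osc \<sigma> u x t < ennreal \<gamma>"
  obtains c where "nn_avg \<mu> (ball x t) (\<lambda>y. ennreal (\<bar>u y - c\<bar> powr \<sigma>)) \<le> ennreal (\<gamma> powr \<sigma>)"
proof -
  have \<gamma>: "0 < \<gamma>" using assms(2) by (metis ennreal_less_zero_iff ennreal_neg not_le not_less_zero)
  have "(INF c. nn_avg \<mu> (ball x t) (\<lambda>y. ennreal (\<bar>u y - c\<bar> powr \<sigma>))) < ennreal (\<gamma> powr \<sigma>)"
    using assms \<gamma> epowr_less_iff[of "1 / \<sigma>" _ "ennreal (\<gamma> powr \<sigma>)"]
    by (simp add: osc_def epowr_ennreal powr_powr)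
  then obtain c where "nn_avg \<mu> (ball x t) (\<lambda>y. ennreal (\<bar>u y - c\<bar> powr \<sigma>)) < ennreal (\<gamma> powr \<sigma>)"
    unfolding INF_less_iff by blast
  then show ?thesis using that[of c] by simp
qed

text \<open>Telescoping at x starts from scale k - 1, at y from scale k. The ball around y is then
  contained in the ball around x, and the two starting constants can be compared.\<close>

lemma osc_difference:
  assumes \<sigma>: "0 < \<sigma>"
  shows "\<exists>K>0. \<forall>u x y k. u \<in> borel_measurable \<mu> \<longrightarrow> x \<in> approx_cont u \<longrightarrow> y \<in> approx_cont u \<longrightarrow> dist x y < rad k \<longrightarrow>
    ennreal \<bar>u x - u y\<bar> \<le> ennreal K * ((\<integral>\<^sup>+ j. osc \<sigma> u x (rad j) \<partial>count_space {k - 1..}) +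
      (\<integral>\<^sup>+ j. osc \<sigma> u y (rad j) \<partial>count_space {k - 1..}))"
proof -
  \<comment> \<open>Solves l^-\<sigma> Dbl^2 = 1/4.\<close>
  define l where "l = (4 * (Dbl * Dbl)) powr (1 / \<sigma>)"
  have l: "0 < l" "l powr (- \<sigma>) * (Dbl * Dbl) \<le> 1 / 4"
    using Dbl_pos \<sigma> by (auto simp: l_def powr_powr powr_minus field_simps)
  show ?thesis
  proof (intro exI[of _ "3 * l"] conjI allI impI)
    show "0 < 3 * l" using l by simp
    fix u x y k
    assume [measurable]: "u \<in> borel_measurable \<mu>" and x: "x \<in> approx_cont u" and y: "y \<in> approx_cont u"
      and d: "dist x y < rad k"
    define S where "S z = (\<integral>\<^sup>+ j. osc \<sigma> u z (rad j) \<partial>count_space {k - 1..})" for z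
    show "ennreal \<bar>u x - u y\<bar> \<le> ennreal (3 * l) * (S x + S y)"
    proof (cases "S x = top \<or> S y = top")
      case True
      then show ?thesis using l by (auto simp: ennreal_mult_top)
    next
      case False
      have "ennreal \<bar>u x - u y\<bar> \<le> ennreal (3 * l) * (S x + S y) + ennreal e" if e: "0 < e" for e
      proof -
        \<comment> \<open>The infimum is approached only through near-minimisers, so each scale is
          granted an error with a geometric decay; the errors enter with the factor 3 l at both
          points, so they add up to e. They also keep every \<gamma> positive.\<close>
        define \<eta> where "\<eta> = e / (6 * l * geom 1)"
        have \<eta>: "0 < \<eta>" using e l geom_pos[of 1] by (simp add: \<eta>_def)
        define \<gamma> where "\<gamma> z j = enn2real (osc \<sigma> u z (rad j)) + \<eta> * 2 powr (of_int (k - 1 - j))" for z j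
        have \<gamma>0: "0 < \<gamma> z j" for z j using \<eta> by (simp add: \<gamma>_def add_nonneg_pos)
        have fin: "osc \<sigma> u z (rad j) < top" if "k - 1 \<le> j" "z = x \<or> z = y" for z j
        proof -
          have "osc \<sigma> u z (rad j) \<le> S z" unfolding S_def using that by (intro nn_integral_ge_point) auto
          then show ?thesis using that False by (auto simp: less_top top_unique)
        qed
        have \<gamma>_eq: "ennreal (\<gamma> z j) = osc \<sigma> u z (rad j) + ennreal \<eta> * wgt 1 (k - 1) j" if "k - 1 \<le> j" "z = x \<or> z = y" for z j
          using fin[OF that] \<eta> that by (simp add: \<gamma>_def wgt_def ennreal_mult)
        have "osc \<sigma> u z (rad j) < ennreal (\<gamma> z j)" if "k - 1 \<le> j" "z = x \<or> z = y" for z j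
        proof -
          have "osc \<sigma> u z (rad j) = ennreal (enn2real (osc \<sigma> u z (rad j)))" using fin[OF that] by simp
          also have "\<dots> < ennreal (\<gamma> z j)" using \<eta> by (intro ennreal_lessI \<gamma>0) (simp add: \<gamma>_def)
          finally show ?thesis .
        qed
        then have ex: "\<exists>c. nn_avg \<mu> (ball z (rad j)) (\<lambda>w. ennreal (\<bar>u w - c\<bar> powr \<sigma>)) \<le> ennreal (\<gamma> z j powr \<sigma>)"
          if "k - 1 \<le> j" "z = x \<or> z = y" for z j using osc_less_obtain[OF \<sigma>] that by metis
        define c where "c z j = (SOME c. nn_avg \<mu> (ball z (rad j)) (\<lambda>w. ennreal (\<bar>u w - c\<bar> powr \<sigma>)) \<le> ennreal (\<gamma> z j powr \<sigma>))" for z j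
        have c: "nn_avg \<mu> (ball z (rad j)) (\<lambda>w. ennreal (\<bar>u w - c z j\<bar> powr \<sigma>)) \<le> ennreal (\<gamma> z j powr \<sigma>)"
          if "k - 1 \<le> j" "z = x \<or> z = y" for z j
          unfolding c_def by (rule someI_ex[OF ex[OF that]])
        have sum\<gamma>: "(\<integral>\<^sup>+ j. ennreal (\<gamma> z j) \<partial>count_space {i..}) \<le> S z + ennreal (\<eta> * geom 1)"
          if "k - 1 \<le> i" "z = x \<or> z = y" for z i
        proof -
          have "(\<integral>\<^sup>+ j. ennreal (\<gamma> z j) \<partial>count_space {i..}) \<le>
            (\<integral>\<^sup>+ j. (if k - 1 \<le> j then osc \<sigma> u z (rad j) else 0) + ennreal \<eta> * wgt 1 (k - 1) j \<partial>count_space UNIV)"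
            unfolding int_sum_atLeast using that by (intro nn_integral_mono) (auto simp: \<gamma>_eq)
          also have "\<dots> = S z + ennreal \<eta> * ennreal (geom 1)"
            by (subst nn_integral_add) (auto simp: nn_integral_cmult sum_wgt S_def int_sum_atLeast)
          finally show ?thesis using \<eta> geom_pos[of 1] by (simp add: ennreal_mult)
        qed
        have X: "ennreal \<bar>u x - c x (k - 1)\<bar> \<le> ennreal (2 * l) * (S x + ennreal (\<eta> * geom 1))"
          by (rule order_trans[OF telescoping[OF \<sigma> l _ x, of "k - 1" "\<gamma> x" "c x"]])
            (auto intro!: \<gamma>0 c mult_left_mono sum\<gamma>)
        have Y: "ennreal \<bar>u y - c y k\<bar> \<le> ennreal (2 * l) * (S y + ennreal (\<eta> * geom 1))"
          by (rule order_trans[OF telescoping[OF \<sigma> l _ y, of k "\<gamma> y" "c y"]])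
            (auto intro!: \<gamma>0 c mult_left_mono sum\<gamma>)
        \<comment> \<open>The larger ball has at most Dbl^2 times the measure of the smaller one;
          this is what the factor Dbl^2 in the choice of l is for.\<close>
        have "\<bar>c x (k - 1) - c y k\<bar> \<le> l * \<gamma> x (k - 1) + l * \<gamma> y k"
        proof -
          let ?P = "{w. l * \<gamma> x (k - 1) \<le> \<bar>u w - c x (k - 1)\<bar>}" and ?Q = "{w. l * \<gamma> y k \<le> \<bar>u w - c y k\<bar>}"
          let ?B = "ball y (rad k)"
          have "nn_avg \<mu> ?B (indicator ?P) \<le> ennreal (Dbl * Dbl) * nn_avg \<mu> (ball x (rad (k - 1))) (indicator ?P)"
          proof (rule nn_avg_le_subset)
            show "?B \<subseteq> ball x (rad (k - 1))" using d by (intro ball_subset_dist) (auto simp: rad_1 dist_commute)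
            have "dist x y \<le> 2 * rad k" using d rad_pos(1)[of k] by linarith
            then have "V x (rad (k - 1)) \<le> V y (2 * (2 * rad k))"
              by (intro V_mono ball_subset_dist) (auto simp: rad_1)
            also have "\<dots> \<le> ennreal Dbl * V y (2 * rad k)" by (rule V_double) simp
            also have "\<dots> \<le> ennreal Dbl * (ennreal Dbl * V y (rad k))" by (intro mult_left_mono V_double) auto
            finally show "V x (rad (k - 1)) \<le> ennreal (Dbl * Dbl) * V y (rad k)"
              using Dbl_pos by (simp add: ennreal_mult mult.assoc)
          qed (use Dbl_pos in auto)
          also have "\<dots> \<le> ennreal (Dbl * Dbl) * ennreal (l powr (- \<sigma>))"
            by (intro mult_left_mono Chebyshev_avg \<sigma> \<gamma>0 l(1) c) auto
          also have "\<dots> \<le> ennreal (1 / 4)"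
            using l Dbl_pos by (simp add: ennreal_mult[symmetric] ennreal_leI mult.commute)
          finally have 1: "nn_avg \<mu> ?B (indicator ?P) \<le> ennreal (1 / 4)" .
          have "l powr (- \<sigma>) * 1 \<le> l powr (- \<sigma>) * (Dbl * Dbl)"
            using Dbl_ge_1 mult_mono[of 1 Dbl 1 Dbl] by (intro mult_left_mono) auto
          then have "l powr (- \<sigma>) \<le> 1 / 4" using l(2) by linarith
          then have 2: "ennreal (l powr (- \<sigma>)) \<le> ennreal (1 / 4)" by (rule ennreal_leI)
          have "nn_avg \<mu> ?B (indicator ?Q) \<le> ennreal (l powr (- \<sigma>))"
            by (intro Chebyshev_avg \<sigma> \<gamma>0 l(1) c) auto
          then have "nn_avg \<mu> ?B (indicator ?P) + nn_avg \<mu> ?B (indicator ?Q) \<le> ennreal (1 / 4) + ennreal (1 / 4)"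
            by (intro add_mono 1 order_trans[OF _ 2])
          also have "\<dots> < 1" by (rule sum_fractions_less_one)
          finally have "\<exists>w\<in>?B. w \<notin> ?P \<and> w \<notin> ?Q" by (intro exists_good_point) auto
          then show ?thesis by (auto simp: abs_le_iff abs_less_iff not_le)
        qed
        then have "ennreal \<bar>c x (k - 1) - c y k\<bar> \<le> ennreal (l * \<gamma> x (k - 1) + l * \<gamma> y k)" by (rule ennreal_leI)
        also have "\<dots> = ennreal l * (ennreal (\<gamma> x (k - 1)) + ennreal (\<gamma> y k))"
          using l \<gamma>0 by (simp add: ennreal_mult less_imp_le distrib_left)
        also have "\<dots> \<le> ennreal l * ((S x + ennreal (\<eta> * geom 1)) + (S y + ennreal (\<eta> * geom 1)))"
        proof (intro mult_left_mono add_mono)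
          have "ennreal (\<gamma> x (k - 1)) \<le> (\<integral>\<^sup>+ j. ennreal (\<gamma> x j) \<partial>count_space {k - 1..})"
            by (rule nn_integral_ge_point) simp
          also have "\<dots> \<le> S x + ennreal (\<eta> * geom 1)" by (rule sum\<gamma>) auto
          finally show "ennreal (\<gamma> x (k - 1)) \<le> S x + ennreal (\<eta> * geom 1)" .
          have "ennreal (\<gamma> y k) \<le> (\<integral>\<^sup>+ j. ennreal (\<gamma> y j) \<partial>count_space {k..})"
            by (rule nn_integral_ge_point) simp
          also have "\<dots> \<le> S y + ennreal (\<eta> * geom 1)" by (rule sum\<gamma>) auto
          finally show "ennreal (\<gamma> y k) \<le> S y + ennreal (\<eta> * geom 1)" .
        qed simp
        finally have XY: "ennreal \<bar>c x (k - 1) - c y k\<bar> \<le> \<dots>" .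
        have "ennreal \<bar>u x - u y\<bar> \<le> ennreal (\<bar>u x - c x (k - 1)\<bar> + \<bar>u y - c y k\<bar> + \<bar>c x (k - 1) - c y k\<bar>)"
          by (rule ennreal_leI) linarith
        also have "\<dots> = ennreal \<bar>u x - c x (k - 1)\<bar> + ennreal \<bar>u y - c y k\<bar> + ennreal \<bar>c x (k - 1) - c y k\<bar>"
          by simp
        also have "\<dots> \<le> ennreal (2 * l) * (S x + ennreal (\<eta> * geom 1)) + ennreal (2 * l) * (S y + ennreal (\<eta> * geom 1)) +
            ennreal l * ((S x + ennreal (\<eta> * geom 1)) + (S y + ennreal (\<eta> * geom 1)))"
          by (intro add_mono X Y XY)
        also have "\<dots> = ennreal (3 * l) * ((S x + ennreal (\<eta> * geom 1)) + (S y + ennreal (\<eta> * geom 1)))"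
        proof -
          have "ennreal (3 * l) = ennreal (2 * l) + ennreal l" using l by (subst ennreal_plus[symmetric]) auto
          then show ?thesis by (simp add: distrib_right distrib_left)
        qed
        also have "\<dots> = ennreal (3 * l) * (S x + S y) + ennreal (3 * l) * (ennreal (\<eta> * geom 1) + ennreal (\<eta> * geom 1))"
          by (simp only: distrib_left[symmetric] add_ac)
        also have "ennreal (3 * l) * (ennreal (\<eta> * geom 1) + ennreal (\<eta> * geom 1)) = ennreal e"
        proof -
          have "ennreal (\<eta> * geom 1) + ennreal (\<eta> * geom 1) = ennreal (2 * (\<eta> * geom 1))"
            using \<eta> geom_pos[of 1] by (subst ennreal_plus[symmetric]) auto
          moreover have "3 * l * (2 * (\<eta> * geom 1)) = e" using l geom_pos[of 1] by (simp add: \<eta>_def)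
          ultimately show ?thesis using l \<eta> geom_pos[of 1] by (simp add: ennreal_mult[symmetric])
        qed
        finally show ?thesis .
      qed
      then show ?thesis by (rule ennreal_le_epsilon)
    qed
  qed
qed

end

section \<open>Measurability of the oscillations\<close>

context doubling_metric_measure_space
begin

text \<open>The infimum without the division by the measure. Unlike the normalised oscillation it is
  monotone in the ball, which is what all measurability arguments below exploit.\<close>

definition Nosc :: "real \<Rightarrow> ('a \<Rightarrow> real) \<Rightarrow> 'a \<Rightarrow> real \<Rightarrow> ennreal" where
  "Nosc \<sigma> u x t = (INF c. \<integral>\<^sup>+ y\<in>ball x t. ennreal (\<bar>u y - c\<bar> powr \<sigma>) \<partial>\<mu>)"

lemma Nosc_mono: "ball x t \<subseteq> ball y r \<Longrightarrow> Nosc \<sigma> u x t \<le> Nosc \<sigma> u y r"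
  unfolding Nosc_def
  by (rule INF_mono') (auto intro!: nn_integral_mono split: split_indicator)

lemma osc_eq_Nosc:
  assumes "0 < t"
  shows "osc \<sigma> u x t = epowr (Nosc \<sigma> u x t / V x t) (1 / \<sigma>)"
proof -
  have "(INF c. nn_avg \<mu> (ball x t) (\<lambda>y. ennreal (\<bar>u y - c\<bar> powr \<sigma>))) = Nosc \<sigma> u x t / V x t" (is "?L = ?R")
  proof (rule antisym)
    have "?L * V x t \<le> Nosc \<sigma> u x t"
      unfolding Nosc_def
    proof (rule INF_greatest)
      fix c
      have "?L \<le> (\<integral>\<^sup>+ y\<in>ball x t. ennreal (\<bar>u y - c\<bar> powr \<sigma>) \<partial>\<mu>) / V x t"
        unfolding nn_avg_def by (rule INF_lower) simp
      then show "?L * V x t \<le> (\<integral>\<^sup>+ y\<in>ball x t. ennreal (\<bar>u y - c\<bar> powr \<sigma>) \<partial>\<mu>)"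
        using assms by (subst (asm) ennreal_le_divide_iff) auto
    qed
    then show "?L \<le> ?R" using assms by (subst ennreal_le_divide_iff) auto
    show "?R \<le> ?L"
      unfolding Nosc_def nn_avg_def
      by (intro INF_greatest divide_right_mono_ennreal INF_lower) simp
  qed
  then show ?thesis by (simp add: osc_def)
qed

text \<open>Near-optimal constants for slightly smaller balls stay bounded, so a subsequence converges and
  Fatou's lemma applies.\<close>

lemma Nosc_left_continuous:
  assumes \<sigma>: "0 < \<sigma>" and u: "u \<in> L_loc \<mu> \<sigma>" and t: "0 < t" and a: "a < Nosc \<sigma> u x t"
  shows "\<exists>r. 0 < r \<and> r < t \<and> a < Nosc \<sigma> u x r"
proof (rule ccontr)
  assume no: "\<not> ?thesis"
  have [measurable]: "u \<in> borel_measurable \<mu>" using u by (simp add: L_loc_def)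
  obtain a' where a': "a < a'" "a' < Nosc \<sigma> u x t" using dense[OF a] by auto
  \<comment> \<open>Radii that increase to t and are all at least r 0 = t/2, the radius of the fixed
    ball on which the constants are bounded.\<close>
  define r where "r m = t * (1 - 1 / real (m + 2))" for m :: nat
  have r: "0 < r m" "r m < t" "r 0 \<le> r m" for m
  proof -
    have q: "0 < 1 / real (m + 2)" "1 / real (m + 2) \<le> 1 / 2" by (simp, rule frac_le) auto
    have "0 < t * (1 / real (m + 2))" using q(1) t by (rule mult_pos_pos[rotated])
    moreover have "t * (1 / real (m + 2)) \<le> t * (1 / 2)" using q(2) t by (intro mult_left_mono) auto
    moreover have "r m = t - t * (1 / real (m + 2))" by (simp add: r_def right_diff_distrib)
    moreover have "r 0 = t - t * (1 / 2)" by (simp add: r_def right_diff_distrib)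
    ultimately show "0 < r m" "r m < t" "r 0 \<le> r m" using t by linarith+
  qed
  have "Nosc \<sigma> u x (r m) < a'" for m using no r[of m] a'(1) by (meson not_less order_le_less_trans)
  then have "\<exists>c. (\<integral>\<^sup>+ y\<in>ball x (r m). ennreal (\<bar>u y - c\<bar> powr \<sigma>) \<partial>\<mu>) < a'" for m
    by (simp add: Nosc_def INF_less_iff)
  then have "\<forall>m. \<exists>c. (\<integral>\<^sup>+ y\<in>ball x (r m). ennreal (\<bar>u y - c\<bar> powr \<sigma>) \<partial>\<mu>) < a'" by blast
  from choice[OF this] obtain c where
    c: "\<And>m. (\<integral>\<^sup>+ y\<in>ball x (r m). ennreal (\<bar>u y - c m\<bar> powr \<sigma>) \<partial>\<mu>) < a'" by blast
  have a'_fin: "a' < top" using a'(2) by (rule order_less_le_trans) simp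
  have fin: "(\<integral>\<^sup>+ y\<in>ball x t. ennreal (\<bar>u y\<bar> powr \<sigma>) \<partial>\<mu>) < top"
    using u t by (auto simp: L_loc_def infinity_ennreal_def)
  \<comment> \<open>On the smallest ball |c|^\<sigma> is at most 2^\<sigma> times the sum of
    |u|^\<sigma> and |u - c|^\<sigma>; both integrals are controlled, so L bounds all constants at
    once.\<close>
  define L where "L = ennreal (2 powr \<sigma>) * ((\<integral>\<^sup>+ y\<in>ball x t. ennreal (\<bar>u y\<bar> powr \<sigma>) \<partial>\<mu>) + a') / V x (r 0)"
  have "L < top"
    using fin a'_fin r(1)[of 0]
    by (auto simp: L_def ennreal_divide_eq_top_iff ennreal_mult_eq_top_iff less_top[symmetric])
  have cL: "ennreal (\<bar>c m\<bar> powr \<sigma>) \<le> L" for m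
  proof -
    have "ennreal (\<bar>c m\<bar> powr \<sigma>) * V x (r 0) = (\<integral>\<^sup>+ y\<in>ball x (r 0). ennreal (\<bar>c m\<bar> powr \<sigma>) \<partial>\<mu>)"
      by (simp add: nn_integral_cmult_indicator)
    also have "\<dots> \<le> (\<integral>\<^sup>+ y. ennreal (2 powr \<sigma>) * (ennreal (\<bar>u y\<bar> powr \<sigma>) * indicator (ball x t) y + ennreal (\<bar>u y - c m\<bar> powr \<sigma>) * indicator (ball x (r m)) y) \<partial>\<mu>)"
    proof (intro nn_integral_mono)
      fix y
      show "ennreal (\<bar>c m\<bar> powr \<sigma>) * indicator (ball x (r 0)) y \<le>
        ennreal (2 powr \<sigma>) * (ennreal (\<bar>u y\<bar> powr \<sigma>) * indicator (ball x t) y + ennreal (\<bar>u y - c m\<bar> powr \<sigma>) * indicator (ball x (r m)) y)"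
      proof (cases "y \<in> ball x (r 0)")
        case True
        then have "y \<in> ball x t" "y \<in> ball x (r m)" using r[of m] r[of 0] by auto
        moreover have "ennreal (\<bar>c m\<bar> powr \<sigma>) \<le> epowr (ennreal \<bar>u y\<bar> + ennreal \<bar>u y - c m\<bar>) \<sigma>"
          using \<sigma> by (auto simp: epowr_ennreal powr_mono2 simp flip: ennreal_plus intro!: ennreal_leI powr_mono2)
        then have "ennreal (\<bar>c m\<bar> powr \<sigma>) \<le> ennreal (2 powr \<sigma>) * (epowr (ennreal \<bar>u y\<bar>) \<sigma> + epowr (ennreal \<bar>u y - c m\<bar>) \<sigma>)"
          by (rule order_trans[OF _ epowr_add_le[OF \<sigma>]])
        ultimately show ?thesis using True by (simp add: epowr_ennreal)
      qed simp
    qed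
    also have "\<dots> = ennreal (2 powr \<sigma>) * ((\<integral>\<^sup>+ y\<in>ball x t. ennreal (\<bar>u y\<bar> powr \<sigma>) \<partial>\<mu>) + (\<integral>\<^sup>+ y\<in>ball x (r m). ennreal (\<bar>u y - c m\<bar> powr \<sigma>) \<partial>\<mu>))"
      by (simp add: nn_integral_cmult nn_integral_add)
    also have "\<dots> \<le> ennreal (2 powr \<sigma>) * ((\<integral>\<^sup>+ y\<in>ball x t. ennreal (\<bar>u y\<bar> powr \<sigma>) \<partial>\<mu>) + a')"
      using c[of m] by (intro mult_left_mono add_left_mono) auto
    finally show ?thesis
      unfolding L_def using r(1)[of 0] by (subst ennreal_le_divide_iff) auto
  qed
  have "bounded (range c)"
  proof (rule boundedI)
    fix z assume "z \<in> range c"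
    then obtain m where z: "z = c m" by auto
    have "epowr (ennreal (\<bar>c m\<bar> powr \<sigma>)) (1 / \<sigma>) \<le> epowr L (1 / \<sigma>)"
      using cL \<sigma> by (intro epowr_mono) auto
    then have "ennreal \<bar>c m\<bar> \<le> epowr L (1 / \<sigma>)" using \<sigma> by (simp add: epowr_ennreal powr_powr)
    also have "\<dots> = ennreal (enn2real (epowr L (1 / \<sigma>)))" using \<open>L < top\<close> by simp
    finally show "norm z \<le> enn2real (epowr L (1 / \<sigma>))" by (simp add: z)
  qed
  then obtain d f where f: "strict_mono f" "(c \<circ> f) \<longlonglongrightarrow> d"
    using bounded_imp_convergent_subsequence[of c] by blast
  have "Nosc \<sigma> u x t \<le> (\<integral>\<^sup>+ y\<in>ball x t. ennreal (\<bar>u y - d\<bar> powr \<sigma>) \<partial>\<mu>)"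
    unfolding Nosc_def by (rule INF_lower) simp
  also have "\<dots> \<le> (\<integral>\<^sup>+ y. liminf (\<lambda>m. ennreal (\<bar>u y - c (f m)\<bar> powr \<sigma>) * indicator (ball x (r (f m))) y) \<partial>\<mu>)"
  proof (intro nn_integral_mono)
    fix y
    show "ennreal (\<bar>u y - d\<bar> powr \<sigma>) * indicator (ball x t) y \<le>
      liminf (\<lambda>m. ennreal (\<bar>u y - c (f m)\<bar> powr \<sigma>) * indicator (ball x (r (f m))) y)"
    proof (cases "y \<in> ball x t")
      case True
      have "r \<longlonglongrightarrow> t * (1 - 0)"
        unfolding r_def by (intro tendsto_intros LIMSEQ_ignore_initial_segment[OF lim_1_over_n])
      then have "(\<lambda>m. r (f m)) \<longlonglongrightarrow> t" using f(1) by (auto dest: LIMSEQ_subseq_LIMSEQ simp: o_def)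
      then have ev: "\<forall>\<^sub>F m in sequentially. dist x y < r (f m)"
        using True by (intro order_tendstoD) auto
      have "(\<lambda>m. ennreal (\<bar>u y - c (f m)\<bar> powr \<sigma>)) \<longlonglongrightarrow> ennreal (\<bar>u y - d\<bar> powr \<sigma>)"
        using f(2) \<sigma> by (intro tendsto_ennrealI tendsto_powr' tendsto_rabs tendsto_diff tendsto_const) (auto simp: o_def)
      then have "(\<lambda>m. ennreal (\<bar>u y - c (f m)\<bar> powr \<sigma>) * indicator (ball x (r (f m))) y) \<longlonglongrightarrow> ennreal (\<bar>u y - d\<bar> powr \<sigma>)"
        by (rule Lim_transform_eventually) (use ev in \<open>auto elim!: eventually_mono\<close>)
      then have "liminf (\<lambda>m. ennreal (\<bar>u y - c (f m)\<bar> powr \<sigma>) * indicator (ball x (r (f m))) y) = ennreal (\<bar>u y - d\<bar> powr \<sigma>)"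
        by (intro lim_imp_Liminf) auto
      then show ?thesis using True by simp
    qed simp
  qed
  also have "\<dots> \<le> liminf (\<lambda>m. \<integral>\<^sup>+ y\<in>ball x (r (f m)). ennreal (\<bar>u y - c (f m)\<bar> powr \<sigma>) \<partial>\<mu>)"
    by (rule nn_integral_liminf) measurable
  also have "\<dots> \<le> a'"
    using c by (intro Liminf_le) (auto intro: less_imp_le always_eventually)
  finally show False using a'(2) by simp
qed

text \<open>Left continuity in the radius and monotonicity give lower semicontinuity in the centre:
  if a smaller radius r already exceeds a, then so does radius t at all centres within t -
  r.\<close>

lemma Nosc_measurable:
  assumes \<sigma>: "0 < \<sigma>" and u: "u \<in> L_loc \<mu> \<sigma>" and t: "0 < t"
  shows "(\<lambda>x. Nosc \<sigma> u x t) \<in> borel_measurable \<mu>"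
proof (rule borel_measurableI_greater)
  fix a
  have "open {x. a < Nosc \<sigma> u x t}"
  proof (rule openI)
    fix x assume "x \<in> {x. a < Nosc \<sigma> u x t}"
    then obtain r where r: "0 < r" "r < t" "a < Nosc \<sigma> u x r"
      using Nosc_left_continuous[OF \<sigma> u t, of a x] by auto
    show "\<exists>e>0. ball x e \<subseteq> {x. a < Nosc \<sigma> u x t}"
    proof (intro exI[of _ "t - r"] conjI subsetI)
      fix y assume "y \<in> ball x (t - r)"
      then have "Nosc \<sigma> u x r \<le> Nosc \<sigma> u y t" by (intro Nosc_mono ball_subset_dist) auto
      then show "y \<in> {x. a < Nosc \<sigma> u x t}" using r(3) by simp
    qed (use r in simp)
  qed
  then show "{x \<in> space \<mu>. a < Nosc \<sigma> u x t} \<in> sets \<mu>" by simp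
qed

section \<open>Measurability of the four oscillations\<close>

lemma osc_measurable:
  assumes "0 < \<sigma>" "u \<in> L_loc \<mu> \<sigma>" "0 < t"
  shows "(\<lambda>x. osc \<sigma> u x t) \<in> borel_measurable \<mu>"
proof -
  note [measurable] = Nosc_measurable[OF assms]
  show ?thesis using assms(3) by (simp add: osc_eq_Nosc) measurable
qed

lemma I_osc_eq: "I_osc \<mu> s \<sigma> u x t = ennreal (t powr (- s)) * osc \<sigma> u x t"
  by (simp add: I_osc_def osc_def)

lemma I_osc_measurable:
  assumes "0 < \<sigma>" "u \<in> L_loc \<mu> \<sigma>" "0 < t"
  shows "(\<lambda>x. I_osc \<mu> s \<sigma> u x t) \<in> borel_measurable \<mu>"
  using osc_measurable[OF assms] unfolding I_osc_eq by measurable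

lemma S_osc_eq:
  "S_osc \<mu> s \<epsilon> \<sigma> u x t = ennreal (t powr (\<epsilon> - s)) * (SUP \<rho>\<in>{0<..t}. ennreal (\<rho> powr (- \<epsilon>)) * osc \<sigma> u x \<rho>)"
  by (simp add: S_osc_def osc_def)

text \<open>The supremum over real radii equals the one over rational radii, again by left
  continuity, and is therefore a countable supremum of measurable functions.\<close>

lemma S_osc_measurable:
  assumes \<sigma>: "0 < \<sigma>" and u: "u \<in> L_loc \<mu> \<sigma>" and t: "0 < t" and \<epsilon>: "0 \<le> \<epsilon>"
  shows "(\<lambda>x. S_osc \<mu> s \<epsilon> \<sigma> u x t) \<in> borel_measurable \<mu>"
proof -
  let ?F = "\<lambda>x \<rho>. ennreal (\<rho> powr (- \<epsilon>)) * osc \<sigma> u x \<rho>"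
  have F_le: "?F x \<rho> \<le> (SUP q\<in>{q \<in> \<rat>. 0 < q \<and> q \<le> t}. ?F x q)" if \<rho>: "0 < \<rho>" "\<rho> \<le> t" for x \<rho>
  proof (rule dense_le)
    fix z assume "z < ?F x \<rho>"
    define w where "w = epowr (ennreal (\<rho> powr \<epsilon>) * z) \<sigma> * V x \<rho>"
    have inv: "ennreal (\<rho> powr \<epsilon>) * (ennreal (\<rho> powr (- \<epsilon>)) * X) = X" for X
      using \<rho> by (simp add: mult.assoc[symmetric] ennreal_mult[symmetric] powr_add[symmetric])
    have "ennreal (\<rho> powr \<epsilon>) * z < ennreal (\<rho> powr \<epsilon>) * ?F x \<rho>"
      using \<open>z < _\<close> \<rho> by (intro ennreal_mult_strict_left_mono) auto
    then have "ennreal (\<rho> powr \<epsilon>) * z < epowr (Nosc \<sigma> u x \<rho> / V x \<rho>) (1 / \<sigma>)"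
      unfolding inv using \<rho> by (simp add: osc_eq_Nosc)
    then have "epowr (ennreal (\<rho> powr \<epsilon>) * z) \<sigma> < epowr (epowr (Nosc \<sigma> u x \<rho> / V x \<rho>) (1 / \<sigma>)) \<sigma>"
      using \<sigma> by (simp only: epowr_less_iff)
    then have "epowr (ennreal (\<rho> powr \<epsilon>) * z) \<sigma> < Nosc \<sigma> u x \<rho> / V x \<rho>"
      using \<sigma> by (simp add: epowr_epowr)
    then have "\<not> Nosc \<sigma> u x \<rho> / V x \<rho> \<le> epowr (ennreal (\<rho> powr \<epsilon>) * z) \<sigma>" by (simp add: not_le)
    then have "\<not> Nosc \<sigma> u x \<rho> \<le> epowr (ennreal (\<rho> powr \<epsilon>) * z) \<sigma> * V x \<rho>"
      using \<rho> by (subst (asm) ennreal_divide_le_iff) auto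
    then have "w < Nosc \<sigma> u x \<rho>" by (simp add: w_def not_le)
    then obtain r where r: "0 < r" "r < \<rho>" "w < Nosc \<sigma> u x r"
      using Nosc_left_continuous[OF \<sigma> u \<rho>(1), of w x] by auto
    \<comment> \<open>A rational radius slightly below \<rho>: monotonicity keeps the infimum above
      w, while \<rho>^-\<epsilon> and the reciprocal of the measure can only grow.\<close>
    obtain q where q: "q \<in> \<rat>" "r < q" "q < \<rho>" using Rats_dense_in_real[OF r(2)] by auto
    have "w \<le> Nosc \<sigma> u x q" using r(3) Nosc_mono[of x r x q \<sigma> u] q by (auto simp: subset_ball)
    moreover have "epowr (ennreal (\<rho> powr \<epsilon>) * z) \<sigma> * V x q \<le> w"
      unfolding w_def using q by (intro mult_left_mono V_mono subset_ball) auto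
    ultimately have "epowr (ennreal (\<rho> powr \<epsilon>) * z) \<sigma> \<le> Nosc \<sigma> u x q / V x q"
      using q r by (subst ennreal_le_divide_iff) auto
    then have "ennreal (\<rho> powr \<epsilon>) * z \<le> osc \<sigma> u x q"
      using \<sigma> q r by (simp add: osc_eq_Nosc le_epowr_swap)
    then have "ennreal (\<rho> powr (- \<epsilon>)) * (ennreal (\<rho> powr \<epsilon>) * z) \<le> ennreal (\<rho> powr (- \<epsilon>)) * osc \<sigma> u x q"
      by (rule mult_left_mono) simp
    then have "z \<le> ennreal (\<rho> powr (- \<epsilon>)) * osc \<sigma> u x q"
      using \<rho> by (simp add: mult.assoc[symmetric] ennreal_mult[symmetric] powr_add[symmetric])
    also have "\<dots> \<le> ?F x q"
      using q r \<epsilon> by (intro mult_right_mono ennreal_leI powr_mono2') auto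
    also have "\<dots> \<le> (SUP q\<in>{q \<in> \<rat>. 0 < q \<and> q \<le> t}. ?F x q)"
      using q r \<rho> by (intro SUP_upper) auto
    finally show "z \<le> (SUP q\<in>{q \<in> \<rat>. 0 < q \<and> q \<le> t}. ?F x q)" .
  qed
  have "(SUP \<rho>\<in>{0<..t}. ?F x \<rho>) = (SUP q\<in>{q \<in> \<rat>. 0 < q \<and> q \<le> t}. ?F x q)" for x
    by (rule antisym) (auto intro!: SUP_least F_le intro: SUP_upper)
  moreover have "countable {q \<in> \<rat>. 0 < q \<and> q \<le> t}"
    by (rule countable_subset[OF _ countable_rat]) auto
  then have "(\<lambda>x. SUP q\<in>{q \<in> \<rat>. 0 < q \<and> q \<le> t}. ?F x q) \<in> borel_measurable \<mu>"
    using osc_measurable[OF \<sigma> u] by (intro borel_measurable_SUP) auto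
  ultimately show ?thesis unfolding S_osc_eq by simp
qed

lemma C_osc_measurable:
  assumes [measurable]: "u \<in> borel_measurable \<mu>"
  shows "(\<lambda>x. C_osc \<mu> s \<sigma> u x t) \<in> borel_measurable \<mu>"
proof -
  have [measurable]: "(\<lambda>x. nn_avg \<mu> (ball x t) (\<lambda>y. ennreal (\<bar>u x - u y\<bar> powr \<sigma>))) \<in> borel_measurable \<mu>"
    by (rule nn_avg_measurable') measurable
  show ?thesis unfolding C_osc_def by measurable
qed

lemma avg_measurable:
  assumes [measurable]: "u \<in> borel_measurable \<mu>"
  shows "(\<lambda>x. avg \<mu> (ball x t) u) \<in> borel_measurable \<mu>"
proof -
  have "(\<lambda>(x :: 'a, y). indicator (ball x t) y :: real) = indicator {z. dist (fst z) (snd z) < t}"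
    by (auto simp: fun_eq_iff split: split_indicator)
  then have [measurable]: "(\<lambda>(x :: 'a, y). indicator (ball x t) y :: real) \<in> borel_measurable (\<mu> \<Otimes>\<^sub>M \<mu>)"
    by simp
  have "(\<lambda>x. \<integral> y. indicator (ball x t) y *\<^sub>R u y \<partial>\<mu>) \<in> borel_measurable \<mu>"
    by (rule borel_measurable_lebesgue_integral) measurable
  then have [measurable]: "(\<lambda>x. LINT y:ball x t|\<mu>. u y) \<in> borel_measurable \<mu>"
    by (simp add: set_lebesgue_integral_def)
  show ?thesis unfolding avg_def measure_def by measurable
qed

lemma A_osc_measurable:
  assumes [measurable]: "u \<in> borel_measurable \<mu>"
  shows "(\<lambda>x. A_osc \<mu> s \<sigma> u x t) \<in> borel_measurable \<mu>"
proof -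
  note [measurable] = avg_measurable[OF assms]
  have [measurable]: "(\<lambda>x. nn_avg \<mu> (ball x t) (\<lambda>y. ennreal (\<bar>u y - avg \<mu> (ball x t) u\<bar> powr \<sigma>))) \<in> borel_measurable \<mu>"
    by (rule nn_avg_measurable') measurable
  show ?thesis unfolding A_osc_def by measurable
qed

end

section \<open>Discretization in the scale variable\<close>

lemma dyadic_scale:
  assumes "0 < t"
  obtains k where "rad (k + 1) < t" "t \<le> rad k"
proof -
  define k where "k = - \<lceil>log 2 t\<rceil>"
  have "- of_int (k + 1) < log 2 t" "log 2 t \<le> - of_int k" unfolding k_def by linarith+
  then show ?thesis
    using assms that[of k] by (simp_all add: rad_def less_log_iff log_le_iff)
qed

lemma rad_strict_imp: "rad (j + 1) < t \<Longrightarrow> t \<le> rad K \<Longrightarrow> K \<le> j"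
  by (rule ccontr) (use rad_mono[of "j + 1" K] in auto)

text \<open>The slab from 2^-(k+1) to 2^-k has mass at most 1 for dt/t. Since h is an arbitrary
  function of t, it is compared with a step function, and only monotonicity of the integral is
  applied to it.\<close>

lemma integral_dyadic_le:
  assumes h: "\<And>k t. rad (k + 1) < t \<Longrightarrow> t \<le> rad k \<Longrightarrow> h t \<le> \<beta> k"
  shows "(\<integral>\<^sup>+ t\<in>{0<..}. (h t / ennreal t) \<partial>lborel) \<le> (\<integral>\<^sup>+ k. \<beta> k \<partial>count_space UNIV)"
    and "\<rho> \<le> rad K \<Longrightarrow> (\<integral>\<^sup>+ t\<in>{0<..<\<rho>}. (h t / ennreal t) \<partial>lborel) \<le> (\<integral>\<^sup>+ k. \<beta> k \<partial>count_space {K..})"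
proof -
  have slab: "(\<integral>\<^sup>+ t\<in>A. (h t / ennreal t) \<partial>lborel) \<le> (\<integral>\<^sup>+ k. \<gamma> k \<partial>count_space UNIV)"
    if A: "A \<subseteq> {0<..}" and le: "\<And>k t. t \<in> A \<Longrightarrow> rad (k + 1) < t \<Longrightarrow> t \<le> rad k \<Longrightarrow> h t \<le> \<gamma> k" for A \<gamma>
  proof -
    have "(\<integral>\<^sup>+ t\<in>A. (h t / ennreal t) \<partial>lborel) \<le>
      (\<integral>\<^sup>+ t. \<integral>\<^sup>+ k. \<gamma> k * ennreal (1 / rad (k + 1)) * indicator {rad (k + 1)<..rad k} t \<partial>count_space UNIV \<partial>lborel)"
    proof (intro nn_integral_mono)
      fix t
      show "h t / ennreal t * indicator A t \<le>
        (\<integral>\<^sup>+ k. \<gamma> k * ennreal (1 / rad (k + 1)) * indicator {rad (k + 1)<..rad k} t \<partial>count_space UNIV)"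
      proof (cases "t \<in> A")
        case True
        then have t: "0 < t" using A by auto
        obtain k where k: "rad (k + 1) < t" "t \<le> rad k" using dyadic_scale[OF t] by blast
        have "h t / ennreal t = h t * ennreal (1 / t)"
          using t by (simp add: divide_ennreal_def inverse_ennreal inverse_eq_divide)
        also have "\<dots> \<le> \<gamma> k * ennreal (1 / rad (k + 1))"
          using k t by (intro mult_mono le True ennreal_leI frac_le) auto
        also have "\<dots> = \<gamma> k * ennreal (1 / rad (k + 1)) * indicator {rad (k + 1)<..rad k} t"
          using k by simp
        also have "\<dots> \<le> (\<integral>\<^sup>+ k. \<gamma> k * ennreal (1 / rad (k + 1)) * indicator {rad (k + 1)<..rad k} t \<partial>count_space UNIV)"
          by (rule nn_integral_ge_point) simp
        finally show ?thesis using True by simp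
      qed simp
    qed
    also have "\<dots> = (\<integral>\<^sup>+ k. \<integral>\<^sup>+ t. \<gamma> k * ennreal (1 / rad (k + 1)) * indicator {rad (k + 1)<..rad k} t \<partial>lborel \<partial>count_space UNIV)"
      by (rule nn_integral_count_space_nn_integral) auto
    also have "\<dots> = (\<integral>\<^sup>+ k. \<gamma> k \<partial>count_space UNIV)"
    proof (intro nn_integral_cong)
      fix k
      have "rad k - rad (k + 1) = rad (k + 1)" using rad_1(1)[of k] by simp
      then have "emeasure lborel {rad (k + 1)<..rad k} = ennreal (rad (k + 1))"
        using rad_mono[of k "k + 1"] by simp
      then show "(\<integral>\<^sup>+ t. \<gamma> k * ennreal (1 / rad (k + 1)) * indicator {rad (k + 1)<..rad k} t \<partial>lborel) = \<gamma> k"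
        by (subst nn_integral_cmult_indicator) (auto simp: mult.assoc ennreal_mult[symmetric])
    qed
    finally show ?thesis .
  qed
  show "(\<integral>\<^sup>+ t\<in>{0<..}. (h t / ennreal t) \<partial>lborel) \<le> (\<integral>\<^sup>+ k. \<beta> k \<partial>count_space UNIV)"
    by (rule slab) (auto intro: h)
  show "(\<integral>\<^sup>+ t\<in>{0<..<\<rho>}. (h t / ennreal t) \<partial>lborel) \<le> (\<integral>\<^sup>+ k. \<beta> k \<partial>count_space {K..})" if "\<rho> \<le> rad K"
    unfolding int_sum_atLeast
  proof (rule slab)
    fix k t assume t: "t \<in> {0<..<\<rho>}" "rad (k + 1) < t" "t \<le> rad k"
    then have "K \<le> k" using that by (intro rad_strict_imp) auto
    then show "h t \<le> (if K \<le> k then \<beta> k else 0)" using h[OF t(2,3)] by simp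
  qed auto
qed

text \<open>The slab from 2^-k to 2^-(k-1) has length 2^-k, and 1/t is at least 1/2^-(k-1) on it, so
  its mass for dt/t is at least 1/2; hence the factor 2.\<close>

lemma integral_dyadic_ge:
  assumes h: "\<And>k t. rad k \<le> t \<Longrightarrow> t < rad (k - 1) \<Longrightarrow> \<alpha> k \<le> h t"
  shows "(\<integral>\<^sup>+ k. \<alpha> k \<partial>count_space UNIV) \<le> 2 * (\<integral>\<^sup>+ t\<in>{0<..}. (h t / ennreal t) \<partial>lborel)"
    and "(\<integral>\<^sup>+ k. \<alpha> k \<partial>count_space {K..}) \<le> 2 * (\<integral>\<^sup>+ t\<in>{0<..<rad (K - 1)}. (h t / ennreal t) \<partial>lborel)"
proof -
  have slab: "(\<integral>\<^sup>+ k. \<gamma> k \<partial>count_space UNIV) \<le> 2 * (\<integral>\<^sup>+ t\<in>A. (h t / ennreal t) \<partial>lborel)"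
    if le: "\<And>k t. rad k \<le> t \<Longrightarrow> t < rad (k - 1) \<Longrightarrow> \<gamma> k \<le> h t"
      and A: "\<And>k t. rad k \<le> t \<Longrightarrow> t < rad (k - 1) \<Longrightarrow> t \<in> A \<or> \<gamma> k = 0" for A \<gamma>
  proof -
    have "(\<integral>\<^sup>+ t. \<integral>\<^sup>+ k. \<gamma> k * ennreal (1 / rad (k - 1)) * indicator {rad k..<rad (k - 1)} t \<partial>count_space UNIV \<partial>lborel)
      \<le> (\<integral>\<^sup>+ t\<in>A. (h t / ennreal t) \<partial>lborel)"
    proof (intro nn_integral_mono)
      fix t
      show "(\<integral>\<^sup>+ k. \<gamma> k * ennreal (1 / rad (k - 1)) * indicator {rad k..<rad (k - 1)} t \<partial>count_space UNIV) \<le>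
        h t / ennreal t * indicator A t"
      proof (cases "0 < t")
        case True
        then obtain k where "rad (k + 1) \<le> t" "t < rad k" using dyadic_annulus by blast
        then have "rad (k + 1) \<le> t" "t < rad (k + 1 - 1)" by simp_all
        then obtain k where k: "rad k \<le> t" "t < rad (k - 1)" by blast
        \<comment> \<open>The slabs are disjoint, so the sum over k collapses to one term at each
          t.\<close>
        have uniq: "j = k" if "t \<in> {rad j..<rad (j - 1)}" for j
        proof -
          from that have j: "rad j \<le> t" "t < rad (j - 1)" by auto
          have "\<not> k \<le> j - 1"
          proof
            assume "k \<le> j - 1"
            then have "rad (j - 1) \<le> rad k" by (rule rad_mono)
            then show False using k(1) j(2) by linarith
          qed
          moreover have "\<not> j \<le> k - 1"
          proof
            assume "j \<le> k - 1"
            then have "rad (k - 1) \<le> rad j" by (rule rad_mono)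
            then show False using k(2) j(1) by linarith
          qed
          ultimately show ?thesis by linarith
        qed
        have "(\<integral>\<^sup>+ k. \<gamma> k * ennreal (1 / rad (k - 1)) * indicator {rad k..<rad (k - 1)} t \<partial>count_space UNIV)
          = (\<integral>\<^sup>+ j. \<gamma> k * ennreal (1 / rad (k - 1)) * indicator {k} j \<partial>count_space UNIV)"
        proof (intro nn_integral_cong)
          fix j
          show "\<gamma> j * ennreal (1 / rad (j - 1)) * indicator {rad j..<rad (j - 1)} t =
            \<gamma> k * ennreal (1 / rad (k - 1)) * indicator {k} j"
          proof (cases "j = k")
            case True
            then show ?thesis using k by simp
          next
            case False
            then have "t \<notin> {rad j..<rad (j - 1)}" using uniq by blast
            then show ?thesis using False by simp
          qed
        qed
        also have "\<dots> = \<gamma> k * ennreal (1 / rad (k - 1))"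
          by (simp add: nn_integral_cmult_indicator)
        also have "\<dots> \<le> h t * ennreal (1 / t) * indicator A t"
        proof (cases "\<gamma> k = 0")
          case False
          then have "t \<in> A" using A[OF k] by simp
          moreover have "\<gamma> k * ennreal (1 / rad (k - 1)) \<le> h t * ennreal (1 / t)"
            using k True by (intro mult_mono le ennreal_leI frac_le) auto
          ultimately show ?thesis by simp
        qed simp
        also have "h t * ennreal (1 / t) = h t / ennreal t"
          using True by (simp add: divide_ennreal_def inverse_ennreal inverse_eq_divide)
        finally show ?thesis .
      next
        case False
        have "t \<notin> {rad k..<rad (k - 1)}" for k
        proof
          assume "t \<in> {rad k..<rad (k - 1)}"
          then have "rad k \<le> t" by simp
          with rad_pos(1)[of k] False show False by linarith
        qed
        then show ?thesis by simp
      qed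
    qed
    moreover have "(\<integral>\<^sup>+ t. \<integral>\<^sup>+ k. \<gamma> k * ennreal (1 / rad (k - 1)) * indicator {rad k..<rad (k - 1)} t \<partial>count_space UNIV \<partial>lborel)
      = (\<integral>\<^sup>+ k. ennreal (1 / 2) * \<gamma> k \<partial>count_space UNIV)"
    proof (subst nn_integral_count_space_nn_integral, simp, simp, intro nn_integral_cong)
      fix k
      have "rad (k - 1) - rad k = rad k" "rad (k - 1) = 2 * rad k" using rad_1(2)[of k] by simp_all
      then have "emeasure lborel {rad k..<rad (k - 1)} = ennreal (rad k)"
        using rad_mono[of "k - 1" k] by simp
      then have eq: "(\<integral>\<^sup>+ t. \<gamma> k * ennreal (1 / rad (k - 1)) * indicator {rad k..<rad (k - 1)} t \<partial>lborel) = \<gamma> k * ennreal (1 / rad (k - 1)) * ennreal (rad k)"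
        by (subst nn_integral_cmult_indicator) auto
      have "ennreal (1 / rad (k - 1)) * ennreal (rad k) = ennreal (1 / 2)"
        unfolding \<open>rad (k - 1) = 2 * rad k\<close> by (subst ennreal_mult[symmetric]) auto
      then show "(\<integral>\<^sup>+ t. \<gamma> k * ennreal (1 / rad (k - 1)) * indicator {rad k..<rad (k - 1)} t \<partial>lborel) = ennreal (1 / 2) * \<gamma> k"
        by (intro trans[OF eq]) (simp only: mult.assoc mult.commute[of "\<gamma> k" "ennreal (1 / 2)"])
    qed
    ultimately have "ennreal (1 / 2) * (\<integral>\<^sup>+ k. \<gamma> k \<partial>count_space UNIV) \<le> (\<integral>\<^sup>+ t\<in>A. (h t / ennreal t) \<partial>lborel)"
      by (simp add: nn_integral_cmult)
    then have "ennreal 2 * (ennreal (1 / 2) * (\<integral>\<^sup>+ k. \<gamma> k \<partial>count_space UNIV)) \<le> ennreal 2 * (\<integral>\<^sup>+ t\<in>A. (h t / ennreal t) \<partial>lborel)"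
      by (rule mult_left_mono) simp
    also have "ennreal 2 * (ennreal (1 / 2) * (\<integral>\<^sup>+ k. \<gamma> k \<partial>count_space UNIV)) = (\<integral>\<^sup>+ k. \<gamma> k \<partial>count_space UNIV)"
    proof -
      have "ennreal 2 * ennreal (1 / 2) = 1" by (subst ennreal_mult[symmetric]) auto
      then show ?thesis by (simp only: mult.assoc[symmetric] mult_1)
    qed
    finally show ?thesis by simp
  qed
  show "(\<integral>\<^sup>+ k. \<alpha> k \<partial>count_space UNIV) \<le> 2 * (\<integral>\<^sup>+ t\<in>{0<..}. (h t / ennreal t) \<partial>lborel)"
    by (rule slab) (auto intro: h less_le_trans[OF rad_pos(1)])
  show "(\<integral>\<^sup>+ k. \<alpha> k \<partial>count_space {K..}) \<le> 2 * (\<integral>\<^sup>+ t\<in>{0<..<rad (K - 1)}. (h t / ennreal t) \<partial>lborel)"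
    unfolding int_sum_atLeast
  proof (rule slab)
    fix k t assume t: "rad k \<le> t" "t < rad (k - 1)"
    show "(if K \<le> k then \<alpha> k else 0) \<le> h t" using h[OF t] by simp
    show "t \<in> {0<..<rad (K - 1)} \<or> (if K \<le> k then \<alpha> k else 0) = 0"
      using t rad_mono[of "K - 1" "k - 1"] less_le_trans[OF rad_pos(1)[of k] t(1)] by auto
  qed
qed

lemma le_cmult_INF:
  fixes a :: ennreal
  assumes C: "0 < C" and "\<And>i. i \<in> I \<Longrightarrow> a \<le> ennreal C * f i"
  shows "a \<le> ennreal C * (INF i\<in>I. f i)"
proof -
  have inv: "ennreal (1 / C) * (ennreal C * z) = z" "ennreal C * (ennreal (1 / C) * z) = z" for z
    using C by (simp_all add: mult.assoc[symmetric] ennreal_mult[symmetric])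
  have "ennreal (1 / C) * a \<le> (INF i\<in>I. f i)"
  proof (rule INF_greatest)
    fix i assume "i \<in> I"
    then have "ennreal (1 / C) * a \<le> ennreal (1 / C) * (ennreal C * f i)"
      by (intro mult_left_mono assms) auto
    then show "ennreal (1 / C) * a \<le> f i" by (simp only: inv)
  qed
  then have "ennreal C * (ennreal (1 / C) * a) \<le> ennreal C * (INF i\<in>I. f i)"
    by (rule mult_left_mono) simp
  then show ?thesis by (simp only: inv)
qed

text \<open>The right-hand function may fail to be measurable, so the constant is first moved to the
  measurable left-hand function and extracted from its norm there.\<close>

lemma Lp_norm_le_cmult:
  assumes "0 < p" "0 < C" and [measurable]: "f \<in> borel_measurable M"
    and le: "AE x in M. f x \<le> ennreal C * g x"
  shows "Lp_norm M p f \<le> ennreal C * Lp_norm M p g"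
proof -
  have inv: "ennreal (1 / C) * (ennreal C * z) = z" "ennreal C * (ennreal (1 / C) * z) = z" for z
    using assms(2) by (simp_all add: mult.assoc[symmetric] ennreal_mult[symmetric])
  have "Lp_norm M p (\<lambda>x. ennreal C * (ennreal (1 / C) * f x)) \<le> ennreal C * Lp_norm M p (\<lambda>x. ennreal (1 / C) * f x)"
    by (rule Lp_norm_cmult_le[OF assms(1)]) measurable
  also have "Lp_norm M p (\<lambda>x. ennreal (1 / C) * f x) \<le> Lp_norm M p g"
  proof (rule Lp_norm_mono_AE[OF assms(1)])
    show "AE x in M. ennreal (1 / C) * f x \<le> g x"
      using le
    proof (rule eventually_mono)
      fix x assume "f x \<le> ennreal C * g x"
      then have "ennreal (1 / C) * f x \<le> ennreal (1 / C) * (ennreal C * g x)" by (rule mult_left_mono) simp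
      then show "ennreal (1 / C) * f x \<le> g x" by (simp only: inv)
    qed
  qed measurable
  finally show ?thesis by (simp add: inv mult_left_mono)
qed

context doubling_metric_measure_space
begin

text \<open>Measurability of \<open>f\<close> at every fixed scale matters only for \<open>p = q = \<infinity>\<close>: the essential supremum
  of a nonmeasurable function is \<open>\<infinity>\<close> by convention.\<close>

lemma F_norm_le_D_norm:
  assumes pq: "0 < p" "0 < q" and [measurable]: "\<And>k. b k \<in> borel_measurable \<mu>"
    and f: "\<And>t. 0 < t \<Longrightarrow> (\<lambda>x. f x t) \<in> borel_measurable \<mu>"
    and le: "AE x in \<mu>. \<forall>k t. rad (k + 1) < t \<and> t \<le> rad k \<longrightarrow> f x t \<le> b k x"
  shows "F_norm \<mu> p q f \<le> ennreal (if p = top \<and> q \<noteq> top then Dbl powr (1 / enn2real q) else 1) * D_norm \<mu> p q b"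
proof -
  consider "p \<noteq> top" "q = top" | "p \<noteq> top" "q \<noteq> top" | "p = top" "q \<noteq> top" | "p = top" "q = top" by blast
  then show ?thesis
  proof cases
    case 1
    have "Lp_norm \<mu> p (\<lambda>x. SUP t\<in>{0<..}. f x t) \<le> Lp_norm \<mu> p (\<lambda>x. lq_norm q (\<lambda>k. b k x))"
    proof (rule Lp_norm_mono_AE[OF pq(1)])
      show "AE x in \<mu>. (SUP t\<in>{0<..}. f x t) \<le> lq_norm q (\<lambda>k. b k x)"
        using le
      proof (rule eventually_mono, intro SUP_least)
        fix x t assume *: "\<forall>k t. rad (k + 1) < t \<and> t \<le> rad k \<longrightarrow> f x t \<le> b k x" and "t \<in> {0::real<..}"
        then obtain k where k: "rad (k + 1) < t" "t \<le> rad k" using dyadic_scale[of t] by auto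
        have "f x t \<le> b k x" using * k by blast
        also have "\<dots> \<le> lq_norm q (\<lambda>k. b k x)" using le_lq_norm[OF pq(2), of "\<lambda>k. b k x" k] by simp
        finally show "f x t \<le> lq_norm q (\<lambda>k. b k x)" .
      qed
    qed (use 1 in simp)
    then show ?thesis using 1 by (simp add: F_norm_def D_norm_def infinity_ennreal_def)
  next
    case 2
    then have q: "0 < enn2real q" using pq by (simp add: enn2real_pos)
    let ?q = "enn2real q"
    have "Lp_norm \<mu> p (\<lambda>x. epowr (\<integral>\<^sup>+ t\<in>{0<..}. (epowr (f x t) ?q / ennreal t) \<partial>lborel) (1 / ?q))
        \<le> Lp_norm \<mu> p (\<lambda>x. lq_norm q (\<lambda>k. b k x))"
    proof (rule Lp_norm_mono_AE[OF pq(1)])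
      show "AE x in \<mu>. epowr (\<integral>\<^sup>+ t\<in>{0<..}. (epowr (f x t) ?q / ennreal t) \<partial>lborel) (1 / ?q) \<le> lq_norm q (\<lambda>k. b k x)"
        using le
      proof (rule eventually_mono)
        fix x assume *: "\<forall>k t. rad (k + 1) < t \<and> t \<le> rad k \<longrightarrow> f x t \<le> b k x"
        have "(\<integral>\<^sup>+ t\<in>{0<..}. (epowr (f x t) ?q / ennreal t) \<partial>lborel) \<le> (\<integral>\<^sup>+ k. epowr (b k x) ?q \<partial>count_space UNIV)"
          using * q by (intro integral_dyadic_le(1) epowr_mono) auto
        then show "epowr (\<integral>\<^sup>+ t\<in>{0<..}. (epowr (f x t) ?q / ennreal t) \<partial>lborel) (1 / ?q) \<le> lq_norm q (\<lambda>k. b k x)"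
          unfolding lq_norm_def using 2 q by (auto intro: epowr_mono)
      qed
    qed (use 2 in simp)
    then show ?thesis using 2 by (simp add: F_norm_def D_norm_def infinity_ennreal_def)
  next
    case 3
    then have q: "0 < enn2real q" using pq by (simp add: enn2real_pos)
    let ?q = "enn2real q"
    let ?D = "D_norm \<mu> p q b"
    have "epowr (\<integral>\<^sup>+ t\<in>{0<..<\<rho>}. (nn_avg \<mu> (ball x \<rho>) (\<lambda>y. epowr (f y t) ?q) / ennreal t) \<partial>lborel) (1 / ?q)
      \<le> ennreal (Dbl powr (1 / ?q)) * ?D" if \<rho>: "0 < \<rho>" for x \<rho>
    proof -
      obtain K where K: "rad (K + 1) < \<rho>" "\<rho> \<le> rad K" using dyadic_scale[OF \<rho>] by blast
      have "(\<integral>\<^sup>+ t\<in>{0<..<\<rho>}. (nn_avg \<mu> (ball x \<rho>) (\<lambda>y. epowr (f y t) ?q) / ennreal t) \<partial>lborel) \<le>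
        (\<integral>\<^sup>+ k. nn_avg \<mu> (ball x \<rho>) (\<lambda>y. epowr (b k y) ?q) \<partial>count_space {K..})"
      proof (rule integral_dyadic_le(2)[OF _ K(2)])
        fix k t assume "rad (k + 1) < t" "t \<le> rad k"
        then show "nn_avg \<mu> (ball x \<rho>) (\<lambda>y. epowr (f y t) ?q) \<le> nn_avg \<mu> (ball x \<rho>) (\<lambda>y. epowr (b k y) ?q)"
          using q by (intro nn_avg_mono_AE eventually_mono[OF le] epowr_mono) auto
      qed
      also have "\<dots> \<le> (\<integral>\<^sup>+ k. ennreal Dbl * nn_avg \<mu> (ball x (rad K)) (\<lambda>y. epowr (b k y) ?q) \<partial>count_space {K..})"
      proof (intro nn_integral_mono nn_avg_le_subset)
        have "V x (rad K) \<le> V x (2 * \<rho>)" using K by (intro V_mono subset_ball) (simp add: rad_1)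
        also have "\<dots> \<le> ennreal Dbl * V x \<rho>" by (rule V_double[OF \<rho>])
        finally show "V x (rad K) \<le> ennreal Dbl * V x \<rho>" .
      qed (use \<rho> K Dbl_pos in \<open>auto intro!: subset_ball\<close>)
      also have "\<dots> = ennreal Dbl * (\<integral>\<^sup>+ k. nn_avg \<mu> (ball x (rad K)) (\<lambda>y. epowr (b k y) ?q) \<partial>count_space {K..})"
        by (rule nn_integral_cmult) simp
      finally have "epowr (\<integral>\<^sup>+ t\<in>{0<..<\<rho>}. (nn_avg \<mu> (ball x \<rho>) (\<lambda>y. epowr (f y t) ?q) / ennreal t) \<partial>lborel) (1 / ?q)
        \<le> epowr (ennreal Dbl * (\<integral>\<^sup>+ k. nn_avg \<mu> (ball x (rad K)) (\<lambda>y. epowr (b k y) ?q) \<partial>count_space {K..})) (1 / ?q)"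
        using q by (intro epowr_mono) auto
      also have "\<dots> = ennreal (Dbl powr (1 / ?q)) * epowr (\<integral>\<^sup>+ k. nn_avg \<mu> (ball x (rad K)) (\<lambda>y. epowr (b k y) ?q) \<partial>count_space {K..}) (1 / ?q)"
        using Dbl_pos by (simp add: epowr_mult epowr_ennreal)
      also have "epowr (\<integral>\<^sup>+ k. nn_avg \<mu> (ball x (rad K)) (\<lambda>y. epowr (b k y) ?q) \<partial>count_space {K..}) (1 / ?q) \<le> ?D"
        using 3 by (simp add: D_norm_def) (rule SUP_upper2[of K], simp, rule SUP_upper, simp)
      finally show ?thesis by (simp add: mult_left_mono)
    qed
    then show ?thesis
      using 3 by (subst F_norm_def) (auto intro!: SUP_least simp: infinity_ennreal_def)
  next
    case 4
    have "esssup \<mu> (\<lambda>x. f x t) \<le> esssup \<mu> (\<lambda>x. lq_norm top (\<lambda>k. b k x))" if t: "0 < t" for t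
    proof -
      obtain k where k: "rad (k + 1) < t" "t \<le> rad k" using dyadic_scale[OF t] by blast
      show ?thesis
      proof (rule esssup_AE_mono[OF f[OF t]], rule eventually_mono[OF le])
        fix x assume "\<forall>k t. rad (k + 1) < t \<and> t \<le> rad k \<longrightarrow> f x t \<le> b k x"
        then have "f x t \<le> b k x" using k by blast
        also have "\<dots> \<le> lq_norm top (\<lambda>k. b k x)" using le_lq_norm[of top "\<lambda>k. b k x" k] by simp
        finally show "f x t \<le> lq_norm top (\<lambda>k. b k x)" .
      qed
    qed
    then show ?thesis
      using 4 by (auto simp: F_norm_def D_norm_def Lp_norm_def infinity_ennreal_def intro!: SUP_least)
  qed
qed

text \<open>Slab by slab the discrete sequence lies below f. For an infinite exponent q the sample
  radius 2^-k of each slab suffices; otherwise the mass of the slabs for dt/t enters.\<close>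

lemma D_norm_le_F_norm:
  assumes pq: "0 < p" "0 < q"
  shows "\<exists>C>0. \<forall>a f. (\<forall>k. a k \<in> borel_measurable \<mu>) \<longrightarrow>
    (\<forall>x k t. rad k \<le> t \<and> t < rad (k - 1) \<longrightarrow> a k x \<le> f x t) \<longrightarrow>
    D_norm \<mu> p q a \<le> ennreal C * F_norm \<mu> p q f"
proof -
  consider "p \<noteq> top" "q = top" | "p \<noteq> top" "q \<noteq> top" | "p = top" "q \<noteq> top" | "p = top" "q = top" by blast
  then show ?thesis
  proof cases
    case 1
    show ?thesis
    proof (intro exI[of _ 1] conjI allI impI)
      fix a :: "int \<Rightarrow> 'a \<Rightarrow> ennreal" and f
      assume "\<forall>k. a k \<in> borel_measurable \<mu>" and le: "\<forall>x k t. rad k \<le> t \<and> t < rad (k - 1) \<longrightarrow> a k x \<le> f x t"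
      have "lq_norm q (\<lambda>k. a k x) \<le> (SUP t\<in>{0<..}. f x t)" for x
        unfolding lq_norm_def using 1
      proof (simp add: infinity_ennreal_def, intro SUP_least)
        fix k
        have "a k x \<le> f x (rad k)" using le by (simp add: rad_1)
        then show "a k x \<le> (SUP t\<in>{0<..}. f x t)" by (rule SUP_upper2[rotated]) simp
      qed
      then have "Lp_norm \<mu> p (\<lambda>x. lq_norm q (\<lambda>k. a k x)) \<le> Lp_norm \<mu> p (\<lambda>x. SUP t\<in>{0<..}. f x t)"
        using 1 by (intro Lp_norm_mono_AE pq) auto
      then show "D_norm \<mu> p q a \<le> ennreal 1 * F_norm \<mu> p q f"
        using 1 by (simp add: F_norm_def D_norm_def infinity_ennreal_def)
    qed simp
  next
    case 2
    then have q: "0 < enn2real q" using pq by (simp add: enn2real_pos)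
    let ?q = "enn2real q"
    show ?thesis
    proof (intro exI[of _ "2 powr (1 / ?q)"] conjI allI impI)
      fix a :: "int \<Rightarrow> 'a \<Rightarrow> ennreal" and f
      assume "\<forall>k. a k \<in> borel_measurable \<mu>" and le: "\<forall>x k t. rad k \<le> t \<and> t < rad (k - 1) \<longrightarrow> a k x \<le> f x t"
      then have [measurable]: "\<And>k. a k \<in> borel_measurable \<mu>" by simp
      have "lq_norm q (\<lambda>k. a k x) \<le> ennreal (2 powr (1 / ?q)) * epowr (\<integral>\<^sup>+ t\<in>{0<..}. (epowr (f x t) ?q / ennreal t) \<partial>lborel) (1 / ?q)" for x
      proof -
        have "(\<integral>\<^sup>+ k. epowr (a k x) ?q \<partial>count_space UNIV) \<le> 2 * (\<integral>\<^sup>+ t\<in>{0<..}. (epowr (f x t) ?q / ennreal t) \<partial>lborel)"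
          using le q by (intro integral_dyadic_ge(1) epowr_mono) auto
        then have "epowr (\<integral>\<^sup>+ k. epowr (a k x) ?q \<partial>count_space UNIV) (1 / ?q) \<le>
            epowr (ennreal 2 * (\<integral>\<^sup>+ t\<in>{0<..}. (epowr (f x t) ?q / ennreal t) \<partial>lborel)) (1 / ?q)"
          using q by (intro epowr_mono) auto
        also have "\<dots> = ennreal (2 powr (1 / ?q)) * epowr (\<integral>\<^sup>+ t\<in>{0<..}. (epowr (f x t) ?q / ennreal t) \<partial>lborel) (1 / ?q)"
          by (subst epowr_mult, subst epowr_ennreal) auto
        finally show ?thesis using 2 by (simp add: lq_norm_def infinity_ennreal_def)
      qed
      then have "Lp_norm \<mu> p (\<lambda>x. lq_norm q (\<lambda>k. a k x)) \<le> ennreal (2 powr (1 / ?q)) *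
          Lp_norm \<mu> p (\<lambda>x. epowr (\<integral>\<^sup>+ t\<in>{0<..}. (epowr (f x t) ?q / ennreal t) \<partial>lborel) (1 / ?q))"
        by (intro Lp_norm_le_cmult pq) auto
      then show "D_norm \<mu> p q a \<le> ennreal (2 powr (1 / ?q)) * F_norm \<mu> p q f"
        using 2 by (simp add: F_norm_def D_norm_def infinity_ennreal_def)
    qed simp
  next
    case 3
    then have q: "0 < enn2real q" using pq by (simp add: enn2real_pos)
    let ?q = "enn2real q"
    show ?thesis
    proof (intro exI[of _ "(Dbl * 2) powr (1 / ?q)"] conjI allI impI)
      show "0 < (Dbl * 2) powr (1 / ?q)" using Dbl_pos by simp
      fix a :: "int \<Rightarrow> 'a \<Rightarrow> ennreal" and f
      assume "\<forall>k. a k \<in> borel_measurable \<mu>" and le: "\<forall>x k t. rad k \<le> t \<and> t < rad (k - 1) \<longrightarrow> a k x \<le> f x t"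
      let ?F = "F_norm \<mu> p q f"
      have "epowr (\<integral>\<^sup>+ j. nn_avg \<mu> (ball x (rad K)) (\<lambda>y. epowr (a j y) ?q) \<partial>count_space {K..}) (1 / ?q) \<le>
        ennreal ((Dbl * 2) powr (1 / ?q)) * ?F" for x K
      proof -
        \<comment> \<open>The slabs of the scales j >= K reach up to 2^-(K-1), so the continuous
          Carleson norm is taken on the ball of doubled radius.\<close>
        let ?\<rho> = "rad (K - 1)"
        have "(\<integral>\<^sup>+ j. nn_avg \<mu> (ball x (rad K)) (\<lambda>y. epowr (a j y) ?q) \<partial>count_space {K..}) \<le>
            (\<integral>\<^sup>+ j. ennreal Dbl * nn_avg \<mu> (ball x ?\<rho>) (\<lambda>y. epowr (a j y) ?q) \<partial>count_space {K..})"
          by (intro nn_integral_mono nn_avg_rad_le)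
        also have "\<dots> = ennreal Dbl * (\<integral>\<^sup>+ j. nn_avg \<mu> (ball x ?\<rho>) (\<lambda>y. epowr (a j y) ?q) \<partial>count_space {K..})"
          by (rule nn_integral_cmult) simp
        also have "(\<integral>\<^sup>+ j. nn_avg \<mu> (ball x ?\<rho>) (\<lambda>y. epowr (a j y) ?q) \<partial>count_space {K..}) \<le>
            2 * (\<integral>\<^sup>+ t\<in>{0<..<?\<rho>}. (nn_avg \<mu> (ball x ?\<rho>) (\<lambda>y. epowr (f y t) ?q) / ennreal t) \<partial>lborel)"
          using le q by (intro integral_dyadic_ge(2) nn_avg_mono epowr_mono) auto
        finally have "epowr (\<integral>\<^sup>+ j. nn_avg \<mu> (ball x (rad K)) (\<lambda>y. epowr (a j y) ?q) \<partial>count_space {K..}) (1 / ?q) \<le>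
          epowr (ennreal (Dbl * 2) * (\<integral>\<^sup>+ t\<in>{0<..<?\<rho>}. (nn_avg \<mu> (ball x ?\<rho>) (\<lambda>y. epowr (f y t) ?q) / ennreal t) \<partial>lborel)) (1 / ?q)"
          using q Dbl_pos by (intro epowr_mono) (auto simp: mult_left_mono ennreal_mult mult.assoc)
        also have "\<dots> = ennreal ((Dbl * 2) powr (1 / ?q)) *
          epowr (\<integral>\<^sup>+ t\<in>{0<..<?\<rho>}. (nn_avg \<mu> (ball x ?\<rho>) (\<lambda>y. epowr (f y t) ?q) / ennreal t) \<partial>lborel) (1 / ?q)"
          using Dbl_pos by (subst epowr_mult, subst epowr_ennreal) auto
        also have "epowr (\<integral>\<^sup>+ t\<in>{0<..<?\<rho>}. (nn_avg \<mu> (ball x ?\<rho>) (\<lambda>y. epowr (f y t) ?q) / ennreal t) \<partial>lborel) (1 / ?q) \<le> ?F"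
          using 3 by (simp add: F_norm_def infinity_ennreal_def)
            (rule SUP_upper2[of x], simp, rule SUP_upper, simp)
        finally show ?thesis by (simp add: mult_left_mono)
      qed
      then show "D_norm \<mu> p q a \<le> ennreal ((Dbl * 2) powr (1 / ?q)) * ?F"
        using 3 by (subst D_norm_def) (auto intro!: SUP_least simp: infinity_ennreal_def)
    qed
  next
    case 4
    show ?thesis
    proof (intro exI[of _ 1] conjI allI impI)
      fix a :: "int \<Rightarrow> 'a \<Rightarrow> ennreal" and f
      assume "\<forall>k. a k \<in> borel_measurable \<mu>" and le: "\<forall>x k t. rad k \<le> t \<and> t < rad (k - 1) \<longrightarrow> a k x \<le> f x t"
      then have [measurable]: "\<And>k. a k \<in> borel_measurable \<mu>" by simp
      let ?F = "SUP t\<in>{0<..}. esssup \<mu> (\<lambda>x. f x t)"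
      have "AE x in \<mu>. \<forall>k. a k x \<le> ?F"
        unfolding AE_all_countable
      proof
        fix k
        have "esssup \<mu> (\<lambda>x. f x (rad k)) \<le> ?F" by (rule SUP_upper) simp
        moreover have "a k x \<le> f x (rad k)" for x using le by (simp add: rad_1)
        ultimately show "AE x in \<mu>. a k x \<le> ?F"
          by (intro eventually_mono[OF esssup_AE[of "\<lambda>x. f x (rad k)" \<mu>]]) (meson order_trans)
      qed
      then have "esssup \<mu> (\<lambda>x. lq_norm top (\<lambda>k. a k x)) \<le> ?F"
        by (intro esssup_I) (auto elim!: eventually_mono intro!: SUP_least simp: lq_norm_def infinity_ennreal_def)
      then show "D_norm \<mu> p q a \<le> ennreal 1 * F_norm \<mu> p q f"
        using 4 by (simp add: F_norm_def D_norm_def Lp_norm_def infinity_ennreal_def)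
    qed simp
  qed
qed

section \<open>From oscillations to Hajlasz gradients\<close>

lemma osc_scale:
  assumes \<sigma>: "0 < \<sigma>" and s: "0 \<le> s" and t: "0 < t" "t \<le> t'" "t' \<le> 2 * t" and le: "X \<le> ennreal Dbl * Y"
  shows "ennreal (t powr (- s)) * epowr X (1 / \<sigma>) \<le>
    ennreal (2 powr s * Dbl powr (1 / \<sigma>)) * (ennreal (t' powr (- s)) * epowr Y (1 / \<sigma>))"
proof -
  have "t powr (- s) \<le> (t' / 2) powr (- s)" using t s by (intro powr_mono2') auto
  also have "\<dots> = 2 powr s * t' powr (- s)" using t by (simp add: powr_divide powr_minus field_simps)
  finally have 1: "ennreal (t powr (- s)) \<le> ennreal (2 powr s * t' powr (- s))" by (rule ennreal_leI)
  have "epowr X (1 / \<sigma>) \<le> epowr (ennreal Dbl * Y) (1 / \<sigma>)" using \<sigma> le by (intro epowr_mono) auto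
  also have "\<dots> = ennreal (Dbl powr (1 / \<sigma>)) * epowr Y (1 / \<sigma>)"
    using Dbl_pos by (simp add: epowr_mult epowr_ennreal)
  finally have "ennreal (t powr (- s)) * epowr X (1 / \<sigma>) \<le>
      ennreal (2 powr s * t' powr (- s)) * (ennreal (Dbl powr (1 / \<sigma>)) * epowr Y (1 / \<sigma>))"
    using 1 by (intro mult_mono) auto
  then show ?thesis by (simp add: ennreal_mult mult_ac)
qed

lemma nn_avg_scale:
  assumes t: "0 < t" "t \<le> t'" "t' \<le> 2 * t"
  shows "nn_avg \<mu> (ball x t) f \<le> ennreal Dbl * nn_avg \<mu> (ball x t') f"
proof (rule nn_avg_le_subset)
  have "V x t' \<le> V x (2 * t)" using t by (intro V_mono subset_ball)
  also have "\<dots> \<le> ennreal Dbl * V x t" by (rule V_double[OF t(1)])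
  finally show "V x t' \<le> ennreal Dbl * V x t" .
qed (use t Dbl_pos in \<open>auto intro!: subset_ball\<close>)

lemma INF_avg_scale:
  assumes t: "0 < t" "t \<le> t'" "t' \<le> 2 * t"
  shows "(INF c. nn_avg \<mu> (ball x t) (f c)) \<le> ennreal Dbl * (INF c. nn_avg \<mu> (ball x t') (f c))"
proof (rule le_cmult_INF[OF Dbl_pos])
  fix c
  have "(INF c. nn_avg \<mu> (ball x t) (f c)) \<le> nn_avg \<mu> (ball x t) (f c)" by (rule INF_lower) simp
  also have "\<dots> \<le> ennreal Dbl * nn_avg \<mu> (ball x t') (f c)" by (rule nn_avg_scale[OF t])
  finally show "(INF c. nn_avg \<mu> (ball x t) (f c)) \<le> ennreal Dbl * nn_avg \<mu> (ball x t') (f c)" .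
qed

lemma I_osc_scale:
  assumes "0 < \<sigma>" "0 \<le> s" "0 < t" "t \<le> t'" "t' \<le> 2 * t"
  shows "I_osc \<mu> s \<sigma> u x t \<le> ennreal (2 powr s * Dbl powr (1 / \<sigma>)) * I_osc \<mu> s \<sigma> u x t'"
  unfolding I_osc_def using assms by (intro osc_scale INF_avg_scale)

lemma C_osc_scale:
  assumes "0 < \<sigma>" "0 \<le> s" "0 < t" "t \<le> t'" "t' \<le> 2 * t"
  shows "C_osc \<mu> s \<sigma> u x t \<le> ennreal (2 powr s * Dbl powr (1 / \<sigma>)) * C_osc \<mu> s \<sigma> u x t'"
  unfolding C_osc_def using assms by (intro osc_scale nn_avg_scale)

lemma exists_exponent_below:
  fixes r :: ennreal
  assumes "0 < r"
  shows "\<exists>\<tau>>0. \<tau> \<le> 1 \<and> ennreal \<tau> < r"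
proof -
  obtain z where z: "0 < z" "z < min r 1" using dense[of 0 "min r 1"] assms by auto
  then have "z < top" by (auto intro: order_less_trans)
  then obtain \<tau> where "z = ennreal \<tau>" "0 \<le> \<tau>" by (cases z) auto
  then show ?thesis using z by (intro exI[of _ \<tau>]) (auto simp: less_le)
qed

lemma approx_cont_AE:
  assumes "u \<in> borel_measurable \<mu>"
  shows "AE x in \<mu>. x \<in> approx_cont u"
  using approximate_continuity[OF assms] by (simp add: approx_cont_def)

text \<open>Dividing the sums of \<open>osc_difference\<close> by the s-th power of the distance
  turns them into one-sided Hardy sums \<open>b\<close> of the dyadic oscillations \<open>a\<close>,
  and these are the gradient. Hardy sums are covered by \<open>T\<close> with some \<tau> <= 1 below
  p and q, so this direction imposes no condition on \<sigma>. As f is any function above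
  \<open>I_osc\<close>, the comparison goes through the measurable sequence
  \<open>a\<close>.\<close>

lemma F_space_to_M_space:
  assumes s: "0 < s" and \<sigma>: "0 < \<sigma>" and pq: "0 < p" "0 < q"
  shows "\<exists>C>0. \<forall>u\<in>L_loc \<mu> \<sigma>. \<forall>f. (\<forall>x t. 0 < t \<longrightarrow> I_osc \<mu> s \<sigma> u x t \<le> f x t) \<longrightarrow> F_norm \<mu> p q f < \<infinity> \<longrightarrow>
    M_norm \<mu> s p q u < \<infinity> \<and> M_norm \<mu> s p q u \<le> ennreal C * F_norm \<mu> p q f"
proof -
  define Kq where "Kq = 2 powr s * Dbl powr (1 / \<sigma>)"
  have Kq: "0 < Kq" using Dbl_pos by (simp add: Kq_def)
  obtain C1 where C1: "0 < C1" "\<And>a f. (\<And>k. a k \<in> borel_measurable \<mu>) \<Longrightarrow>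
    (\<And>x k t. rad k \<le> t \<Longrightarrow> t < rad (k - 1) \<Longrightarrow> a k x \<le> f x t) \<Longrightarrow>
    D_norm \<mu> p q a \<le> ennreal C1 * F_norm \<mu> p q f"
    using D_norm_le_F_norm[OF pq] by blast
  obtain K where K: "0 < K" "\<And>u x y k. u \<in> borel_measurable \<mu> \<Longrightarrow> x \<in> approx_cont u \<Longrightarrow> y \<in> approx_cont u \<Longrightarrow> dist x y < rad k \<Longrightarrow>
    ennreal \<bar>u x - u y\<bar> \<le> ennreal K * ((\<integral>\<^sup>+ j. osc \<sigma> u x (rad j) \<partial>count_space {k - 1..}) +
      (\<integral>\<^sup>+ j. osc \<sigma> u y (rad j) \<partial>count_space {k - 1..}))"
    using osc_difference[OF \<sigma>] by blast
  obtain \<tau> where \<tau>: "0 < \<tau>" "\<tau> \<le> 1" "ennreal \<tau> < p" "ennreal \<tau> < q"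
    using exists_exponent_below[of "min p q"] pq by auto
  \<comment> \<open>The two factors 2^s bridge the gap between scale k + 1, the lower end of the
    annulus, and scale k - 1, where the sums start.\<close>
  define K2 where "K2 = K * 2 powr s * 2 powr s"
  have K2: "0 < K2" using K by (simp add: K2_def)
  define K3 where "K3 = K2 * (2 powr (s * \<tau>) * Dbl) powr (1 / \<tau>)"
  have K3: "0 < K3" using K2 Dbl_pos by (simp add: K3_def)
  have "0 < s * \<tau>" using s \<tau> by simp
  from D_norm_le_T[OF this \<tau>(1,3,4) K3] obtain C2 where C2: "0 < C2"
    "\<And>a g. (\<And>k. a k \<in> borel_measurable \<mu>) \<Longrightarrow> (\<And>k. g k \<in> borel_measurable \<mu>) \<Longrightarrow>
    (\<And>k. AE x in \<mu>. a k x \<le> ennreal K3 * epowr (T (s * \<tau>) (\<lambda>j y. epowr (g j y) \<tau>) (k - 2) x) (1 / \<tau>)) \<Longrightarrow>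
    D_norm \<mu> p q a \<le> ennreal C2 * D_norm \<mu> p q g" by blast
  show ?thesis
  proof (intro exI[of _ "C2 * (Kq * C1)"] conjI ballI allI impI)
    show "0 < C2 * (Kq * C1)" using C1 C2 Kq by simp
    fix u f assume uL: "u \<in> L_loc \<mu> \<sigma>" and If: "\<forall>x t. 0 < t \<longrightarrow> I_osc \<mu> s \<sigma> u x t \<le> f x t"
      and fin: "F_norm \<mu> p q f < \<infinity>"
    from uL have um [measurable]: "u \<in> borel_measurable \<mu>" by (simp add: L_loc_def)
    define a where "a k x = I_osc \<mu> s \<sigma> u x (rad k)" for k x
    have [measurable]: "a k \<in> borel_measurable \<mu>" for k
      unfolding a_def[abs_def] by (rule I_osc_measurable[OF \<sigma> uL]) simp
    have Da: "D_norm \<mu> p q a \<le> ennreal (Kq * C1) * F_norm \<mu> p q f"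
    proof -
      \<comment> \<open>The comparison with \<open>F_norm\<close> asks for a pointwise bound without
        a constant, so \<open>a\<close> is rescaled by 1/Kq.\<close>
      have "D_norm \<mu> p q a \<le> ennreal Kq * D_norm \<mu> p q (\<lambda>k x. ennreal (1 / Kq) * a k x)"
        using Kq by (intro D_norm_le_cmult pq) (auto simp: mult.assoc[symmetric] ennreal_mult[symmetric])
      also have "D_norm \<mu> p q (\<lambda>k x. ennreal (1 / Kq) * a k x) \<le> ennreal C1 * F_norm \<mu> p q f"
      proof (rule C1(2))
        fix x k t assume t: "rad k \<le> t" "t < rad (k - 1)"
        have t0: "0 < t" using t(1) rad_pos(1)[of k] by linarith
        have "a k x \<le> ennreal Kq * I_osc \<mu> s \<sigma> u x t"
          unfolding a_def Kq_def using t s \<sigma> by (intro I_osc_scale) (auto simp: rad_1)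
        also have "\<dots> \<le> ennreal Kq * f x t" using If t0 by (intro mult_left_mono) auto
        finally have "ennreal (1 / Kq) * a k x \<le> ennreal (1 / Kq) * (ennreal Kq * f x t)"
          by (rule mult_left_mono) simp
        then show "ennreal (1 / Kq) * a k x \<le> f x t"
          using Kq by (simp add: mult.assoc[symmetric] ennreal_mult[symmetric])
      qed measurable
      finally show ?thesis using Kq C1 by (simp add: ennreal_mult mult_left_mono mult.assoc)
    qed
    define b where "b k x = ennreal K2 * (\<integral>\<^sup>+ j. wgt s (k - 1) j * a j x \<partial>count_space UNIV)" for k x
    have [measurable]: "b k \<in> borel_measurable \<mu>" for k unfolding b_def[abs_def] by measurable
    have b_le: "b k x \<le> ennreal K3 * epowr (T (s * \<tau>) (\<lambda>j y. epowr (a j y) \<tau>) (k - 2) x) (1 / \<tau>)" for k x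
    proof -
      have "b k x \<le> ennreal K2 * epowr (T (s * \<tau>) (\<lambda>j y. epowr (a j y) \<tau>) (k - 1) x) (1 / \<tau>)"
        unfolding b_def by (intro mult_left_mono Hardy_le_T \<tau>) auto
      also have "\<dots> \<le> ennreal K2 * (ennreal ((2 powr (s * \<tau>) * Dbl) powr (1 / \<tau>)) * epowr (T (s * \<tau>) (\<lambda>j y. epowr (a j y) \<tau>) (k - 2) x) (1 / \<tau>))"
        using epowr_T_shift[OF \<tau>(1), of "s * \<tau>" _ "k - 1" x] by (intro mult_left_mono) auto
      finally show ?thesis using K2 Dbl_pos by (simp add: K3_def ennreal_mult mult.assoc)
    qed
    have Db: "D_norm \<mu> p q b \<le> ennreal C2 * D_norm \<mu> p q a"
      by (rule C2(2)) (auto intro: b_le)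
    also have "\<dots> \<le> ennreal C2 * (ennreal (Kq * C1) * F_norm \<mu> p q f)"
      by (rule mult_left_mono[OF Da]) simp
    finally have Dbf: "D_norm \<mu> p q b \<le> ennreal (C2 * (Kq * C1)) * F_norm \<mu> p q f"
      using C1 C2 Kq by (simp add: ennreal_mult mult.assoc)
    also have "\<dots> < top" using fin by (simp add: ennreal_mult_less_top infinity_ennreal_def)
    finally have Dfin: "D_norm \<mu> p q b < top" .
    \<comment> \<open>Both sources of exceptional points: failure of approximate continuity, and
      infinite Hardy sums, where the real-valued g would not bound anything.\<close>
    have "AE x in \<mu>. x \<in> approx_cont u \<and> (\<forall>k. b k x < top)"
      using approx_cont_AE[OF um] D_norm_finite_AE[OF pq _ Dfin] by (intro AE_conjI) auto
    then obtain E where E: "E \<in> null_sets \<mu>" and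
      Egood': "\<And>x. x \<in> space \<mu> - E \<Longrightarrow> x \<in> approx_cont u \<and> (\<forall>k. b k x < top)"
      by (rule AE_E3) blast
    have Egood: "x \<in> approx_cont u" "b k x < top" if "x \<notin> E" for x k using Egood'[of x] that by auto
    define g where "g k x = enn2real (b k x)" for k x
    have S_eq: "ennreal K * (\<integral>\<^sup>+ j. osc \<sigma> u x (rad j) \<partial>count_space {k - 1..}) = ennreal (rad (k + 1) powr s) * b k x" for k x
    proof -
      have "ennreal (rad (k + 1) powr s) * b k x =
        (\<integral>\<^sup>+ j. ennreal (rad (k + 1) powr s) * (ennreal K2 * (wgt s (k - 1) j * a j x)) \<partial>count_space UNIV)"
        unfolding b_def by (simp add: nn_integral_cmult)
      also have "\<dots> = (\<integral>\<^sup>+ j. ennreal K * (if k - 1 \<le> j then osc \<sigma> u x (rad j) else 0) \<partial>count_space UNIV)"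
      proof (intro nn_integral_cong)
        fix j
        have "rad (k + 1) powr s * (K2 * (2 powr (of_int (k - 1 - j) * s) * rad j powr (- s))) = K"
        proof -
          have "rad (k + 1) powr s * (2 powr s * 2 powr s) * (2 powr (of_int (k - 1 - j) * s) * rad j powr (- s)) =
            2 powr (- of_int (k + 1) * s + (s + s) + (of_int (k - 1 - j) * s + - of_int j * (- s)))"
            by (simp only: rad_powr powr_add)
          also have "- of_int (k + 1) * s + (s + s) + (of_int (k - 1 - j) * s + - of_int j * (- s)) = 0"
            by (simp add: algebra_simps)
          finally show ?thesis by (simp add: K2_def mult_ac)
        qed
        moreover have "0 < K2 * (2 powr (of_int (k - 1 - j) * s) * rad j powr (- s))" using K2 by simp
        ultimately show "ennreal (rad (k + 1) powr s) * (ennreal K2 * (wgt s (k - 1) j * a j x)) =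
          ennreal K * (if k - 1 \<le> j then osc \<sigma> u x (rad j) else 0)"
          using K2 by (auto simp: wgt_def a_def I_osc_eq ennreal_mult[symmetric] mult.assoc[symmetric])
      qed
      also have "\<dots> = ennreal K * (\<integral>\<^sup>+ j. osc \<sigma> u x (rad j) \<partial>count_space {k - 1..})"
        unfolding int_sum_atLeast by (rule nn_integral_cmult) simp
      finally show ?thesis by simp
    qed
    have grad: "\<bar>u x - u y\<bar> \<le> dist x y powr s * (g k x + g k y)"
      if xy: "x \<notin> E" "y \<notin> E" and d: "rad (k + 1) \<le> dist x y" "dist x y < rad k" for x y k
    proof -
      have "ennreal \<bar>u x - u y\<bar> \<le> ennreal (rad (k + 1) powr s) * (b k x + b k y)"
        using K(2)[OF um Egood(1)[OF xy(1)] Egood(1)[OF xy(2)] d(2)] by (simp add: distrib_left S_eq)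
      also have "\<dots> = ennreal (rad (k + 1) powr s * (g k x + g k y))"
        using Egood(2)[OF xy(1), of k] Egood(2)[OF xy(2), of k] by (simp add: g_def ennreal_mult)
      finally have "\<bar>u x - u y\<bar> \<le> rad (k + 1) powr s * (g k x + g k y)"
        by (subst (asm) ennreal_le_iff) (auto simp: g_def)
      \<comment> \<open>The lower end of the annulus is used here: the distance is at least
        2^-(k+1).\<close>
      also have "\<dots> \<le> dist x y powr s * (g k x + g k y)"
        using d s by (intro mult_right_mono powr_mono2) (auto simp: g_def)
      finally show ?thesis .
    qed
    have g: "g \<in> hajlasz_gradients \<mu> s u"
      unfolding hajlasz_gradients_def
    proof (intro CollectI conjI allI bexI[of _ E] ballI impI)
      show "g k \<in> borel_measurable \<mu>" for k unfolding g_def[abs_def] by measurable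
      show "0 \<le> g k x" for k x by (simp add: g_def)
      show "\<bar>u x - u y\<bar> \<le> dist x y powr s * (g k x + g k y)"
        if "x \<in> - E" "y \<in> - E" "2 powi (- k - 1) \<le> dist x y \<and> dist x y < 2 powi (- k)" for k x y
        using that grad[of x y k] rad_powi[of "k + 1"] rad_powi[of k] by simp
    qed (rule E)
    have "M_norm \<mu> s p q u \<le> D_norm \<mu> p q (\<lambda>k x. ennreal (g k x))"
      unfolding M_norm_eq by (rule INF_lower[OF g])
    also have "\<dots> \<le> D_norm \<mu> p q b"
    proof (rule D_norm_mono_AE[OF pq])
      show "(\<lambda>x. ennreal (g k x)) \<in> borel_measurable \<mu>" for k unfolding g_def by measurable
      show "AE x in \<mu>. ennreal (g k x) \<le> b k x" for k by (simp add: g_def ennreal_enn2real_if)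
    qed
    finally have M: "M_norm \<mu> s p q u \<le> D_norm \<mu> p q b" .
    then show "M_norm \<mu> s p q u \<le> ennreal (C2 * (Kq * C1)) * F_norm \<mu> p q f" using Dbf by (rule order_trans)
    show "M_norm \<mu> s p q u < \<infinity>" using M Dfin by (simp add: infinity_ennreal_def)
  qed
qed

end

section \<open>From Hajlasz gradients to oscillations\<close>

context doubling_metric_measure_space
begin

lemma AE_in_ball:
  assumes "AE x in \<mu>. P x" "0 < r"
  shows "\<exists>x\<in>ball z r. P x"
proof (rule ccontr)
  assume no: "\<not> ?thesis"
  obtain N where N: "N \<in> null_sets \<mu>" "\<And>x. x \<in> space \<mu> - N \<Longrightarrow> P x"
    using assms(1) by (rule AE_E3) blast
  have "ball z r \<subseteq> N" using no N(2) by auto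
  then have "V z r \<le> emeasure \<mu> N" using N(1) by (intro emeasure_mono) auto
  then show False using N(1) assms(2) by auto
qed

text \<open>Good centres are dense, so every ball lies in a large dyadic ball around a good centre,
  where u differs from a constant by a function with finite \<sigma>-integral.\<close>

lemma L_loc_from_oscillation:
  assumes \<sigma>: "0 < \<sigma>" and [measurable]: "u \<in> borel_measurable \<mu>"
    and fin: "AE x in \<mu>. \<forall>k. \<exists>c. nn_avg \<mu> (ball x (rad k)) (\<lambda>y. ennreal (\<bar>u y - c\<bar> powr \<sigma>)) < top"
  shows "u \<in> L_loc \<mu> \<sigma>"
  unfolding L_loc_def
proof (intro CollectI conjI allI impI)
  fix z and r :: real assume r: "0 < r"
  obtain x where x: "x \<in> ball z r"
    "\<And>k. \<exists>c. nn_avg \<mu> (ball x (rad k)) (\<lambda>y. ennreal (\<bar>u y - c\<bar> powr \<sigma>)) < top"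
    using AE_in_ball[OF fin r] by blast
  obtain k where k: "2 * r < rad k" using rad_unbounded by blast
  obtain c where c: "nn_avg \<mu> (ball x (rad k)) (\<lambda>y. ennreal (\<bar>u y - c\<bar> powr \<sigma>)) < top" using x(2) by blast
  have "(\<integral>\<^sup>+ y\<in>ball x (rad k). ennreal (\<bar>u y - c\<bar> powr \<sigma>) \<partial>\<mu>) =
      nn_avg \<mu> (ball x (rad k)) (\<lambda>y. ennreal (\<bar>u y - c\<bar> powr \<sigma>)) * V x (rad k)"
    by (simp add: nn_avg_def ennreal_divide_mult_cancel)
  also have "\<dots> < top" using c by (simp add: ennreal_mult_less_top)
  finally have 1: "(\<integral>\<^sup>+ y\<in>ball x (rad k). ennreal (\<bar>u y - c\<bar> powr \<sigma>) \<partial>\<mu>) < top" .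
  have "(\<integral>\<^sup>+ y\<in>ball z r. ennreal (\<bar>u y\<bar> powr \<sigma>) \<partial>\<mu>) \<le>
      (\<integral>\<^sup>+ y. ennreal (2 powr \<sigma>) * (ennreal (\<bar>u y - c\<bar> powr \<sigma>) * indicator (ball x (rad k)) y +
        ennreal (\<bar>c\<bar> powr \<sigma>) * indicator (ball x (rad k)) y) \<partial>\<mu>)"
  proof (intro nn_integral_mono)
    fix y
    show "ennreal (\<bar>u y\<bar> powr \<sigma>) * indicator (ball z r) y \<le>
      ennreal (2 powr \<sigma>) * (ennreal (\<bar>u y - c\<bar> powr \<sigma>) * indicator (ball x (rad k)) y +
        ennreal (\<bar>c\<bar> powr \<sigma>) * indicator (ball x (rad k)) y)"
    proof (cases "y \<in> ball z r")
      case True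
      then have "y \<in> ball x (rad k)" using x(1) k dist_triangle[of x y z] by (simp add: dist_commute)
      moreover have "ennreal (\<bar>u y\<bar> powr \<sigma>) \<le> epowr (ennreal \<bar>u y - c\<bar> + ennreal \<bar>c\<bar>) \<sigma>"
        using \<sigma> by (auto simp: epowr_ennreal simp flip: ennreal_plus intro!: ennreal_leI powr_mono2)
      then have "ennreal (\<bar>u y\<bar> powr \<sigma>) \<le> ennreal (2 powr \<sigma>) * (epowr (ennreal \<bar>u y - c\<bar>) \<sigma> + epowr (ennreal \<bar>c\<bar>) \<sigma>)"
        by (rule order_trans[OF _ epowr_add_le[OF \<sigma>]])
      ultimately show ?thesis using True by (simp add: epowr_ennreal)
    qed simp
  qed
  also have "\<dots> = ennreal (2 powr \<sigma>) * ((\<integral>\<^sup>+ y\<in>ball x (rad k). ennreal (\<bar>u y - c\<bar> powr \<sigma>) \<partial>\<mu>) + ennreal (\<bar>c\<bar> powr \<sigma>) * V x (rad k))"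
    by (simp add: nn_integral_cmult nn_integral_add nn_integral_cmult_indicator)
  also have "\<dots> < top" using 1 by (simp add: ennreal_mult_less_top)
  finally show "(\<integral>\<^sup>+ y\<in>ball z r. ennreal (\<bar>u y\<bar> powr \<sigma>) \<partial>\<mu>) < \<infinity>" by (simp add: infinity_ennreal_def)
qed fact

lemma epowr_T_shift2:
  assumes "0 < \<tau>"
  shows "epowr (T \<delta> h k x) (1 / \<tau>) \<le>
    ennreal ((2 powr \<delta> * Dbl) powr (1 / \<tau>) * (2 powr \<delta> * Dbl) powr (1 / \<tau>)) * epowr (T \<delta> h (k - 2) x) (1 / \<tau>)"
proof -
  have "epowr (T \<delta> h k x) (1 / \<tau>) \<le> ennreal ((2 powr \<delta> * Dbl) powr (1 / \<tau>)) * epowr (T \<delta> h (k - 1) x) (1 / \<tau>)"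
    by (rule epowr_T_shift[OF assms])
  also have "\<dots> \<le> ennreal ((2 powr \<delta> * Dbl) powr (1 / \<tau>)) *
      (ennreal ((2 powr \<delta> * Dbl) powr (1 / \<tau>)) * epowr (T \<delta> h (k - 2) x) (1 / \<tau>))"
    using epowr_T_shift[OF assms, of \<delta> h "k - 1" x] by (intro mult_left_mono) auto
  finally show ?thesis by (simp add: ennreal_mult mult.assoc)
qed

section \<open>Bounds by the Hajlasz norm\<close>

lemma M_norm_dominates:
  assumes \<delta>: "0 < \<delta>" and \<tau>: "0 < \<tau>" and pq: "ennreal \<tau> < p" "ennreal \<tau> < q" and K: "0 < K"
  shows "\<exists>C>0. \<forall>u a. (\<forall>k. a k \<in> borel_measurable \<mu>) \<longrightarrow>
    (\<forall>g\<in>hajlasz_gradients \<mu> s u. \<forall>k. AE x in \<mu>. a k x \<le>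
      ennreal K * epowr (T \<delta> (\<lambda>j y. epowr (ennreal (g j y)) \<tau>) (k - 2) x) (1 / \<tau>)) \<longrightarrow>
    D_norm \<mu> p q a \<le> ennreal C * M_norm \<mu> s p q u"
proof -
  obtain C where C: "0 < C" "\<And>a g. (\<And>k. a k \<in> borel_measurable \<mu>) \<Longrightarrow> (\<And>k. g k \<in> borel_measurable \<mu>) \<Longrightarrow>
    (\<And>k. AE x in \<mu>. a k x \<le> ennreal K * epowr (T \<delta> (\<lambda>j y. epowr (g j y) \<tau>) (k - 2) x) (1 / \<tau>)) \<Longrightarrow>
    D_norm \<mu> p q a \<le> ennreal C * D_norm \<mu> p q g"
    using D_norm_le_T[OF \<delta> \<tau> pq K] by blast
  show ?thesis
  proof (intro exI[of _ C] conjI allI impI)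
    show "0 < C" by (rule C)
    fix u and a :: "int \<Rightarrow> 'a \<Rightarrow> ennreal"
    assume a: "\<forall>k. a k \<in> borel_measurable \<mu>" and le: "\<forall>g\<in>hajlasz_gradients \<mu> s u. \<forall>k. AE x in \<mu>. a k x \<le>
      ennreal K * epowr (T \<delta> (\<lambda>j y. epowr (ennreal (g j y)) \<tau>) (k - 2) x) (1 / \<tau>)"
    show "D_norm \<mu> p q a \<le> ennreal C * M_norm \<mu> s p q u"
      unfolding M_norm_eq
    proof (rule le_cmult_INF[OF C(1)])
      fix g assume g: "g \<in> hajlasz_gradients \<mu> s u"
      then have [measurable]: "\<And>k. g k \<in> borel_measurable \<mu>" by (simp add: hajlasz_gradients_def)
      show "D_norm \<mu> p q a \<le> ennreal C * D_norm \<mu> p q (\<lambda>k x. ennreal (g k x))"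
        using a le g by (intro C(2)) auto
    qed
  qed
qed

lemma T_finite_AE:
  assumes \<delta>: "0 < \<delta>" and \<tau>: "0 < \<tau>" and pq: "ennreal \<tau> < p" "ennreal \<tau> < q"
    and M: "M_norm \<mu> s p q u < \<infinity>"
  shows "\<exists>g\<in>hajlasz_gradients \<mu> s u. AE x in \<mu>. \<forall>k. T \<delta> (\<lambda>j y. epowr (ennreal (g j y)) \<tau>) k x < top"
proof -
  have pq0: "0 < p" "0 < q" using pq by (auto intro: le_less_trans[OF zero_le])
  obtain C where C: "0 < C" "\<And>g. (\<And>k. g k \<in> borel_measurable \<mu>) \<Longrightarrow>
    D_norm \<mu> p q (\<lambda>k x. epowr (T \<delta> (\<lambda>j y. epowr (g j y) \<tau>) k x) (1 / \<tau>)) \<le> ennreal C * D_norm \<mu> p q g"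
    using T_norm_bound[OF \<delta> \<tau> pq] by blast
  obtain g where g: "g \<in> hajlasz_gradients \<mu> s u" "D_norm \<mu> p q (\<lambda>k x. ennreal (g k x)) < top"
    using M unfolding M_norm_eq by (auto simp: INF_less_iff infinity_ennreal_def)
  then have [measurable]: "\<And>k. g k \<in> borel_measurable \<mu>" by (simp add: hajlasz_gradients_def)
  have "D_norm \<mu> p q (\<lambda>k x. epowr (T \<delta> (\<lambda>j y. epowr (ennreal (g j y)) \<tau>) k x) (1 / \<tau>)) < top"
    using C(2)[of "\<lambda>k x. ennreal (g k x)"] g(2)
    by (auto intro: le_less_trans simp: ennreal_mult_less_top)
  then have "AE x in \<mu>. \<forall>k. epowr (T \<delta> (\<lambda>j y. epowr (ennreal (g j y)) \<tau>) k x) (1 / \<tau>) < top"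
    by (intro D_norm_finite_AE[OF pq0]) auto
  then show ?thesis using g(1) by (intro bexI[of _ g]) simp_all
qed

text \<open>For finite r the inequality \<open>key\<close>, which is the case \<epsilon> = s,
  rewrites \<sigma> < r_*(s) if r s < n and holds for every \<sigma> otherwise. Being strict, it
  survives for \<epsilon> slightly below s.\<close>

lemma Sobolev_exponent:
  assumes \<sigma>: "0 < \<sigma>" and s: "0 < s" and r: "0 < r" "ennreal \<sigma> < r_star n r s"
  shows "\<exists>\<epsilon>>0. \<epsilon> < s \<and> ennreal (\<sigma> * n / (n + \<sigma> * \<epsilon>)) < r"
proof (cases r)
  case top
  then show ?thesis using s by (intro exI[of _ "s / 2"]) auto
next
  case (real r')
  then have r': "0 < r'" using r by auto
  have key: "\<sigma> * n < r' * (n + \<sigma> * s)"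
  proof (cases "r' < n / s")
    case True
    then have d: "0 < n - r' * s" using s by (simp add: field_simps)
    have "r < ennreal (n / s)" using True real by (simp add: ennreal_less_iff)
    then have "ennreal \<sigma> < ennreal (n * r' / (n - r' * s))" using r real by (simp add: r_star_def)
    then have "\<sigma> < n * r' / (n - r' * s)" using \<sigma> by (simp add: ennreal_less_iff)
    then have "\<sigma> * (n - r' * s) < n * r'" using d by (simp add: field_simps)
    then show ?thesis by (simp add: algebra_simps)
  next
    case False
    then have "n \<le> r' * s" using s by (simp add: field_simps)
    then have "\<sigma> * n \<le> \<sigma> * (r' * s)" using \<sigma> by (intro mult_left_mono) auto
    moreover have "0 < r' * n" using r' n_pos by simp
    ultimately show ?thesis by (simp add: algebra_simps)
  qed
  \<comment> \<open>The value of \<epsilon> at which the exponent equals r'. It may be negative, so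
    \<epsilon> is taken midway between max e0 0 and s.\<close>
  define e0 where "e0 = (\<sigma> * n / r' - n) / \<sigma>"
  have "\<sigma> * n / r' - n < \<sigma> * s" using key r' by (simp add: field_simps)
  then have e0: "e0 < s" using \<sigma> by (simp add: e0_def field_simps)
  define \<epsilon> where "\<epsilon> = (max e0 0 + s) / 2"
  have \<epsilon>: "0 < \<epsilon>" "\<epsilon> < s" "e0 < \<epsilon>" using e0 s by (auto simp: \<epsilon>_def)
  have "\<sigma> * n / r' - n < \<sigma> * \<epsilon>" using \<epsilon>(3) \<sigma> by (simp add: e0_def field_simps)
  then have "\<sigma> * n < r' * (n + \<sigma> * \<epsilon>)" using r' by (simp add: field_simps)
  moreover have "0 < n + \<sigma> * \<epsilon>" using n_pos \<sigma> \<epsilon> by (simp add: add_pos_pos)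
  ultimately have "\<sigma> * n / (n + \<sigma> * \<epsilon>) < r'" by (simp add: pos_divide_less_eq mult.commute)
  then show ?thesis using \<epsilon> real r' by (intro exI[of _ \<epsilon>]) (auto simp: ennreal_less_iff ennreal_lessI)
qed

text \<open>Membership in \<open>L_loc\<close> has to come first, from one gradient whose image
  under \<open>T\<close> is finite almost everywhere: the measurability of the oscillation, required
  by the norm estimate, relies on it.\<close>

lemma M_space_I_osc:
  assumes s: "0 < s" and \<sigma>: "0 < \<sigma>" and pq: "0 < p" "0 < q" and r: "ennreal \<sigma> < r_star n (min p q) s"
  shows "\<exists>C>0. \<forall>u\<in>borel_measurable \<mu>. M_norm \<mu> s p q u < \<infinity> \<longrightarrow>
    u \<in> L_loc \<mu> \<sigma> \<and> D_norm \<mu> p q (\<lambda>k x. I_osc \<mu> s \<sigma> u x (rad k)) \<le> ennreal C * M_norm \<mu> s p q u"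
proof -
  obtain \<epsilon> where \<epsilon>: "0 < \<epsilon>" "\<epsilon> < s" and small: "ennreal (\<sigma> * n / (n + \<sigma> * \<epsilon>)) < min p q"
    using Sobolev_exponent[OF \<sigma> s _ r] pq by auto
  define \<tau> where "\<tau> = \<sigma> * n / (n + \<sigma> * \<epsilon>)"
  have \<tau>: "0 < \<tau>" "ennreal \<tau> < p" "ennreal \<tau> < q"
    using small \<sigma> \<epsilon> n_pos by (auto simp: \<tau>_def add_pos_pos)
  define \<delta> where "\<delta> = (s - \<epsilon>) * \<tau>"
  have \<delta>: "0 < \<delta>" using \<tau> \<epsilon> by (simp add: \<delta>_def)
  obtain K where K: "0 < K" "\<And>u g k x. g \<in> hajlasz_gradients \<mu> s u \<Longrightarrow> I_osc \<mu> s \<sigma> u x (rad k) \<le>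
    ennreal K * epowr (T \<delta> (\<lambda>j y. epowr (ennreal (g j y)) \<tau>) (k - 2) x) (1 / \<tau>)"
    using I_osc_le_T[OF s \<sigma> \<epsilon> \<tau>_def] unfolding \<delta>_def by blast
  obtain C where C: "0 < C" "\<And>u a. (\<And>k. a k \<in> borel_measurable \<mu>) \<Longrightarrow>
    (\<And>g k. g \<in> hajlasz_gradients \<mu> s u \<Longrightarrow> AE x in \<mu>. a k x \<le>
      ennreal K * epowr (T \<delta> (\<lambda>j y. epowr (ennreal (g j y)) \<tau>) (k - 2) x) (1 / \<tau>)) \<Longrightarrow>
    D_norm \<mu> p q a \<le> ennreal C * M_norm \<mu> s p q u"
    using M_norm_dominates[OF \<delta> \<tau> K(1), of s] by blast
  show ?thesis
  proof (intro exI[of _ C] conjI ballI impI C(1))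
    fix u assume u: "u \<in> borel_measurable \<mu>" and M: "M_norm \<mu> s p q u < \<infinity>"
    obtain g where g: "g \<in> hajlasz_gradients \<mu> s u"
      and fin: "AE x in \<mu>. \<forall>k. T \<delta> (\<lambda>j y. epowr (ennreal (g j y)) \<tau>) k x < top"
      using T_finite_AE[OF \<delta> \<tau> M] by blast
    show L: "u \<in> L_loc \<mu> \<sigma>"
    proof (rule L_loc_from_oscillation[OF \<sigma> u], rule eventually_mono[OF fin], intro allI)
      fix x k assume *: "\<forall>k. T \<delta> (\<lambda>j y. epowr (ennreal (g j y)) \<tau>) k x < top"
      have "I_osc \<mu> s \<sigma> u x (rad k) < top"
        using K(2)[OF g, of x k] *[rule_format, of "k - 2"]
        by (auto intro: le_less_trans simp: ennreal_mult_less_top)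
      then have "(INF c. nn_avg \<mu> (ball x (rad k)) (\<lambda>y. ennreal (\<bar>u y - c\<bar> powr \<sigma>))) < top"
        by (auto simp: I_osc_def ennreal_mult_less_top)
      then show "\<exists>c. nn_avg \<mu> (ball x (rad k)) (\<lambda>y. ennreal (\<bar>u y - c\<bar> powr \<sigma>)) < top"
        by (simp add: INF_less_iff)
    qed
    show "D_norm \<mu> p q (\<lambda>k x. I_osc \<mu> s \<sigma> u x (rad k)) \<le> ennreal C * M_norm \<mu> s p q u"
      by (rule C(2)) (auto intro: I_osc_measurable[OF \<sigma> L] K(2))
  qed
qed

lemma M_space_C_osc:
  assumes s: "0 < s" and \<sigma>: "0 < \<sigma>" "ennreal \<sigma> < p" "ennreal \<sigma> < q"
  shows "\<exists>C>0. \<forall>u\<in>borel_measurable \<mu>. M_norm \<mu> s p q u < \<infinity> \<longrightarrow>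
    u \<in> L_loc \<mu> \<sigma> \<and> D_norm \<mu> p q (\<lambda>k x. C_osc \<mu> s \<sigma> u x (rad k)) \<le> ennreal C * M_norm \<mu> s p q u"
proof -
  define \<delta> where "\<delta> = s * \<sigma>"
  have \<delta>: "0 < \<delta>" using s \<sigma> by (simp add: \<delta>_def)
  \<comment> \<open>2 is the constant of the pointwise estimate; the other two factors shift
    \<open>T\<close> from scale k to the scale k - 2 that the norm estimate expects.\<close>
  define K where "K = 2 * ((2 powr \<delta> * Dbl) powr (1 / \<sigma>) * (2 powr \<delta> * Dbl) powr (1 / \<sigma>))"
  have K: "0 < K" using Dbl_pos by (simp add: K_def)
  have le: "AE x in \<mu>. C_osc \<mu> s \<sigma> u x (rad k) \<le>
    ennreal K * epowr (T \<delta> (\<lambda>j y. epowr (ennreal (g j y)) \<sigma>) (k - 2) x) (1 / \<sigma>)"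
    if "g \<in> hajlasz_gradients \<mu> s u" for g u k
  proof (rule eventually_mono[OF C_osc_le_T[OF s \<sigma>(1) that]])
    fix x assume "\<forall>k. C_osc \<mu> s \<sigma> u x (rad k) \<le>
      ennreal 2 * epowr (T (s * \<sigma>) (\<lambda>j y. epowr (ennreal (g j y)) \<sigma>) k x) (1 / \<sigma>)"
    then have "C_osc \<mu> s \<sigma> u x (rad k) \<le>
      ennreal 2 * epowr (T \<delta> (\<lambda>j y. epowr (ennreal (g j y)) \<sigma>) k x) (1 / \<sigma>)" by (simp add: \<delta>_def)
    also have "\<dots> \<le> ennreal 2 * (ennreal ((2 powr \<delta> * Dbl) powr (1 / \<sigma>) * (2 powr \<delta> * Dbl) powr (1 / \<sigma>)) *
        epowr (T \<delta> (\<lambda>j y. epowr (ennreal (g j y)) \<sigma>) (k - 2) x) (1 / \<sigma>))"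
      by (intro mult_left_mono epowr_T_shift2 \<sigma>) auto
    also have "\<dots> = ennreal K * epowr (T \<delta> (\<lambda>j y. epowr (ennreal (g j y)) \<sigma>) (k - 2) x) (1 / \<sigma>)"
      unfolding K_def by (subst ennreal_mult) (auto simp: mult.assoc)
    finally show "C_osc \<mu> s \<sigma> u x (rad k) \<le> \<dots>" .
  qed
  obtain C where C: "0 < C" "\<And>u a. (\<And>k. a k \<in> borel_measurable \<mu>) \<Longrightarrow>
    (\<And>g k. g \<in> hajlasz_gradients \<mu> s u \<Longrightarrow> AE x in \<mu>. a k x \<le>
      ennreal K * epowr (T \<delta> (\<lambda>j y. epowr (ennreal (g j y)) \<sigma>) (k - 2) x) (1 / \<sigma>)) \<Longrightarrow>
    D_norm \<mu> p q a \<le> ennreal C * M_norm \<mu> s p q u"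
    using M_norm_dominates[OF \<delta> \<sigma> K, of s] by blast
  show ?thesis
  proof (intro exI[of _ C] conjI ballI impI C(1))
    fix u assume u: "u \<in> borel_measurable \<mu>" and M: "M_norm \<mu> s p q u < \<infinity>"
    obtain g where g: "g \<in> hajlasz_gradients \<mu> s u"
      and fin: "AE x in \<mu>. \<forall>k. T \<delta> (\<lambda>j y. epowr (ennreal (g j y)) \<sigma>) k x < top"
      using T_finite_AE[OF \<delta> \<sigma> M] by blast
    show "u \<in> L_loc \<mu> \<sigma>"
    proof (rule L_loc_from_oscillation[OF \<sigma>(1) u])
      have "AE x in \<mu>. \<forall>k. C_osc \<mu> s \<sigma> u x (rad k) < top"
      proof (rule eventually_mono[OF AE_conjI[OF fin]])
        show "AE x in \<mu>. \<forall>k. C_osc \<mu> s \<sigma> u x (rad k) \<le>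
          ennreal K * epowr (T \<delta> (\<lambda>j y. epowr (ennreal (g j y)) \<sigma>) (k - 2) x) (1 / \<sigma>)"
          using le[OF g] by (simp add: AE_all_countable)
      qed (auto intro: le_less_trans simp: ennreal_mult_less_top)
      then show "AE x in \<mu>. \<forall>k. \<exists>c. nn_avg \<mu> (ball x (rad k)) (\<lambda>y. ennreal (\<bar>u y - c\<bar> powr \<sigma>)) < top"
      proof (rule eventually_mono, intro allI)
        fix x k assume "\<forall>k. C_osc \<mu> s \<sigma> u x (rad k) < top"
        then have "C_osc \<mu> s \<sigma> u x (rad k) < top" ..
        then have "nn_avg \<mu> (ball x (rad k)) (\<lambda>y. ennreal (\<bar>u y - u x\<bar> powr \<sigma>)) < top"
          by (auto simp: C_osc_def ennreal_mult_less_top abs_minus_commute)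
        then show "\<exists>c. nn_avg \<mu> (ball x (rad k)) (\<lambda>y. ennreal (\<bar>u y - c\<bar> powr \<sigma>)) < top" ..
      qed
    qed
    show "D_norm \<mu> p q (\<lambda>k x. C_osc \<mu> s \<sigma> u x (rad k)) \<le> ennreal C * M_norm \<mu> s p q u"
      by (rule C(2)) (auto intro: C_osc_measurable[OF u] le)
  qed
qed

lemma F_norm_le_scaled:
  assumes pq: "0 < p" "0 < q" and K: "0 < K"
  shows "\<exists>C>0. \<forall>a f. (\<forall>k. a k \<in> borel_measurable \<mu>) \<longrightarrow> (\<forall>t>0. (\<lambda>x. f x t) \<in> borel_measurable \<mu>) \<longrightarrow>
    (\<forall>x k t. rad (k + 1) < t \<and> t \<le> rad k \<longrightarrow> f x t \<le> ennreal K * a k x) \<longrightarrow>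
    F_norm \<mu> p q f \<le> ennreal C * D_norm \<mu> p q a"
proof -
  let ?C = "if p = top \<and> q \<noteq> top then Dbl powr (1 / enn2real q) else 1"
  show ?thesis
  proof (intro exI[of _ "?C * K"] conjI allI impI)
    show "0 < ?C * K" using K Dbl_pos by simp
    fix a :: "int \<Rightarrow> 'a \<Rightarrow> ennreal" and f
    assume "\<forall>k. a k \<in> borel_measurable \<mu>" and fm: "\<forall>t>0. (\<lambda>x. f x t) \<in> borel_measurable \<mu>"
      and le: "\<forall>x k t. rad (k + 1) < t \<and> t \<le> rad k \<longrightarrow> f x t \<le> ennreal K * a k x"
    then have [measurable]: "\<And>k. a k \<in> borel_measurable \<mu>" by simp
    have "F_norm \<mu> p q f \<le> ennreal ?C * D_norm \<mu> p q (\<lambda>k x. ennreal K * a k x)"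
      using fm le by (intro F_norm_le_D_norm pq) auto
    also have "\<dots> \<le> ennreal ?C * (ennreal K * D_norm \<mu> p q a)"
      by (intro mult_left_mono D_norm_cmult_le pq) auto
    finally show "F_norm \<mu> p q f \<le> ennreal (?C * K) * D_norm \<mu> p q a"
      using K by (simp add: ennreal_mult mult.assoc)
  qed
qed

text \<open>The weight t^(\<epsilon>-s) \<rho>^-\<epsilon> equals (\<rho>/t)^(s-\<epsilon>)
  \<rho>^-s, so a radius \<rho> of scale j contributes the oscillation of that scale with decay
  2^(-(j-k)(s-\<epsilon>)). This is genuine decay because \<epsilon> < s, and the supremum is below
  the resulting sum.\<close>

lemma S_osc_le_sum:
  assumes \<sigma>: "0 < \<sigma>" and \<epsilon>: "0 \<le> \<epsilon>" "\<epsilon> < s" and t: "rad (k + 1) < t" "t \<le> rad k"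
  shows "S_osc \<mu> s \<epsilon> \<sigma> u x t \<le> ennreal (2 powr s * Dbl powr (1 / \<sigma>)) *
    (\<integral>\<^sup>+ j. wgt (s - \<epsilon>) k j * I_osc \<mu> s \<sigma> u x (rad j) \<partial>count_space UNIV)"
proof -
  have t0: "0 < t" using t(1) rad_pos(1)[of "k + 1"] by linarith
  let ?S = "\<integral>\<^sup>+ j. wgt (s - \<epsilon>) k j * I_osc \<mu> s \<sigma> u x (rad j) \<partial>count_space UNIV"
  have "ennreal (t powr (\<epsilon> - s)) * (ennreal (\<rho> powr (- \<epsilon>)) * osc \<sigma> u x \<rho>) \<le> ennreal (2 powr s * Dbl powr (1 / \<sigma>)) * ?S"
    if \<rho>: "0 < \<rho>" "\<rho> \<le> t" for \<rho>
  proof -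
    obtain j where j: "rad (j + 1) < \<rho>" "\<rho> \<le> rad j" using dyadic_scale[OF \<rho>(1)] by blast
    have kj: "k \<le> j" using j t \<rho> by (intro rad_strict_imp[of j \<rho>]) auto
    have scale: "ennreal (\<rho> powr (- \<epsilon>)) * osc \<sigma> u x \<rho> \<le>
      ennreal (2 powr \<epsilon> * Dbl powr (1 / \<sigma>)) * (ennreal (rad j powr (- \<epsilon>)) * osc \<sigma> u x (rad j))"
      unfolding osc_def using \<rho> j \<epsilon> \<sigma> by (intro osc_scale INF_avg_scale) (auto simp: rad_1)
    have "t powr (\<epsilon> - s) \<le> rad (k + 1) powr (\<epsilon> - s)" using t \<epsilon> by (intro powr_mono2') auto
    also have "\<dots> = 2 powr (s - \<epsilon>) * rad k powr (\<epsilon> - s)"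
      by (simp add: rad_powr powr_add[symmetric] algebra_simps)
    finally have "ennreal (t powr (\<epsilon> - s)) * (ennreal (\<rho> powr (- \<epsilon>)) * osc \<sigma> u x \<rho>) \<le>
      ennreal (2 powr (s - \<epsilon>) * rad k powr (\<epsilon> - s)) *
      (ennreal (2 powr \<epsilon> * Dbl powr (1 / \<sigma>)) * (ennreal (rad j powr (- \<epsilon>)) * osc \<sigma> u x (rad j)))"
      by (intro mult_mono scale ennreal_leI) auto
    also have "\<dots> = ennreal (2 powr (s - \<epsilon>) * rad k powr (\<epsilon> - s) * (2 powr \<epsilon> * Dbl powr (1 / \<sigma>) * rad j powr (- \<epsilon>))) * osc \<sigma> u x (rad j)"
      by (simp add: ennreal_mult mult.assoc)
    also have "2 powr (s - \<epsilon>) * rad k powr (\<epsilon> - s) * (2 powr \<epsilon> * Dbl powr (1 / \<sigma>) * rad j powr (- \<epsilon>)) =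
      2 powr s * Dbl powr (1 / \<sigma>) * (2 powr (of_int (k - j) * (s - \<epsilon>)) * rad j powr (- s))"
    proof -
      have "2 powr (s - \<epsilon>) * rad k powr (\<epsilon> - s) * (2 powr \<epsilon> * rad j powr (- \<epsilon>)) =
        2 powr ((s - \<epsilon>) + - of_int k * (\<epsilon> - s) + (\<epsilon> + - of_int j * (- \<epsilon>)))"
        by (simp only: rad_powr powr_add)
      also have "(s - \<epsilon>) + - of_int k * (\<epsilon> - s) + (\<epsilon> + - of_int j * (- \<epsilon>)) =
        s + (of_int (k - j) * (s - \<epsilon>) + - of_int j * (- s))" by (simp add: algebra_simps)
      also have "2 powr \<dots> = 2 powr s * (2 powr (of_int (k - j) * (s - \<epsilon>)) * rad j powr (- s))"
        by (simp only: rad_powr powr_add)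
      finally show ?thesis by (simp add: mult_ac)
    qed
    also have "ennreal (2 powr s * Dbl powr (1 / \<sigma>) * (2 powr (of_int (k - j) * (s - \<epsilon>)) * rad j powr (- s))) * osc \<sigma> u x (rad j) =
      ennreal (2 powr s * Dbl powr (1 / \<sigma>)) * (wgt (s - \<epsilon>) k j * I_osc \<mu> s \<sigma> u x (rad j))"
      using kj by (simp add: wgt_def I_osc_eq ennreal_mult mult.assoc)
    also have "\<dots> \<le> ennreal (2 powr s * Dbl powr (1 / \<sigma>)) * ?S"
      by (intro mult_left_mono nn_integral_ge_point) auto
    finally show ?thesis .
  qed
  then show ?thesis
    unfolding S_osc_eq by (subst SUP_mult_left_ennreal) (auto intro!: SUP_least)
qed

section \<open>Mean values as near-optimal constants\<close>

lemma set_integrable_ball: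
  assumes \<sigma>: "1 \<le> \<sigma>" and u: "u \<in> L_loc \<mu> \<sigma>" and t: "0 < t"
  shows "set_integrable \<mu> (ball x t) u"
proof -
  have [measurable]: "u \<in> borel_measurable \<mu>" using u by (simp add: L_loc_def)
  have fin: "(\<integral>\<^sup>+ y\<in>ball x t. ennreal (\<bar>u y\<bar> powr \<sigma>) \<partial>\<mu>) < top"
    using u t by (auto simp: L_loc_def infinity_ennreal_def)
  show ?thesis
    unfolding set_integrable_def
  proof (rule integrableI_bounded)
    have "(\<integral>\<^sup>+ y. ennreal (norm (indicator (ball x t) y *\<^sub>R u y)) \<partial>\<mu>) \<le>
      (\<integral>\<^sup>+ y. indicator (ball x t) y + ennreal (\<bar>u y\<bar> powr \<sigma>) * indicator (ball x t) y \<partial>\<mu>)"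
    proof (intro nn_integral_mono)
      fix y
      have "\<bar>u y\<bar> \<le> 1 + \<bar>u y\<bar> powr \<sigma>"
      proof (cases "\<bar>u y\<bar> \<le> 1")
        case False
        then have "\<bar>u y\<bar> powr 1 \<le> \<bar>u y\<bar> powr \<sigma>" using \<sigma> by (intro powr_mono) auto
        then show ?thesis using False by simp
      qed (simp add: add_increasing2)
      then have "ennreal \<bar>u y\<bar> \<le> ennreal (1 + \<bar>u y\<bar> powr \<sigma>)" by (rule ennreal_leI)
      then show "ennreal (norm (indicator (ball x t) y *\<^sub>R u y)) \<le>
        indicator (ball x t) y + ennreal (\<bar>u y\<bar> powr \<sigma>) * indicator (ball x t) y"
        by (auto split: split_indicator)
    qed
    also have "\<dots> = V x t + (\<integral>\<^sup>+ y\<in>ball x t. ennreal (\<bar>u y\<bar> powr \<sigma>) \<partial>\<mu>)"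
      by (subst nn_integral_add) auto
    also have "\<dots> < \<infinity>" using fin by (simp add: infinity_ennreal_def)
    finally show "(\<integral>\<^sup>+ y. ennreal (norm (indicator (ball x t) y *\<^sub>R u y)) \<partial>\<mu>) < \<infinity>" .
  qed measurable
qed

lemma avg_diff_le:
  assumes t: "0 < t" and int: "set_integrable \<mu> (ball x t) u"
  shows "ennreal \<bar>c - avg \<mu> (ball x t) u\<bar> \<le> nn_avg \<mu> (ball x t) (\<lambda>y. ennreal \<bar>u y - c\<bar>)"
proof -
  let ?B = "ball x t"
  have m: "0 < measure \<mu> ?B" "emeasure \<mu> ?B = ennreal (measure \<mu> ?B)"
    using t V_pos(1)[OF t, of x] V_finite(1)[of x t]
    by (auto simp: measure_def enn2real_positive_iff)
  have ci: "integrable \<mu> (\<lambda>y. indicator ?B y *\<^sub>R c)"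
    by (rule integrable_scaleR_left) (auto simp: integrable_indicator_iff less_top[symmetric] infinity_ennreal_def)
  have ui: "integrable \<mu> (\<lambda>y. indicator ?B y *\<^sub>R u y)" using int by (simp add: set_integrable_def)
  have "avg \<mu> ?B u - c = (\<integral> y. indicator ?B y *\<^sub>R u y - indicator ?B y *\<^sub>R c \<partial>\<mu>) / measure \<mu> ?B"
    using m(1) ui ci by (simp add: avg_def set_lebesgue_integral_def diff_divide_distrib)
  then have "ennreal \<bar>c - avg \<mu> ?B u\<bar> = ennreal (norm (\<integral> y. indicator ?B y *\<^sub>R u y - indicator ?B y *\<^sub>R c \<partial>\<mu>)) / V x t"
    using m by (simp add: abs_minus_commute[of c] abs_divide divide_ennreal)
  also have "\<dots> \<le> (\<integral>\<^sup>+ y. norm (indicator ?B y *\<^sub>R u y - indicator ?B y *\<^sub>R c) \<partial>\<mu>) / V x t"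
    using ui ci by (intro divide_right_mono_ennreal integral_norm_bound_ennreal) auto
  also have "(\<integral>\<^sup>+ y. norm (indicator ?B y *\<^sub>R u y - indicator ?B y *\<^sub>R c) \<partial>\<mu>) = (\<integral>\<^sup>+ y\<in>?B. ennreal \<bar>u y - c\<bar> \<partial>\<mu>)"
    by (intro nn_integral_cong) (auto split: split_indicator)
  finally show ?thesis by (simp add: nn_avg_def)
qed

text \<open>For an exponent \<sigma>' >= 1 Jensen's inequality bounds the distance from the mean
  value to any constant c by the oscillation around c. A smaller \<sigma> is first raised to
  \<sigma>', again by Jensen.\<close>

lemma A_osc_le_I_osc:
  assumes \<sigma>: "0 < \<sigma>" "\<sigma> \<le> \<sigma>'" "1 \<le> \<sigma>'" and u: "u \<in> L_loc \<mu> \<sigma>'" and t: "0 < t"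
  shows "A_osc \<mu> s \<sigma> u x t \<le> ennreal ((2 powr \<sigma>' * 2) powr (1 / \<sigma>')) * I_osc \<mu> s \<sigma>' u x t"
proof -
  have \<sigma>'0: "0 < \<sigma>'" using \<sigma> by simp
  have [measurable]: "u \<in> borel_measurable \<mu>" using u by (simp add: L_loc_def)
  let ?B = "ball x t"
  define m where "m = avg \<mu> ?B u"
  have pw: "ennreal (\<bar>z\<bar> powr b) = epowr (ennreal \<bar>z\<bar>) b" for z b :: real by (simp add: epowr_ennreal)
  have J: "epowr (nn_avg \<mu> ?B (\<lambda>y. ennreal (\<bar>u y - m\<bar> powr \<sigma>))) (1 / \<sigma>) \<le>
    epowr (nn_avg \<mu> ?B (\<lambda>y. ennreal (\<bar>u y - m\<bar> powr \<sigma>'))) (1 / \<sigma>')"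
  proof -
    have "epowr (nn_avg \<mu> ?B (\<lambda>y. ennreal (\<bar>u y - m\<bar> powr \<sigma>))) (\<sigma>' / \<sigma>) \<le>
      nn_avg \<mu> ?B (\<lambda>y. epowr (ennreal (\<bar>u y - m\<bar> powr \<sigma>)) (\<sigma>' / \<sigma>))"
      using \<sigma> t by (intro nn_avg_Jensen) auto
    then have "epowr (epowr (nn_avg \<mu> ?B (\<lambda>y. ennreal (\<bar>u y - m\<bar> powr \<sigma>))) (\<sigma>' / \<sigma>)) (1 / \<sigma>') \<le>
      epowr (nn_avg \<mu> ?B (\<lambda>y. epowr (ennreal (\<bar>u y - m\<bar> powr \<sigma>)) (\<sigma>' / \<sigma>))) (1 / \<sigma>')"
      using \<sigma>'0 by (intro epowr_mono) auto
    then show ?thesis using \<sigma> \<sigma>'0 by (simp add: epowr_epowr epowr_ennreal powr_powr)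
  qed
  have I: "nn_avg \<mu> ?B (\<lambda>y. ennreal (\<bar>u y - m\<bar> powr \<sigma>')) \<le>
    ennreal (2 powr \<sigma>' * 2) * (INF c. nn_avg \<mu> ?B (\<lambda>y. ennreal (\<bar>u y - c\<bar> powr \<sigma>')))"
  proof (rule le_cmult_INF)
    fix c
    let ?X = "nn_avg \<mu> ?B (\<lambda>y. ennreal (\<bar>u y - c\<bar> powr \<sigma>'))"
    have "ennreal \<bar>c - m\<bar> \<le> nn_avg \<mu> ?B (\<lambda>y. ennreal \<bar>u y - c\<bar>)"
      unfolding m_def by (intro avg_diff_le t set_integrable_ball[OF \<sigma>(3) u])
    then have "epowr (ennreal \<bar>c - m\<bar>) \<sigma>' \<le> epowr (nn_avg \<mu> ?B (\<lambda>y. ennreal \<bar>u y - c\<bar>)) \<sigma>'"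
      using \<sigma>'0 by (intro epowr_mono) auto
    also have "\<dots> \<le> ?X"
      unfolding pw by (rule nn_avg_Jensen[OF \<sigma>(3) _ t]) measurable
    finally have cm: "epowr (ennreal \<bar>c - m\<bar>) \<sigma>' \<le> ?X" .
    have "nn_avg \<mu> ?B (\<lambda>y. ennreal (\<bar>u y - m\<bar> powr \<sigma>')) \<le>
      nn_avg \<mu> ?B (\<lambda>y. ennreal (2 powr \<sigma>') * (ennreal (\<bar>u y - c\<bar> powr \<sigma>') + epowr (ennreal \<bar>c - m\<bar>) \<sigma>'))"
    proof (rule nn_avg_mono)
      fix y
      have "ennreal (\<bar>u y - m\<bar> powr \<sigma>') \<le> epowr (ennreal \<bar>u y - c\<bar> + ennreal \<bar>c - m\<bar>) \<sigma>'"
        using \<sigma>'0 by (auto simp: epowr_ennreal simp flip: ennreal_plus intro!: ennreal_leI powr_mono2)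
      also have "\<dots> \<le> ennreal (2 powr \<sigma>') * (epowr (ennreal \<bar>u y - c\<bar>) \<sigma>' + epowr (ennreal \<bar>c - m\<bar>) \<sigma>')"
        by (rule epowr_add_le[OF \<sigma>'0])
      finally show "ennreal (\<bar>u y - m\<bar> powr \<sigma>') \<le> ennreal (2 powr \<sigma>') * (ennreal (\<bar>u y - c\<bar> powr \<sigma>') + epowr (ennreal \<bar>c - m\<bar>) \<sigma>')"
        by (simp add: pw)
    qed
    also have "\<dots> = ennreal (2 powr \<sigma>') * (?X + epowr (ennreal \<bar>c - m\<bar>) \<sigma>')"
      using t by (simp add: nn_avg_cmult nn_avg_add nn_avg_const)
    also have "\<dots> \<le> ennreal (2 powr \<sigma>') * (?X + ?X)" by (intro mult_left_mono add_left_mono cm) auto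
    also have "\<dots> = ennreal (2 powr \<sigma>' * 2) * ?X"
      by (subst ennreal_mult) (auto simp: mult_2 mult.assoc)
    finally show "nn_avg \<mu> ?B (\<lambda>y. ennreal (\<bar>u y - m\<bar> powr \<sigma>')) \<le> ennreal (2 powr \<sigma>' * 2) * ?X" .
  qed simp
  have "epowr (nn_avg \<mu> ?B (\<lambda>y. ennreal (\<bar>u y - m\<bar> powr \<sigma>))) (1 / \<sigma>) \<le>
    epowr (ennreal (2 powr \<sigma>' * 2) * (INF c. nn_avg \<mu> ?B (\<lambda>y. ennreal (\<bar>u y - c\<bar> powr \<sigma>')))) (1 / \<sigma>')"
    using \<sigma>'0 by (intro order_trans[OF J] epowr_mono I) auto
  also have "\<dots> = ennreal ((2 powr \<sigma>' * 2) powr (1 / \<sigma>')) * osc \<sigma>' u x t"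
    by (subst epowr_mult, subst epowr_ennreal) (auto simp: osc_def)
  finally have "A_osc \<mu> s \<sigma> u x t \<le> ennreal (t powr (- s)) * (ennreal ((2 powr \<sigma>' * 2) powr (1 / \<sigma>')) * osc \<sigma>' u x t)"
    unfolding A_osc_def m_def by (rule mult_left_mono) simp
  then show ?thesis by (simp add: I_osc_eq mult.left_commute)
qed

lemma L_loc_mono:
  assumes \<sigma>: "0 < \<sigma>" "\<sigma> \<le> \<sigma>'" and u: "u \<in> L_loc \<mu> \<sigma>'"
  shows "u \<in> L_loc \<mu> \<sigma>"
  unfolding L_loc_def
proof (intro CollectI conjI allI impI)
  show [measurable]: "u \<in> borel_measurable \<mu>" using u by (simp add: L_loc_def)
  fix x and r :: real assume r: "0 < r"
  have fin: "(\<integral>\<^sup>+ y\<in>ball x r. ennreal (\<bar>u y\<bar> powr \<sigma>') \<partial>\<mu>) < top"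
    using u r by (auto simp: L_loc_def infinity_ennreal_def)
  have "(\<integral>\<^sup>+ y\<in>ball x r. ennreal (\<bar>u y\<bar> powr \<sigma>) \<partial>\<mu>) \<le>
    (\<integral>\<^sup>+ y. indicator (ball x r) y + ennreal (\<bar>u y\<bar> powr \<sigma>') * indicator (ball x r) y \<partial>\<mu>)"
  proof (intro nn_integral_mono)
    fix y
    have "\<bar>u y\<bar> powr \<sigma> \<le> 1 + \<bar>u y\<bar> powr \<sigma>'"
    proof (cases "\<bar>u y\<bar> \<le> 1")
      case True
      then have "\<bar>u y\<bar> powr \<sigma> \<le> 1" using \<sigma> by (intro powr_le1) auto
      then show ?thesis by (simp add: add_increasing2)
    next
      case False
      then have "\<bar>u y\<bar> powr \<sigma> \<le> \<bar>u y\<bar> powr \<sigma>'" using \<sigma> by (intro powr_mono) auto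
      then show ?thesis by simp
    qed
    then have "ennreal (\<bar>u y\<bar> powr \<sigma>) \<le> ennreal (1 + \<bar>u y\<bar> powr \<sigma>')" by (rule ennreal_leI)
    then show "ennreal (\<bar>u y\<bar> powr \<sigma>) * indicator (ball x r) y \<le>
      indicator (ball x r) y + ennreal (\<bar>u y\<bar> powr \<sigma>') * indicator (ball x r) y"
      by (auto split: split_indicator)
  qed
  also have "\<dots> = V x r + (\<integral>\<^sup>+ y\<in>ball x r. ennreal (\<bar>u y\<bar> powr \<sigma>') \<partial>\<mu>)"
    by (subst nn_integral_add) auto
  also have "\<dots> < \<infinity>" using fin by (simp add: infinity_ennreal_def)
  finally show "(\<integral>\<^sup>+ y\<in>ball x r. ennreal (\<bar>u y\<bar> powr \<sigma>) \<partial>\<mu>) < \<infinity>" .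
qed

section \<open>Equality of the spaces\<close>

lemma fspace_le_M_F:
  assumes "\<exists>C>0. \<forall>u\<in>borel_measurable \<mu>. M_norm \<mu> s p q u < \<infinity> \<longrightarrow>
    u \<in> L_loc \<mu> \<sigma> \<and> F_norm \<mu> p q (E u) \<le> ennreal C * M_norm \<mu> s p q u"
  shows "fspace_le (M_space \<mu> s p q) (F_space \<mu> \<sigma> p q E)"
proof -
  obtain C where C: "0 < C" "\<And>u. u \<in> borel_measurable \<mu> \<Longrightarrow> M_norm \<mu> s p q u < \<infinity> \<Longrightarrow>
    u \<in> L_loc \<mu> \<sigma> \<and> F_norm \<mu> p q (E u) \<le> ennreal C * M_norm \<mu> s p q u" using assms by blast
  have "F_norm \<mu> p q (E u) < \<infinity>" if "u \<in> borel_measurable \<mu>" "M_norm \<mu> s p q u < \<infinity>" for u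
  proof -
    have "F_norm \<mu> p q (E u) \<le> ennreal C * M_norm \<mu> s p q u" using C that by blast
    also have "\<dots> < \<infinity>" using that by (simp add: ennreal_mult_less_top infinity_ennreal_def)
    finally show ?thesis .
  qed
  then show ?thesis
    unfolding fspace_le_def M_space_def F_space_def using C by auto
qed

lemma fspace_le_F_M:
  assumes "0 < s" "0 < \<sigma>" "0 < p" "0 < q"
    and le: "\<And>u x t. u \<in> L_loc \<mu> \<sigma> \<Longrightarrow> 0 < t \<Longrightarrow> I_osc \<mu> s \<sigma> u x t \<le> E u x t"
  shows "fspace_le (F_space \<mu> \<sigma> p q E) (M_space \<mu> s p q)"
proof -
  obtain C where C: "0 < C" "\<And>u f. u \<in> L_loc \<mu> \<sigma> \<Longrightarrow> (\<And>x t. 0 < t \<Longrightarrow> I_osc \<mu> s \<sigma> u x t \<le> f x t) \<Longrightarrow>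
    F_norm \<mu> p q f < \<infinity> \<Longrightarrow> M_norm \<mu> s p q u < \<infinity> \<and> M_norm \<mu> s p q u \<le> ennreal C * F_norm \<mu> p q f"
    using F_space_to_M_space[OF assms(1-4)] by blast
  have "M_norm \<mu> s p q u < \<infinity> \<and> M_norm \<mu> s p q u \<le> ennreal C * F_norm \<mu> p q (E u)"
    if "u \<in> L_loc \<mu> \<sigma>" "F_norm \<mu> p q (E u) < \<infinity>" for u
    using that by (intro C(2) le) auto
  then show ?thesis
    unfolding fspace_le_def M_space_def F_space_def using C(1)
    by (auto simp: L_loc_def)
qed

text \<open>The discrete majorant \<open>a\<close> is kept abstract: it is an oscillation at dyadic
  radii for C, I and A, but a Hardy sum over finer scales for S.\<close>

lemma M_le_scaled_F:
  assumes pq: "0 < p" "0 < q" and K: "0 < K"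
    and D: "\<exists>C>0. \<forall>u\<in>borel_measurable \<mu>. M_norm \<mu> s p q u < \<infinity> \<longrightarrow>
      u \<in> L_loc \<mu> \<sigma> \<and> (\<forall>k. a u k \<in> borel_measurable \<mu>) \<and> D_norm \<mu> p q (a u) \<le> ennreal C * M_norm \<mu> s p q u"
    and meas: "\<And>u t. u \<in> L_loc \<mu> \<sigma> \<Longrightarrow> 0 < t \<Longrightarrow> (\<lambda>x. E u x t) \<in> borel_measurable \<mu>"
    and le: "\<And>u x k t. u \<in> L_loc \<mu> \<sigma> \<Longrightarrow> rad (k + 1) < t \<Longrightarrow> t \<le> rad k \<Longrightarrow> E u x t \<le> ennreal K * a u k x"
  shows "\<exists>C>0. \<forall>u\<in>borel_measurable \<mu>. M_norm \<mu> s p q u < \<infinity> \<longrightarrow>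
    u \<in> L_loc \<mu> \<sigma> \<and> F_norm \<mu> p q (E u) \<le> ennreal C * M_norm \<mu> s p q u"
proof -
  obtain C where C: "0 < C" "\<And>u. u \<in> borel_measurable \<mu> \<Longrightarrow> M_norm \<mu> s p q u < \<infinity> \<Longrightarrow>
    u \<in> L_loc \<mu> \<sigma> \<and> (\<forall>k. a u k \<in> borel_measurable \<mu>) \<and> D_norm \<mu> p q (a u) \<le> ennreal C * M_norm \<mu> s p q u"
    using D by blast
  obtain C' where C': "0 < C'" "\<forall>a f. (\<forall>k. a k \<in> borel_measurable \<mu>) \<longrightarrow> (\<forall>t>0. (\<lambda>x. f x t) \<in> borel_measurable \<mu>) \<longrightarrow>
    (\<forall>x k t. rad (k + 1) < t \<and> t \<le> rad k \<longrightarrow> f x t \<le> ennreal K * a k x) \<longrightarrow>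
    F_norm \<mu> p q f \<le> ennreal C' * D_norm \<mu> p q a"
    using F_norm_le_scaled[OF pq K] by (elim exE conjE)
  show ?thesis
  proof (intro exI[of _ "C' * C"] conjI ballI impI)
    show "0 < C' * C" using C C' by simp
    fix u assume u: "u \<in> borel_measurable \<mu>" "M_norm \<mu> s p q u < \<infinity>"
    show L: "u \<in> L_loc \<mu> \<sigma>" using C(2)[OF u] by simp
    have "F_norm \<mu> p q (E u) \<le> ennreal C' * D_norm \<mu> p q (a u)"
      using C(2)[OF u] meas[OF L] le[OF L] by (intro C'(2)[rule_format]) simp_all
    also have "\<dots> \<le> ennreal C' * (ennreal C * M_norm \<mu> s p q u)"
      using C(2)[OF u] by (intro mult_left_mono) auto
    finally show "F_norm \<mu> p q (E u) \<le> ennreal (C' * C) * M_norm \<mu> s p q u"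
      using C C' by (simp add: ennreal_mult mult.assoc)
  qed
qed

lemma rad_slab: "rad (k + 1) < t \<Longrightarrow> t \<le> rad k \<Longrightarrow> 0 < t \<and> rad k \<le> 2 * t"
  using rad_pos(1)[of "k + 1"] rad_1(1)[of k] by linarith

lemma M_eq_C:
  assumes s: "0 < s" and pq: "0 < p" "0 < q" and \<sigma>: "0 < \<sigma>" "ennreal \<sigma> < min p q"
  shows "fspace_eq (M_space \<mu> s p q) (CF_space \<mu> s \<sigma> p q)"
  unfolding fspace_eq_def CF_space_def
proof
  define K where "K = 2 powr s * Dbl powr (1 / \<sigma>)"
  have K: "0 < K" using Dbl_pos by (simp add: K_def)
  show "fspace_le (M_space \<mu> s p q) (F_space \<mu> \<sigma> p q (C_osc \<mu> s \<sigma>))"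
  proof (intro fspace_le_M_F M_le_scaled_F[OF pq K, where a = "\<lambda>u k x. C_osc \<mu> s \<sigma> u x (rad k)"])
    show "\<exists>C>0. \<forall>u\<in>borel_measurable \<mu>. M_norm \<mu> s p q u < \<infinity> \<longrightarrow> u \<in> L_loc \<mu> \<sigma> \<and>
      (\<forall>k. (\<lambda>x. C_osc \<mu> s \<sigma> u x (rad k)) \<in> borel_measurable \<mu>) \<and>
      D_norm \<mu> p q (\<lambda>k x. C_osc \<mu> s \<sigma> u x (rad k)) \<le> ennreal C * M_norm \<mu> s p q u"
    proof -
      have "ennreal \<sigma> < p" "ennreal \<sigma> < q" using \<sigma>(2) by auto
      from M_space_C_osc[OF s \<sigma>(1) this] show ?thesis using C_osc_measurable by blast
    qed
    show "(\<lambda>x. C_osc \<mu> s \<sigma> u x t) \<in> borel_measurable \<mu>" if "u \<in> L_loc \<mu> \<sigma>" for u t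
      using that by (intro C_osc_measurable) (simp add: L_loc_def)
    show "C_osc \<mu> s \<sigma> u x t \<le> ennreal K * C_osc \<mu> s \<sigma> u x (rad k)" if "rad (k + 1) < t" "t \<le> rad k" for u x k t
      unfolding K_def using rad_slab[OF that] that s \<sigma> by (intro C_osc_scale) auto
  qed
  show "fspace_le (F_space \<mu> \<sigma> p q (C_osc \<mu> s \<sigma>)) (M_space \<mu> s p q)"
  proof (rule fspace_le_F_M[OF s \<sigma>(1) pq])
    fix u x and t :: real
    have "(INF c. nn_avg \<mu> (ball x t) (\<lambda>y. ennreal (\<bar>u y - c\<bar> powr \<sigma>))) \<le>
      nn_avg \<mu> (ball x t) (\<lambda>y. ennreal (\<bar>u x - u y\<bar> powr \<sigma>))"
      \<comment> \<open>The value u x is one of the competing constants.\<close>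
      by (rule INF_lower2[of "u x"]) (auto simp: abs_minus_commute)
    then show "I_osc \<mu> s \<sigma> u x t \<le> C_osc \<mu> s \<sigma> u x t"
      unfolding I_osc_def C_osc_def using \<sigma> by (intro mult_left_mono epowr_mono) auto
  qed
qed

lemma M_space_I_osc':
  assumes "0 < s" "0 < \<sigma>" "0 < p" "0 < q" "ennreal \<sigma> < r_star n (min p q) s"
  shows "\<exists>C>0. \<forall>u\<in>borel_measurable \<mu>. M_norm \<mu> s p q u < \<infinity> \<longrightarrow> u \<in> L_loc \<mu> \<sigma> \<and>
    (\<forall>k. (\<lambda>x. I_osc \<mu> s \<sigma> u x (rad k)) \<in> borel_measurable \<mu>) \<and>
    D_norm \<mu> p q (\<lambda>k x. I_osc \<mu> s \<sigma> u x (rad k)) \<le> ennreal C * M_norm \<mu> s p q u"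
proof -
  have "(\<lambda>x. I_osc \<mu> s \<sigma> u x (rad k)) \<in> borel_measurable \<mu>" if "u \<in> L_loc \<mu> \<sigma>" for u k
    using that assms by (intro I_osc_measurable) auto
  then show ?thesis using M_space_I_osc[OF assms] by blast
qed

lemma M_eq_I:
  assumes s: "0 < s" and pq: "0 < p" "0 < q" and \<sigma>: "0 < \<sigma>" "ennreal \<sigma> < r_star n (min p q) s"
  shows "fspace_eq (M_space \<mu> s p q) (IF_space \<mu> s \<sigma> p q)"
  unfolding fspace_eq_def IF_space_def
proof
  define K where "K = 2 powr s * Dbl powr (1 / \<sigma>)"
  have K: "0 < K" using Dbl_pos by (simp add: K_def)
  show "fspace_le (M_space \<mu> s p q) (F_space \<mu> \<sigma> p q (I_osc \<mu> s \<sigma>))"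
  proof (intro fspace_le_M_F M_le_scaled_F[OF pq K, where a = "\<lambda>u k x. I_osc \<mu> s \<sigma> u x (rad k)"])
    show "I_osc \<mu> s \<sigma> u x t \<le> ennreal K * I_osc \<mu> s \<sigma> u x (rad k)" if "rad (k + 1) < t" "t \<le> rad k" for u x k t
      unfolding K_def using rad_slab[OF that] that s \<sigma> by (intro I_osc_scale) auto
    show "(\<lambda>x. I_osc \<mu> s \<sigma> u x t) \<in> borel_measurable \<mu>" if "u \<in> L_loc \<mu> \<sigma>" "0 < t" for u t
      using that by (intro I_osc_measurable[OF \<sigma>(1)])
  qed (rule M_space_I_osc'[OF s \<sigma>(1) pq \<sigma>(2)])
  show "fspace_le (F_space \<mu> \<sigma> p q (I_osc \<mu> s \<sigma>)) (M_space \<mu> s p q)"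
    by (rule fspace_le_F_M[OF s \<sigma>(1) pq]) simp
qed

lemma M_eq_S:
  assumes s: "0 < s" and pq: "0 < p" "0 < q" and \<epsilon>: "0 \<le> \<epsilon>" "\<epsilon> < s"
    and \<sigma>: "0 < \<sigma>" "ennreal \<sigma> < r_star n (min p q) s"
  shows "fspace_eq (M_space \<mu> s p q) (SF_space \<mu> s \<epsilon> \<sigma> p q)"
  unfolding fspace_eq_def SF_space_def
proof
  define K where "K = 2 powr s * Dbl powr (1 / \<sigma>)"
  have K: "0 < K" using Dbl_pos by (simp add: K_def)
  \<comment> \<open>The supremum over all smaller radii is not comparable to one dyadic oscillation,
    so the majorant is a Hardy sum, again bounded by means of \<open>T\<close>.\<close>
  define a where "a u k x = (\<integral>\<^sup>+ j. wgt (s - \<epsilon>) k j * I_osc \<mu> s \<sigma> u x (rad j) \<partial>count_space UNIV)" for u k x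
  show "fspace_le (M_space \<mu> s p q) (F_space \<mu> \<sigma> p q (S_osc \<mu> s \<epsilon> \<sigma>))"
  proof (intro fspace_le_M_F M_le_scaled_F[OF pq K, where a = a])
    obtain \<tau> where \<tau>: "0 < \<tau>" "\<tau> \<le> 1" "ennreal \<tau> < p" "ennreal \<tau> < q"
      using exists_exponent_below[of "min p q"] pq by auto
    define \<delta> where "\<delta> = (s - \<epsilon>) * \<tau>"
    have \<delta>: "0 < \<delta>" using \<epsilon> \<tau> by (simp add: \<delta>_def)
    define L where "L = (2 powr \<delta> * Dbl) powr (1 / \<tau>) * (2 powr \<delta> * Dbl) powr (1 / \<tau>)"
    have L: "0 < L" using Dbl_pos by (simp add: L_def)
    obtain C1 where C1: "0 < C1" "\<And>u. u \<in> borel_measurable \<mu> \<Longrightarrow> M_norm \<mu> s p q u < \<infinity> \<Longrightarrow> u \<in> L_loc \<mu> \<sigma> \<and>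
      (\<forall>k. (\<lambda>x. I_osc \<mu> s \<sigma> u x (rad k)) \<in> borel_measurable \<mu>) \<and>
      D_norm \<mu> p q (\<lambda>k x. I_osc \<mu> s \<sigma> u x (rad k)) \<le> ennreal C1 * M_norm \<mu> s p q u"
      using M_space_I_osc'[OF s \<sigma>(1) pq \<sigma>(2)] by blast
    obtain C2 where C2: "0 < C2" "\<And>a g. (\<And>k. a k \<in> borel_measurable \<mu>) \<Longrightarrow> (\<And>k. g k \<in> borel_measurable \<mu>) \<Longrightarrow>
      (\<And>k. AE x in \<mu>. a k x \<le> ennreal L * epowr (T \<delta> (\<lambda>j y. epowr (g j y) \<tau>) (k - 2) x) (1 / \<tau>)) \<Longrightarrow>
      D_norm \<mu> p q a \<le> ennreal C2 * D_norm \<mu> p q g"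
      using D_norm_le_T[OF \<delta> \<tau>(1,3,4) L] by blast
    show "\<exists>C>0. \<forall>u\<in>borel_measurable \<mu>. M_norm \<mu> s p q u < \<infinity> \<longrightarrow> u \<in> L_loc \<mu> \<sigma> \<and>
      (\<forall>k. a u k \<in> borel_measurable \<mu>) \<and> D_norm \<mu> p q (a u) \<le> ennreal C * M_norm \<mu> s p q u"
    proof (intro exI[of _ "C2 * C1"] conjI ballI impI)
      show "0 < C2 * C1" using C1 C2 by simp
      fix u assume u: "u \<in> borel_measurable \<mu>" "M_norm \<mu> s p q u < \<infinity>"
      show "u \<in> L_loc \<mu> \<sigma>" using C1(2)[OF u] by simp
      have Im [measurable]: "(\<lambda>x. I_osc \<mu> s \<sigma> u x (rad k)) \<in> borel_measurable \<mu>" for k using C1(2)[OF u] by simp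
      show am: "\<forall>k. a u k \<in> borel_measurable \<mu>" unfolding a_def[abs_def] by measurable
      have "D_norm \<mu> p q (a u) \<le> ennreal C2 * D_norm \<mu> p q (\<lambda>k x. I_osc \<mu> s \<sigma> u x (rad k))"
      proof (rule C2(2))
        fix k
        let ?I = "\<lambda>j y. epowr (I_osc \<mu> s \<sigma> u y (rad j)) \<tau>"
        have "a u k x \<le> ennreal L * epowr (T \<delta> ?I (k - 2) x) (1 / \<tau>)" for x
        proof -
          have "a u k x \<le> epowr (T \<delta> ?I k x) (1 / \<tau>)"
            unfolding a_def \<delta>_def using Hardy_le_T[OF \<tau>(1,2), of "s - \<epsilon>" k "\<lambda>j y. I_osc \<mu> s \<sigma> u y (rad j)" x] .
          also have "\<dots> \<le> ennreal L * epowr (T \<delta> ?I (k - 2) x) (1 / \<tau>)"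
            unfolding L_def by (rule epowr_T_shift2[OF \<tau>(1)])
          finally show ?thesis .
        qed
        then show "AE x in \<mu>. a u k x \<le> ennreal L * epowr (T \<delta> ?I (k - 2) x) (1 / \<tau>)" by simp
      qed (use am in auto)
      also have "\<dots> \<le> ennreal C2 * (ennreal C1 * M_norm \<mu> s p q u)"
        using C1(2)[OF u] by (intro mult_left_mono) auto
      finally show "D_norm \<mu> p q (a u) \<le> ennreal (C2 * C1) * M_norm \<mu> s p q u"
        using C1 C2 by (simp add: ennreal_mult mult.assoc)
    qed
    show "S_osc \<mu> s \<epsilon> \<sigma> u x t \<le> ennreal K * a u k x" if "rad (k + 1) < t" "t \<le> rad k" for u x k t
      unfolding K_def a_def using that by (intro S_osc_le_sum \<sigma> \<epsilon>)
    show "(\<lambda>x. S_osc \<mu> s \<epsilon> \<sigma> u x t) \<in> borel_measurable \<mu>" if "u \<in> L_loc \<mu> \<sigma>" "0 < t" for u t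
      using that by (intro S_osc_measurable \<sigma> \<epsilon>)
  qed
  show "fspace_le (F_space \<mu> \<sigma> p q (S_osc \<mu> s \<epsilon> \<sigma>)) (M_space \<mu> s p q)"
  proof (rule fspace_le_F_M[OF s \<sigma>(1) pq])
    fix u x and t :: real assume t: "0 < t"
    have "I_osc \<mu> s \<sigma> u x t = ennreal (t powr (\<epsilon> - s)) * (ennreal (t powr (- \<epsilon>)) * osc \<sigma> u x t)"
      using t by (simp add: I_osc_eq mult.assoc[symmetric] ennreal_mult[symmetric] powr_add[symmetric])
    also have "\<dots> \<le> S_osc \<mu> s \<epsilon> \<sigma> u x t"
      unfolding S_osc_eq using t by (intro mult_left_mono SUP_upper2[of t]) auto
    finally show "I_osc \<mu> s \<sigma> u x t \<le> S_osc \<mu> s \<epsilon> \<sigma> u x t" .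
  qed
qed

lemma M_eq_A:
  assumes s: "0 < s" and pq: "0 < p" "0 < q" and r: "ennreal (n / (n + s)) < min p q"
    and \<sigma>: "0 < \<sigma>" "ennreal \<sigma> < r_star n (min p q) s"
  shows "fspace_eq (M_space \<mu> s p q) (AF_space \<mu> s \<sigma> p q)"
proof -
  \<comment> \<open>Mean values are near-optimal only for exponents at least 1, so the estimate from
    the Hajlasz side is carried out with \<sigma>'.\<close>
  define \<sigma>' where "\<sigma>' = max \<sigma> 1"
  have \<sigma>': "0 < \<sigma>'" "\<sigma> \<le> \<sigma>'" "1 \<le> \<sigma>'" by (auto simp: \<sigma>'_def)
  \<comment> \<open>The condition r > n/(n+s) is used here: for r < n/s the inequality n r / (n - r
    s) > 1 is the same as r (n + s) > n. It makes \<sigma>' admissible.\<close>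
  have "ennreal 1 < r_star n (min p q) s"
  proof (cases "min p q < ennreal (n / s)")
    case True
    then obtain r' where r': "min p q = ennreal r'" "0 \<le> r'" by (cases "min p q") auto
    then have "r' < n / s" "n / (n + s) < r'" using True r n_pos s by (auto simp: ennreal_less_iff)
    then have "0 < n - r' * s" "n < r' * (n + s)" using s n_pos by (auto simp: field_simps)
    then have "1 < n * r' / (n - r' * s)" by (simp add: field_simps)
    then have "ennreal 1 < ennreal (n * r' / (n - r' * s))" by (subst ennreal_less_iff) auto
    then show ?thesis using True r' by (simp add: r_star_def)
  qed (simp add: r_star_def)
  then have \<sigma>'r: "ennreal \<sigma>' < r_star n (min p q) s" using \<sigma>(2) by (auto simp: \<sigma>'_def max_def)
  define K where "K = (2 powr \<sigma>' * 2) powr (1 / \<sigma>') * (2 powr s * Dbl powr (1 / \<sigma>'))"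
  have K: "0 < K" using Dbl_pos by (simp add: K_def)
  have M_A: "\<exists>C>0. \<forall>u\<in>borel_measurable \<mu>. M_norm \<mu> s p q u < \<infinity> \<longrightarrow>
    u \<in> L_loc \<mu> \<sigma>' \<and> F_norm \<mu> p q (A_osc \<mu> s \<sigma> u) \<le> ennreal C * M_norm \<mu> s p q u"
  proof (intro M_le_scaled_F[OF pq K, where a = "\<lambda>u k x. I_osc \<mu> s \<sigma>' u x (rad k)"] M_space_I_osc'[OF s \<sigma>'(1) pq \<sigma>'r])
    show "(\<lambda>x. A_osc \<mu> s \<sigma> u x t) \<in> borel_measurable \<mu>" if "u \<in> L_loc \<mu> \<sigma>'" for u t
      using that by (intro A_osc_measurable) (simp add: L_loc_def)
    show "A_osc \<mu> s \<sigma> u x t \<le> ennreal K * I_osc \<mu> s \<sigma>' u x (rad k)"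
      if u: "u \<in> L_loc \<mu> \<sigma>'" and t: "rad (k + 1) < t" "t \<le> rad k" for u x k t
    proof -
      have "A_osc \<mu> s \<sigma> u x t \<le> ennreal ((2 powr \<sigma>' * 2) powr (1 / \<sigma>')) * I_osc \<mu> s \<sigma>' u x t"
        using rad_slab[OF t] by (intro A_osc_le_I_osc \<sigma>(1) \<sigma>' u) auto
      also have "\<dots> \<le> ennreal ((2 powr \<sigma>' * 2) powr (1 / \<sigma>')) * (ennreal (2 powr s * Dbl powr (1 / \<sigma>')) * I_osc \<mu> s \<sigma>' u x (rad k))"
        using rad_slab[OF t] t s \<sigma>' by (intro mult_left_mono I_osc_scale) auto
      finally show ?thesis by (simp add: K_def ennreal_mult mult.assoc)
    qed
  qed
  have "fspace_le (M_space \<mu> s p q) (F_space \<mu> \<sigma> p q (A_osc \<mu> s \<sigma>))"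
    using M_A L_loc_mono[OF \<sigma>(1) \<sigma>'(2)] by (intro fspace_le_M_F) blast
  \<comment> \<open>Local integrability to the power \<sigma>' >= 1 supplies the integrability on
    balls that \<open>AF_space\<close> demands when \<sigma> < 1.\<close>
  moreover have "set_integrable \<mu> (ball x t) u"
    if "u \<in> fst (M_space \<mu> s p q)" "0 < t" for u x t
    using that M_A set_integrable_ball[OF \<sigma>'(3)] by (auto simp: M_space_def)
  ultimately have 1: "fspace_le (M_space \<mu> s p q) (AF_space \<mu> s \<sigma> p q)"
    by (auto simp: fspace_le_def AF_space_def)
  have "fspace_le (F_space \<mu> \<sigma> p q (A_osc \<mu> s \<sigma>)) (M_space \<mu> s p q)"
  proof (rule fspace_le_F_M[OF s \<sigma>(1) pq])
    fix u x and t :: real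
    show "I_osc \<mu> s \<sigma> u x t \<le> A_osc \<mu> s \<sigma> u x t"
      unfolding I_osc_def A_osc_def using \<sigma> by (intro mult_left_mono epowr_mono INF_lower) auto
  qed
  then have "fspace_le (AF_space \<mu> s \<sigma> p q) (M_space \<mu> s p q)"
    by (auto simp: fspace_le_def AF_space_def)
  with 1 show ?thesis by (simp add: fspace_eq_def)
qed

end

theorem theorem3p1:
  fixes \<mu> :: "'a::metric_space measure" and C1 n s :: real and p q r :: ennreal
  assumes "doubling_metric_measure_space \<mu> C1 n"
    and "0 < s" and "0 < p" and "0 < q" and "r = min p q"
  shows
    "(\<forall>\<sigma>::real. 0 < \<sigma> \<and> ennreal \<sigma> < r \<longrightarrow>
        fspace_eq (M_space \<mu> s p q) (CF_space \<mu> s \<sigma> p q)) \<and>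
     (\<forall>\<sigma>::real. 0 < \<sigma> \<and> ennreal \<sigma> < r_star n r s \<longrightarrow>
        fspace_eq (M_space \<mu> s p q) (IF_space \<mu> s \<sigma> p q)) \<and>
     (\<forall>\<epsilon> \<sigma>::real. 0 \<le> \<epsilon> \<and> \<epsilon> < s \<and> 0 < \<sigma> \<and> ennreal \<sigma> < r_star n r s \<longrightarrow>
        fspace_eq (M_space \<mu> s p q) (SF_space \<mu> s \<epsilon> \<sigma> p q)) \<and>
     (ennreal (n / (n + s)) < r \<longrightarrow>
        (\<forall>\<sigma>::real. 0 < \<sigma> \<and> ennreal \<sigma> < r_star n r s \<longrightarrow>
          fspace_eq (M_space \<mu> s p q) (AF_space \<mu> s \<sigma> p q)))"
proof -
  interpret doubling_metric_measure_space \<mu> C1 n by fact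
  show ?thesis
    unfolding \<open>r = min p q\<close>
    using M_eq_C[OF assms(2-4)] M_eq_I[OF assms(2-4)] M_eq_S[OF assms(2-4)] M_eq_A[OF assms(2-4)]
    by blast
qed

end
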